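(* Let $w$ satisfy Assumption A, let $\rho\in\mathcal D_{\rm per}$, and for each $\varepsilon>0$ let $v_\varepsilon(\rho)\in\mathrm H^{-1}_{\rm per}(I)$ be any potential such that $\min\{F^\varepsilon_{\rm per}(\zeta)-n\langle v_\varepsilon(\rho),\zeta\rangle:\sqrt\zeta\in\mathrm H^1_{\rm per}(I),\ \int_I\zeta=1\}=F^\varepsilon_{\rm per}(\rho)-n\langle v_\varepsilon(\rho),\rho\rangle.$ Then there exist constants $C_\varepsilon\in\mathbb R$ and a sequence $\varepsilon_k\downarrow0$ such that $v_{\varepsilon_k}(\rho)+C_{\varepsilon_k}\rightharpoonup v_{\rm OT}(\rho)$ weakly in $\mathrm H^{-1}_{\rm per}(I)$, where $v_{\rm OT}(\rho)$ is a regular Kantorovich potential for $F_{\rm OT}(\rho)$. Moreover, if $w$ is $C^1$ on $\{(x,y)\in I\times I:|x-y|_{\mathbb T}>0\}$, then the regular Kantorovich potential $v_{\rm OT}(\rho)$ is unique and $v_\varepsilon(\rho)+C_\varepsilon\rightharpoonup v_{\rm OT}(\rho)$ as $\varepsilon\downarrow0$ without passing to a subsequence.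
   Context: $I=[0,2\pi]$, $I_n=I^n$, $|t|_{\mathbb T}=\min\{|t-k|:k\in2\pi\mathbb Z\}$. Assumption A: $w:I\times I\to[0,+\infty]$ symmetric, continuous (for the topology of $[0,+\infty]$), with $\{w=\infty\}=\{(x,y):|x-y|_{\mathbb T}=0\}$. $c_n(x)=\sum_{i\ne j}w(x_i,x_j)$; $F_{\rm OT}(\rho)=\min\{\int_{I_n}c_n\,d\gamma:\gamma\in\mathcal P(I_n),\text{ all marginals }=\rho\}$. $\mathrm H^1_{\rm per}(I)$: restrictions to $I$ of $2\pi$-periodic $\mathrm H^1_{\rm loc}(\mathbb R)$ functions; $\mathrm H^{-1}_{\rm per}(I)$ its dual, $\langle\cdot,\cdot\rangle$ the duality pairing. $\mathcal D_{\rm per}=\{\rho\in\mathrm H^1_{\rm per}(I):\rho(x)>0\ \forall x\in I,\ \int_I\rho=1\}$. $F^\varepsilon_{\rm per}(\rho)=\inf\{\sum_k\lambda_k\int_{I_n}(\varepsilon|\nabla\Psi_k|^2+c_n|\Psi_k|^2)\}$ over orthonormal $\Psi_k\in\wedge^n\mathrm L^2(I)\cap\mathrm H^1_{\rm per}(I_n)$, $\lambda_k\ge0$, $\sum\lambda_k=1$, $\sum_k\lambda_k\rho_{\Psi_k}=n\rho$, where $\rho_\Psi(x)=n\int|\Psi(x,x_2,\dots,x_n)|^2dx_2\cdots dx_n$ and $\mathrm H^1_{\rm per}(I_n)$ is periodic $\mathrm H^1$ on $I_n$. Kantorovich potential: a $\rho$-integrable $v:I\to\mathbb R$ with $F_{\rm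 OT}(\rho)=n\int_I\rho v$ and $c_n(x_1,\dots,x_n)-\sum_{j=1}^nv(x_j)\ge0$ for every $(x_1,\dots,x_n)\in I_n$; it is regular if continuous (a continuous function is viewed as an element of $\mathrm H^{-1}_{\rm per}(I)$). *)

theory Defs
  imports "HOL-Probability.Probability" "HOL-Combinatorics.Permutations"
begin

definition Iper :: "real set" where
  "Iper = {0 .. 2 * pi}"

definition distT :: "real \<Rightarrow> real" where
  "distT t = Inf {\<bar>t - 2 * pi * real_of_int k\<bar> | k. True}"

definition assumptionA :: "(real \<times> real \<Rightarrow> ennreal) \<Rightarrow> bool" where
  "assumptionA w \<longleftrightarrow>
     (\<forall>x\<in>Iper. \<forall>y\<in>Iper. w (x, y) = w (y, x)) \<and>
     continuous_on (Iper \<times> Iper) w \<and>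
     {p \<in> Iper \<times> Iper. w p = \<infinity>} = {(x, y) \<in> Iper \<times> Iper. distT (x - y) = 0}"

definition offdiag :: "(real \<times> real) set" where
  "offdiag = {(x, y) \<in> Iper \<times> Iper. distT (x - y) > 0}"

definition C1_offdiag :: "(real \<times> real \<Rightarrow> ennreal) \<Rightarrow> bool" where
  "C1_offdiag w \<longleftrightarrow>
     (\<exists>D :: real \<times> real \<Rightarrow> ((real \<times> real) \<Rightarrow>\<^sub>L real).
        continuous_on offdiag D \<and>
        (\<forall>p\<in>offdiag. ((\<lambda>q. enn2real (w q)) has_derivative blinfun_apply (D p)) (at p within offdiag)))"

definition trig1 :: "int \<Rightarrow> real \<Rightarrow> complex" where
  "trig1 m t = cis (real_of_int m * t)"

text \<open>g is the periodic weak derivative of f on I (test functions: trigonometric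
  polynomials, i.e. smooth 2 pi-periodic functions up to density).\<close>
definition wderiv1 :: "(real \<Rightarrow> complex) \<Rightarrow> (real \<Rightarrow> complex) \<Rightarrow> bool" where
  "wderiv1 f g \<longleftrightarrow>
     f \<in> borel_measurable (lebesgue_on Iper) \<and> g \<in> borel_measurable (lebesgue_on Iper) \<and>
     integrable (lebesgue_on Iper) (\<lambda>t. (cmod (f t))\<^sup>2) \<and>
     integrable (lebesgue_on Iper) (\<lambda>t. (cmod (g t))\<^sup>2) \<and>
     (\<forall>m::int. (\<integral>t. f t * (\<i> * of_int m * trig1 m t) \<partial>lebesgue_on Iper)
                = - (\<integral>t. g t * trig1 m t \<partial>lebesgue_on Iper))"

definition H1per :: "(real \<Rightarrow> real) \<Rightarrow> bool" where
  "H1per f \<longleftrightarrow> (\<exists>g. wderiv1 (\<lambda>t. complex_of_real (f t)) g)"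

definition Hminus :: "((real \<Rightarrow> real) \<Rightarrow> real) \<Rightarrow> bool" where
  "Hminus v \<longleftrightarrow>
     (\<forall>f h a b. H1per f \<longrightarrow> H1per h \<longrightarrow> v (\<lambda>t. a * f t + b * h t) = a * v f + b * v h) \<and>
     (\<exists>B. \<forall>f g. wderiv1 (\<lambda>t. complex_of_real (f t)) g \<longrightarrow>
          \<bar>v f\<bar> \<le> B * sqrt ((\<integral>t. (f t)\<^sup>2 \<partial>lebesgue_on Iper) + (\<integral>t. (cmod (g t))\<^sup>2 \<partial>lebesgue_on Iper)))"

text \<open>The set D_per (continuous representative of rho).\<close>
definition Dper :: "(real \<Rightarrow> real) \<Rightarrow> bool" where
  "Dper \<rho> \<longleftrightarrow> H1per \<rho> \<and> continuous_on Iper \<rho> \<and> (\<forall>x\<in>Iper. \<rho> x > 0) \<and>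
     (\<integral>t. \<rho> t \<partial>lebesgue_on Iper) = 1"

definition adm :: "(real \<Rightarrow> real) \<Rightarrow> bool" where
  "adm \<zeta> \<longleftrightarrow> (\<forall>x\<in>Iper. 0 \<le> \<zeta> x) \<and> H1per (\<lambda>t. sqrt (\<zeta> t)) \<and>
     (\<integral>t. \<zeta> t \<partial>lebesgue_on Iper) = 1"

definition muN :: "nat \<Rightarrow> (nat \<Rightarrow> real) measure" where
  "muN n = PiM {..<n} (\<lambda>_. lebesgue_on Iper)"

definition cN :: "nat \<Rightarrow> (real \<times> real \<Rightarrow> ennreal) \<Rightarrow> (nat \<Rightarrow> real) \<Rightarrow> ennreal" where
  "cN n w x = (\<Sum>i\<in>{..<n}. \<Sum>j\<in>{..<n} - {i}. w (x i, x j))"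

definition trigN :: "nat \<Rightarrow> (nat \<Rightarrow> int) \<Rightarrow> (nat \<Rightarrow> real) \<Rightarrow> complex" where
  "trigN n m x = cis (\<Sum>j<n. real_of_int (m j) * x j)"

definition wgradN :: "nat \<Rightarrow> ((nat \<Rightarrow> real) \<Rightarrow> complex) \<Rightarrow> (nat \<Rightarrow> (nat \<Rightarrow> real) \<Rightarrow> complex) \<Rightarrow> bool" where
  "wgradN n \<Psi> G \<longleftrightarrow>
     \<Psi> \<in> borel_measurable (muN n) \<and> integrable (muN n) (\<lambda>x. (cmod (\<Psi> x))\<^sup>2) \<and>
     (\<forall>j<n. G j \<in> borel_measurable (muN n) \<and> integrable (muN n) (\<lambda>x. (cmod (G j x))\<^sup>2) \<and>
        (\<forall>m::nat \<Rightarrow> int. (\<integral>x. \<Psi> x * (\<i> * of_int (m j) * trigN n m x) \<partial>muN n)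
                = - (\<integral>x. G j x * trigN n m x \<partial>muN n)))"

definition antisymN :: "nat \<Rightarrow> ((nat \<Rightarrow> real) \<Rightarrow> complex) \<Rightarrow> bool" where
  "antisymN n \<Psi> \<longleftrightarrow>
     (\<forall>\<sigma>. \<sigma> permutes {..<n} \<longrightarrow>
        (AE x in muN n. \<Psi> (x \<circ> \<sigma>) = of_int (sign \<sigma>) * \<Psi> x))"

definition innerN :: "nat \<Rightarrow> ((nat \<Rightarrow> real) \<Rightarrow> complex) \<Rightarrow> ((nat \<Rightarrow> real) \<Rightarrow> complex) \<Rightarrow> complex" where
  "innerN n \<Psi> \<Phi> = (\<integral>x. cnj (\<Psi> x) * \<Phi> x \<partial>muN n)"

text \<open>rho_Psi(t) = n * integral of |Psi(t, x_2, ..., x_n)|^2 (first variable is index 0).\<close>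
definition densN :: "nat \<Rightarrow> ((nat \<Rightarrow> real) \<Rightarrow> complex) \<Rightarrow> real \<Rightarrow> ennreal" where
  "densN n \<Psi> t = ennreal (real n) *
     (\<integral>\<^sup>+ y. ennreal ((cmod (\<Psi> (y(0 := t))))\<^sup>2) \<partial>PiM {1..<n} (\<lambda>_. lebesgue_on Iper))"

definition energyN :: "nat \<Rightarrow> (real \<times> real \<Rightarrow> ennreal) \<Rightarrow> real \<Rightarrow> ((nat \<Rightarrow> real) \<Rightarrow> complex)
    \<Rightarrow> (nat \<Rightarrow> (nat \<Rightarrow> real) \<Rightarrow> complex) \<Rightarrow> ennreal" where
  "energyN n w \<epsilon> \<Psi> G =
     (\<integral>\<^sup>+ x. ennreal (\<epsilon> * (\<Sum>j<n. (cmod (G j x))\<^sup>2)) + cN n w x * ennreal ((cmod (\<Psi> x))\<^sup>2) \<partial>muN n)"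

definition mixed :: "nat \<Rightarrow> (real \<Rightarrow> real) \<Rightarrow> (nat \<Rightarrow> real) \<Rightarrow> (nat \<Rightarrow> (nat \<Rightarrow> real) \<Rightarrow> complex)
    \<Rightarrow> (nat \<Rightarrow> nat \<Rightarrow> (nat \<Rightarrow> real) \<Rightarrow> complex) \<Rightarrow> bool" where
  "mixed n \<rho> lam \<Psi> G \<longleftrightarrow>
     (\<forall>k. 0 \<le> lam k) \<and> lam sums 1 \<and>
     (\<forall>k. antisymN n (\<Psi> k) \<and> wgradN n (\<Psi> k) (G k)) \<and>
     (\<forall>k l. innerN n (\<Psi> k) (\<Psi> l) = (if k = l then 1 else 0)) \<and>
     (AE t in lebesgue_on Iper. (\<Sum>k. ennreal (lam k) * densN n (\<Psi> k) t) = ennreal (real n * \<rho> t))"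

definition Feps :: "nat \<Rightarrow> (real \<times> real \<Rightarrow> ennreal) \<Rightarrow> real \<Rightarrow> (real \<Rightarrow> real) \<Rightarrow> ennreal" where
  "Feps n w \<epsilon> \<rho> =
     (INF s \<in> {(lam, \<Psi>, G). mixed n \<rho> lam \<Psi> G}.
        (case s of (lam, \<Psi>, G) \<Rightarrow> (\<Sum>k. ennreal (lam k) * energyN n w \<epsilon> (\<Psi> k) (G k))))"

definition coupling :: "nat \<Rightarrow> (real \<Rightarrow> real) \<Rightarrow> (nat \<Rightarrow> real) measure \<Rightarrow> bool" where
  "coupling n \<rho> \<gamma> \<longleftrightarrow>
     sets \<gamma> = sets (PiM {..<n} (\<lambda>_. restrict_space lborel Iper)) \<and> prob_space \<gamma> \<and>
     (\<forall>j<n. distr \<gamma> (restrict_space lborel Iper) (\<lambda>x. x j)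
             = density (restrict_space lborel Iper) (\<lambda>t. ennreal (\<rho> t)))"

definition FOT :: "nat \<Rightarrow> (real \<times> real \<Rightarrow> ennreal) \<Rightarrow> (real \<Rightarrow> real) \<Rightarrow> ennreal" where
  "FOT n w \<rho> = (INF \<gamma> \<in> {\<gamma>. coupling n \<rho> \<gamma>}. \<integral>\<^sup>+ x. cN n w x \<partial>\<gamma>)"

definition kantorovich_pot :: "nat \<Rightarrow> (real \<times> real \<Rightarrow> ennreal) \<Rightarrow> (real \<Rightarrow> real) \<Rightarrow> (real \<Rightarrow> real) \<Rightarrow> bool" where
  "kantorovich_pot n w \<rho> v \<longleftrightarrow>
     integrable (lebesgue_on Iper) (\<lambda>t. \<rho> t * v t) \<and>
     enn2ereal (FOT n w \<rho>) = ereal (real n * (\<integral>t. \<rho> t * v t \<partial>lebesgue_on Iper)) \<and>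
     (\<forall>x\<in>PiE {..<n} (\<lambda>_. Iper). 0 \<le> enn2ereal (cN n w x) - ereal (\<Sum>j<n. v (x j)))"

definition regular_kantorovich_pot :: "nat \<Rightarrow> (real \<times> real \<Rightarrow> ennreal) \<Rightarrow> (real \<Rightarrow> real) \<Rightarrow> (real \<Rightarrow> real) \<Rightarrow> bool" where
  "regular_kantorovich_pot n w \<rho> v \<longleftrightarrow> kantorovich_pot n w \<rho> v \<and> continuous_on Iper v"

end

theory Submission
  imports Defs "HOL-Library.Diagonal_Subsequence"
begin

text \<open>
Normalise the potential by a constant so that n V(rho) is the quantum energy of rho. For disjointly supported
orbitals with squares f_1, ..., f_n, multiplying each orbital by phases running through its mass coordinate gives
infinitely many orthonormal Slater determinants with the same density, so mixed states realise the density
(f_1 + ... + f_n) / n with energy at most epsilon times a kinetic term plus the maximal cost on the product of the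
supports. Minimality therefore bounds V(f_1) + ... + V(f_n) from above. A density comparable to rho can be cut into
windows of equal mass that are grouped into such families, and since V(rho) is nonnegative this yields a bound on
the normalised potentials in the dual norm that is uniform in epsilon, and hence a weak limit V.

For the limit the kinetic term disappears, and testing with narrow bumps shows that the upper envelope of V is
feasible in the dual transport problem. A maximal feasible u above the envelope (Zorn's lemma) is an infimum of
translates of the cost away from the diagonal, hence continuous, and V is dominated by integration against u. The
quantum energy dominates the transport cost, so n V(rho) is at least the transport cost, which by weak duality is at
least n times the integral of rho u. Since rho is strictly positive, equality at rho forces V to be integration
against u, and u is a Kantorovich potential.

If the cost is differentiable off the diagonal, any two potentials are touched from above by the same smooth
functions, so their difference is constant, and the constant is zero because the values agree. Convergence of the
whole family then follows from uniqueness of the limit along subsequences.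
\<close>

section \<open>Smooth periodic functions and their weak derivatives\<close>

text \<open>Two features shape the proof. \<open>mixed\<close> asks for an infinite orthonormal
  sequence even when a single weight is nonzero, so a pure state has to be embedded in such a
  sequence before it is a competitor. And w is infinite at (0, 2 pi) but need not be periodic, while
  the functionals act on periodic functions: u is continuous on I with possibly different values at
  0 and 2 pi, so localisation has to treat the seam separately.

  Of minimality only an upper bound on Slater densities is kept (\<open>slater_ineq\<close>). It is
  linear in V and its kinetic term carries the factor \<epsilon>, so it survives the limit. A lower
  bound enters only through V(\<rho>) \<ge> 0; it becomes two-sided because \<rho> is interior to
  the positive densities and can be perturbed by f and by -f.

  Neither strong duality nor an optimal coupling is presupposed. Duality comes out of the chain FOT
  \<le> n V(\<rho>) \<le> n times the integral of \<rho> u \<le> FOT, and contact points are found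
  with near-optimal couplings.\<close>

abbreviation Lper :: "real measure" where "Lper \<equiv> lebesgue_on Iper"

lemma Iper_sets [simp, measurable]: "Iper \<in> sets lebesgue" "Iper \<in> sets borel" "Iper \<in> sets lborel"
  by (auto simp: Iper_def)

lemma compact_Iper: "compact Iper" by (simp add: Iper_def)

lemma finite_measure_Lper: "finite_measure Lper"
  by (rule finite_measure_lebesgue_on) (simp add: Iper_def)

lemma emeasure_Lper: "emeasure Lper Iper = ennreal (2 * pi)"
  by (simp add: Iper_def emeasure_restrict_space)

lemma measure_Lper: "measure Lper Iper = 2 * pi"
  by (simp add: measure_def emeasure_Lper)

lemma integral_Lper_const: "(\<integral>t. c \<partial>Lper) = (2 * pi) * (c::real)"
  by (simp add: measure_Lper)

lemma integrable_Lper_cont: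
  fixes f :: "real \<Rightarrow> 'b::euclidean_space"
  assumes "continuous_on Iper f" shows "integrable Lper f"
  using assms unfolding Iper_def by (rule continuous_imp_integrable_real)

lemma integral_Lper_HK:
  fixes f :: "real \<Rightarrow> 'b::euclidean_space"
  assumes "continuous_on Iper f" shows "integral\<^sup>L Lper f = integral Iper f"
  by (rule lebesgue_integral_eq_integral[OF integrable_Lper_cont[OF assms]]) simp

lemma measurable_Lper_cont:
  fixes f :: "real \<Rightarrow> 'b::euclidean_space"
  assumes "continuous_on Iper f" shows "f \<in> borel_measurable Lper"
  using integrable_Lper_cont[OF assms] by auto

lemma integral_Lper_FTC:
  fixes f :: "real \<Rightarrow> 'b::euclidean_space"
  assumes "\<And>t. (f has_vector_derivative f' t) (at t)" "continuous_on UNIV f'"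
  shows "integral\<^sup>L Lper f' = f (2 * pi) - f 0"
proof -
  have "(f' has_integral (f (2 * pi) - f 0)) {0..2*pi}"
    by (rule fundamental_theorem_of_calculus)
      (auto intro: has_vector_derivative_at_within assms)
  then have "integral Iper f' = f (2*pi) - f 0" unfolding Iper_def by (rule integral_unique)
  then show ?thesis
    using integral_Lper_HK[of f'] assms(2) continuous_on_subset by (metis subset_UNIV)
qed

text \<open>The derivative is carried along and everything lives on the whole line, so that
  translations, antiderivatives and compositions involve no boundary cases. Orbitals are built in
  this class; general H^1 functions are reached only by approximation.\<close>

definition C1per :: "(real \<Rightarrow> real) \<Rightarrow> (real \<Rightarrow> real) \<Rightarrow> bool" where
  "C1per f f' \<longleftrightarrow> (\<forall>t. (f has_real_derivative f' t) (at t)) \<and> continuous_on UNIV f' \<and>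
     (\<forall>t. f (t + 2 * pi) = f t)"

lemma C1per_cont: assumes "C1per f f'" shows "continuous_on A f" "continuous_on A f'"
proof -
  have "continuous_on UNIV f" using assms unfolding C1per_def
    by (meson DERIV_isCont continuous_at_imp_continuous_on)
  then show "continuous_on A f" using continuous_on_subset by blast
  show "continuous_on A f'" using assms unfolding C1per_def using continuous_on_subset by blast
qed

lemma C1per_lin: assumes "C1per f f'" "C1per h h'"
  shows "C1per (\<lambda>t. a * f t + b * h t) (\<lambda>t. a * f' t + b * h' t)"
  using assms unfolding C1per_def
  by (auto intro!: derivative_eq_intros continuous_intros)

lemma C1per_mult: assumes "C1per f f'" "C1per h h'"
  shows "C1per (\<lambda>t. f t * h t) (\<lambda>t. f' t * h t + f t * h' t)"
proof -
  have "continuous_on UNIV f" "continuous_on UNIV h" using assms C1per_cont by blast+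
  then show ?thesis
  using assms unfolding C1per_def
  by (auto intro!: derivative_eq_intros continuous_intros)
qed

lemma C1per_compose:
  assumes "C1per f f'" "\<And>t. (\<phi> has_real_derivative \<phi>' (f t)) (at (f t))"
    "continuous_on (range f) \<phi>'"
  shows "C1per (\<lambda>t. \<phi> (f t)) (\<lambda>t. \<phi>' (f t) * f' t)"
  unfolding C1per_def
proof (intro conjI allI)
  fix t show "((\<lambda>t. \<phi> (f t)) has_real_derivative \<phi>' (f t) * f' t) (at t)"
    by (rule DERIV_chain2[where g=f]) (use assms in \<open>auto simp: C1per_def\<close>)
  show "\<phi> (f (t + 2 * pi)) = \<phi> (f t)" using assms(1) by (simp add: C1per_def)
next
  show "continuous_on UNIV (\<lambda>t. \<phi>' (f t) * f' t)"
    using C1per_cont[OF assms(1)] assms(3)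
    by (intro continuous_on_mult continuous_on_compose2[OF assms(3)]) auto
qed

lemma C1per_const: "C1per (\<lambda>t. c) (\<lambda>t. 0)"
  by (auto simp: C1per_def)

lemma trig1_vderiv: "((\<lambda>t. trig1 m t) has_vector_derivative \<i> * of_int m * trig1 m t) (at t)"
proof -
  have "((\<lambda>t. exp (\<i> * of_int m * of_real t)) has_vector_derivative
     (1 * (\<i> * of_int m)) * exp (\<i> * of_int m * of_real t)) (at t)"
    by (rule has_vector_derivative_real_field)
       (auto intro!: derivative_eq_intros)
  then show ?thesis
    by (simp add: trig1_def cis_conv_exp mult_ac)
qed

lemma trig1_cont: "continuous_on A (trig1 m)"
  unfolding trig1_def by (intro continuous_intros)

lemma trig1_periodic: "trig1 m (t + 2 * pi) = trig1 m t"
  using cis_multiple_2pi[of "real_of_int m"]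
  by (simp add: trig1_def distrib_left cis_mult[symmetric] mult_ac)

lemma trig1_mult: "trig1 m t * trig1 k t = trig1 (m + k) t"
  by (simp add: trig1_def cis_mult algebra_simps)

lemma trig1_cnj: "cnj (trig1 m t) = trig1 (- m) t"
  by (simp add: trig1_def cis_cnj)

lemma wderiv1_C1:
  fixes f f' :: "real \<Rightarrow> complex"
  assumes "\<And>t. (f has_vector_derivative f' t) (at t)" "continuous_on UNIV f'"
    "f (2 * pi) = f 0"
  shows "wderiv1 f f'"
proof -
  have cf: "continuous_on UNIV f"
    using assms(1) by (meson continuous_at_imp_continuous_on has_vector_derivative_continuous)
  have cfI: "continuous_on Iper f" "continuous_on Iper f'"
    using cf assms(2) continuous_on_subset by blast+
  show ?thesis unfolding wderiv1_def
  proof (intro conjI allI)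
    show "f \<in> borel_measurable Lper" "f' \<in> borel_measurable Lper"
      using cfI by (auto intro: measurable_Lper_cont)
    show "integrable Lper (\<lambda>t. (cmod (f t))\<^sup>2)" "integrable Lper (\<lambda>t. (cmod (f' t))\<^sup>2)"
      using cfI by (auto intro!: integrable_Lper_cont continuous_intros)
    fix m
    have "integral\<^sup>L Lper (\<lambda>t. f t * (\<i> * of_int m * trig1 m t) + f' t * trig1 m t)
       = f (2*pi) * trig1 m (2*pi) - f 0 * trig1 m 0"
      by (rule integral_Lper_FTC)
        (auto intro!: derivative_eq_intros assms trig1_vderiv continuous_intros trig1_cont cf)
    also have "\<dots> = 0" using trig1_periodic[of m 0] assms(3) by simp
    also have "integral\<^sup>L Lper (\<lambda>t. f t * (\<i> * of_int m * trig1 m t) + f' t * trig1 m t)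
      = integral\<^sup>L Lper (\<lambda>t. f t * (\<i> * of_int m * trig1 m t)) + integral\<^sup>L Lper (\<lambda>t. f' t * trig1 m t)"
      by (intro Bochner_Integration.integral_add integrable_Lper_cont continuous_intros cfI trig1_cont)
    finally show "(\<integral>t. f t * (\<i> * of_int m * trig1 m t) \<partial>Lper) = - (\<integral>t. f' t * trig1 m t \<partial>Lper)"
      by (simp add: eq_neg_iff_add_eq_0)
  qed
qed

lemma C1per_wderiv1:
  assumes "C1per f f'"
  shows "wderiv1 (\<lambda>t. complex_of_real (f t)) (\<lambda>t. complex_of_real (f' t))"
proof (rule wderiv1_C1)
  show "((\<lambda>t. complex_of_real (f t)) has_vector_derivative complex_of_real (f' t)) (at t)" for t
    using assms unfolding C1per_def
    by (intro has_vector_derivative_of_real) (auto simp: has_real_derivative_iff_has_vector_derivative)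
  show "continuous_on UNIV (\<lambda>t. complex_of_real (f' t))"
    using assms unfolding C1per_def by (auto intro: continuous_intros)
  show "complex_of_real (f (2*pi)) = complex_of_real (f 0)"
    using assms unfolding C1per_def by (metis add_0)
qed

lemma C1per_H1per: "C1per f f' \<Longrightarrow> H1per f"
  using C1per_wderiv1 unfolding H1per_def by blast

text \<open>One-dimensional Sobolev embedding by hand: at some point h^2 is at most its integral,
  and from there h^2 changes by at most the integral of |2 h h'| \<le> h^2 + h'^2.\<close>

lemma C1per_sup_bound:
  assumes h: "C1per h h'" and t: "t \<in> Iper"
  shows "(h t)\<^sup>2 \<le> 2 * ((\<integral>t. (h t)\<^sup>2 \<partial>Lper) + (\<integral>t. (h' t)\<^sup>2 \<partial>Lper))"
proof -
  have c: "continuous_on A h" "continuous_on A h'" for A using C1per_cont[OF h] by auto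
  have hk: "integral\<^sup>L Lper (\<lambda>t. (h t)\<^sup>2) = integral Iper (\<lambda>t. (h t)\<^sup>2)"
    "integral\<^sup>L Lper (\<lambda>t. (h' t)\<^sup>2) = integral Iper (\<lambda>t. (h' t)\<^sup>2)"
    by (auto intro!: integral_Lper_HK continuous_intros c)
  have "\<exists>s\<in>Iper. (h s)\<^sup>2 \<le> (\<integral>t. (h t)\<^sup>2 \<partial>Lper)"
  proof (rule ccontr)
    assume "\<not> ?thesis"
    then have *: "(h s)\<^sup>2 \<ge> (\<integral>t. (h t)\<^sup>2 \<partial>Lper)" "(h s)\<^sup>2 > (\<integral>t. (h t)\<^sup>2 \<partial>Lper)" if "s \<in> Iper" for s
      using that by force+
    have "(2 * pi) * (\<integral>t. (h t)\<^sup>2 \<partial>Lper) = (\<integral>s. (\<integral>t. (h t)\<^sup>2 \<partial>Lper) \<partial>Lper)"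
      by (simp only: integral_Lper_const)
    also have "\<dots> \<le> (\<integral>t. (h t)\<^sup>2 \<partial>Lper)"
      by (intro integral_mono integrable_Lper_cont continuous_intros c) (use * in auto)
    \<comment> \<open>The interval has length 2 pi > 1, so a lower bound of h^2 by its own integral
      A gives 2 pi A \<le> A. Then A = 0 and h vanishes identically, against the strict
      inequality.\<close>
    finally have 1: "(2 * pi - 1) * (\<integral>t. (h t)\<^sup>2 \<partial>Lper) \<le> 0" by (simp add: algebra_simps)
    have p: "2 * pi - 1 > 0" using pi_gt3 by simp
    have nn: "(\<integral>t. (h t)\<^sup>2 \<partial>Lper) \<ge> 0" by simp
    have z: "(\<integral>t. (h t)\<^sup>2 \<partial>Lper) = 0" using 1 p nn by (smt (verit) mult_pos_pos)
    then have "\<forall>x\<in>{0..2*pi}. (h x)\<^sup>2 = 0"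
      using integralL_eq_0_iff[of 0 "2*pi" "\<lambda>t. (h t)\<^sup>2"] c by (auto simp: Iper_def intro!: continuous_intros)
    then have "(h 0)\<^sup>2 = 0" by simp
    moreover have "0 \<in> Iper" by (simp add: Iper_def)
    ultimately show False using *(2)[of 0] z by simp
  qed
  then obtain s where s: "s \<in> Iper" "(h s)\<^sup>2 \<le> (\<integral>t. (h t)\<^sup>2 \<partial>Lper)" by blast
  have key: "\<bar>(h b)\<^sup>2 - (h a)\<^sup>2\<bar> \<le> (\<integral>t. (h t)\<^sup>2 \<partial>Lper) + (\<integral>t. (h' t)\<^sup>2 \<partial>Lper)"
    if ab: "a \<le> b" "a \<in> Iper" "b \<in> Iper" for a b
  proof -
    have sub: "{a..b} \<subseteq> Iper" using ab by (auto simp: Iper_def)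
    have "((\<lambda>t. 2 * h t * h' t) has_integral ((h b)\<^sup>2 - (h a)\<^sup>2)) {a..b}"
      using h unfolding C1per_def
      by (intro fundamental_theorem_of_calculus ab(1))
        (auto intro!: derivative_eq_intros simp: has_real_derivative_iff_has_vector_derivative[symmetric] intro: DERIV_subset)
    then have "\<bar>(h b)\<^sup>2 - (h a)\<^sup>2\<bar> = \<bar>integral {a..b} (\<lambda>t. 2 * h t * h' t)\<bar>"
      by (simp add: integral_unique)
    also have "\<dots> \<le> integral {a..b} (\<lambda>t. (h t)\<^sup>2 + (h' t)\<^sup>2)"
      unfolding real_norm_def[symmetric]
    proof (rule integral_norm_bound_integral)
      show "(\<lambda>t. 2 * h t * h' t) integrable_on {a..b}"
        "(\<lambda>t. (h t)\<^sup>2 + (h' t)\<^sup>2) integrable_on {a..b}"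
        by (auto intro!: integrable_continuous_real continuous_intros c)
      show "norm (2 * h x * h' x) \<le> (h x)\<^sup>2 + (h' x)\<^sup>2" for x
        using sum_squares_bound[of "h x" "h' x"] sum_squares_bound[of "h x" "- h' x"]
        by (auto simp: abs_le_iff)
    qed
    also have "\<dots> \<le> integral Iper (\<lambda>t. (h t)\<^sup>2 + (h' t)\<^sup>2)"
      using sub by (intro integral_subset_le) (auto intro!: integrable_continuous_real continuous_intros c simp: Iper_def)
    also have "\<dots> = integral Iper (\<lambda>t. (h t)\<^sup>2) + integral Iper (\<lambda>t. (h' t)\<^sup>2)"
      by (intro Henstock_Kurzweil_Integration.integral_add) (auto intro!: integrable_continuous_real continuous_intros c simp: Iper_def)
    finally show ?thesis by (simp add: hk)
  qed
  have "(h t)\<^sup>2 \<le> (h s)\<^sup>2 + ((\<integral>t. (h t)\<^sup>2 \<partial>Lper) + (\<integral>t. (h' t)\<^sup>2 \<partial>Lper))"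
    using key[of s t] key[of t s] s(1) t by (cases "s \<le> t") auto
  moreover have "(\<integral>t. (h' t)\<^sup>2 \<partial>Lper) \<ge> 0" by (rule Bochner_Integration.integral_nonneg) simp
  ultimately show ?thesis using s(2) by (smt (verit))
qed

lemma C1per_antideriv:
  assumes g: "continuous_on UNIV g"
  obtains G where "\<And>t. (G has_real_derivative g t) (at t)" "G 0 = (0::real)"
proof -
  have "\<exists>F. \<forall>x :: real. - \<infinity> < ereal x \<longrightarrow> ereal x < \<infinity> \<longrightarrow> (F has_vector_derivative g x) (at x)"
    using g by (intro einterval_antiderivative) (auto simp: continuous_on_eq_continuous_at)
  then obtain F where F: "\<And>x. (F has_vector_derivative g x) (at x)" by auto
  show ?thesis
    by (rule that[of "\<lambda>t. F t - F 0"])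
      (use F in \<open>auto intro!: derivative_eq_intros simp: has_real_derivative_iff_has_vector_derivative[symmetric]\<close>)
qed

text \<open>The increment over one period has derivative g(t + 2 pi) - g(t) = 0, so it equals its
  value at t = 0.\<close>

lemma antideriv_periodic:
  assumes G: "\<And>t. (G has_real_derivative g t) (at t)" and g: "\<And>t. g (t + 2 * pi) = g t"
    and c: "continuous_on UNIV g"
  shows "G (t + 2 * pi) = G t + (\<integral>t. g t \<partial>Lper)"
proof -
  have "((\<lambda>t. G (t + 2*pi) - G t) has_real_derivative 0) (at x)" for x
  proof -
    have "((\<lambda>t. G (t + 2*pi)) has_real_derivative g (x + 2*pi) * 1) (at x)"
      by (rule DERIV_chain2[OF G]) (auto intro!: derivative_eq_intros)
    from DERIV_diff[OF this G[of x]] show ?thesis by (simp add: g)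
  qed
  then have "\<forall>x. ((\<lambda>t. G (t + 2*pi) - G t) has_real_derivative 0) (at x)" by blast
  then have "G (t + 2*pi) - G t = G (0 + 2*pi) - G 0"
    by (rule DERIV_isconst_all)
  also have "\<dots> = (\<integral>t. g t \<partial>Lper)"
    using integral_Lper_FTC[of G g] G c by (simp add: has_real_derivative_iff_has_vector_derivative)
  finally show ?thesis by simp
qed

section \<open>Fourier approximation in the periodic Sobolev space\<close>

lemma integrable_mult_L2:
  fixes f g :: "'a \<Rightarrow> complex"
  assumes "f \<in> borel_measurable M" "g \<in> borel_measurable M"
    "integrable M (\<lambda>t. (cmod (f t))\<^sup>2)" "integrable M (\<lambda>t. (cmod (g t))\<^sup>2)"
  shows "integrable M (\<lambda>t. f t * g t)"
proof (rule Bochner_Integration.integrable_bound)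
  show "integrable M (\<lambda>t. (cmod (f t))\<^sup>2 + (cmod (g t))\<^sup>2)" using assms by auto
  show "(\<lambda>t. f t * g t) \<in> borel_measurable M" using assms by measurable
  show "AE x in M. norm (f x * g x) \<le> norm ((cmod (f x))\<^sup>2 + (cmod (g x))\<^sup>2)"
  proof (rule AE_I2)
    fix x
    have "cmod (f x) * cmod (g x) \<le> 2 * cmod (f x) * cmod (g x)" by (simp add: mult_le_cancel_right1)
    also have "\<dots> \<le> (cmod (f x))\<^sup>2 + (cmod (g x))\<^sup>2" by (rule sum_squares_bound)
    finally show "norm (f x * g x) \<le> norm ((cmod (f x))\<^sup>2 + (cmod (g x))\<^sup>2)"
      by (simp add: norm_mult)
  qed
qed

lemma integrable_add_L2:
  fixes f g :: "'a \<Rightarrow> complex"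
  assumes "f \<in> borel_measurable M" "g \<in> borel_measurable M"
    "integrable M (\<lambda>t. (cmod (f t))\<^sup>2)" "integrable M (\<lambda>t. (cmod (g t))\<^sup>2)"
  shows "integrable M (\<lambda>t. (cmod (a * f t + b * g t))\<^sup>2)"
proof (rule Bochner_Integration.integrable_bound)
  show "integrable M (\<lambda>t. 2 * (cmod a)\<^sup>2 * (cmod (f t))\<^sup>2 + 2 * (cmod b)\<^sup>2 * (cmod (g t))\<^sup>2)" using assms by auto
  show "(\<lambda>t. (cmod (a * f t + b * g t))\<^sup>2) \<in> borel_measurable M" using assms by measurable
  show "AE x in M. norm ((cmod (a * f x + b * g x))\<^sup>2) \<le> norm (2 * (cmod a)\<^sup>2 * (cmod (f x))\<^sup>2 + 2 * (cmod b)\<^sup>2 * (cmod (g x))\<^sup>2)"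
  proof (rule AE_I2)
    fix x
    have "(cmod (a * f x + b * g x))\<^sup>2 \<le> (cmod (a * f x) + cmod (b * g x))\<^sup>2"
      by (intro power_mono norm_triangle_ineq) auto
    also have "\<dots> \<le> 2 * (cmod (a * f x))\<^sup>2 + 2 * (cmod (b * g x))\<^sup>2"
      using sum_squares_bound[of "cmod (a * f x)" "cmod (b * g x)"] by (simp add: power2_sum)
    finally show "norm ((cmod (a * f x + b * g x))\<^sup>2) \<le> norm (2 * (cmod a)\<^sup>2 * (cmod (f x))\<^sup>2 + 2 * (cmod b)\<^sup>2 * (cmod (g x))\<^sup>2)"
      by (simp add: norm_mult power_mult_distrib)
  qed
qed

definition L2per :: "(real \<Rightarrow> complex) \<Rightarrow> bool" where
  "L2per f \<longleftrightarrow> f \<in> borel_measurable Lper \<and> integrable Lper (\<lambda>t. (cmod (f t))\<^sup>2)"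

lemma L2per_cont: "continuous_on Iper f \<Longrightarrow> L2per f"
  by (auto simp: L2per_def intro!: measurable_Lper_cont integrable_Lper_cont continuous_intros)

lemma L2per_lin: "L2per f \<Longrightarrow> L2per g \<Longrightarrow> L2per (\<lambda>t. a * f t + b * g t)"
  unfolding L2per_def using integrable_add_L2[of f Lper g a b] by auto

lemma L2per_diff: "L2per f \<Longrightarrow> L2per g \<Longrightarrow> L2per (\<lambda>t. f t - g t)"
  using L2per_lin[of f g 1 "-1"] by simp

lemma L2per_mult_integrable: "L2per f \<Longrightarrow> L2per g \<Longrightarrow> integrable Lper (\<lambda>t. f t * g t)"
  unfolding L2per_def by (auto intro: integrable_mult_L2)

lemma L2per_integrable: "L2per f \<Longrightarrow> integrable Lper f"
  using L2per_mult_integrable[OF _ L2per_cont[of "\<lambda>_. 1"]] by auto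

lemma L2per_cnj: "L2per f \<Longrightarrow> L2per (\<lambda>t. cnj (f t))"
  unfolding L2per_def
  by (auto intro!: measurable_compose[of f Lper borel cnj borel] borel_measurable_continuous_onI continuous_intros)

section \<open>Orthogonality and best approximation by trigonometric polynomials\<close>

lemma trig1_orth: "(\<integral>t. trig1 m t \<partial>Lper) = (if m = 0 then 2 * pi else 0)"
proof (cases "m = 0")
  case True then show ?thesis by (simp add: trig1_def measure_Lper scaleR_conv_of_real)
next
  case False
  have "integral\<^sup>L Lper (\<lambda>t. \<i> * of_int m * trig1 m t) = trig1 m (2*pi) - trig1 m 0"
    by (rule integral_Lper_FTC) (auto intro!: trig1_vderiv continuous_intros trig1_cont)
  also have "\<dots> = 0" using trig1_periodic[of m 0] by simp
  finally show ?thesis using False by simp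
qed

definition tpoly :: "nat \<Rightarrow> (int \<Rightarrow> complex) \<Rightarrow> real \<Rightarrow> complex" where
  "tpoly k a t = (\<Sum>m\<in>{-int k..int k}. a m * trig1 m t)"

lemma tpoly_cont: "continuous_on A (tpoly k a)"
  unfolding tpoly_def by (intro continuous_intros trig1_cont)

lemma L2per_tpoly: "L2per (tpoly k a)"
  by (rule L2per_cont[OF tpoly_cont])

definition fcoef :: "(real \<Rightarrow> complex) \<Rightarrow> int \<Rightarrow> complex" where
  "fcoef u m = complex_of_real (1 / (2 * pi)) * (\<integral>t. u t * trig1 (- m) t \<partial>Lper)"

lemma tpoly_coeff:
  assumes "m \<in> {-int k..int k}"
  shows "(\<integral>t. tpoly k a t * trig1 (- m) t \<partial>Lper) = complex_of_real (2 * pi) * a m"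
proof -
  have "(\<integral>t. tpoly k a t * trig1 (- m) t \<partial>Lper) = (\<integral>t. (\<Sum>j\<in>{-int k..int k}. a j * trig1 (j - m) t) \<partial>Lper)"
    by (simp add: tpoly_def sum_distrib_right mult.assoc trig1_mult)
  also have "\<dots> = (\<Sum>j\<in>{-int k..int k}. a j * (\<integral>t. trig1 (j - m) t \<partial>Lper))"
    by (subst Bochner_Integration.integral_sum) (auto intro!: integrable_Lper_cont continuous_intros trig1_cont)
  also have "\<dots> = (\<Sum>j\<in>{-int k..int k}. if j = m then complex_of_real (2 * pi) * a j else 0)"
    by (rule sum.cong) (auto simp: trig1_orth)
  also have "\<dots> = complex_of_real (2 * pi) * a m" using assms by simp
  finally show ?thesis .
qed

text \<open>Pythagoras: the remainder of the Fourier sum is orthogonal to all trigonometric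
  polynomials of degree k, among them the difference of the two candidates.\<close>

lemma fourier_best_approx:
  assumes u: "L2per u"
  shows "(\<integral>t. (cmod (u t - tpoly k (fcoef u) t))\<^sup>2 \<partial>Lper) \<le> (\<integral>t. (cmod (u t - tpoly k a t))\<^sup>2 \<partial>Lper)"
proof -
  let ?S = "tpoly k (fcoef u)" let ?b = "\<lambda>m. fcoef u m - a m"
  let ?D = "tpoly k ?b"
  have D: "?D t = ?S t - tpoly k a t" for t
    by (simp add: tpoly_def sum_subtractf left_diff_distrib)
  have uS: "L2per (\<lambda>t. u t - ?S t)" by (intro L2per_diff u L2per_tpoly)
  have orth0: "(\<integral>t. (u t - ?S t) * trig1 (- m) t \<partial>Lper) = 0" if "m \<in> {-int k..int k}" for m
  proof -
    have "(\<integral>t. (u t - ?S t) * trig1 (- m) t \<partial>Lper) = (\<integral>t. u t * trig1 (- m) t \<partial>Lper) - (\<integral>t. ?S t * trig1 (- m) t \<partial>Lper)"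
      unfolding left_diff_distrib
      by (intro Bochner_Integration.integral_diff L2per_mult_integrable u L2per_tpoly L2per_cont trig1_cont)
    also have "\<dots> = 0" using tpoly_coeff[OF that, of "fcoef u"] by (simp add: fcoef_def)
    finally show ?thesis .
  qed
  have cnjD: "cnj (?D t) = (\<Sum>m\<in>{-int k..int k}. cnj (?b m) * trig1 (- m) t)" for t
    by (simp add: tpoly_def trig1_cnj)
  have "(\<integral>t. (u t - ?S t) * cnj (?D t) \<partial>Lper) = (\<integral>t. (\<Sum>m\<in>{-int k..int k}. cnj (?b m) * ((u t - ?S t) * trig1 (- m) t)) \<partial>Lper)"
    unfolding cnjD by (simp add: sum_distrib_left mult_ac)
  also have "\<dots> = (\<Sum>m\<in>{-int k..int k}. cnj (?b m) * (\<integral>t. (u t - ?S t) * trig1 (- m) t \<partial>Lper))"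
    by (subst Bochner_Integration.integral_sum)
      (auto intro!: integrable_mult_right L2per_mult_integrable[OF uS] L2per_cont trig1_cont)
  also have "\<dots> = 0" by (intro sum.neutral) (simp add: orth0)
  finally have orth: "(\<integral>t. (u t - ?S t) * cnj (?D t) \<partial>Lper) = 0" .
  have int1: "integrable Lper (\<lambda>t. (u t - ?S t) * cnj (?D t))"
    by (intro L2per_mult_integrable uS L2per_cnj L2per_tpoly)
  have i2: "integrable Lper (\<lambda>t. (cmod (u t - ?S t))\<^sup>2)" "integrable Lper (\<lambda>t. (cmod (?D t))\<^sup>2)"
    using uS L2per_tpoly[of k ?b] by (auto simp: L2per_def)
  have "(\<integral>t. (cmod (u t - tpoly k a t))\<^sup>2 \<partial>Lper) =
     (\<integral>t. (cmod (u t - ?S t))\<^sup>2 + (cmod (?D t))\<^sup>2 + 2 * Re ((u t - ?S t) * cnj (?D t)) \<partial>Lper)"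
  proof (rule Bochner_Integration.integral_cong[OF refl])
    fix t
    have "u t - tpoly k a t = (u t - ?S t) + ?D t" by (simp add: D)
    then show "(cmod (u t - tpoly k a t))\<^sup>2 = (cmod (u t - ?S t))\<^sup>2 + (cmod (?D t))\<^sup>2 + 2 * Re ((u t - ?S t) * cnj (?D t))"
      by (simp only: cmod_power2 Re_complex_of_real plus_complex.simps complex_cnj times_complex.simps cnj.simps)
        (simp add: power2_eq_square algebra_simps)
  qed
  also have "\<dots> = (\<integral>t. (cmod (u t - ?S t))\<^sup>2 \<partial>Lper) + (\<integral>t. (cmod (?D t))\<^sup>2 \<partial>Lper) + 2 * Re (\<integral>t. (u t - ?S t) * cnj (?D t) \<partial>Lper)"
    using i2 int1 by (simp del: times_complex.sel minus_complex.sel complex_cnj cnj.sel)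
  also have "\<dots> = (\<integral>t. (cmod (u t - ?S t))\<^sup>2 \<partial>Lper) + (\<integral>t. (cmod (?D t))\<^sup>2 \<partial>Lper)" using orth by simp
  also have "\<dots> \<ge> (\<integral>t. (cmod (u t - ?S t))\<^sup>2 \<partial>Lper)" by simp
  finally show ?thesis .
qed

lemma tpoly_extend: "k \<le> l \<Longrightarrow> tpoly k a = tpoly l (\<lambda>m. if \<bar>m\<bar> \<le> int k then a m else 0)"
  unfolding tpoly_def fun_eq_iff
  by (intro allI sum.mono_neutral_cong_left) auto

text \<open>Coefficients are convolved; the guard in \<open>?c\<close> restricts the convolution to
  the frequencies that occur in the second factor.\<close>

lemma tpoly_mult: "\<exists>c. (\<lambda>t. tpoly k a t * tpoly l b t) = tpoly (k + l) c"
proof -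
  let ?c = "\<lambda>m. \<Sum>i\<in>{-int k..int k}. if m - i \<in> {-int l..int l} then a i * b (m - i) else 0"
  have "tpoly k a t * tpoly l b t = tpoly (k + l) ?c t" for t
  proof -
    have "tpoly (k + l) ?c t = (\<Sum>m\<in>{-int (k+l)..int (k+l)}. \<Sum>i\<in>{-int k..int k}.
        (if m - i \<in> {-int l..int l} then a i * b (m - i) * trig1 m t else 0))"
      unfolding tpoly_def sum_distrib_right by (intro sum.cong refl) auto
    also have "\<dots> = (\<Sum>i\<in>{-int k..int k}. \<Sum>m\<in>{-int (k+l)..int (k+l)}.
        (if m - i \<in> {-int l..int l} then a i * b (m - i) * trig1 m t else 0))"
      by (rule sum.swap)
    also have "\<dots> = (\<Sum>i\<in>{-int k..int k}. \<Sum>j\<in>{-int l..int l}. a i * b j * trig1 (i + j) t)"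
    proof (rule sum.cong[OF refl])
      fix i assume i: "i \<in> {-int k..int k}"
      have "(\<Sum>m\<in>{-int (k+l)..int (k+l)}. (if m - i \<in> {-int l..int l} then a i * b (m - i) * trig1 m t else 0))
        = (\<Sum>m\<in>{i - int l..i + int l}. a i * b (m - i) * trig1 m t)"
        using i by (intro sum.mono_neutral_cong_right) auto
      also have "\<dots> = (\<Sum>j\<in>{-int l..int l}. a i * b j * trig1 (i + j) t)"
        by (rule sum.reindex_bij_witness[of _ "\<lambda>j. i + j" "\<lambda>m. m - i"]) auto
      finally show "(\<Sum>m\<in>{-int (k+l)..int (k+l)}. (if m - i \<in> {-int l..int l} then a i * b (m - i) * trig1 m t else 0))
        = (\<Sum>j\<in>{-int l..int l}. a i * b j * trig1 (i + j) t)" .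
    qed
    also have "\<dots> = tpoly k a t * tpoly l b t"
      unfolding tpoly_def sum_product trig1_mult[symmetric] by (simp add: mult_ac)
    finally show ?thesis by simp
  qed
  then show ?thesis by blast
qed

lemma tpoly_add: "\<exists>c. (\<lambda>t. x * tpoly k a t + y * tpoly l b t) = tpoly (max k l) c"
proof -
  have "(\<lambda>t. x * tpoly (max k l) a' t + y * tpoly (max k l) b' t) = tpoly (max k l) (\<lambda>m. x * a' m + y * b' m)" for a' b'
    by (auto simp: tpoly_def fun_eq_iff sum_distrib_left sum.distrib algebra_simps)
  then show ?thesis
    using tpoly_extend[of k "max k l" a] tpoly_extend[of l "max k l" b] by auto
qed

text \<open>Links Weierstrass approximation on the circle to trigonometric polynomials. The base
  case rests on f(cis t) = cos t f(1) + sin t f(i) for a real-linear f on the plane.\<close>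

lemma polynomial_on_circle_tpoly:
  assumes "real_polynomial_function (p :: complex \<Rightarrow> real)"
  shows "\<exists>k a. (\<lambda>t. complex_of_real (p (cis t))) = tpoly k a"
  using assms
proof (induction rule: real_polynomial_function.induct)
  case (linear f)
  interpret bounded_linear f by fact
  have *: "complex_of_real (f (cis t)) = (f 1 / 2 - \<i> * f \<i> / 2) * trig1 1 t + (f 1 / 2 + \<i> * f \<i> / 2) * trig1 (-1) t" for t
  proof -
    have "cis t = cos t *\<^sub>R 1 + sin t *\<^sub>R \<i>" by (simp add: complex_eq_iff)
    then have "f (cis t) = cos t * f 1 + sin t * f \<i>" by (simp only: add scaleR) simp
    then show ?thesis by (simp add: trig1_def complex_eq_iff algebra_simps)
  qed
  have "(\<lambda>t. complex_of_real (f (cis t))) = tpoly 1 (\<lambda>m. if m = 1 then (f 1 / 2 - \<i> * f \<i> / 2) else if m = -1 then (f 1 / 2 + \<i> * f \<i> / 2) else 0)"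
  proof
    fix t
    have s: "{- int 1..int 1} = {-1, 0, 1}" by auto
    show "complex_of_real (f (cis t)) = tpoly 1 (\<lambda>m. if m = 1 then (f 1 / 2 - \<i> * f \<i> / 2) else if m = -1 then (f 1 / 2 + \<i> * f \<i> / 2) else 0) t"
      unfolding * tpoly_def s by simp
  qed
  then show ?case by blast
next
  case (const c)
  have "(\<lambda>t. complex_of_real c) = tpoly 0 (\<lambda>_. c)" by (auto simp: tpoly_def trig1_def)
  then show ?case by metis
next
  case (add f g)
  then obtain k a l b where "(\<lambda>t. complex_of_real (f (cis t))) = tpoly k a" "(\<lambda>t. complex_of_real (g (cis t))) = tpoly l b" by blast
  then have "(\<lambda>t. complex_of_real (f (cis t) + g (cis t))) = (\<lambda>t. 1 * tpoly k a t + 1 * tpoly l b t)"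
    by (auto simp: fun_eq_iff)
  then show ?case using tpoly_add[of 1 k a 1 l b] by metis
next
  case (mult f g)
  then obtain k a l b where "(\<lambda>t. complex_of_real (f (cis t))) = tpoly k a" "(\<lambda>t. complex_of_real (g (cis t))) = tpoly l b" by blast
  then have "(\<lambda>t. complex_of_real (f (cis t) * g (cis t))) = (\<lambda>t. tpoly k a t * tpoly l b t)"
    by (auto simp: fun_eq_iff)
  then show ?case using tpoly_mult[of k a l b] by metis
qed

section \<open>Density of the trigonometric polynomials in L^2\<close>

definition trig_approximable :: "(real \<Rightarrow> complex) \<Rightarrow> bool" where
  "trig_approximable u \<longleftrightarrow> L2per u \<and> (\<forall>e>0. \<exists>k a. (\<integral>t. (cmod (u t - tpoly k a t))\<^sup>2 \<partial>Lper) < e)"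

lemma L2_triangle:
  assumes "L2per u" "L2per v" "L2per h"
  shows "(\<integral>t. (cmod (u t - h t))\<^sup>2 \<partial>Lper) \<le> 2 * (\<integral>t. (cmod (u t - v t))\<^sup>2 \<partial>Lper) + 2 * (\<integral>t. (cmod (v t - h t))\<^sup>2 \<partial>Lper)"
proof -
  have i: "integrable Lper (\<lambda>t. (cmod (u t - v t))\<^sup>2)" "integrable Lper (\<lambda>t. (cmod (v t - h t))\<^sup>2)" "integrable Lper (\<lambda>t. (cmod (u t - h t))\<^sup>2)"
    using L2per_diff assms unfolding L2per_def by blast+
  have "(\<integral>t. (cmod (u t - h t))\<^sup>2 \<partial>Lper) \<le> (\<integral>t. 2 * (cmod (u t - v t))\<^sup>2 + 2 * (cmod (v t - h t))\<^sup>2 \<partial>Lper)"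
  proof (rule integral_mono)
    fix t
    have "(cmod (u t - h t))\<^sup>2 \<le> (cmod (u t - v t) + cmod (v t - h t))\<^sup>2"
      using norm_triangle_ineq[of "u t - v t" "v t - h t"] by (intro power_mono) auto
    also have "\<dots> \<le> 2 * (cmod (u t - v t))\<^sup>2 + 2 * (cmod (v t - h t))\<^sup>2"
      using sum_squares_bound[of "cmod (u t - v t)" "cmod (v t - h t)"] by (simp add: power2_sum)
    finally show "(cmod (u t - h t))\<^sup>2 \<le> 2 * (cmod (u t - v t))\<^sup>2 + 2 * (cmod (v t - h t))\<^sup>2" .
  qed (use i in auto)
  then show ?thesis using i by simp
qed

lemma trig_approximable_limit:
  assumes u: "L2per u" and h: "\<And>n. trig_approximable (h n)"
    and lim: "(\<lambda>n. \<integral>t. (cmod (u t - h n t))\<^sup>2 \<partial>Lper) \<longlonglongrightarrow> 0"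
  shows "trig_approximable u"
  unfolding trig_approximable_def
proof (intro conjI allI impI u)
  fix e :: real assume "e > 0"
  then have "\<forall>\<^sub>F n in sequentially. (\<integral>t. (cmod (u t - h n t))\<^sup>2 \<partial>Lper) < e / 4"
    using lim by (intro order_tendstoD) auto
  then obtain n where n: "(\<integral>t. (cmod (u t - h n t))\<^sup>2 \<partial>Lper) < e / 4"
    by (auto simp: eventually_sequentially)
  have "\<forall>e>0. \<exists>k a. (\<integral>t. (cmod (h n t - tpoly k a t))\<^sup>2 \<partial>Lper) < e"
    using h[of n] unfolding trig_approximable_def by blast
  then obtain k a where ka: "(\<integral>t. (cmod (h n t - tpoly k a t))\<^sup>2 \<partial>Lper) < e / 4"
    using \<open>e > 0\<close> by (meson divide_pos_pos zero_less_numeral)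
  have "(\<integral>t. (cmod (u t - tpoly k a t))\<^sup>2 \<partial>Lper) < e"
    using L2_triangle[OF u _ L2per_tpoly, of "h n" k a] h[of n] n ka by (auto simp: trig_approximable_def)
  then show "\<exists>k a. (\<integral>t. (cmod (u t - tpoly k a t))\<^sup>2 \<partial>Lper) < e" by blast
qed

lemma trig_approximable_circle:
  assumes F: "continuous_on (sphere 0 1) (F :: complex \<Rightarrow> real)"
  shows "trig_approximable (\<lambda>t. complex_of_real (F (cis t)))"
proof -
  have cF: "continuous_on A (\<lambda>t. complex_of_real (F (cis t)))" for A
    by (intro continuous_intros continuous_on_compose2[OF F]) auto
  show ?thesis unfolding trig_approximable_def
  proof (intro conjI allI impI)
    show "L2per (\<lambda>t. complex_of_real (F (cis t)))" by (rule L2per_cont[OF cF])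
    fix e :: real assume e: "e > 0"
    define d where "d = sqrt (e / 8)"
    have d: "d > 0" using e by (simp add: d_def)
    obtain p where p: "real_polynomial_function p" "\<And>x. x \<in> sphere 0 1 \<Longrightarrow> \<bar>F x - p x\<bar> < d"
      using Stone_Weierstrass_real_polynomial_function[OF _ F d] by auto
    obtain k a where ka: "(\<lambda>t. complex_of_real (p (cis t))) = tpoly k a"
      using polynomial_on_circle_tpoly[OF p(1)] by blast
    have "(\<integral>t. (cmod (complex_of_real (F (cis t)) - tpoly k a t))\<^sup>2 \<partial>Lper) \<le> (\<integral>t. d\<^sup>2 \<partial>Lper)"
    proof (rule integral_mono)
      fix t
      have "cmod (complex_of_real (F (cis t)) - tpoly k a t) = \<bar>F (cis t) - p (cis t)\<bar>"
        unfolding ka[symmetric] by (metis norm_of_real of_real_diff)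
      also have "\<dots> \<le> d" using p(2)[of "cis t"] by simp
      finally show "(cmod (complex_of_real (F (cis t)) - tpoly k a t))\<^sup>2 \<le> d\<^sup>2" by (intro power_mono) auto
    qed (auto intro!: integrable_Lper_cont continuous_intros cF tpoly_cont)
    also have "\<dots> = 2 * pi * (e / 8)" using e by (simp add: measure_Lper d_def)
    also have "\<dots> < e" using e pi_less_4 by (simp add: field_simps)
    finally show "\<exists>k a. (\<integral>t. (cmod (complex_of_real (F (cis t)) - tpoly k a t))\<^sup>2 \<partial>Lper) < e" by blast
  qed
qed

lemma dct_L2:
  assumes m: "\<And>n. h n \<in> borel_measurable Lper" "u \<in> borel_measurable Lper"
    and b: "integrable Lper b" "\<And>n t. t \<in> Iper \<Longrightarrow> (cmod (u t - h n t))\<^sup>2 \<le> b t"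
    and l: "AE t in Lper. (\<lambda>n. h n t) \<longlonglongrightarrow> u t"
  shows "(\<lambda>n. \<integral>t. (cmod (u t - h n t))\<^sup>2 \<partial>Lper) \<longlonglongrightarrow> 0"
proof -
  have "(\<lambda>n. \<integral>t. (cmod (u t - h n t))\<^sup>2 \<partial>Lper) \<longlonglongrightarrow> (\<integral>t. 0 \<partial>Lper)"
  proof (rule integral_dominated_convergence[where w=b])
    show "AE x in Lper. (\<lambda>i. (cmod (u x - h i x))\<^sup>2) \<longlonglongrightarrow> 0"
      using l
    proof (rule AE_mp, intro AE_I2 impI)
      fix x assume "(\<lambda>n. h n x) \<longlonglongrightarrow> u x"
      then have "(\<lambda>i. (cmod (u x - h i x))\<^sup>2) \<longlonglongrightarrow> (cmod (u x - u x))\<^sup>2" by (intro tendsto_intros)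
      then show "(\<lambda>i. (cmod (u x - h i x))\<^sup>2) \<longlonglongrightarrow> 0" by simp
    qed
  qed (use m b in auto)
  then show ?thesis by simp
qed

lemma AE_Lper_not_endpoints: "AE t in Lper. t \<noteq> 0 \<and> t \<noteq> 2 * pi"
proof (rule AE_I')
  show "{0, 2*pi} \<in> null_sets Lper"
    by (auto simp: null_sets_restrict_space Iper_def negligible_iff_null_sets[symmetric])
qed auto

text \<open>As g need not be periodic, g composed with \<open>Arg2pi\<close> may jump at z = 1. The
  factor min 1 (n |z - 1|) vanishes there and restores continuity on the circle, while it tends to 1
  at every other point; dominated convergence then gives the limit in L^2.\<close>

lemma trig_approximable_cont:
  assumes g: "continuous_on UNIV (g :: real \<Rightarrow> real)"
  shows "trig_approximable (\<lambda>t. complex_of_real (g t))"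
proof -
  have cg: "continuous_on A g" for A using g continuous_on_subset by blast
  have "bounded (g ` Iper)" using compact_continuous_image[OF cg compact_Iper] compact_imp_bounded by blast
  then obtain B0 where B0: "\<And>t. t \<in> Iper \<Longrightarrow> \<bar>g t\<bar> \<le> B0" by (auto simp: bounded_iff)
  define B where "B = max B0 0"
  have B: "\<bar>g t\<bar> \<le> B" "0 \<le> B" if "t \<in> Iper" for t using B0[OF that] by (auto simp: B_def)
  define F where "F = (\<lambda>(n::nat) z. g (Arg2pi z) * min 1 (real n * cmod (z - 1)))"
  have Arg_I: "Arg2pi z \<in> Iper" for z using Arg2pi[of z] by (auto simp: Iper_def)
  have Fc: "continuous_on (sphere 0 1) (F n)" for n
    unfolding continuous_on_eq_continuous_within
  proof
    fix z :: complex assume z: "z \<in> sphere 0 1"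
    show "continuous (at z within sphere 0 1) (F n)"
    proof (cases "z = 1")
      case True
      have "((\<lambda>y. B * (real n * cmod (y - 1))) \<longlongrightarrow> B * (real n * cmod (1 - 1))) (at z within sphere 0 1)"
        unfolding True by (intro tendsto_intros)
      then have 1: "((\<lambda>y. B * (real n * cmod (y - 1))) \<longlongrightarrow> 0) (at z within sphere 0 1)" by simp
      have "(F n \<longlongrightarrow> 0) (at z within sphere 0 1)"
      proof (rule tendsto_0_le[OF 1, of _ 1], rule always_eventually, rule allI)
        fix y
        have "\<bar>F n y\<bar> \<le> B * (real n * cmod (y - 1))"
          unfolding F_def abs_mult using B[OF Arg_I[of y]] by (intro mult_mono) auto
        then show "norm (F n y) \<le> norm (B * (real n * cmod (y - 1))) * 1" by simp
      qed
      moreover have "F n z = 0" by (simp add: F_def True)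
      ultimately show ?thesis by (simp add: continuous_within)
    next
      case False
      have "z \<notin> \<real>\<^sub>\<ge>\<^sub>0"
      proof
        assume "z \<in> \<real>\<^sub>\<ge>\<^sub>0"
        then obtain r where "z = of_real r" "r \<ge> 0" by (auto simp: nonneg_Reals_def)
        then show False using z False by simp
      qed
      then have "isCont Arg2pi z" by (rule continuous_at_Arg2pi)
      then have "isCont (\<lambda>z. g (Arg2pi z)) z"
        using isCont_o2[of z Arg2pi g] g by (simp add: continuous_on_eq_continuous_at)
      then have "isCont (F n) z" unfolding F_def
        by (intro continuous_intros)
      then show ?thesis by (rule continuous_at_imp_continuous_at_within)
    qed
  qed
  have Fg: "F n (cis t) = g t * min 1 (real n * cmod (cis t - 1))" if "t \<in> Iper" "t \<noteq> 2 * pi" for n t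
  proof -
    have "Arg2pi (cis t) = t"
      using that by (intro Arg2pi_unique[of 1]) (auto simp: Iper_def cis_conv_exp)
    then show ?thesis by (simp add: F_def)
  qed
  show ?thesis
  proof (rule trig_approximable_limit)
    show "L2per (\<lambda>t. complex_of_real (g t))" by (intro L2per_cont continuous_intros cg)
    show tF: "trig_approximable (\<lambda>t. complex_of_real (F n (cis t)))" for n
      by (rule trig_approximable_circle[OF Fc])
    show "(\<lambda>n. \<integral>t. (cmod (complex_of_real (g t) - complex_of_real (F n (cis t))))\<^sup>2 \<partial>Lper) \<longlonglongrightarrow> 0"
    proof (rule dct_L2[where b = "\<lambda>_. (2 * B)\<^sup>2"])
      show "(\<lambda>t. complex_of_real (F n (cis t))) \<in> borel_measurable Lper" for n
        using tF[of n] by (auto simp: trig_approximable_def L2per_def)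
      show "(\<lambda>t. complex_of_real (g t)) \<in> borel_measurable Lper"
        by (intro measurable_Lper_cont continuous_intros cg)
      show "integrable Lper (\<lambda>_. (2 * B)\<^sup>2)" by (intro integrable_Lper_cont continuous_intros)
      fix n t assume t: "t \<in> Iper"
      have "\<bar>F n (cis t)\<bar> \<le> B * 1" unfolding F_def abs_mult using B[OF Arg_I[of "cis t"]] by (intro mult_mono) auto
      then have "\<bar>g t - F n (cis t)\<bar> \<le> 2 * B" using B[OF t] by linarith
      then have "\<bar>g t - F n (cis t)\<bar>\<^sup>2 \<le> (2 * B)\<^sup>2" by (intro power_mono) auto
      then show "(cmod (complex_of_real (g t) - complex_of_real (F n (cis t))))\<^sup>2 \<le> (2 * B)\<^sup>2"
        by (metis norm_of_real of_real_diff)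
    next
      show "AE t in Lper. (\<lambda>n. complex_of_real (F n (cis t))) \<longlonglongrightarrow> complex_of_real (g t)"
        using AE_Lper_not_endpoints
      proof (rule AE_mp, intro AE_I2 impI)
        fix t assume t: "t \<in> space Lper" "t \<noteq> 0 \<and> t \<noteq> 2 * pi"
        have tI: "t \<in> Iper" using t by simp
        have "cis t \<noteq> 1"
        proof
          assume "cis t = 1"
          then have "cos t = 1" by (simp add: complex_eq_iff)
          then obtain k::int where k: "t = of_int k * 2 * pi" using cos_one_2pi_int by auto
          have "0 < t" "t < 2 * pi" using t by (auto simp: Iper_def)
          then have "0 < of_int k * (2 * pi)" "of_int k * (2 * pi) < 1 * (2*pi)" using k by (auto simp: mult_ac)
          then have "0 < real_of_int k" "real_of_int k < 1"
            using pi_gt_zero by (auto simp only: zero_less_mult_iff mult_less_cancel_right)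
          then have "0 < k" "k < 1" by simp_all
          then show False by simp
        qed
        then have c: "cmod (cis t - 1) > 0" by simp
        then obtain N where N: "real N * cmod (cis t - 1) > 1" using ex_less_of_nat_mult by blast
        have "\<forall>n\<ge>N. F n (cis t) = g t"
        proof (intro allI impI)
          fix n assume "N \<le> n"
          then have "real N * cmod (cis t - 1) \<le> real n * cmod (cis t - 1)" by (intro mult_right_mono) auto
          then have "min 1 (real n * cmod (cis t - 1)) = 1" using N by linarith
          then show "F n (cis t) = g t" using Fg[OF tI] t by simp
        qed
        then show "(\<lambda>n. complex_of_real (F n (cis t))) \<longlonglongrightarrow> complex_of_real (g t)"
          by (intro tendsto_eventually eventually_sequentiallyI[of N]) auto
      qed
    qed
  qed
qed

text \<open>A measurable function is an almost everywhere limit of continuous ones. Clamping both to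
  [-k, k] provides a dominating constant; afterwards k tends to infinity with |u|^2 as the
  dominating function.\<close>

lemma trig_approximable_real:
  assumes u: "L2per (\<lambda>t. complex_of_real (u t))"
  shows "trig_approximable (\<lambda>t. complex_of_real (u t))"
proof -
  have "(\<lambda>t. Re (complex_of_real (u t))) \<in> borel_measurable Lper"
    using u unfolding L2per_def borel_measurable_complex_iff by blast
  then have um: "u \<in> borel_measurable Lper" by simp
  then have "(\<lambda>x. if x \<in> Iper then u x else 0) \<in> borel_measurable lebesgue"
    by (simp only: borel_measurable_if[OF Iper_sets(1)])
  then have "(\<lambda>x. if x \<in> Iper then u x else 0) measurable_on UNIV"
    by (intro lebesgue_measurable_imp_measurable_on) auto
  then obtain N g where N: "negligible N" and g: "\<And>n. continuous_on UNIV (g n)"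
    and l: "\<And>x. x \<notin> N \<Longrightarrow> (\<lambda>n. g n x) \<longlonglongrightarrow> (if x \<in> Iper then u x else 0)"
    unfolding measurable_on_def by auto
  have NAE: "AE x in Lper. x \<notin> N"
  proof (rule AE_I')
    show "N \<inter> Iper \<in> null_sets Lper"
      using N by (auto simp: null_sets_restrict_space negligible_iff_null_sets[symmetric] intro: negligible_subset)
  qed auto
  let ?cl = "\<lambda>(k::nat) y. max (- real k) (min (real k) y)"
  have cont_cl: "continuous_on UNIV (?cl k)" for k by (intro continuous_intros)
  have bounded: "trig_approximable (\<lambda>t. complex_of_real (?cl k (u t)))" for k
  proof (rule trig_approximable_limit[where h = "\<lambda>n t. complex_of_real (?cl k (g n t))"])
    have mes: "(\<lambda>t. complex_of_real (?cl k (u t))) \<in> borel_measurable Lper" using um by measurable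
    have "cmod (complex_of_real (?cl k (u t))) \<le> real k" for t by auto
    then have "(cmod (complex_of_real (?cl k (u t))))\<^sup>2 \<le> (real k)\<^sup>2" for t by (intro power_mono) auto
    then have "integrable Lper (\<lambda>t. (cmod (complex_of_real (?cl k (u t))))\<^sup>2)"
      using mes um by (intro Bochner_Integration.integrable_bound[OF integrable_Lper_cont[of "\<lambda>_. (real k)\<^sup>2"]])
         auto
    then show "L2per (\<lambda>t. complex_of_real (?cl k (u t)))" using mes by (simp add: L2per_def)
    show "trig_approximable (\<lambda>t. complex_of_real (?cl k (g n t)))" for n
      by (intro trig_approximable_cont continuous_intros g)
    show "(\<lambda>n. \<integral>t. (cmod (complex_of_real (?cl k (u t)) - complex_of_real (?cl k (g n t))))\<^sup>2 \<partial>Lper) \<longlonglongrightarrow> 0"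
    proof (rule dct_L2[where b = "\<lambda>_. (2 * real k)\<^sup>2"])
      show "(\<lambda>t. complex_of_real (?cl k (g n t))) \<in> borel_measurable Lper" for n
        using g[of n] by (intro measurable_Lper_cont continuous_intros) (auto intro: continuous_on_subset)
      show "integrable Lper (\<lambda>_. (2 * real k)\<^sup>2)" by (intro integrable_Lper_cont continuous_intros)
      fix n t
      have "\<bar>?cl k (u t) - ?cl k (g n t)\<bar> \<le> 2 * real k" by linarith
      then have "\<bar>?cl k (u t) - ?cl k (g n t)\<bar>\<^sup>2 \<le> (2 * real k)\<^sup>2" by (rule power_mono) simp
      then show "(cmod (complex_of_real (?cl k (u t)) - complex_of_real (?cl k (g n t))))\<^sup>2 \<le> (2 * real k)\<^sup>2"
        by (metis norm_of_real of_real_diff)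
    next
      show "AE t in Lper. (\<lambda>n. complex_of_real (?cl k (g n t))) \<longlonglongrightarrow> complex_of_real (?cl k (u t))"
        using NAE
      proof (rule AE_mp, intro AE_I2 impI)
        fix t assume "t \<in> space Lper" "t \<notin> N"
        then have "(\<lambda>n. g n t) \<longlonglongrightarrow> u t" using l[of t] by simp
        then show "(\<lambda>n. complex_of_real (?cl k (g n t))) \<longlonglongrightarrow> complex_of_real (?cl k (u t))"
          by (intro tendsto_intros)
      qed
    qed (rule mes)
  qed
  show ?thesis
  proof (rule trig_approximable_limit[OF u bounded])
    show "(\<lambda>k. \<integral>t. (cmod (complex_of_real (u t) - complex_of_real (?cl k (u t))))\<^sup>2 \<partial>Lper) \<longlonglongrightarrow> 0"
    proof (rule dct_L2[where b = "\<lambda>t. (cmod (complex_of_real (u t)))\<^sup>2"])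
      show "(\<lambda>t. complex_of_real (?cl n (u t))) \<in> borel_measurable Lper" for n using um by measurable
      fix n t
      have "\<bar>u t - ?cl n (u t)\<bar> \<le> \<bar>u t\<bar>" by linarith
      then have "\<bar>u t - ?cl n (u t)\<bar>\<^sup>2 \<le> \<bar>u t\<bar>\<^sup>2" by (rule power_mono) simp
      then show "(cmod (complex_of_real (u t) - complex_of_real (?cl n (u t))))\<^sup>2 \<le> (cmod (complex_of_real (u t)))\<^sup>2"
        by (metis norm_of_real of_real_diff)
    next
      show "AE t in Lper. (\<lambda>n. complex_of_real (?cl n (u t))) \<longlonglongrightarrow> complex_of_real (u t)"
      proof (rule AE_I2)
        fix t
        obtain K :: nat where K: "\<bar>u t\<bar> \<le> real K" using real_arch_simple by blast
        show "(\<lambda>n. complex_of_real (?cl n (u t))) \<longlonglongrightarrow> complex_of_real (u t)"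
          using K by (intro tendsto_eventually eventually_sequentiallyI[of K]) auto
      qed
    qed (use u in \<open>auto simp: L2per_def\<close>)
  qed
qed

lemma trig_approximable_L2:
  assumes u: "L2per u" shows "trig_approximable u"
  unfolding trig_approximable_def
proof (intro conjI allI impI u)
  fix e :: real assume e: "e > 0"
  have *: "L2per (\<lambda>t. complex_of_real (q (u t)))" if "q \<in> {Re, Im}" for q
    unfolding L2per_def
  proof
    have q: "(\<lambda>t. q (u t)) \<in> borel_measurable Lper"
      using u that unfolding L2per_def borel_measurable_complex_iff by auto
    then show m: "(\<lambda>t. complex_of_real (q (u t))) \<in> borel_measurable Lper" by measurable
    have "integrable Lper (\<lambda>t. (cmod (u t))\<^sup>2)" using u by (simp add: L2per_def)
    then show "integrable Lper (\<lambda>t. (cmod (complex_of_real (q (u t))))\<^sup>2)"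
    proof (rule Bochner_Integration.integrable_bound)
      have "\<bar>q (u t)\<bar> \<le> cmod (u t)" for t using that abs_Re_le_cmod abs_Im_le_cmod by auto
      then have "\<bar>q (u t)\<bar>\<^sup>2 \<le> (cmod (u t))\<^sup>2" for t by (intro power_mono) auto
      then show "AE t in Lper. norm ((cmod (complex_of_real (q (u t))))\<^sup>2) \<le> norm ((cmod (u t))\<^sup>2)" by simp
    qed (use q in auto)
  qed
  have ta: "trig_approximable (\<lambda>t. complex_of_real (Re (u t)))" "trig_approximable (\<lambda>t. complex_of_real (Im (u t)))"
    by (rule trig_approximable_real[OF *]; simp)+
  have e4: "e / 4 > 0" using e by simp
  from ta(1) e4 obtain k a where ka: "(\<integral>t. (cmod (complex_of_real (Re (u t)) - tpoly k a t))\<^sup>2 \<partial>Lper) < e / 4"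
    unfolding trig_approximable_def by blast
  from ta(2) e4 obtain l b where lb: "(\<integral>t. (cmod (complex_of_real (Im (u t)) - tpoly l b t))\<^sup>2 \<partial>Lper) < e / 4"
    unfolding trig_approximable_def by blast
  obtain c where c: "(\<lambda>t. 1 * tpoly k a t + \<i> * tpoly l b t) = tpoly (max k l) c" using tpoly_add by blast
  have "(\<integral>t. (cmod (u t - tpoly (max k l) c t))\<^sup>2 \<partial>Lper) \<le>
     2 * (\<integral>t. (cmod (u t - (1 * tpoly k a t + \<i> * complex_of_real (Im (u t)))))\<^sup>2 \<partial>Lper) +
     2 * (\<integral>t. (cmod ((1 * tpoly k a t + \<i> * complex_of_real (Im (u t))) - tpoly (max k l) c t))\<^sup>2 \<partial>Lper)"
    by (intro L2_triangle u L2per_tpoly L2per_lin *) auto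
  also have "(\<lambda>t. cmod (u t - (1 * tpoly k a t + \<i> * complex_of_real (Im (u t))))) = (\<lambda>t. cmod (complex_of_real (Re (u t)) - tpoly k a t))"
  proof
    fix t
    have "u t - (1 * tpoly k a t + \<i> * complex_of_real (Im (u t))) = complex_of_real (Re (u t)) - tpoly k a t"
      by (simp add: complex_eq_iff)
    then show "cmod (u t - (1 * tpoly k a t + \<i> * complex_of_real (Im (u t)))) = cmod (complex_of_real (Re (u t)) - tpoly k a t)" by (simp only:)
  qed
  also have "(\<lambda>t. cmod ((1 * tpoly k a t + \<i> * complex_of_real (Im (u t))) - tpoly (max k l) c t)) = (\<lambda>t. cmod (complex_of_real (Im (u t)) - tpoly l b t))"
  proof
    fix t
    have "(1 * tpoly k a t + \<i> * complex_of_real (Im (u t))) - tpoly (max k l) c t = \<i> * (complex_of_real (Im (u t)) - tpoly l b t)"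
      by (simp add: c[symmetric] algebra_simps)
    then show "cmod ((1 * tpoly k a t + \<i> * complex_of_real (Im (u t))) - tpoly (max k l) c t) = cmod (complex_of_real (Im (u t)) - tpoly l b t)"
      by (simp add: norm_mult)
  qed
  finally have "(\<integral>t. (cmod (u t - tpoly (max k l) c t))\<^sup>2 \<partial>Lper) < e" using ka lb by linarith
  then show "\<exists>k a. (\<integral>t. (cmod (u t - tpoly k a t))\<^sup>2 \<partial>Lper) < e" by blast
qed

text \<open>Density gives some polynomial close to u, and best approximation transfers the error
  bound to the Fourier sums of that and every higher degree.\<close>

lemma fourier_L2:
  assumes u: "L2per u"
  shows "(\<lambda>k. \<integral>t. (cmod (u t - tpoly k (fcoef u) t))\<^sup>2 \<partial>Lper) \<longlonglongrightarrow> 0"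
proof (rule LIMSEQ_I)
  fix r :: real assume "0 < r"
  then obtain k0 a where ka: "(\<integral>t. (cmod (u t - tpoly k0 a t))\<^sup>2 \<partial>Lper) < r"
    using trig_approximable_L2[OF u] unfolding trig_approximable_def by blast
  show "\<exists>no. \<forall>n\<ge>no. norm ((\<integral>t. (cmod (u t - tpoly n (fcoef u) t))\<^sup>2 \<partial>Lper) - 0) < r"
  proof (intro exI[of _ k0] allI impI)
    fix n assume "k0 \<le> n"
    from tpoly_extend[OF this, of a]
    have "(\<integral>t. (cmod (u t - tpoly n (fcoef u) t))\<^sup>2 \<partial>Lper) \<le> (\<integral>t. (cmod (u t - tpoly k0 a t))\<^sup>2 \<partial>Lper)"
      using fourier_best_approx[OF u, of n "\<lambda>m. if \<bar>m\<bar> \<le> int k0 then a m else 0"] by simp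
    then have "(\<integral>t. (cmod (u t - tpoly n (fcoef u) t))\<^sup>2 \<partial>Lper) < r" using ka by linarith
    then show "norm ((\<integral>t. (cmod (u t - tpoly n (fcoef u) t))\<^sup>2 \<partial>Lper) - 0) < r" by simp
  qed
qed

text \<open>Generated from the countable family of sines and cosines by binary linear combinations,
  so that convergence of linear functionals on this family spreads by induction.\<close>

inductive rtrig :: "(real \<Rightarrow> real) \<Rightarrow> bool" where
  cos: "rtrig (\<lambda>t. cos (real_of_int m * t))"
| sin: "rtrig (\<lambda>t. sin (real_of_int m * t))"
| lin: "rtrig f \<Longrightarrow> rtrig h \<Longrightarrow> rtrig (\<lambda>t. a * f t + b * h t)"

lemma rtrig_const: "rtrig (\<lambda>t. c)"
  using rtrig.lin[OF rtrig.cos[of 0] rtrig.cos[of 0], of c 0] by simp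

lemma rtrig_sum: "finite A \<Longrightarrow> (\<And>i. i \<in> A \<Longrightarrow> rtrig (f i)) \<Longrightarrow> rtrig (\<lambda>t. \<Sum>i\<in>A. f i t)"
proof (induction rule: finite_induct)
  case empty then show ?case using rtrig_const[of 0] by simp
next
  case (insert x F)
  have "rtrig (\<lambda>t. 1 * f x t + 1 * (\<Sum>i\<in>F. f i t))"
    using insert by (intro rtrig.lin) auto
  then show ?case using insert by simp
qed

lemma rtrig_C1per: "rtrig f \<Longrightarrow> \<exists>f'. C1per f f'"
proof (induction rule: rtrig.induct)
  case (cos m)
  have "cos (real_of_int m * (t + 2 * pi)) = cos (real_of_int m * t)" for t
    using trig1_periodic[of m t] by (simp add: trig1_def complex_eq_iff)
  then have "C1per (\<lambda>t. cos (real_of_int m * t)) (\<lambda>t. - real_of_int m * sin (real_of_int m * t))"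
    by (auto simp: C1per_def intro!: derivative_eq_intros continuous_intros)
  then show ?case by blast
next
  case (sin m)
  have "sin (real_of_int m * (t + 2 * pi)) = sin (real_of_int m * t)" for t
    using trig1_periodic[of m t] by (simp add: trig1_def complex_eq_iff)
  then have "C1per (\<lambda>t. sin (real_of_int m * t)) (\<lambda>t. real_of_int m * cos (real_of_int m * t))"
    by (auto simp: C1per_def intro!: derivative_eq_intros continuous_intros)
  then show ?case by blast
next
  case (lin f h a b)
  then show ?case using C1per_lin by blast
qed

lemma wderiv1_L2: "wderiv1 f g \<Longrightarrow> L2per f" "wderiv1 f g \<Longrightarrow> L2per g"
  by (auto simp: wderiv1_def L2per_def)

lemma L2_trig: "L2per (\<lambda>t. c * trig1 m t)"
  by (intro L2per_cont continuous_intros trig1_cont)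

lemma wderiv1_lin:
  assumes "wderiv1 f g" "wderiv1 h k"
  shows "wderiv1 (\<lambda>t. a * f t + b * h t) (\<lambda>t. a * g t + b * k t)"
  unfolding wderiv1_def
proof (intro conjI allI)
  have "L2per (\<lambda>t. a * f t + b * h t)" "L2per (\<lambda>t. a * g t + b * k t)"
    using assms by (auto intro: L2per_lin wderiv1_L2)
  then show "(\<lambda>t. a * f t + b * h t) \<in> borel_measurable Lper" "(\<lambda>t. a * g t + b * k t) \<in> borel_measurable Lper"
    "integrable Lper (\<lambda>t. (cmod (a * f t + b * h t))\<^sup>2)" "integrable Lper (\<lambda>t. (cmod (a * g t + b * k t))\<^sup>2)"
    by (auto simp: L2per_def)
  fix m
  have i: "integrable Lper (\<lambda>t. f t * (\<i> * of_int m * trig1 m t))" "integrable Lper (\<lambda>t. h t * (\<i> * of_int m * trig1 m t))"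
    "integrable Lper (\<lambda>t. g t * trig1 m t)" "integrable Lper (\<lambda>t. k t * trig1 m t)"
    using L2_trig[of 1 m] assms by (auto intro!: L2per_mult_integrable L2_trig intro: wderiv1_L2)
  have "(\<integral>t. (a * f t + b * h t) * (\<i> * of_int m * trig1 m t) \<partial>Lper) =
    a * (\<integral>t. f t * (\<i> * of_int m * trig1 m t) \<partial>Lper) + b * (\<integral>t. h t * (\<i> * of_int m * trig1 m t) \<partial>Lper)"
    using i by (simp add: distrib_right mult.assoc)
  also have "\<dots> = - (a * (\<integral>t. g t * trig1 m t \<partial>Lper) + b * (\<integral>t. k t * trig1 m t \<partial>Lper))"
    using assms by (simp add: wderiv1_def)
  also have "\<dots> = - (\<integral>t. (a * g t + b * k t) * trig1 m t \<partial>Lper)"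
    using i by (simp add: distrib_right mult.assoc)
  finally show "(\<integral>t. (a * f t + b * h t) * (\<i> * of_int m * trig1 m t) \<partial>Lper) = - (\<integral>t. (a * g t + b * k t) * trig1 m t \<partial>Lper)" .
qed

text \<open>Conjugation exchanges the test functions with frequencies m and -m, so for real f the
  conjugate of a weak derivative is again one, and the average of the two is real.\<close>

lemma wderiv1_real:
  assumes w: "wderiv1 (\<lambda>t. complex_of_real (f t)) g"
  shows "wderiv1 (\<lambda>t. complex_of_real (f t)) (\<lambda>t. complex_of_real (Re (g t)))"
proof -
  have "wderiv1 (\<lambda>t. complex_of_real (f t)) (\<lambda>t. cnj (g t))"
    unfolding wderiv1_def
  proof (intro conjI allI)
    show "(\<lambda>t. complex_of_real (f t)) \<in> borel_measurable Lper" "integrable Lper (\<lambda>t. (cmod (complex_of_real (f t)))\<^sup>2)"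
      using w by (auto simp: wderiv1_def)
    show "(\<lambda>t. cnj (g t)) \<in> borel_measurable Lper" "integrable Lper (\<lambda>t. (cmod (cnj (g t)))\<^sup>2)"
      using L2per_cnj[OF wderiv1_L2(2)[OF w]] by (auto simp: L2per_def)
    fix m
    have "(\<integral>t. complex_of_real (f t) * (\<i> * of_int m * trig1 m t) \<partial>Lper) = (\<integral>t. cnj (complex_of_real (f t) * (\<i> * of_int (-m) * trig1 (-m) t)) \<partial>Lper)"
      by (rule Bochner_Integration.integral_cong) (auto simp: trig1_cnj)
    also have "\<dots> = cnj (\<integral>t. (complex_of_real (f t) * (\<i> * of_int (-m) * trig1 (-m) t)) \<partial>Lper)" by (rule Bochner_Integration.integral_cnj)
    also have "\<dots> = cnj (- (\<integral>t. g t * trig1 (-m) t \<partial>Lper))" using w by (simp only: wderiv1_def)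
    also have "\<dots> = - (\<integral>t. cnj (g t * trig1 (-m) t) \<partial>Lper)" by (simp only: complex_cnj_minus Bochner_Integration.integral_cnj)
    also have "\<dots> = - (\<integral>t. cnj (g t) * trig1 m t \<partial>Lper)" by (simp add: trig1_cnj)
    finally show "(\<integral>t. complex_of_real (f t) * (\<i> * of_int m * trig1 m t) \<partial>Lper) = - (\<integral>t. cnj (g t) * trig1 m t \<partial>Lper)" .
  qed
  from wderiv1_lin[OF w this, of "1/2" "1/2"]
  have "wderiv1 (\<lambda>t. 1/2 * complex_of_real (f t) + 1/2 * complex_of_real (f t)) (\<lambda>t. 1/2 * g t + 1/2 * cnj (g t))" .
  moreover have "(\<lambda>t. 1/2 * complex_of_real (f t) + 1/2 * complex_of_real (f t)) = (\<lambda>t. complex_of_real (f t))"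
    "(\<lambda>t. 1/2 * g t + 1/2 * cnj (g t)) = (\<lambda>t. complex_of_real (Re (g t)))"
    by (auto simp: complex_eq_iff fun_eq_iff)
  ultimately show ?thesis by simp
qed

text \<open>The squared H^1 norm, the second argument standing for the derivative of the
  first.\<close>

definition h1dist :: "(real \<Rightarrow> real) \<Rightarrow> (real \<Rightarrow> real) \<Rightarrow> real" where
  "h1dist f g = (\<integral>t. (f t)\<^sup>2 \<partial>Lper) + (\<integral>t. (g t)\<^sup>2 \<partial>Lper)"

lemma fcoef_wderiv1:
  assumes "wderiv1 f g" shows "fcoef g m = \<i> * of_int m * fcoef f m"
proof -
  have "(\<integral>t. f t * (\<i> * of_int (-m) * trig1 (-m) t) \<partial>Lper) = - (\<integral>t. g t * trig1 (-m) t \<partial>Lper)"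
    using assms unfolding wderiv1_def by blast
  moreover have "(\<integral>t. f t * (\<i> * of_int (-m) * trig1 (-m) t) \<partial>Lper) = - (\<i> * of_int m * (\<integral>t. f t * trig1 (-m) t \<partial>Lper))"
    by (simp add: mult_ac)
  ultimately show ?thesis by (simp add: fcoef_def)
qed

text \<open>The m-th Fourier coefficient of the weak derivative is i m times that of f, so
  differentiating the Fourier sums of f gives the Fourier sums of g, and both converge in L^2.
  Taking real parts keeps the approximants real and does not increase the error.\<close>

lemma H1per_trig_approx:
  assumes "H1per f"
  obtains g T T' where "wderiv1 (\<lambda>t. complex_of_real (f t)) (\<lambda>t. complex_of_real (g t))"
    "\<And>k. rtrig (T k)" "\<And>k. C1per (T k) (T' k)"
    "(\<lambda>k::nat. h1dist (\<lambda>t. f t - T k t) (\<lambda>t. g t - T' k t)) \<longlonglongrightarrow> 0"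
proof -
  obtain g0 where g0: "wderiv1 (\<lambda>t. complex_of_real (f t)) g0" using assms by (auto simp: H1per_def)
  note w = wderiv1_real[OF g0]
  let ?f = "\<lambda>t. complex_of_real (f t)" let ?g = "\<lambda>t. complex_of_real (Re (g0 t))"
  note Lf = wderiv1_L2(1)[OF w] and Lg = wderiv1_L2(2)[OF w]
  let ?a = "fcoef ?f" let ?b = "\<lambda>m. \<i> * of_int m * ?a m"
  have b: "fcoef ?g = ?b" by (rule ext) (rule fcoef_wderiv1[OF w])
  define T where "T = (\<lambda>(k::nat) t. Re (tpoly k ?a t))"
  define T' where "T' = (\<lambda>(k::nat) t. Re (tpoly k ?b t))"
  have Teq: "T k = (\<lambda>t. \<Sum>m\<in>{-int k..int k}. Re (?a m) * cos (real_of_int m * t) + (- Im (?a m)) * sin (real_of_int m * t))" for k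
    by (auto simp: T_def tpoly_def trig1_def fun_eq_iff intro!: sum.cong)
  have rT: "rtrig (T k)" for k unfolding Teq
    by (rule rtrig_sum) (simp, rule rtrig.lin[OF rtrig.cos rtrig.sin])
  have CT: "C1per (T k) (T' k)" for k
    unfolding C1per_def
  proof (intro conjI allI)
    fix t
    have "(tpoly k ?a has_vector_derivative tpoly k ?b t) (at t)"
      unfolding tpoly_def
      by (rule has_vector_derivative_sum) (auto intro!: derivative_eq_intros trig1_vderiv)
    then show "(T k has_real_derivative T' k t) (at t)"
      unfolding T_def T'_def has_real_derivative_iff_has_vector_derivative
      by (rule bounded_linear.has_vector_derivative[OF bounded_linear_Re])
    show "continuous_on UNIV (T' k)" unfolding T'_def by (intro continuous_intros tpoly_cont)
    show "T k (t + 2 * pi) = T k t" by (simp add: T_def tpoly_def trig1_periodic)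
  qed
  have le: "(\<integral>t. (q t - Re (tpoly k a t))\<^sup>2 \<partial>Lper) \<le> (\<integral>t. (cmod (complex_of_real (q t) - tpoly k a t))\<^sup>2 \<partial>Lper)"
    if "L2per (\<lambda>t. complex_of_real (q t))" for q k a
  proof (rule integral_mono')
    show "integrable Lper (\<lambda>t. (cmod (complex_of_real (q t) - tpoly k a t))\<^sup>2)"
      using L2per_diff[OF that L2per_tpoly] by (auto simp: L2per_def)
    fix t
    have "\<bar>Re (complex_of_real (q t) - tpoly k a t)\<bar>\<^sup>2 \<le> (cmod (complex_of_real (q t) - tpoly k a t))\<^sup>2"
      by (intro power_mono abs_Re_le_cmod) auto
    then show "(q t - Re (tpoly k a t))\<^sup>2 \<le> (cmod (complex_of_real (q t) - tpoly k a t))\<^sup>2" by simp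
  qed simp
  have l1: "(\<lambda>k. \<integral>t. (f t - T k t)\<^sup>2 \<partial>Lper) \<longlonglongrightarrow> 0"
    by (rule tendsto_sandwich[OF _ _ tendsto_const fourier_L2[OF Lf]])
      (use le[OF Lf] in \<open>auto simp: T_def\<close>)
  have l2: "(\<lambda>k. \<integral>t. (Re (g0 t) - T' k t)\<^sup>2 \<partial>Lper) \<longlonglongrightarrow> 0"
    by (rule tendsto_sandwich[OF _ _ tendsto_const fourier_L2[OF Lg]])
      (use le[OF Lg] in \<open>auto simp: T'_def b\<close>)
  have "(\<lambda>k. h1dist (\<lambda>t. f t - T k t) (\<lambda>t. Re (g0 t) - T' k t)) \<longlonglongrightarrow> 0"
    unfolding h1dist_def using tendsto_add[OF l1 l2] by simp
  then show ?thesis by (intro that[of "\<lambda>t. Re (g0 t)" T T'] w rT CT)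
qed

lemma integrable_sq_of_L2:
  assumes "L2per (\<lambda>t. complex_of_real (f t))"
  shows "integrable Lper (\<lambda>t. (f t)\<^sup>2)" "f \<in> borel_measurable Lper" "integrable Lper f"
proof -
  show "integrable Lper (\<lambda>t. (f t)\<^sup>2)" using assms by (simp add: L2per_def)
  show "f \<in> borel_measurable Lper" using assms by (simp add: L2per_def borel_measurable_complex_iff)
  show "integrable Lper f" using integrable_Re[OF L2per_integrable[OF assms]] by simp
qed

lemma H1per_integrable: "H1per f \<Longrightarrow> integrable Lper f"
  unfolding H1per_def using wderiv1_L2(1) integrable_sq_of_L2(3) by blast

lemma H1per_lin:
  assumes "H1per f" "H1per h" shows "H1per (\<lambda>t. a * f t + b * h t)"
proof -
  obtain g k where "wderiv1 (\<lambda>t. complex_of_real (f t)) g" "wderiv1 (\<lambda>t. complex_of_real (h t)) k"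
    using assms by (auto simp: H1per_def)
  from wderiv1_lin[OF this, of a b] show ?thesis by (auto simp: H1per_def)
qed

text \<open>Cauchy-Schwarz against the constant 1, in the form that the variance of f is
  nonnegative.\<close>

lemma abs_integral_le_L2:
  assumes "integrable Lper f" "integrable Lper (\<lambda>t. (f t)\<^sup>2)"
  shows "\<bar>\<integral>t. f t \<partial>Lper\<bar> \<le> sqrt (2 * pi * (\<integral>t. (f t)\<^sup>2 \<partial>Lper))"
proof -
  let ?m = "\<integral>t. f t \<partial>Lper"
  have "0 \<le> (\<integral>t. (f t - ?m / (2*pi))\<^sup>2 \<partial>Lper)" by (rule Bochner_Integration.integral_nonneg) simp
  also have "\<dots> = (\<integral>t. (f t)\<^sup>2 - (?m / pi) * f t + (?m / (2 * pi))\<^sup>2 \<partial>Lper)"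
    by (rule Bochner_Integration.integral_cong) (auto simp: power2_eq_square algebra_simps)
  also have "\<dots> = (\<integral>t. (f t)\<^sup>2 \<partial>Lper) - (?m / pi) * ?m + 2 * pi * (?m / (2 * pi))\<^sup>2"
    using assms by (simp add: measure_Lper finite_measure.integrable_const[OF finite_measure_Lper])
  also have "\<dots> = (\<integral>t. (f t)\<^sup>2 \<partial>Lper) - ?m\<^sup>2 / (2 * pi)"
    by (simp add: power2_eq_square field_simps)
  finally have "?m\<^sup>2 \<le> 2 * pi * (\<integral>t. (f t)\<^sup>2 \<partial>Lper)" by (simp add: field_simps)
  then show ?thesis by (metis real_sqrt_abs real_sqrt_le_mono)
qed

lemma Hminus_bound_trig:
  assumes u: "Hminus u" and f: "H1per f"
    and w: "wderiv1 (\<lambda>t. complex_of_real (f t)) (\<lambda>t. complex_of_real (g t))"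
    and T: "\<And>k. C1per (T k) (T' k)"
    and l: "(\<lambda>k::nat. h1dist (\<lambda>t. f t - T k t) (\<lambda>t. g t - T' k t)) \<longlonglongrightarrow> 0"
  shows "(\<lambda>k. u (T k)) \<longlonglongrightarrow> u f"
proof -
  obtain B where B: "\<And>f g. wderiv1 (\<lambda>t. complex_of_real (f t)) g \<Longrightarrow>
          \<bar>u f\<bar> \<le> B * sqrt ((\<integral>t. (f t)\<^sup>2 \<partial>Lper) + (\<integral>t. (cmod (g t))\<^sup>2 \<partial>Lper))"
    using u unfolding Hminus_def by blast
  have lin: "u (\<lambda>t. a * f t + b * h t) = a * u f + b * u h" if "H1per f" "H1per h" for f h a b
    using u that unfolding Hminus_def by blast
  have le: "norm (u (T k) - u f) \<le> B * sqrt (h1dist (\<lambda>t. f t - T k t) (\<lambda>t. g t - T' k t))" for k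
  proof -
    have "u (\<lambda>t. 1 * f t + (-1) * T k t) = u f - u (T k)"
      using lin[OF f C1per_H1per[OF T[of k]], of 1 "-1"] by simp
    moreover have "wderiv1 (\<lambda>t. complex_of_real (1 * f t + (-1) * T k t)) (\<lambda>t. complex_of_real (g t - T' k t))"
      using wderiv1_lin[OF w C1per_wderiv1[OF T[of k]], of 1 "-1"] by simp
    ultimately have "\<bar>u f - u (T k)\<bar> \<le> B * sqrt ((\<integral>t. (f t - T k t)\<^sup>2 \<partial>Lper) + (\<integral>t. (g t - T' k t)\<^sup>2 \<partial>Lper))"
      using B[of "\<lambda>t. 1 * f t + (-1) * T k t" "\<lambda>t. complex_of_real (g t - T' k t)"] by (simp add: norm_of_real del: of_real_diff)
    then show ?thesis by (simp add: h1dist_def abs_minus_commute)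
  qed
  have "(\<lambda>k. B * sqrt (h1dist (\<lambda>t. f t - T k t) (\<lambda>t. g t - T' k t))) \<longlonglongrightarrow> B * sqrt 0"
    by (intro tendsto_intros l)
  then have "(\<lambda>k. B * sqrt (h1dist (\<lambda>t. f t - T k t) (\<lambda>t. g t - T' k t))) \<longlonglongrightarrow> 0" by simp
  then have "(\<lambda>k. u (T k) - u f) \<longlonglongrightarrow> 0"
    by (rule Lim_null_comparison[OF always_eventually[OF allI[OF le]]])
  then show ?thesis by (rule LIM_zero_cancel)
qed

text \<open>The Sobolev bound turns H^1 convergence of the smooth approximants into a uniform Cauchy
  property. Their uniform limit agrees with f in L^2, and both are continuous, so they agree
  everywhere on I.\<close>

lemma trig_approx_uniform:
  assumes c: "continuous_on Iper f"
    and w: "wderiv1 (\<lambda>t. complex_of_real (f t)) (\<lambda>t. complex_of_real (g t))"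
    and T: "\<And>k. C1per (T k) (T' k)"
    and l: "(\<lambda>k::nat. h1dist (\<lambda>t. f t - T k t) (\<lambda>t. g t - T' k t)) \<longlonglongrightarrow> 0"
  shows "uniform_limit Iper T f sequentially"
proof -
  let ?d = "\<lambda>k. h1dist (\<lambda>t. f t - T k t) (\<lambda>t. g t - T' k t)"
  note Lf = wderiv1_L2(1)[OF w] and Lg = wderiv1_L2(2)[OF w]
  have LT: "L2per (\<lambda>t. complex_of_real (T k t))" "L2per (\<lambda>t. complex_of_real (T' k t))" for k
    using C1per_wderiv1[OF T] wderiv1_L2 by blast+
  have sq: "(\<integral>t. (T k t - T j t)\<^sup>2 \<partial>Lper) \<le> 2 * (\<integral>t. (f t - T k t)\<^sup>2 \<partial>Lper) + 2 * (\<integral>t. (f t - T j t)\<^sup>2 \<partial>Lper)" for k j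
    using L2_triangle[OF LT(1)[of k] Lf LT(1)[of j]]
    by (simp only: of_real_diff[symmetric] norm_of_real power2_abs power2_commute[of "T k _" "f _"])
  have sq': "(\<integral>t. (T' k t - T' j t)\<^sup>2 \<partial>Lper) \<le> 2 * (\<integral>t. (g t - T' k t)\<^sup>2 \<partial>Lper) + 2 * (\<integral>t. (g t - T' j t)\<^sup>2 \<partial>Lper)" for k j
    using L2_triangle[OF LT(2)[of k] Lg LT(2)[of j]]
    by (simp only: of_real_diff[symmetric] norm_of_real power2_abs power2_commute[of "T' k _" "g _"])
  have sup: "(T k x - T j x)\<^sup>2 \<le> 4 * ?d k + 4 * ?d j" if "x \<in> Iper" for k j x
    using C1per_sup_bound[OF C1per_lin[OF T[of k] T[of j], of 1 "-1"] that] sq[of k j] sq'[of k j]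
    by (simp add: h1dist_def)
  have "uniformly_Cauchy_on Iper T"
    unfolding uniformly_Cauchy_on_def
  proof (intro allI impI)
    fix e :: real assume e: "e > 0"
    \<comment> \<open>8 = 4 + 4: each of the two indices contributes the constant 2 of the Sobolev
      bound times the 2 of the triangle inequality for squares.\<close>
    then have "\<forall>\<^sub>F k in sequentially. ?d k < e\<^sup>2 / 8" using l by (intro order_tendstoD) auto
    then obtain M where M: "\<And>k. k \<ge> M \<Longrightarrow> ?d k < e\<^sup>2 / 8" by (auto simp: eventually_sequentially)
    show "\<exists>M. \<forall>x\<in>Iper. \<forall>m\<ge>M. \<forall>n\<ge>M. dist (T m x) (T n x) < e"
    proof (intro exI[of _ M] ballI allI impI)
      fix x m n assume "x \<in> Iper" "M \<le> m" "M \<le> n"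
      then have "(T m x - T n x)\<^sup>2 < e\<^sup>2" using sup[of x m n] M[of m] M[of n] by (simp add: field_simps)
      then have "\<bar>T m x - T n x\<bar> < e" using e by (metis abs_le_square_iff abs_of_pos not_le)
      then show "dist (T m x) (T n x) < e" by (simp add: dist_real_def)
    qed
  qed
  then have "uniformly_convergent_on Iper T" by (rule Cauchy_uniformly_convergent)
  then obtain F where F: "uniform_limit Iper T F sequentially" by (auto simp: uniformly_convergent_on_def)
  have cF: "continuous_on Iper F"
    by (rule uniform_limit_theorem[OF _ F]) (auto intro!: always_eventually C1per_cont[OF T])
  have "(\<integral>t. (f t - F t)\<^sup>2 \<partial>Lper) \<le> e" if e: "e > 0" for e
  proof -
    \<comment> \<open>Chosen such that d^2 integrated over length 2 pi is e / 4.\<close>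
    define d where "d = sqrt (e / (8 * pi))"
    have d: "d > 0" using e by (simp add: d_def)
    have "\<forall>\<^sub>F k in sequentially. \<forall>x\<in>Iper. dist (T k x) (F x) < d" using F d by (auto simp: uniform_limit_iff)
    moreover have "\<forall>\<^sub>F k in sequentially. ?d k < e / 4" using e l by (intro order_tendstoD) auto
    ultimately have "\<forall>\<^sub>F k in sequentially. (\<forall>x\<in>Iper. dist (T k x) (F x) < d) \<and> ?d k < e / 4"
      by (rule eventually_conj)
    then obtain k where k: "\<And>x. x \<in> Iper \<Longrightarrow> dist (T k x) (F x) < d" "?d k < e / 4" by (auto simp: eventually_sequentially)
    have "(\<integral>t. (f t - F t)\<^sup>2 \<partial>Lper) \<le> 2 * (\<integral>t. (f t - T k t)\<^sup>2 \<partial>Lper) + 2 * (\<integral>t. (T k t - F t)\<^sup>2 \<partial>Lper)"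
      using L2_triangle[OF Lf LT(1)[of k] L2per_cont[of "\<lambda>t. complex_of_real (F t)"]] cF
      by (simp only: of_real_diff[symmetric] norm_of_real power2_abs) (simp add: continuous_on_of_real)
    also have "(\<integral>t. (T k t - F t)\<^sup>2 \<partial>Lper) \<le> (\<integral>t. d\<^sup>2 \<partial>Lper)"
    proof (rule integral_mono)
      show "integrable Lper (\<lambda>t. (T k t - F t)\<^sup>2)" by (intro integrable_Lper_cont continuous_intros C1per_cont[OF T] cF)
      show "integrable Lper (\<lambda>t. d\<^sup>2)" by (intro integrable_Lper_cont continuous_intros)
      fix t assume "t \<in> space Lper"
      then have "\<bar>T k t - F t\<bar> \<le> d" using k(1)[of t] by (simp add: dist_real_def)
      then have "\<bar>T k t - F t\<bar>\<^sup>2 \<le> d\<^sup>2" by (intro power_mono) auto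
      then show "(T k t - F t)\<^sup>2 \<le> d\<^sup>2" by simp
    qed
    also have "(\<integral>t. d\<^sup>2 \<partial>Lper) = e / 4" using e by (simp add: measure_Lper d_def)
    also have "(\<integral>t. (f t - T k t)\<^sup>2 \<partial>Lper) \<le> ?d k" by (simp add: h1dist_def)
    finally show ?thesis using k(2) e by simp
  qed
  then have "(\<integral>t. (f t - F t)\<^sup>2 \<partial>Lper) \<le> 0" by (rule field_le_epsilon[where y=0, simplified]) 
  then have z: "(\<integral>t. (f t - F t)\<^sup>2 \<partial>Lper) = 0" by (simp add: antisym)
  have "continuous_on {0..2*pi} (\<lambda>t. (f t - F t)\<^sup>2)"
    using c cF unfolding Iper_def by (intro continuous_intros)
  then have "\<forall>x\<in>{0..2*pi}. (f x - F x)\<^sup>2 = 0"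
    using integralL_eq_0_iff[of 0 "2*pi" "\<lambda>t. (f t - F t)\<^sup>2"] z by (simp add: Iper_def)
  then have "\<And>x. x \<in> Iper \<Longrightarrow> F x = f x" by (auto simp: Iper_def)
  then show ?thesis using F uniform_limit_cong'[of Iper T T F f sequentially] by auto
qed

section \<open>Slater determinants of disjointly supported orbitals\<close>

interpretation Lprod: product_sigma_finite "\<lambda>_::nat. Lper"
  by (simp add: product_sigma_finite_def finite_measure.sigma_finite_measure[OF finite_measure_Lper])

definition slater_term :: "nat \<Rightarrow> (nat \<Rightarrow> nat \<Rightarrow> real \<Rightarrow> complex) \<Rightarrow> (nat \<Rightarrow> nat) \<Rightarrow> (nat \<Rightarrow> real) \<Rightarrow> complex" where
  "slater_term n f p x = (\<Prod>i<n. f i (p i) (x i))"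

text \<open>The orbitals carry a slot index i as well, so that the same sum also yields the partial derivatives.\<close>

definition slater :: "nat \<Rightarrow> (nat \<Rightarrow> nat \<Rightarrow> real \<Rightarrow> complex) \<Rightarrow> (nat \<Rightarrow> real) \<Rightarrow> complex" where
  "slater n f x = complex_of_real (1 / sqrt (fact n)) * (\<Sum>p | p permutes {..<n}. of_int (sign p) * slater_term n f p x)"

definition slater_grad :: "nat \<Rightarrow> (nat \<Rightarrow> real \<Rightarrow> complex) \<Rightarrow> (nat \<Rightarrow> real \<Rightarrow> complex) \<Rightarrow> nat \<Rightarrow> (nat \<Rightarrow> real) \<Rightarrow> complex" where
  "slater_grad n f f' j = slater n (\<lambda>i. if i = j then f' else f)"

lemma finite_perms: "finite {p. p permutes {..<n::nat}}" by (rule finite_permutations) simp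

lemma trigN_prod: "trigN n m x = (\<Prod>i<n. trig1 (m i) (x i))"
  unfolding trigN_def by (induction n) (auto simp: trig1_def cis_mult[symmetric])

lemma perm_less: "p permutes {..<n::nat} \<Longrightarrow> i < n \<Longrightarrow> p i < n"
  using permutes_in_image[of p "{..<n}" i] by auto

lemma slater_term_measurable:
  assumes "\<And>i k. i < n \<Longrightarrow> k < n \<Longrightarrow> f i k \<in> borel_measurable Lper" "p permutes {..<n}"
  shows "slater_term n f p \<in> borel_measurable (muN n)"
  unfolding slater_term_def muN_def
proof (rule borel_measurable_prod)
  fix i assume i: "i \<in> {..<n}"
  have "(\<lambda>x. x i) \<in> measurable (Pi\<^sub>M {..<n} (\<lambda>_. Lper)) Lper" using i by (rule measurable_component_singleton)
  moreover have "f i (p i) \<in> borel_measurable Lper" using assms i perm_less by auto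
  ultimately show "(\<lambda>x. f i (p i) (x i)) \<in> borel_measurable (Pi\<^sub>M {..<n} (\<lambda>_. Lper))"
    by (rule measurable_compose)
qed

lemma slater_term_sq_integrable:
  assumes "\<And>i k. i < n \<Longrightarrow> k < n \<Longrightarrow> L2per (f i k)" "p permutes {..<n}"
  shows "integrable (muN n) (\<lambda>x. (cmod (slater_term n f p x))\<^sup>2)"
    "(\<integral>x. (cmod (slater_term n f p x))\<^sup>2 \<partial>muN n) = (\<Prod>i<n. \<integral>t. (cmod (f i (p i) t))\<^sup>2 \<partial>Lper)"
proof -
  have e: "(cmod (slater_term n f p x))\<^sup>2 = (\<Prod>i<n. (cmod (f i (p i) (x i)))\<^sup>2)" for x
    by (simp add: slater_term_def prod_norm[symmetric] prod_power_distrib)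
  have i: "integrable Lper (\<lambda>t. (cmod (f i (p i) t))\<^sup>2)" if "i \<in> {..<n}" for i
    using assms(1)[of i "p i"] perm_less[OF assms(2)] that by (auto simp: L2per_def)
  show "integrable (muN n) (\<lambda>x. (cmod (slater_term n f p x))\<^sup>2)"
    unfolding e muN_def by (rule Lprod.product_integrable_prod) (use i in auto)
  show "(\<integral>x. (cmod (slater_term n f p x))\<^sup>2 \<partial>muN n) = (\<Prod>i<n. \<integral>t. (cmod (f i (p i) t))\<^sup>2 \<partial>Lper)"
    unfolding e muN_def by (rule Lprod.product_integral_prod) (use i in auto)
qed

lemma slater_measurable:
  assumes "\<And>i k. i < n \<Longrightarrow> k < n \<Longrightarrow> f i k \<in> borel_measurable Lper"
  shows "slater n f \<in> borel_measurable (muN n)"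
  unfolding slater_def using slater_term_measurable[OF assms]
  by (intro borel_measurable_times borel_measurable_const borel_measurable_sum) auto

text \<open>Cauchy-Schwarz over the n! terms loses a factor n!, which the normalisation 1 / sqrt(n!)
  compensates. The estimate is crude, but it covers the slot-modified sums that represent partial
  derivatives as well.\<close>

lemma slater_sq_le: "(cmod (slater n f x))\<^sup>2 \<le> (\<Sum>p | p permutes {..<n}. (cmod (slater_term n f p x))\<^sup>2)"
proof -
  let ?P = "{p. p permutes {..<n}}"
  have "cmod (slater n f x) \<le> (1 / sqrt (fact n)) * (\<Sum>p\<in>?P. cmod (slater_term n f p x))"
    unfolding slater_def norm_mult norm_of_real
    using norm_sum[of "\<lambda>p. of_int (sign p) * slater_term n f p x" ?P]
    by (auto simp: norm_mult sign_def if_distrib[of abs] if_distrib[of real_of_int] cong: if_cong intro!: divide_right_mono)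
  then have "(cmod (slater n f x))\<^sup>2 \<le> ((1 / sqrt (fact n)) * (\<Sum>p\<in>?P. cmod (slater_term n f p x)))\<^sup>2"
    by (intro power_mono) auto
  also have "\<dots> = (1 / fact n) * (\<Sum>p\<in>?P. cmod (slater_term n f p x))\<^sup>2"
    by (simp add: power_mult_distrib power_divide)
  also have "\<dots> \<le> (1 / fact n) * ((\<Sum>p\<in>?P. (cmod (slater_term n f p x))\<^sup>2) * real (card ?P))"
    by (intro mult_left_mono sum_squared_le_sum_of_squares finite_perms) auto
  also have "\<dots> = (\<Sum>p\<in>?P. (cmod (slater_term n f p x))\<^sup>2)"
    by (subst card_permutations[of "{..<n}" n]) auto
  finally show ?thesis .
qed

lemma slater_sq_integrable:
  assumes "\<And>i k. i < n \<Longrightarrow> k < n \<Longrightarrow> L2per (f i k)"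
  shows "integrable (muN n) (\<lambda>x. (cmod (slater n f x))\<^sup>2)"
    "(\<integral>x. (cmod (slater n f x))\<^sup>2 \<partial>muN n) \<le> (\<Sum>p | p permutes {..<n}. \<Prod>i<n. \<integral>t. (cmod (f i (p i) t))\<^sup>2 \<partial>Lper)"
proof -
  have i: "integrable (muN n) (\<lambda>x. \<Sum>p | p permutes {..<n}. (cmod (slater_term n f p x))\<^sup>2)"
    using slater_term_sq_integrable(1)[OF assms] by (intro Bochner_Integration.integrable_sum) auto
  have m: "slater n f \<in> borel_measurable (muN n)"
    by (rule slater_measurable) (use assms in \<open>auto simp: L2per_def\<close>)
  show *: "integrable (muN n) (\<lambda>x. (cmod (slater n f x))\<^sup>2)"
    by (rule Bochner_Integration.integrable_bound[OF i])
      (use m slater_sq_le[of n f] in \<open>auto intro!: AE_I2 order_trans[OF slater_sq_le] abs_ge_self\<close>)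
  have "(\<integral>x. (cmod (slater n f x))\<^sup>2 \<partial>muN n) \<le> (\<integral>x. (\<Sum>p | p permutes {..<n}. (cmod (slater_term n f p x))\<^sup>2) \<partial>muN n)"
    by (intro integral_mono * i slater_sq_le)
  also have "\<dots> = (\<Sum>p | p permutes {..<n}. \<integral>x. (cmod (slater_term n f p x))\<^sup>2 \<partial>muN n)"
    using slater_term_sq_integrable(1)[OF assms] by (intro Bochner_Integration.integral_sum) auto
  also have "\<dots> = (\<Sum>p | p permutes {..<n}. \<Prod>i<n. \<integral>t. (cmod (f i (p i) t))\<^sup>2 \<partial>Lper)"
    using slater_term_sq_integrable(2)[OF assms] by (intro sum.cong) auto
  finally show "(\<integral>x. (cmod (slater n f x))\<^sup>2 \<partial>muN n) \<le> (\<Sum>p | p permutes {..<n}. \<Prod>i<n. \<integral>t. (cmod (f i (p i) t))\<^sup>2 \<partial>Lper)" .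
qed

lemma slater_integral_product:
  assumes "\<And>i k. i < n \<Longrightarrow> k < n \<Longrightarrow> L2per (f i k)" "\<And>i. i < n \<Longrightarrow> L2per (h i)"
  shows "(\<integral>x. slater n f x * (\<Prod>i<n. h i (x i)) \<partial>muN n) =
    complex_of_real (1 / sqrt (fact n)) * (\<Sum>p | p permutes {..<n}. of_int (sign p) * (\<Prod>i<n. \<integral>t. f i (p i) t * h i t \<partial>Lper))"
proof -
  have e: "slater_term n f p x * (\<Prod>i<n. h i (x i)) = (\<Prod>i<n. f i (p i) (x i) * h i (x i))" for p x
    by (simp add: slater_term_def prod.distrib)
  have i0: "integrable Lper (\<lambda>t. f i (p i) t * h i t)" if "p permutes {..<n}" "i < n" for p i
    using assms that perm_less by (intro L2per_mult_integrable) auto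
  have i1: "integrable (muN n) (\<lambda>x. slater_term n f p x * (\<Prod>i<n. h i (x i)))" if "p permutes {..<n}" for p
    unfolding e muN_def using i0[OF that] by (intro Lprod.product_integrable_prod) auto
  have i2: "(\<integral>x. slater_term n f p x * (\<Prod>i<n. h i (x i)) \<partial>muN n) = (\<Prod>i<n. \<integral>t. f i (p i) t * h i t \<partial>Lper)" if "p permutes {..<n}" for p
    unfolding e muN_def using i0[OF that] by (intro Lprod.product_integral_prod) auto
  have "(\<integral>x. slater n f x * (\<Prod>i<n. h i (x i)) \<partial>muN n) =
    (\<integral>x. complex_of_real (1 / sqrt (fact n)) * (\<Sum>p | p permutes {..<n}. of_int (sign p) * (slater_term n f p x * (\<Prod>i<n. h i (x i)))) \<partial>muN n)"
    unfolding slater_def by (simp add: sum_distrib_right mult.assoc)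
  also have "\<dots> = complex_of_real (1 / sqrt (fact n)) * (\<Sum>p | p permutes {..<n}. of_int (sign p) * (\<integral>x. slater_term n f p x * (\<Prod>i<n. h i (x i)) \<partial>muN n))"
    using i1 by (simp add: Bochner_Integration.integral_sum)
  also have "(\<Sum>p | p permutes {..<n}. of_int (sign p) * (\<integral>x. slater_term n f p x * (\<Prod>i<n. h i (x i)) \<partial>muN n)) = (\<Sum>p | p permutes {..<n}. of_int (sign p) * (\<Prod>i<n. \<integral>t. f i (p i) t * h i t \<partial>Lper))"
    using i2 by (intro sum.cong) auto
  finally show ?thesis .
qed

text \<open>Trigonometric test functions factor over the coordinates, so by Fubini the weak
  derivative in x_j reduces, term by term, to the one-dimensional weak derivative of the orbital in
  slot j.\<close>

lemma slater_wgradN: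
  assumes w: "\<And>k. k < n \<Longrightarrow> wderiv1 (f k) (f' k)"
  shows "wgradN n (slater n (\<lambda>i. f)) (slater_grad n f f')"
  unfolding wgradN_def
proof (intro conjI allI impI)
  have Lf: "L2per (f k)" "L2per (f' k)" if "k < n" for k using w[OF that] wderiv1_L2 by auto
  have mf: "f k \<in> borel_measurable Lper" "f' k \<in> borel_measurable Lper" if "k < n" for k
    using Lf[OF that] by (auto simp: L2per_def)
  show "slater n (\<lambda>i. f) \<in> borel_measurable (muN n)" by (intro slater_measurable mf)
  show "integrable (muN n) (\<lambda>x. (cmod (slater n (\<lambda>i. f) x))\<^sup>2)" by (intro slater_sq_integrable Lf)
  fix j assume j: "j < n"
  show "slater_grad n f f' j \<in> borel_measurable (muN n)" unfolding slater_grad_def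
    by (intro slater_measurable) (use mf in auto)
  show "integrable (muN n) (\<lambda>x. (cmod (slater_grad n f f' j x))\<^sup>2)" unfolding slater_grad_def
    by (intro slater_sq_integrable) (use Lf in auto)
  fix m :: "nat \<Rightarrow> int"
  \<comment> \<open>The factor i m_j of the differentiated test function is absorbed into slot
    j.\<close>
  let ?h = "\<lambda>i t. (if i = j then \<i> * of_int (m j) else 1) * trig1 (m i) t"
  have h: "\<i> * of_int (m j) * trigN n m x = (\<Prod>i<n. ?h i (x i))" for x
    using j by (simp add: trigN_prod prod.distrib prod.delta)
  have "(\<integral>x. slater n (\<lambda>i. f) x * (\<i> * of_int (m j) * trigN n m x) \<partial>muN n) =
    complex_of_real (1 / sqrt (fact n)) * (\<Sum>p | p permutes {..<n}. of_int (sign p) * (\<Prod>i<n. \<integral>t. f (p i) t * ?h i t \<partial>Lper))"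
    unfolding h by (intro slater_integral_product Lf L2_trig)
  also have "\<dots> = complex_of_real (1 / sqrt (fact n)) * (\<Sum>p | p permutes {..<n}. of_int (sign p) * - (\<Prod>i<n. \<integral>t. (if i = j then f' else f) (p i) t * (1 * trig1 (m i) t) \<partial>Lper))"
  proof (intro arg_cong2[where f="(*)"] refl sum.cong)
    fix p assume "p \<in> {p. p permutes {..<n}}"
    then have pj: "p j < n" using perm_less j by auto
    have "(\<Prod>i<n. \<integral>t. f (p i) t * ?h i t \<partial>Lper) = (\<integral>t. f (p j) t * ?h j t \<partial>Lper) * (\<Prod>i\<in>{..<n}-{j}. \<integral>t. f (p i) t * ?h i t \<partial>Lper)"
      using j by (subst prod.remove[of _ j]) auto
    also have "(\<integral>t. f (p j) t * ?h j t \<partial>Lper) = - (\<integral>t. f' (p j) t * (1 * trig1 (m j) t) \<partial>Lper)"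
      using w[OF pj] unfolding wderiv1_def by simp
    also have "(\<Prod>i\<in>{..<n}-{j}. \<integral>t. f (p i) t * ?h i t \<partial>Lper) = (\<Prod>i\<in>{..<n}-{j}. \<integral>t. (if i = j then f' else f) (p i) t * (1 * trig1 (m i) t) \<partial>Lper)"
      by (intro prod.cong) auto
    also have "- (\<integral>t. f' (p j) t * (1 * trig1 (m j) t) \<partial>Lper) * (\<Prod>i\<in>{..<n}-{j}. \<integral>t. (if i = j then f' else f) (p i) t * (1 * trig1 (m i) t) \<partial>Lper) =
      - (\<Prod>i<n. \<integral>t. (if i = j then f' else f) (p i) t * (1 * trig1 (m i) t) \<partial>Lper)"
      using j by (subst prod.remove[of "{..<n}" j]) auto
    finally show "(\<Prod>i<n. \<integral>t. f (p i) t * ?h i t \<partial>Lper) = - (\<Prod>i<n. \<integral>t. (if i = j then f' else f) (p i) t * (1 * trig1 (m i) t) \<partial>Lper)" .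
  qed
  also have "\<dots> = - (complex_of_real (1 / sqrt (fact n)) * (\<Sum>p | p permutes {..<n}. of_int (sign p) * (\<Prod>i<n. \<integral>t. (if i = j then f' else f) (p i) t * (1 * trig1 (m i) t) \<partial>Lper)))"
    by (simp add: sum_negf)
  also have "\<dots> = - (\<integral>x. slater n (\<lambda>i. if i = j then f' else f) x * (\<Prod>i<n. 1 * trig1 (m i) (x i)) \<partial>muN n)"
    by (subst slater_integral_product) (use Lf in \<open>auto intro: L2_trig[of 1, simplified]\<close>)
  finally show "(\<integral>x. slater n (\<lambda>i. f) x * (\<i> * of_int (m j) * trigN n m x) \<partial>muN n) = - (\<integral>x. slater_grad n f f' j x * trigN n m x \<partial>muN n)"
    by (simp add: slater_grad_def trigN_prod)
qed

text \<open>Replacing p by its composition with \<tau> in the sum compensates the permuted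
  coordinates, at the price of the sign of \<tau>.\<close>

lemma slater_antisym: "antisymN n (slater n (\<lambda>i. f))"
  unfolding antisymN_def
proof (intro allI impI AE_I2)
  fix \<tau> x assume t: "\<tau> permutes {..<n}"
  have "(\<Sum>p | p permutes {..<n}. of_int (sign p) * slater_term n (\<lambda>i. f) p (x \<circ> \<tau>)) =
    (\<Sum>p | p permutes {..<n}. of_int (sign (p \<circ> \<tau>)) * slater_term n (\<lambda>i. f) (p \<circ> \<tau>) (x \<circ> \<tau>))"
    by (rule sum_permutations_compose_right[OF t])
  also have "\<dots> = (\<Sum>p | p permutes {..<n}. of_int (sign \<tau>) * (of_int (sign p) * slater_term n (\<lambda>i. f) p x))"
  proof (rule sum.cong[OF refl])
    fix p assume p: "p \<in> {p. p permutes {..<n}}"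
    have "slater_term n (\<lambda>i. f) (p \<circ> \<tau>) (x \<circ> \<tau>) = (\<Prod>i<n. (\<lambda>k. f (p k) (x k)) (\<tau> i))" by (simp add: slater_term_def)
    also have "\<dots> = slater_term n (\<lambda>i. f) p x" unfolding slater_term_def
      using prod.permute[OF t, of "\<lambda>k. f (p k) (x k)"] by (simp add: o_def)
    finally have 1: "slater_term n (\<lambda>i. f) (p \<circ> \<tau>) (x \<circ> \<tau>) = slater_term n (\<lambda>i. f) p x" .
    have "permutation p" "permutation \<tau>" using p t by (auto simp: permutation_permutes)
    then have "sign (p \<circ> \<tau>) = sign p * sign \<tau>" by (rule sign_compose)
    then show "of_int (sign (p \<circ> \<tau>)) * slater_term n (\<lambda>i. f) (p \<circ> \<tau>) (x \<circ> \<tau>) = of_int (sign \<tau>) * (of_int (sign p) * slater_term n (\<lambda>i. f) p x)"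
      using 1 by simp
  qed
  finally show "slater n (\<lambda>i. f) (x \<circ> \<tau>) = of_int (sign \<tau>) * slater n (\<lambda>i. f) x"
    unfolding slater_def by (simp add: sum_distrib_left mult_ac)
qed

lemma slater_disjoint_product:
  assumes d: "\<And>k l t. k < n \<Longrightarrow> l < n \<Longrightarrow> k \<noteq> l \<Longrightarrow> t \<in> Iper \<Longrightarrow> f k t * h l t = 0"
    and x: "\<And>i. i < n \<Longrightarrow> x i \<in> Iper"
  shows "cnj (slater n (\<lambda>i. f) x) * slater n (\<lambda>i. h) x =
    complex_of_real (1 / fact n) * (\<Sum>p | p permutes {..<n}. \<Prod>i<n. cnj (f (p i) (x i)) * h (p i) (x i))"
proof -
  let ?P = "{p. p permutes {..<n}}"
  have z: "cnj (slater_term n (\<lambda>i. f) p x) * slater_term n (\<lambda>i. h) q x = 0" if pq: "p \<in> ?P" "q \<in> ?P" "p \<noteq> q" for p q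
  proof -
    have "\<exists>i<n. p i \<noteq> q i"
    proof (rule ccontr)
      assume "\<not> ?thesis"
      then have "p i = q i" for i using pq permutes_not_in[of p "{..<n}" i] permutes_not_in[of q "{..<n}" i] by (cases "i < n") auto
      then show False using pq by auto
    qed
    then obtain i where i: "i < n" "p i \<noteq> q i" by auto
    then have "f (p i) (x i) * h (q i) (x i) = 0" using d[of "p i" "q i" "x i"] x pq perm_less by auto
    then have "\<exists>i\<in>{..<n}. cnj (f (p i) (x i)) * h (q i) (x i) = 0" using i by auto
    then show ?thesis by (simp add: slater_term_def prod.distrib[symmetric])
  qed
  have "cnj (slater n (\<lambda>i. f) x) * slater n (\<lambda>i. h) x = complex_of_real (1 / fact n) *
     (\<Sum>p\<in>?P. \<Sum>q\<in>?P. of_int (sign p) * of_int (sign q) * (cnj (slater_term n (\<lambda>i. f) p x) * slater_term n (\<lambda>i. h) q x))"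
  proof -
    have "complex_of_real (1 / sqrt (fact n)) * complex_of_real (1 / sqrt (fact n)) = complex_of_real (1 / fact n)"
      unfolding of_real_mult[symmetric] by (simp add: real_sqrt_mult_self)
    note c = this
    have a: "cnj (slater n (\<lambda>i. f) x) = complex_of_real (1 / sqrt (fact n)) * (\<Sum>p\<in>?P. of_int (sign p) * cnj (slater_term n (\<lambda>i. f) p x))"
      by (simp add: slater_def)
    have r: "(c * A) * (c * B) = (c * c) * (A * B)" for c A B :: complex by (simp add: mult_ac)
    have "cnj (slater n (\<lambda>i. f) x) * slater n (\<lambda>i. h) x = complex_of_real (1 / fact n) *
      ((\<Sum>p\<in>?P. of_int (sign p) * cnj (slater_term n (\<lambda>i. f) p x)) * (\<Sum>q\<in>?P. of_int (sign q) * slater_term n (\<lambda>i. h) q x))"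
      unfolding a slater_def[of n "\<lambda>i. h"] r c ..
    then show ?thesis unfolding sum_product by (simp add: mult_ac)
  qed
  also have "(\<Sum>p\<in>?P. \<Sum>q\<in>?P. of_int (sign p) * of_int (sign q) * (cnj (slater_term n (\<lambda>i. f) p x) * slater_term n (\<lambda>i. h) q x))
    = (\<Sum>p\<in>?P. \<Sum>q\<in>?P. if q = p then (\<Prod>i<n. cnj (f (p i) (x i)) * h (p i) (x i)) else 0)"
  proof (intro sum.cong refl)
    fix p q assume "p \<in> ?P" "q \<in> ?P"
    have "of_int (sign p) * of_int (sign p) = (1::complex)"
      by (metis (no_types) of_int_1 of_int_mult sign_idempotent)
    then show "of_int (sign p) * of_int (sign q) * (cnj (slater_term n (\<lambda>i. f) p x) * slater_term n (\<lambda>i. h) q x) =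
      (if q = p then (\<Prod>i<n. cnj (f (p i) (x i)) * h (p i) (x i)) else 0)"
      using z[of p q] \<open>p \<in> ?P\<close> \<open>q \<in> ?P\<close> by (auto simp: slater_term_def prod.distrib)
  qed
  also have "\<dots> = (\<Sum>p\<in>?P. \<Prod>i<n. cnj (f (p i) (x i)) * h (p i) (x i))"
    using finite_perms by (intro sum.cong refl) (simp add: sum.delta')
  finally show ?thesis .
qed

text \<open>Every surviving term is the same product of one-particle overlaps up to reindexing;
  there are n! of them, which removes the prefactor.\<close>

lemma slater_inner:
  assumes Lf: "\<And>k. k < n \<Longrightarrow> L2per (f k)" and Lh: "\<And>k. k < n \<Longrightarrow> L2per (h k)"
    and d: "\<And>k l t. k < n \<Longrightarrow> l < n \<Longrightarrow> k \<noteq> l \<Longrightarrow> t \<in> Iper \<Longrightarrow> f k t * h l t = 0"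
  shows "innerN n (slater n (\<lambda>i. f)) (slater n (\<lambda>i. h)) = (\<Prod>k<n. \<integral>t. cnj (f k t) * h k t \<partial>Lper)"
proof -
  let ?P = "{p. p permutes {..<n}}"
  have i0: "integrable Lper (\<lambda>t. cnj (f (p i) t) * h (p i) t)" if "p \<in> ?P" "i < n" for p i
    using Lf Lh that perm_less by (intro L2per_mult_integrable L2per_cnj) auto
  have i1: "integrable (muN n) (\<lambda>x. \<Prod>i<n. cnj (f (p i) (x i)) * h (p i) (x i))" if "p \<in> ?P" for p
    unfolding muN_def using i0[OF that] by (intro Lprod.product_integrable_prod) auto
  have i2: "(\<integral>x. (\<Prod>i<n. cnj (f (p i) (x i)) * h (p i) (x i)) \<partial>muN n) = (\<Prod>i<n. \<integral>t. cnj (f (p i) t) * h (p i) t \<partial>Lper)" if "p \<in> ?P" for p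
    unfolding muN_def using i0[OF that] by (intro Lprod.product_integral_prod) auto
  have "innerN n (slater n (\<lambda>i. f)) (slater n (\<lambda>i. h)) =
    (\<integral>x. complex_of_real (1 / fact n) * (\<Sum>p\<in>?P. \<Prod>i<n. cnj (f (p i) (x i)) * h (p i) (x i)) \<partial>muN n)"
    unfolding innerN_def
    by (intro Bochner_Integration.integral_cong refl slater_disjoint_product d) (auto simp: muN_def space_PiM)
  also have "\<dots> = complex_of_real (1 / fact n) * (\<Sum>p\<in>?P. \<Prod>i<n. \<integral>t. cnj (f (p i) t) * h (p i) t \<partial>Lper)"
    using i1 i2 by (simp add: Bochner_Integration.integral_sum)
  also have "(\<Sum>p\<in>?P. \<Prod>i<n. \<integral>t. cnj (f (p i) t) * h (p i) t \<partial>Lper) = (\<Sum>p\<in>?P. \<Prod>k<n. \<integral>t. cnj (f k t) * h k t \<partial>Lper)"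
  proof (rule sum.cong[OF refl])
    fix p assume "p \<in> ?P"
    then have p: "p permutes {..<n}" by simp
    show "(\<Prod>i<n. \<integral>t. cnj (f (p i) t) * h (p i) t \<partial>Lper) = (\<Prod>k<n. \<integral>t. cnj (f k t) * h k t \<partial>Lper)"
      using prod.permute[OF p, of "\<lambda>k. \<integral>t. cnj (f k t) * h k t \<partial>Lper"] by (simp add: o_def)
  qed
  also have "complex_of_real (1 / fact n) * (\<Sum>p\<in>?P. \<Prod>k<n. \<integral>t. cnj (f k t) * h k t \<partial>Lper) = (\<Prod>k<n. \<integral>t. cnj (f k t) * h k t \<partial>Lper)"
    by (simp add: card_permutations[of "{..<n}" n])
  finally show ?thesis .
qed

text \<open>Transposing two slots shows that the sum does not depend on the slot; summed over all
  slots, every permutation contributes the total of \<eta>.\<close>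

lemma sum_perms_slot:
  fixes \<eta> :: "nat \<Rightarrow> real"
  assumes "j < n"
  shows "real n * (\<Sum>p | p permutes {..<n}. \<eta> (p j)) = fact n * (\<Sum>k<n. \<eta> k)"
proof -
  let ?P = "{p. p permutes {..<n}}"
  have "(\<Sum>p\<in>?P. \<eta> (p i)) = (\<Sum>p\<in>?P. \<eta> (p j))" if "i < n" for i
  proof -
    have t: "Transposition.transpose i j permutes {..<n}" using that assms by (intro permutes_swap_id) auto
    show ?thesis using sum_permutations_compose_right[OF t, of "\<lambda>p. \<eta> (p i)"] by simp
  qed
  then have "real n * (\<Sum>p\<in>?P. \<eta> (p j)) = (\<Sum>i<n. \<Sum>p\<in>?P. \<eta> (p i))" by simp
  also have "\<dots> = (\<Sum>p\<in>?P. \<Sum>i<n. \<eta> (p i))" by (rule sum.swap)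
  also have "\<dots> = (\<Sum>p\<in>?P. \<Sum>k<n. \<eta> k)"
  proof (rule sum.cong[OF refl])
    fix p assume "p \<in> ?P"
    then show "(\<Sum>i<n. \<eta> (p i)) = (\<Sum>k<n. \<eta> k)"
      using sum.permute[of p "{..<n}" \<eta>] by (simp add: o_def)
  qed
  also have "\<dots> = fact n * (\<Sum>k<n. \<eta> k)" by (simp add: card_permutations[of "{..<n}" n])
  finally show ?thesis .
qed

text \<open>By disjointness the squared modulus is an average of products of orbital densities.
  Integrating out the slots 1, ..., n - 1 leaves the orbital in slot 0, and every orbital occupies
  that slot equally often.\<close>

lemma slater_dens:
  assumes n: "1 \<le> n" and Lf: "\<And>k. k < n \<Longrightarrow> L2per (f k)"
    and d: "\<And>k l t. k < n \<Longrightarrow> l < n \<Longrightarrow> k \<noteq> l \<Longrightarrow> t \<in> Iper \<Longrightarrow> f k t * f l t = 0"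
    and one: "\<And>k. k < n \<Longrightarrow> (\<integral>t. (cmod (f k t))\<^sup>2 \<partial>Lper) = 1" and t: "t \<in> Iper"
  shows "densN n (slater n (\<lambda>i. f)) t = ennreal (\<Sum>k<n. (cmod (f k t))\<^sup>2)"
proof -
  let ?P = "{p. p permutes {..<n}}"
  have split: "{..<n} = insert 0 {1..<n}" using n by auto
  have sq: "(cmod (slater n (\<lambda>i. f) (y(0 := t))))\<^sup>2 = 1 / fact n * (\<Sum>p\<in>?P. (cmod (f (p 0) t))\<^sup>2 * (\<Prod>i\<in>{1..<n}. (cmod (f (p i) (y i)))\<^sup>2))"
    if y: "y \<in> space (Pi\<^sub>M {1..<n} (\<lambda>_. Lper))" for y
  proof -
    let ?x = "y(0 := t)"
    have x: "?x i \<in> Iper" if "i < n" for i using y t that by (auto simp: space_PiM PiE_def Pi_def)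
    have "complex_of_real ((cmod (slater n (\<lambda>i. f) ?x))\<^sup>2) = cnj (slater n (\<lambda>i. f) ?x) * slater n (\<lambda>i. f) ?x"
      by (simp add: complex_norm_square mult.commute del: of_real_power)
    also have "\<dots> = complex_of_real (1 / fact n) * (\<Sum>p\<in>?P. \<Prod>i<n. cnj (f (p i) (?x i)) * f (p i) (?x i))"
      by (rule slater_disjoint_product[OF d x])
    also have "\<dots> = complex_of_real (1 / fact n * (\<Sum>p\<in>?P. \<Prod>i<n. (cmod (f (p i) (?x i)))\<^sup>2))"
      by (simp add: complex_norm_square mult.commute del: of_real_power)
    finally have "(cmod (slater n (\<lambda>i. f) ?x))\<^sup>2 = 1 / fact n * (\<Sum>p\<in>?P. \<Prod>i<n. (cmod (f (p i) (?x i)))\<^sup>2)"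
      by (simp only: of_real_eq_iff)
    also have "\<dots> = 1 / fact n * (\<Sum>p\<in>?P. (cmod (f (p 0) t))\<^sup>2 * (\<Prod>i\<in>{1..<n}. (cmod (f (p i) (y i)))\<^sup>2))"
      unfolding split by (intro arg_cong2[where f="(*)"] sum.cong refl) (auto intro!: prod.cong)
    finally show ?thesis .
  qed
  have m: "(\<lambda>y. \<Prod>i\<in>{1..<n}. ennreal ((cmod (f (p i) (y i)))\<^sup>2)) \<in> borel_measurable (Pi\<^sub>M {1..<n} (\<lambda>_. Lper))"
    and one': "(\<integral>\<^sup>+y. (\<Prod>i\<in>{1..<n}. ennreal ((cmod (f (p i) (y i)))\<^sup>2)) \<partial>Pi\<^sub>M {1..<n} (\<lambda>_. Lper)) = 1" if "p \<in> ?P" for p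
  proof -
    have pi: "p i < n" if "i \<in> {1..<n}" for i using perm_less[of p n i] \<open>p \<in> ?P\<close> that by auto
    have mi: "(\<lambda>s. ennreal ((cmod (f (p i) s))\<^sup>2)) \<in> borel_measurable Lper" if "i \<in> {1..<n}" for i
    proof -
      have [measurable]: "f (p i) \<in> borel_measurable Lper" using Lf[OF pi[OF that]] by (simp add: L2per_def)
      show ?thesis by measurable
    qed
    show "(\<lambda>y. \<Prod>i\<in>{1..<n}. ennreal ((cmod (f (p i) (y i)))\<^sup>2)) \<in> borel_measurable (Pi\<^sub>M {1..<n} (\<lambda>_. Lper))"
    proof (rule borel_measurable_prod_ennreal)
      fix i assume i: "i \<in> {1..<n}"
      show "(\<lambda>y. ennreal ((cmod (f (p i) (y i)))\<^sup>2)) \<in> borel_measurable (Pi\<^sub>M {1..<n} (\<lambda>_. Lper))"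
        by (rule measurable_compose[OF measurable_component_singleton[OF i] mi[OF i]])
    qed
    have "(\<integral>\<^sup>+y. (\<Prod>i\<in>{1..<n}. ennreal ((cmod (f (p i) (y i)))\<^sup>2)) \<partial>Pi\<^sub>M {1..<n} (\<lambda>_. Lper)) = (\<Prod>i\<in>{1..<n}. \<integral>\<^sup>+s. ennreal ((cmod (f (p i) s))\<^sup>2) \<partial>Lper)"
      using mi by (intro Lprod.product_nn_integral_prod) auto
    also have "\<dots> = 1"
    proof (intro prod.neutral ballI)
      fix i assume "i \<in> {1..<n}"
      then show "(\<integral>\<^sup>+s. ennreal ((cmod (f (p i) s))\<^sup>2) \<partial>Lper) = 1"
        using Lf[OF pi] one[OF pi] by (subst nn_integral_eq_integral) (auto simp: L2per_def)
    qed
    finally show "(\<integral>\<^sup>+y. (\<Prod>i\<in>{1..<n}. ennreal ((cmod (f (p i) (y i)))\<^sup>2)) \<partial>Pi\<^sub>M {1..<n} (\<lambda>_. Lper)) = 1" .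
  qed
  have "(\<integral>\<^sup>+ y. ennreal ((cmod (slater n (\<lambda>i. f) (y(0 := t))))\<^sup>2) \<partial>PiM {1..<n} (\<lambda>_. Lper)) =
    (\<integral>\<^sup>+ y. (\<Sum>p\<in>?P. ennreal (1 / fact n * (cmod (f (p 0) t))\<^sup>2) * (\<Prod>i\<in>{1..<n}. ennreal ((cmod (f (p i) (y i)))\<^sup>2))) \<partial>PiM {1..<n} (\<lambda>_. Lper))"
  proof (rule nn_integral_cong)
    fix y assume y: "y \<in> space (Pi\<^sub>M {1..<n} (\<lambda>_. Lper))"
    have "ennreal ((cmod (slater n (\<lambda>i. f) (y(0 := t))))\<^sup>2) = ennreal (\<Sum>p\<in>?P. (1 / fact n * (cmod (f (p 0) t))\<^sup>2) * (\<Prod>i\<in>{1..<n}. (cmod (f (p i) (y i)))\<^sup>2))"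
      unfolding sq[OF y] by (simp add: sum_distrib_left mult.assoc)
    also have "\<dots> = (\<Sum>p\<in>?P. ennreal (1 / fact n * (cmod (f (p 0) t))\<^sup>2) * (\<Prod>i\<in>{1..<n}. ennreal ((cmod (f (p i) (y i)))\<^sup>2)))"
    proof (subst sum_ennreal[symmetric])
      show "(\<Sum>p\<in>?P. ennreal (1 / fact n * (cmod (f (p 0) t))\<^sup>2 * (\<Prod>i\<in>{1..<n}. (cmod (f (p i) (y i)))\<^sup>2))) =
        (\<Sum>p\<in>?P. ennreal (1 / fact n * (cmod (f (p 0) t))\<^sup>2) * (\<Prod>i\<in>{1..<n}. ennreal ((cmod (f (p i) (y i)))\<^sup>2)))"
        by (rule sum.cong[OF refl], subst ennreal_mult) (auto simp: prod_nonneg prod_ennreal)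
    qed (auto intro!: divide_nonneg_nonneg mult_nonneg_nonneg prod_nonneg)
    finally show "ennreal ((cmod (slater n (\<lambda>i. f) (y(0 := t))))\<^sup>2) = (\<Sum>p\<in>?P. ennreal (1 / fact n * (cmod (f (p 0) t))\<^sup>2) * (\<Prod>i\<in>{1..<n}. ennreal ((cmod (f (p i) (y i)))\<^sup>2)))" .
  qed
  also have "\<dots> = (\<Sum>p\<in>?P. ennreal (1 / fact n * (cmod (f (p 0) t))\<^sup>2) * 1)"
    using m one' by (subst nn_integral_sum) (auto simp: nn_integral_cmult)
  also have "\<dots> = ennreal (1 / fact n * (\<Sum>p\<in>?P. (cmod (f (p 0) t))\<^sup>2))"
    by (simp add: sum_ennreal sum_distrib_left)
  finally have "densN n (slater n (\<lambda>i. f)) t = ennreal (real n) * ennreal (1 / fact n * (\<Sum>p\<in>?P. (cmod (f (p 0) t))\<^sup>2))"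
    unfolding densN_def by (simp only:)
  also have "\<dots> = ennreal (real n * (1 / fact n * (\<Sum>p\<in>?P. (cmod (f (p 0) t))\<^sup>2)))"
    by (rule ennreal_mult[symmetric]) (auto intro!: divide_nonneg_nonneg sum_nonneg)
  also have "real n * (1 / fact n * (\<Sum>p\<in>?P. (cmod (f (p 0) t))\<^sup>2)) = 1 / fact n * (real n * (\<Sum>p\<in>?P. (cmod (f (p 0) t))\<^sup>2))" by simp
  also have "\<dots> = (\<Sum>k<n. (cmod (f k t))\<^sup>2)"
    using sum_perms_slot[of 0 n "\<lambda>k. (cmod (f k t))\<^sup>2"] n by simp
  finally show ?thesis .
qed

lemma cN_permute:
  assumes s: "\<sigma> permutes {..<n}"
  shows "cN n w (x \<circ> \<sigma>) = cN n w x"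
proof -
  let ?g = "\<lambda>k. \<Sum>j\<in>{..<n} - {k}. w (x k, x j)"
  have "cN n w (x \<circ> \<sigma>) = (\<Sum>i<n. ?g (\<sigma> i))"
    unfolding cN_def
  proof (rule sum.cong[OF refl])
    fix i assume i: "i \<in> {..<n}"
    have "bij_betw \<sigma> ({..<n} - {i}) ({..<n} - {\<sigma> i})"
      using permutes_imp_bij[OF s] i by (intro bij_betw_DiffI) (auto simp: bij_betw_def inj_on_def)
    from sum.reindex_bij_betw[OF this, of "\<lambda>l. w (x (\<sigma> i), x l)"]
    show "(\<Sum>j\<in>{..<n} - {i}. w ((x \<circ> \<sigma>) i, (x \<circ> \<sigma>) j)) = ?g (\<sigma> i)" by simp
  qed
  also have "\<dots> = (\<Sum>i<n. ?g i)" using sum.permute[OF s, of ?g] by (simp add: o_def)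
  finally show ?thesis by (simp add: cN_def)
qed

lemma wderiv1_cong:
  assumes "wderiv1 f g" "\<And>t. t \<in> Iper \<Longrightarrow> f t = f2 t" "\<And>t. t \<in> Iper \<Longrightarrow> g t = g2 t"
  shows "wderiv1 f2 g2"
proof -
  have 1: "f \<in> borel_measurable Lper \<longleftrightarrow> f2 \<in> borel_measurable Lper" "g \<in> borel_measurable Lper \<longleftrightarrow> g2 \<in> borel_measurable Lper"
    using assms(2,3) by (auto intro!: measurable_cong)
  have 2: "integrable Lper (\<lambda>t. (cmod (f t))\<^sup>2) \<longleftrightarrow> integrable Lper (\<lambda>t. (cmod (f2 t))\<^sup>2)"
    "integrable Lper (\<lambda>t. (cmod (g t))\<^sup>2) \<longleftrightarrow> integrable Lper (\<lambda>t. (cmod (g2 t))\<^sup>2)"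
    using assms(2,3) by (auto intro!: Bochner_Integration.integrable_cong)
  have 3: "(\<integral>t. f t * c t \<partial>Lper) = (\<integral>t. f2 t * c t \<partial>Lper)" "(\<integral>t. g t * c t \<partial>Lper) = (\<integral>t. g2 t * c t \<partial>Lper)" for c
    using assms(2,3) by (auto intro!: Bochner_Integration.integral_cong)
  show ?thesis using assms(1) unfolding wderiv1_def 1 2 3 .
qed

lemma cis_vderiv:
  assumes "(\<theta> has_real_derivative d) (at t)"
  shows "((\<lambda>t. cis (\<theta> t)) has_vector_derivative \<i> * complex_of_real d * cis (\<theta> t)) (at t)"
  unfolding has_vector_derivative_def
  by (rule has_derivative_eq_rhs[OF has_derivative_cis[OF assms[unfolded has_field_derivative_def]]])
    (auto simp: fun_eq_iff scaleR_conv_of_real)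

section \<open>Mixed states with a prescribed density\<close>

text \<open>Multiplying the orbital by a phase running through the mass coordinate produces infinitely many
  orthonormal orbitals with the same density.\<close>

definition phase_orb :: "(real \<Rightarrow> real) \<Rightarrow> (real \<Rightarrow> real) \<Rightarrow> nat \<Rightarrow> real \<Rightarrow> complex" where
  "phase_orb \<phi> s k t = complex_of_real (\<phi> t) * cis (2 * pi * real k * s t)"

definition phase_orb' :: "(real \<Rightarrow> real) \<Rightarrow> (real \<Rightarrow> real) \<Rightarrow> (real \<Rightarrow> real) \<Rightarrow> nat \<Rightarrow> real \<Rightarrow> complex" where
  "phase_orb' \<phi> \<phi>' s k t = complex_of_real (\<phi>' t) * cis (2 * pi * real k * s t)
     + complex_of_real (\<phi> t) * (\<i> * complex_of_real (2 * pi * real k * (\<phi> t)\<^sup>2) * cis (2 * pi * real k * s t))"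

text \<open>s is the accumulated mass of \<phi>^2 and runs from 0 to 1 over the period. In this
  coordinate, orbitals of the form \<phi> times a phase become plane waves (Harriman's
  construction).\<close>

locale mass_coordinate =
  fixes \<phi> \<phi>' s :: "real \<Rightarrow> real"
  assumes C1: "C1per \<phi> \<phi>'" and s: "\<And>t. (s has_real_derivative (\<phi> t)\<^sup>2) (at t)"
    and s0: "s 0 = 0" and one: "(\<integral>t. (\<phi> t)\<^sup>2 \<partial>Lper) = 1"
begin

lemma s_end: "s (2 * pi) = 1"
proof -
  have "s (0 + 2 * pi) = s 0 + (\<integral>t. (\<phi> t)\<^sup>2 \<partial>Lper)"
    by (rule antideriv_periodic[OF s])
      (use C1 C1per_cont[OF C1] in \<open>auto simp: C1per_def intro!: continuous_intros\<close>)
  then show ?thesis by (simp add: s0 one)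
qed

lemma s_cont: "continuous_on A s"
  using s by (meson DERIV_isCont continuous_at_imp_continuous_on)

lemma phase_deriv: "((\<lambda>t. cis (2 * pi * a * s t)) has_vector_derivative
    \<i> * complex_of_real (2 * pi * a * (\<phi> t)\<^sup>2) * cis (2 * pi * a * s t)) (at t)"
  by (rule cis_vderiv) (auto intro!: derivative_eq_intros s)

lemma phase_orb_wderiv1: "wderiv1 (phase_orb \<phi> s k) (phase_orb' \<phi> \<phi>' s k)"
proof (rule wderiv1_C1)
  fix t
  have d: "((\<lambda>t. complex_of_real (\<phi> t)) has_vector_derivative complex_of_real (\<phi>' t)) (at t)"
    using C1 unfolding C1per_def
    by (intro has_vector_derivative_of_real) (auto simp: has_real_derivative_iff_has_vector_derivative)
  show "(phase_orb \<phi> s k has_vector_derivative phase_orb' \<phi> \<phi>' s k t) (at t)"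
    using has_vector_derivative_mult[OF d phase_deriv[of "real k"]]
    unfolding phase_orb_def phase_orb'_def by (simp add: add.commute)
  show "continuous_on UNIV (phase_orb' \<phi> \<phi>' s k)" unfolding phase_orb'_def
    by (intro continuous_intros C1per_cont[OF C1] s_cont)
  have "\<phi> (0 + 2 * pi) = \<phi> 0" using C1 unfolding C1per_def by blast
  then show "phase_orb \<phi> s k (2 * pi) = phase_orb \<phi> s k 0"
    using cis_multiple_2pi[of "real k"] by (simp add: phase_orb_def s_end s0)
qed

text \<open>For k \<noteq> l the integrand is, up to a nonzero constant, the derivative of cis (2 pi
  (l - k) s(t)), which takes the same value at s = 0 and at s = 1.\<close>

lemma phase_orb_inner: "(\<integral>t. cnj (phase_orb \<phi> s k t) * phase_orb \<phi> s l t \<partial>Lper) = (if k = l then 1 else 0)"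
proof -
  let ?a = "real l - real k"
  have e: "cnj (phase_orb \<phi> s k t) * phase_orb \<phi> s l t = complex_of_real ((\<phi> t)\<^sup>2) * cis (2 * pi * ?a * s t)" for t
  proof -
    have "cnj (phase_orb \<phi> s k t) * phase_orb \<phi> s l t = complex_of_real ((\<phi> t)\<^sup>2) * (cis (- (2 * pi * real k * s t)) * cis (2 * pi * real l * s t))"
      by (simp add: phase_orb_def cis_cnj power2_eq_square)
    also have "cis (- (2 * pi * real k * s t)) * cis (2 * pi * real l * s t) = cis (2 * pi * ?a * s t)"
      by (simp add: cis_mult algebra_simps)
    finally show ?thesis .
  qed
  show ?thesis
  proof (cases "k = l")
    case True
    have "(\<integral>t. complex_of_real ((\<phi> t)\<^sup>2) \<partial>Lper) = complex_of_real (\<integral>t. (\<phi> t)\<^sup>2 \<partial>Lper)" by (rule integral_complex_of_real)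
    then show ?thesis unfolding e using True one by (simp del: of_real_power)
  next
    case False
    have "(\<integral>t. \<i> * complex_of_real (2 * pi * ?a * (\<phi> t)\<^sup>2) * cis (2 * pi * ?a * s t) \<partial>Lper) = cis (2 * pi * ?a * s (2*pi)) - cis (2 * pi * ?a * s 0)"
      by (rule integral_Lper_FTC[OF phase_deriv]) (intro continuous_intros C1per_cont[OF C1] s_cont)
    also have "\<dots> = 0" using cis_multiple_2pi[of ?a] by (simp add: s_end s0)
    finally have "(\<integral>t. (\<i> * complex_of_real (2 * pi * ?a)) * (complex_of_real ((\<phi> t)\<^sup>2) * cis (2 * pi * ?a * s t)) \<partial>Lper) = 0"
      by (simp add: mult_ac)
    then have "(\<i> * complex_of_real (2 * pi * ?a)) * (\<integral>t. complex_of_real ((\<phi> t)\<^sup>2) * cis (2 * pi * ?a * s t) \<partial>Lper) = 0"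
      by (simp only: integral_mult_right_zero)
    then have "(\<integral>t. complex_of_real ((\<phi> t)\<^sup>2) * cis (2 * pi * ?a * s t) \<partial>Lper) = 0" using False by (simp del: of_real_power)
    then show ?thesis unfolding e using False by simp
  qed
qed

end

lemma C1per_sum: "finite A \<Longrightarrow> (\<And>i. i \<in> A \<Longrightarrow> C1per (f i) (f' i)) \<Longrightarrow> C1per (\<lambda>t. \<Sum>i\<in>A. f i t) (\<lambda>t. \<Sum>i\<in>A. f' i t)"
proof (induction rule: finite_induct)
  case empty then show ?case by (simp add: C1per_const)
next
  case (insert x F)
  have "C1per (\<lambda>t. 1 * f x t + 1 * (\<Sum>i\<in>F. f i t)) (\<lambda>t. 1 * f' x t + 1 * (\<Sum>i\<in>F. f' i t))"
    using insert by (intro C1per_lin) auto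
  then show ?case using insert by simp
qed

text \<open>Makes the square root of a Slater density, up to the factor 1 / sqrt n, the plain sum of
  the orbitals, hence C^1 and periodic.\<close>

lemma sq_sum_disjoint:
  fixes a :: "nat \<Rightarrow> real"
  assumes "\<And>i j. i < n \<Longrightarrow> j < n \<Longrightarrow> i \<noteq> j \<Longrightarrow> a i * a j = 0"
  shows "(\<Sum>i<n. a i)\<^sup>2 = (\<Sum>i<n. (a i)\<^sup>2)"
proof -
  have "(\<Sum>i<n. a i)\<^sup>2 = (\<Sum>i<n. \<Sum>j<n. a i * a j)" by (simp add: power2_eq_square sum_product)
  also have "\<dots> = (\<Sum>i<n. \<Sum>j<n. if j = i then (a i)\<^sup>2 else 0)"
    using assms by (intro sum.cong refl) (auto simp: power2_eq_square)
  finally show ?thesis by (simp add: sum.delta')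
qed

text \<open>The competitor behind all upper bounds is the determinant of the orbitals without
  phases. It lives on the permuted products of the supports, where S bounds the cost, so its
  potential energy is at most S. The factor n! is the loss of the crude kinetic estimate
  \<open>slater_sq_integrable\<close>.\<close>

lemma slater_Feps:
  assumes n: "1 \<le> n" and C1: "\<And>j. j < n \<Longrightarrow> C1per (\<phi> j) (\<phi>' j)"
    and nn: "\<And>j t. j < n \<Longrightarrow> 0 \<le> \<phi> j t"
    and one: "\<And>j. j < n \<Longrightarrow> (\<integral>t. (\<phi> j t)\<^sup>2 \<partial>Lper) = 1"
    and dis: "\<And>i j t. i < n \<Longrightarrow> j < n \<Longrightarrow> i \<noteq> j \<Longrightarrow> t \<in> Iper \<Longrightarrow> \<phi> i t * \<phi> j t = 0"
    and S0: "0 \<le> S"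
    and S: "\<And>x. (\<And>j. j < n \<Longrightarrow> x j \<in> Iper) \<Longrightarrow> (\<And>j. j < n \<Longrightarrow> \<phi> j (x j) \<noteq> 0) \<Longrightarrow> cN n w x \<le> ennreal S"
    and eps: "0 < \<epsilon>"
  defines "\<zeta> \<equiv> (\<lambda>t. (1 / real n) * (\<Sum>j<n. (\<phi> j t)\<^sup>2))"
  shows "adm \<zeta>" "Feps n w \<epsilon> \<zeta> \<le> ennreal (\<epsilon> * (fact n * (\<Sum>j<n. \<integral>t. (\<phi>' j t)\<^sup>2 \<partial>Lper)) + S)"
proof -
  have int2: "integrable Lper (\<lambda>t. (\<phi> j t)\<^sup>2)" if "j < n" for j
    by (intro integrable_Lper_cont continuous_intros C1per_cont[OF C1[OF that]])
  show "adm \<zeta>" unfolding adm_def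
  proof (intro conjI ballI)
    show "0 \<le> \<zeta> x" for x by (simp add: \<zeta>_def sum_nonneg)
    have "C1per (\<lambda>t. \<Sum>j<n. \<phi> j t) (\<lambda>t. \<Sum>j<n. \<phi>' j t)" using C1 by (intro C1per_sum) auto
    from C1per_lin[OF this this, of "1 / sqrt (real n)" 0]
    have "C1per (\<lambda>t. (1 / sqrt (real n)) * (\<Sum>j<n. \<phi> j t)) (\<lambda>t. (1 / sqrt (real n)) * (\<Sum>j<n. \<phi>' j t))" by simp
    note w = C1per_wderiv1[OF this]
    have "sqrt (\<zeta> t) = (1 / sqrt (real n)) * (\<Sum>j<n. \<phi> j t)" if t: "t \<in> Iper" for t
    proof -
      have "\<zeta> t = (1 / real n) * (\<Sum>j<n. \<phi> j t)\<^sup>2"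
        using sq_sum_disjoint[of n "\<lambda>j. \<phi> j t"] dis[OF _ _ _ t] by (simp add: \<zeta>_def)
      moreover have "(\<Sum>j<n. \<phi> j t) \<ge> 0" using nn by (auto intro: sum_nonneg)
      ultimately show ?thesis by (simp add: real_sqrt_divide)
    qed
    then have "wderiv1 (\<lambda>t. complex_of_real (sqrt (\<zeta> t))) (\<lambda>t. complex_of_real ((1 / sqrt (real n)) * (\<Sum>j<n. \<phi>' j t)))"
      by (intro wderiv1_cong[OF w]) auto
    then show "H1per (\<lambda>t. sqrt (\<zeta> t))" by (auto simp: H1per_def)
    show "(\<integral>t. \<zeta> t \<partial>Lper) = 1" unfolding \<zeta>_def using int2 one n by (simp add: Bochner_Integration.integral_sum)
  qed
  have "\<exists>s. mass_coordinate (\<phi> j) (\<phi>' j) s" if j: "j < n" for j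
  proof -
    obtain s where "\<And>t. (s has_real_derivative (\<phi> j t)\<^sup>2) (at t)" "s 0 = 0"
      using C1per_antideriv[of "\<lambda>t. (\<phi> j t)\<^sup>2"] C1per_cont[OF C1[OF j]] by (auto intro!: continuous_intros)
    then show ?thesis using C1[OF j] one[OF j] by (intro exI[of _ s]) (simp add: mass_coordinate_def)
  qed
  then obtain s where mc: "\<And>j. j < n \<Longrightarrow> mass_coordinate (\<phi> j) (\<phi>' j) (s j)" by metis
  define orb where "orb = (\<lambda>k j. phase_orb (\<phi> j) (s j) k)"
  define orb' where "orb' = (\<lambda>k j. phase_orb' (\<phi> j) (\<phi>' j) (s j) k)"
  have w: "wderiv1 (orb k j) (orb' k j)" if "j < n" for k j
    unfolding orb_def orb'_def by (rule mass_coordinate.phase_orb_wderiv1[OF mc[OF that]])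
  have L: "L2per (orb k j)" "L2per (orb' k j)" if "j < n" for k j using w[OF that] wderiv1_L2 by blast+
  have disj: "orb k i t * orb l j t = 0" if "i < n" "j < n" "i \<noteq> j" "t \<in> Iper" for k l i j t
    using dis[OF that] by (auto simp: orb_def phase_orb_def)
  \<comment> \<open>All weight sits on k = 0; the phased determinants with k \<ge> 1 only complete
    the orthonormal sequence.\<close>
  define lam where "lam = (\<lambda>k::nat. if k = 0 then 1 else (0::real))"
  define \<Psi> where "\<Psi> = (\<lambda>k. slater n (\<lambda>i. orb k))"
  define G where "G = (\<lambda>k. slater_grad n (orb k) (orb' k))"
  have inner: "innerN n (\<Psi> k) (\<Psi> l) = (if k = l then 1 else 0)" for k l
  proof -
    have "innerN n (\<Psi> k) (\<Psi> l) = (\<Prod>j<n. \<integral>t. cnj (orb k j t) * orb l j t \<partial>Lper)"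
      unfolding \<Psi>_def by (intro slater_inner L disj)
    also have "\<dots> = (\<Prod>j<n. if k = l then 1 else 0)"
      unfolding orb_def by (intro prod.cong refl mass_coordinate.phase_orb_inner[OF mc]) auto
    also have "\<dots> = (if k = l then 1 else 0)" using n by (auto simp: power_0_left)
    finally show ?thesis .
  qed
  have orb0: "orb 0 j t = complex_of_real (\<phi> j t)" "orb' 0 j t = complex_of_real (\<phi>' j t)" for j t
    by (auto simp: orb_def orb'_def phase_orb_def phase_orb'_def)
  have single: "(\<Sum>k. ennreal (lam k) * c k) = c 0" for c
    by (subst suminf_finite[of "{0}"]) (auto simp: lam_def)
  have dens: "densN n (\<Psi> 0) t = ennreal (real n * \<zeta> t)" if t: "t \<in> Iper" for t
  proof -
    have "densN n (\<Psi> 0) t = ennreal (\<Sum>k<n. (cmod (orb 0 k t))\<^sup>2)"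
      unfolding \<Psi>_def by (intro slater_dens n L disj t) (auto simp: orb0 one)
    then show ?thesis using n by (simp add: orb0 \<zeta>_def)
  qed
  have mix: "mixed n \<zeta> lam \<Psi> G"
    unfolding mixed_def
  proof (intro conjI allI)
    show "0 \<le> lam k" for k by (simp add: lam_def)
    show "lam sums 1" using sums_single[of 0 "\<lambda>_. 1::real"] by (simp add: lam_def)
    show "antisymN n (\<Psi> k)" for k unfolding \<Psi>_def by (rule slater_antisym)
    show "wgradN n (\<Psi> k) (G k)" for k unfolding \<Psi>_def G_def by (intro slater_wgradN w)
    show "innerN n (\<Psi> k) (\<Psi> l) = (if k = l then 1 else 0)" for k l by (rule inner)
    show "AE t in Lper. (\<Sum>k. ennreal (lam k) * densN n (\<Psi> k) t) = ennreal (real n * \<zeta> t)"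
      by (rule AE_I2) (simp add: single dens)
  qed
  have iG: "integrable (muN n) (\<lambda>x. (cmod (G 0 j x))\<^sup>2)" if "j < n" for j
    using mix that unfolding mixed_def wgradN_def by blast
  have iP: "integrable (muN n) (\<lambda>x. (cmod (\<Psi> 0 x))\<^sup>2)"
    using mix unfolding mixed_def wgradN_def by blast
  have "Feps n w \<epsilon> \<zeta> \<le> (\<Sum>k. ennreal (lam k) * energyN n w \<epsilon> (\<Psi> k) (G k))"
    unfolding Feps_def by (rule INF_lower2[of "(lam, \<Psi>, G)"]) (use mix in auto)
  also have "\<dots> = energyN n w \<epsilon> (\<Psi> 0) (G 0)" by (rule single)
  also have "\<dots> \<le> (\<integral>\<^sup>+ x. ennreal (\<epsilon> * (\<Sum>j<n. (cmod (G 0 j x))\<^sup>2)) + ennreal S * ennreal ((cmod (\<Psi> 0 x))\<^sup>2) \<partial>muN n)"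
    unfolding energyN_def
  proof (rule nn_integral_mono, rule add_left_mono)
    fix x assume x: "x \<in> space (muN n)"
    show "cN n w x * ennreal ((cmod (\<Psi> 0 x))\<^sup>2) \<le> ennreal S * ennreal ((cmod (\<Psi> 0 x))\<^sup>2)"
    proof (cases "\<Psi> 0 x = 0")
      case False
      \<comment> \<open>Where the determinant is nonzero some term is. Undoing its permutation moves
        every coordinate into the support of the orbital with the same index, and the cost does not
        see the permutation.\<close>
      then have "\<exists>p. p permutes {..<n} \<and> slater_term n (\<lambda>i. orb 0) p x \<noteq> 0"
        unfolding \<Psi>_def slater_def by (metis (mono_tags, lifting) mem_Collect_eq mult_eq_0_iff sum.neutral)
      then obtain p where p: "p permutes {..<n}" "slater_term n (\<lambda>i. orb 0) p x \<noteq> 0" by blast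
      define y where "y = x \<circ> inv p"
      have ip: "inv p permutes {..<n}" by (rule permutes_inv[OF p(1)])
      have y: "y j \<in> Iper" "\<phi> j (y j) \<noteq> 0" if j: "j < n" for j
      proof -
        have i: "inv p j < n" using perm_less[OF ip j] .
        then show "y j \<in> Iper" using x by (auto simp: y_def muN_def space_PiM)
        have "orb 0 (p (inv p j)) (x (inv p j)) \<noteq> 0" using p(2) i by (auto simp: slater_term_def)
        then show "\<phi> j (y j) \<noteq> 0" using permutes_inverses(1)[OF p(1)] by (simp add: y_def orb0)
      qed
      have "cN n w x = cN n w y" unfolding y_def by (simp add: cN_permute[OF ip])
      also have "\<dots> \<le> ennreal S" by (intro S y)
      finally show ?thesis by (intro mult_right_mono) auto
    qed simp
  qed
  also have "\<dots> = (\<integral>\<^sup>+ x. ennreal (\<epsilon> * (\<Sum>j<n. (cmod (G 0 j x))\<^sup>2) + S * (cmod (\<Psi> 0 x))\<^sup>2) \<partial>muN n)"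
    using eps S0 by (intro nn_integral_cong) (simp add: ennreal_plus ennreal_mult sum_nonneg)
  also have "\<dots> = ennreal (\<integral> x. \<epsilon> * (\<Sum>j<n. (cmod (G 0 j x))\<^sup>2) + S * (cmod (\<Psi> 0 x))\<^sup>2 \<partial>muN n)"
  proof (rule nn_integral_eq_integral)
    show "AE x in muN n. 0 \<le> \<epsilon> * (\<Sum>j<n. (cmod (G 0 j x))\<^sup>2) + S * (cmod (\<Psi> 0 x))\<^sup>2"
      using eps S0 by (intro AE_I2) (simp add: sum_nonneg)
    show "integrable (muN n) (\<lambda>x. \<epsilon> * (\<Sum>j<n. (cmod (G 0 j x))\<^sup>2) + S * (cmod (\<Psi> 0 x))\<^sup>2)"
      using iG iP by (auto intro!: Bochner_Integration.integrable_add integrable_mult_right Bochner_Integration.integrable_sum)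
  qed
  also have "(\<integral> x. \<epsilon> * (\<Sum>j<n. (cmod (G 0 j x))\<^sup>2) + S * (cmod (\<Psi> 0 x))\<^sup>2 \<partial>muN n) = \<epsilon> * (\<Sum>j<n. \<integral>x. (cmod (G 0 j x))\<^sup>2 \<partial>muN n) + S * (\<integral>x. (cmod (\<Psi> 0 x))\<^sup>2 \<partial>muN n)"
  proof -
    have "(\<integral> x. \<epsilon> * (\<Sum>j<n. (cmod (G 0 j x))\<^sup>2) + S * (cmod (\<Psi> 0 x))\<^sup>2 \<partial>muN n) =
      (\<integral> x. \<epsilon> * (\<Sum>j<n. (cmod (G 0 j x))\<^sup>2) \<partial>muN n) + (\<integral> x. S * (cmod (\<Psi> 0 x))\<^sup>2 \<partial>muN n)"
      using iG iP by (intro Bochner_Integration.integral_add integrable_mult_right Bochner_Integration.integrable_sum) auto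
    also have "(\<integral> x. \<epsilon> * (\<Sum>j<n. (cmod (G 0 j x))\<^sup>2) \<partial>muN n) = \<epsilon> * (\<integral>x. (\<Sum>j<n. (cmod (G 0 j x))\<^sup>2) \<partial>muN n)" by simp
    also have "(\<integral>x. (\<Sum>j<n. (cmod (G 0 j x))\<^sup>2) \<partial>muN n) = (\<Sum>j<n. \<integral>x. (cmod (G 0 j x))\<^sup>2 \<partial>muN n)"
      using iG by (intro Bochner_Integration.integral_sum) auto
    finally show ?thesis by simp
  qed
  also have "(\<integral>x. (cmod (\<Psi> 0 x))\<^sup>2 \<partial>muN n) = 1"
  proof -
    have "complex_of_real (\<integral>x. (cmod (\<Psi> 0 x))\<^sup>2 \<partial>muN n) = (\<integral>x. complex_of_real ((cmod (\<Psi> 0 x))\<^sup>2) \<partial>muN n)"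
      by (rule integral_complex_of_real[symmetric])
    also have "\<dots> = innerN n (\<Psi> 0) (\<Psi> 0)"
      unfolding innerN_def complex_norm_square by (simp add: mult.commute)
    also have "\<dots> = complex_of_real 1" by (simp add: inner)
    finally show ?thesis by (simp only: of_real_eq_iff)
  qed
  also have "(\<Sum>j<n. \<integral>x. (cmod (G 0 j x))\<^sup>2 \<partial>muN n) \<le> fact n * (\<Sum>j<n. \<integral>t. (\<phi>' j t)\<^sup>2 \<partial>Lper)"
  proof -
    have "(\<integral>x. (cmod (G 0 j x))\<^sup>2 \<partial>muN n) \<le> (\<Sum>p | p permutes {..<n}. \<integral>t. (\<phi>' (p j) t)\<^sup>2 \<partial>Lper)" if j: "j < n" for j
    proof -
      have "(\<integral>x. (cmod (G 0 j x))\<^sup>2 \<partial>muN n) \<le> (\<Sum>p | p permutes {..<n}. \<Prod>i<n. \<integral>t. (cmod ((if i = j then orb' 0 else orb 0) (p i) t))\<^sup>2 \<partial>Lper)"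
        unfolding G_def slater_grad_def by (rule slater_sq_integrable(2)) (use L in auto)
      also have "\<dots> = (\<Sum>p | p permutes {..<n}. \<integral>t. (\<phi>' (p j) t)\<^sup>2 \<partial>Lper)"
      proof (rule sum.cong[OF refl])
        fix p assume p: "p \<in> {p. p permutes {..<n}}"
        have "(\<Prod>i<n. \<integral>t. (cmod ((if i = j then orb' 0 else orb 0) (p i) t))\<^sup>2 \<partial>Lper) = (\<Prod>i<n. if i = j then \<integral>t. (\<phi>' (p j) t)\<^sup>2 \<partial>Lper else 1)"
          using p perm_less one by (intro prod.cong refl) (auto simp: orb0)
        also have "\<dots> = (\<integral>t. (\<phi>' (p j) t)\<^sup>2 \<partial>Lper)" using j by (simp add: prod.delta)
        finally show "(\<Prod>i<n. \<integral>t. (cmod ((if i = j then orb' 0 else orb 0) (p i) t))\<^sup>2 \<partial>Lper) = (\<integral>t. (\<phi>' (p j) t)\<^sup>2 \<partial>Lper)" .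
      qed
      finally show ?thesis .
    qed
    then have "(\<Sum>j<n. \<integral>x. (cmod (G 0 j x))\<^sup>2 \<partial>muN n) \<le> (\<Sum>j<n. \<Sum>p | p permutes {..<n}. \<integral>t. (\<phi>' (p j) t)\<^sup>2 \<partial>Lper)"
      by (intro sum_mono) auto
    \<comment> \<open>The factor n is inserted and divided out again to match the form of
      \<open>sum_perms_slot\<close>.\<close>
    also have "\<dots> = (\<Sum>j<n. (1 / real n) * (real n * (\<Sum>p | p permutes {..<n}. \<integral>t. (\<phi>' (p j) t)\<^sup>2 \<partial>Lper)))"
      using n by (intro sum.cong) auto
    also have "\<dots> = (\<Sum>j<n. (1 / real n) * (fact n * (\<Sum>k<n. \<integral>t. (\<phi>' k t)\<^sup>2 \<partial>Lper)))"
      by (intro sum.cong arg_cong2[where f="(*)"] refl sum_perms_slot) auto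
    also have "\<dots> = fact n * (\<Sum>j<n. \<integral>t. (\<phi>' j t)\<^sup>2 \<partial>Lper)" using n by simp
    finally show ?thesis .
  qed
  finally show "Feps n w \<epsilon> \<zeta> \<le> ennreal (\<epsilon> * (fact n * (\<Sum>j<n. \<integral>t. (\<phi>' j t)\<^sup>2 \<partial>Lper)) + S)"
    using eps by (simp add: ennreal_leI mult_left_mono)
qed

section \<open>Comparison of the quantum and the classical energy\<close>

text \<open>Couplings live on Borel sets, wave functions on the Lebesgue completion. The identity is
  measurable from the completion to the Borel space, so measures are pushed forward in that
  direction.\<close>

abbreviation Bper :: "real measure" where "Bper \<equiv> restrict_space lborel Iper"

lemma nn_integral_Bper: "nn_integral Bper f = nn_integral Lper f"
  by (simp add: nn_integral_restrict_space nn_integral_completion)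

lemma space_Bper [simp]: "space Bper = Iper" by (simp add: space_restrict_space)

lemma Lper_to_Bper: "(\<lambda>x. x) \<in> measurable Lper Bper"
proof (rule measurable_restrict_space3)
  show "(\<lambda>x. x) \<in> measurable lebesgue lborel" by (rule measurable_completion) simp
qed auto

lemma Bper_to_borel: "(\<lambda>x. x) \<in> measurable Bper borel"
  by (rule measurable_restrict_space1) simp

lemma space_muN: "space (muN n) = PiE {..<n} (\<lambda>_. Iper)"
  by (simp add: muN_def space_PiM)

lemma muN_permute_measurable:
  assumes s: "\<sigma> permutes {..<n}"
  shows "(\<lambda>x. x \<circ> \<sigma>) \<in> measurable (muN n) (muN n)"
proof -
  have "(\<lambda>x i. x (\<sigma> i)) \<in> measurable (muN n) (Pi\<^sub>M {..<n} (\<lambda>_. Lper))"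
  proof (rule measurable_PiM_single')
    fix i assume "i \<in> {..<n}"
    then have "\<sigma> i \<in> {..<n}" using perm_less[OF s] by auto
    then show "(\<lambda>x. x (\<sigma> i)) \<in> measurable (muN n) Lper"
      unfolding muN_def by (rule measurable_component_singleton)
  next
    show "(\<lambda>x i. x (\<sigma> i)) \<in> space (muN n) \<rightarrow> (\<Pi>\<^sub>E i\<in>{..<n}. space Lper)"
      using perm_less[OF s] permutes_not_in[OF s] by (auto simp: space_muN PiE_def Pi_def extensional_def)
  qed
  then show ?thesis by (simp add: muN_def o_def)
qed

text \<open>A product measure is determined by its values on rectangles, and the preimage of a
  rectangle is the rectangle with permuted sides.\<close>

lemma muN_permute_distr:
  assumes s: "\<sigma> permutes {..<n}"
  shows "distr (muN n) (muN n) (\<lambda>x. x \<circ> \<sigma>) = muN n"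
  unfolding muN_def
proof (rule Lprod.PiM_eqI)
  fix A :: "nat \<Rightarrow> real set" assume A: "\<And>i. i \<in> {..<n} \<Longrightarrow> A i \<in> sets Lper"
  let ?M = "Pi\<^sub>M {..<n} (\<lambda>_. Lper)"
  have Asub: "A i \<subseteq> Iper" if "i < n" for i using sets.sets_into_space[OF A, of i] that by auto
  have isg: "inv \<sigma> permutes {..<n}" by (rule permutes_inv[OF s])
  have S: "Pi\<^sub>E {..<n} A \<in> sets ?M" using A by (intro sets_PiM_I_finite) auto
  have "(\<lambda>x. x \<circ> \<sigma>) -` (Pi\<^sub>E {..<n} A) \<inter> space ?M = Pi\<^sub>E {..<n} (A \<circ> inv \<sigma>)"
  proof (intro set_eqI iffI)
    fix x assume x: "x \<in> (\<lambda>x. x \<circ> \<sigma>) -` (Pi\<^sub>E {..<n} A) \<inter> space ?M"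
    then have xs: "x \<in> extensional {..<n}" by (auto simp: space_PiM PiE_def)
    have "x i \<in> A (inv \<sigma> i)" if i: "i < n" for i
    proof -
      have "inv \<sigma> i < n" by (rule perm_less[OF isg i])
      moreover have "x \<circ> \<sigma> \<in> Pi\<^sub>E {..<n} A" using x by simp
      ultimately have "(x \<circ> \<sigma>) (inv \<sigma> i) \<in> A (inv \<sigma> i)" by (simp only: PiE_mem lessThan_iff)
      then show ?thesis using permutes_inverses(1)[OF s] by simp
    qed
    then show "x \<in> Pi\<^sub>E {..<n} (A \<circ> inv \<sigma>)" using xs by (auto simp: PiE_def)
  next
    fix x assume x: "x \<in> Pi\<^sub>E {..<n} (A \<circ> inv \<sigma>)"
    have 1: "x i \<in> A (inv \<sigma> i)" if "i < n" for i using PiE_mem[OF x, of i] that by simp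
    have "(x \<circ> \<sigma>) i \<in> A i" if i: "i < n" for i
      using 1[OF perm_less[OF s i]] permutes_inverses(2)[OF s] by simp
    moreover have "x \<circ> \<sigma> \<in> extensional {..<n}"
      using x permutes_not_in[OF s] by (auto simp: extensional_def PiE_def)
    moreover have "x \<in> space ?M"
      using x 1 Asub perm_less[OF isg] by (auto simp: space_PiM PiE_def Pi_def)
    ultimately show "x \<in> (\<lambda>x. x \<circ> \<sigma>) -` (Pi\<^sub>E {..<n} A) \<inter> space ?M" by (auto simp: PiE_def)
  qed
  then have "emeasure (distr ?M ?M (\<lambda>x. x \<circ> \<sigma>)) (Pi\<^sub>E {..<n} A) = emeasure ?M (Pi\<^sub>E {..<n} (A \<circ> inv \<sigma>))"
    using muN_permute_measurable[OF s] S by (simp add: emeasure_distr muN_def)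
  also have "\<dots> = (\<Prod>i\<in>{..<n}. emeasure Lper ((A \<circ> inv \<sigma>) i))"
    using A perm_less[OF isg] by (intro Lprod.emeasure_PiM) auto
  also have "\<dots> = (\<Prod>i\<in>{..<n}. emeasure Lper (A i))"
    using prod.permute[OF isg, of "\<lambda>i. emeasure Lper (A i)"] by (simp add: o_def)
  finally show "emeasure (distr ?M ?M (\<lambda>x. x \<circ> \<sigma>)) (Pi\<^sub>E {..<n} A) = (\<Prod>i\<in>{..<n}. emeasure Lper (A i))" .
qed simp_all

lemma cN_measurable:
  assumes "assumptionA w"
  shows "cN n w \<in> borel_measurable (Pi\<^sub>M {..<n} (\<lambda>_. Bper))"
proof -
  have w: "w \<in> borel_measurable (restrict_space borel (Iper \<times> Iper))"
    using assms by (intro borel_measurable_continuous_on_restrict) (simp add: assumptionA_def)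
  have "(\<lambda>x. w (x i, x j)) \<in> borel_measurable (Pi\<^sub>M {..<n} (\<lambda>_. Bper))" if ij: "i < n" "j < n" for i j
  proof (rule measurable_compose[OF _ w], rule measurable_restrict_space2)
    show "(\<lambda>x. (x i, x j)) \<in> space (Pi\<^sub>M {..<n} (\<lambda>_. Bper)) \<rightarrow> Iper \<times> Iper"
      using ij by (auto simp: space_PiM)
    have "(\<lambda>x. x k) \<in> borel_measurable (Pi\<^sub>M {..<n} (\<lambda>_. Bper))" if "k < n" for k
      using that by (intro measurable_compose[OF measurable_component_singleton[of k "{..<n}" "\<lambda>_. Bper"] Bper_to_borel]) auto
    then show "(\<lambda>x. (x i, x j)) \<in> borel_measurable (Pi\<^sub>M {..<n} (\<lambda>_. Bper))"
      using ij by (intro borel_measurable_Pair) auto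
  qed
  then show ?thesis unfolding cN_def by (intro borel_measurable_sum) auto
qed

text \<open>The squared modulus of a mixed state with one-particle density n * rho is a coupling of rho,
  all marginals agreeing by antisymmetry.\<close>

lemma FOT_le_Feps:
  assumes n: "1 \<le> n" and A: "assumptionA w" and c: "continuous_on Iper \<rho>"
  shows "FOT n w \<rho> \<le> Feps n w \<epsilon> \<rho>"
  unfolding Feps_def
proof (rule INF_greatest)
  fix st assume "st \<in> {(lam, \<Psi>, G). mixed n \<rho> lam \<Psi> G}"
  then obtain lam \<Psi> G where st: "st = (lam, \<Psi>, G)" and mix: "mixed n \<rho> lam \<Psi> G" by auto
  have lam: "lam sums 1" "\<And>k. 0 \<le> lam k" using mix by (auto simp: mixed_def)
  have mP [measurable]: "\<Psi> k \<in> borel_measurable (muN n)" for k using mix by (auto simp: mixed_def wgradN_def)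
  have iP: "integrable (muN n) (\<lambda>x. (cmod (\<Psi> k x))\<^sup>2)" for k using mix by (auto simp: mixed_def wgradN_def)
  let ?B = "Pi\<^sub>M {..<n} (\<lambda>_. Bper)"
  let ?P = "\<lambda>k x. ennreal ((cmod (\<Psi> k x))\<^sup>2)"
  \<comment> \<open>Density of the mixed state with respect to the product measure, extended-real
    valued because convergence of the series at a given point is not assumed.\<close>
  define D where "D = (\<lambda>x. \<Sum>k. ennreal (lam k) * ?P k x)"
  have mD [measurable]: "D \<in> borel_measurable (muN n)" unfolding D_def by measurable
  have idm: "(\<lambda>x. x) \<in> measurable (muN n) ?B"
  proof (rule measurable_PiM_single'[where f="\<lambda>i x. x i"])
    show "(\<lambda>x. x i) \<in> measurable (muN n) Bper" if "i \<in> {..<n}" for i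
      unfolding muN_def by (rule measurable_compose[OF measurable_component_singleton[OF that] Lper_to_Bper])
    show "(\<lambda>x i. x i) \<in> space (muN n) \<rightarrow> (\<Pi>\<^sub>E i\<in>{..<n}. space Bper)" by (simp add: space_muN)
  qed
  define \<gamma> where "\<gamma> = distr (density (muN n) D) ?B (\<lambda>x. x)"
  have nnB: "(\<integral>\<^sup>+x. f x \<partial>\<gamma>) = (\<Sum>k. ennreal (lam k) * (\<integral>\<^sup>+x. f x * ?P k x \<partial>muN n))"
    if f: "f \<in> borel_measurable ?B" for f
  proof -
    have fm [measurable]: "f \<in> borel_measurable (muN n)" using measurable_compose[OF idm f] by simp
    have "(\<integral>\<^sup>+x. f x \<partial>\<gamma>) = (\<integral>\<^sup>+x. f x \<partial>density (muN n) D)"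
      unfolding \<gamma>_def using idm f by (intro nn_integral_distr) simp_all
    also have "\<dots> = (\<integral>\<^sup>+x. D x * f x \<partial>muN n)" by (intro nn_integral_density) measurable
    also have "\<dots> = (\<integral>\<^sup>+x. (\<Sum>k. ennreal (lam k) * (f x * ?P k x)) \<partial>muN n)"
      unfolding D_def by (intro nn_integral_cong) (simp add: ennreal_suminf_multc[symmetric] mult_ac)
    also have "\<dots> = (\<Sum>k. \<integral>\<^sup>+x. ennreal (lam k) * (f x * ?P k x) \<partial>muN n)"
      by (intro nn_integral_suminf) measurable
    also have "\<dots> = (\<Sum>k. ennreal (lam k) * (\<integral>\<^sup>+x. f x * ?P k x \<partial>muN n))"
      by (intro suminf_cong nn_integral_cmult) measurable
    finally show ?thesis .
  qed
  have norm1: "(\<integral>\<^sup>+x. ?P k x \<partial>muN n) = 1" for k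
  proof -
    have "complex_of_real (\<integral>x. (cmod (\<Psi> k x))\<^sup>2 \<partial>muN n) = (\<integral>x. complex_of_real ((cmod (\<Psi> k x))\<^sup>2) \<partial>muN n)"
      by (rule integral_complex_of_real[symmetric])
    also have "\<dots> = innerN n (\<Psi> k) (\<Psi> k)"
      unfolding innerN_def complex_norm_square by (simp add: mult.commute)
    also have "\<dots> = complex_of_real 1" using mix by (simp add: mixed_def)
    finally have "(\<integral>x. (cmod (\<Psi> k x))\<^sup>2 \<partial>muN n) = 1" by (simp only: of_real_eq_iff)
    then show ?thesis using iP by (subst nn_integral_eq_integral) auto
  qed
  have lam1: "(\<Sum>k. ennreal (lam k)) = 1"
    using suminf_ennreal2[OF lam(2) sums_summable[OF lam(1)]] sums_unique[OF lam(1)] by simp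
  have coup: "coupling n \<rho> \<gamma>"
    unfolding coupling_def
  proof (intro conjI allI impI)
    show "sets \<gamma> = sets ?B" by (simp add: \<gamma>_def)
    show "prob_space \<gamma>"
    proof
      have "emeasure \<gamma> (space \<gamma>) = (\<integral>\<^sup>+x. 1 \<partial>\<gamma>)" by simp
      also have "\<dots> = 1" by (subst nnB) (auto simp: norm1 lam1)
      finally show "emeasure \<gamma> (space \<gamma>) = 1" .
    qed
    fix j assume j: "j < n"
    have cj: "(\<lambda>x. x i) \<in> measurable ?B Bper" if "i < n" for i using that by (intro measurable_component_singleton) auto
    have cjg: "(\<lambda>x. x j) \<in> measurable \<gamma> Bper" using cj[OF j] by (simp add: \<gamma>_def)
    have rm: "(\<lambda>t. ennreal (\<rho> t)) \<in> borel_measurable Bper"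
    proof -
      have "\<rho> \<in> borel_measurable (restrict_space borel Iper)" by (rule borel_measurable_continuous_on_restrict[OF c])
      moreover have "sets (restrict_space borel Iper) = sets Bper" by (simp add: sets_restrict_space)
      ultimately have [measurable]: "\<rho> \<in> borel_measurable Bper" using measurable_cong_sets by blast
      show ?thesis by measurable
    qed
    show "distr \<gamma> Bper (\<lambda>x. x j) = density Bper (\<lambda>t. ennreal (\<rho> t))"
    proof (rule measure_eqI)
      fix E assume "E \<in> sets (distr \<gamma> Bper (\<lambda>x. x j))"
      then have E: "E \<in> sets Bper" by simp
      have EL: "E \<in> sets Lper" using measurable_sets[OF Lper_to_Bper E] sets.sets_into_space[OF E]
        by (simp add: Int_absorb2)
      define g where "g = (\<lambda>i x. indicator E (x (i::nat)) :: ennreal)"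
      have gB: "g i \<in> borel_measurable ?B" if "i < n" for i
        unfolding g_def by (rule measurable_compose[OF cj[OF that]]) (use E in auto)
      have gM: "g i \<in> borel_measurable (muN n)" if "i < n" for i
        using measurable_compose[OF idm gB[OF that]] by simp
      \<comment> \<open>By antisymmetry the squared modulus is invariant under exchanging
        coordinates 0 and j, and so is the product measure. Hence all marginals reduce to that of
        coordinate 0, which is the one \<open>densN\<close> describes.\<close>
      have swap: "(\<integral>\<^sup>+x. g j x * ?P k x \<partial>muN n) = (\<integral>\<^sup>+x. g 0 x * ?P k x \<partial>muN n)" for k
      proof -
        let ?t = "Transposition.transpose 0 j"
        have t: "?t permutes {..<n}" using j n by (intro permutes_swap_id) auto
        have gm [measurable]: "g 0 \<in> borel_measurable (muN n)" using gM[of 0] n by simp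
        have "(\<integral>\<^sup>+x. g 0 x * ?P k x \<partial>muN n) = (\<integral>\<^sup>+x. g 0 x * ?P k x \<partial>distr (muN n) (muN n) (\<lambda>x. x \<circ> ?t))"
          by (simp only: muN_permute_distr[OF t])
        also have "\<dots> = (\<integral>\<^sup>+x. g 0 (x \<circ> ?t) * ?P k (x \<circ> ?t) \<partial>muN n)"
          by (intro nn_integral_distr muN_permute_measurable[OF t]) measurable
        also have "\<dots> = (\<integral>\<^sup>+x. g j x * ?P k x \<partial>muN n)"
        proof (rule nn_integral_cong_AE)
          have "AE x in muN n. \<Psi> k (x \<circ> ?t) = of_int (sign ?t) * \<Psi> k x"
            using mix t unfolding mixed_def antisymN_def by blast
          then show "AE x in muN n. g 0 (x \<circ> ?t) * ?P k (x \<circ> ?t) = g j x * ?P k x"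
          proof (rule AE_mp, intro AE_I2 impI)
            fix x assume "\<Psi> k (x \<circ> ?t) = of_int (sign ?t) * \<Psi> k x"
            then have "cmod (\<Psi> k (x \<circ> ?t)) = cmod (\<Psi> k x)" by (simp add: norm_mult sign_def)
            then show "g 0 (x \<circ> ?t) * ?P k (x \<circ> ?t) = g j x * ?P k x" by (simp add: g_def)
          qed
        qed
        finally show ?thesis by simp
      qed
      have split: "{..<n} = insert 0 {1..<n}" using n by auto
      let ?C = "Pi\<^sub>M {1..<n} (\<lambda>_. Lper)"
      have nP: "ennreal (real n) * (\<integral>\<^sup>+x. g 0 x * ?P k x \<partial>muN n) = (\<integral>\<^sup>+t. densN n (\<Psi> k) t * indicator E t \<partial>Lper)"
        and mdens: "densN n (\<Psi> k) \<in> borel_measurable Lper" for k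
      proof -
        have m1: "(\<lambda>x. g 0 x * ?P k x) \<in> borel_measurable (Pi\<^sub>M (insert 0 {1..<n}) (\<lambda>_. Lper))"
        proof -
          have [measurable]: "g 0 \<in> borel_measurable (muN n)" using gM[of 0] n by simp
          have "(\<lambda>x. g 0 x * ?P k x) \<in> borel_measurable (muN n)" by measurable
          then show ?thesis by (simp only: muN_def split)
        qed
        have pm: "(\<lambda>(t, y). y(0 := t)) \<in> measurable (Lper \<Otimes>\<^sub>M ?C) (muN n)"
          unfolding muN_def split case_prod_beta' by (rule measurable_fun_upd[where J="{1..<n}"]) auto
        have "(\<lambda>z. ?P k (case z of (t, y) \<Rightarrow> y(0 := t))) \<in> borel_measurable (Lper \<Otimes>\<^sub>M ?C)"
          by (rule measurable_compose[OF pm]) measurable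
        then have pm2: "(\<lambda>(t, y). ?P k (y(0 := t))) \<in> borel_measurable (Lper \<Otimes>\<^sub>M ?C)"
          by (simp add: case_prod_beta')
        interpret C: sigma_finite_measure ?C
          by (rule Lprod.sigma_finite) simp
        have md: "(\<lambda>t. \<integral>\<^sup>+y. ?P k (y(0 := t)) \<partial>?C) \<in> borel_measurable Lper"
          by (rule C.borel_measurable_nn_integral[OF pm2])
        then show "densN n (\<Psi> k) \<in> borel_measurable Lper" unfolding densN_def by measurable
        have "(\<integral>\<^sup>+x. g 0 x * ?P k x \<partial>muN n) = (\<integral>\<^sup>+t. (\<integral>\<^sup>+y. g 0 (y(0 := t)) * ?P k (y(0 := t)) \<partial>?C) \<partial>Lper)"
          unfolding muN_def split by (rule Lprod.product_nn_integral_insert_rev[OF _ _ m1]) auto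
        also have "\<dots> = (\<integral>\<^sup>+t. indicator E t * (\<integral>\<^sup>+y. ?P k (y(0 := t)) \<partial>?C) \<partial>Lper)"
        proof (rule nn_integral_cong)
          fix t assume t: "t \<in> space Lper"
          have "(\<lambda>y. ?P k (y(0 := t))) \<in> borel_measurable ?C"
            using measurable_compose[OF measurable_Pair1'[OF t] pm2] by simp
          then show "(\<integral>\<^sup>+y. g 0 (y(0 := t)) * ?P k (y(0 := t)) \<partial>?C) = indicator E t * (\<integral>\<^sup>+y. ?P k (y(0 := t)) \<partial>?C)"
            by (simp add: g_def nn_integral_cmult)
        qed
        finally have "ennreal (real n) * (\<integral>\<^sup>+x. g 0 x * ?P k x \<partial>muN n) = ennreal (real n) * (\<integral>\<^sup>+t. indicator E t * (\<integral>\<^sup>+y. ?P k (y(0 := t)) \<partial>?C) \<partial>Lper)" by simp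
        also have "\<dots> = (\<integral>\<^sup>+t. ennreal (real n) * (indicator E t * (\<integral>\<^sup>+y. ?P k (y(0 := t)) \<partial>?C)) \<partial>Lper)"
          using md EL by (intro nn_integral_cmult[symmetric] borel_measurable_times_ennreal) auto
        finally show "ennreal (real n) * (\<integral>\<^sup>+x. g 0 x * ?P k x \<partial>muN n) = (\<integral>\<^sup>+t. densN n (\<Psi> k) t * indicator E t \<partial>Lper)"
          by (simp add: densN_def mult_ac)
      qed
      have "emeasure (distr \<gamma> Bper (\<lambda>x. x j)) E = (\<integral>\<^sup>+t. indicator E t \<partial>distr \<gamma> Bper (\<lambda>x. x j))" using E by simp
      also have "\<dots> = (\<integral>\<^sup>+x. g j x \<partial>\<gamma>)"
        unfolding g_def using cjg E by (intro nn_integral_distr) auto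
      also have "\<dots> = (\<Sum>k. ennreal (lam k) * (\<integral>\<^sup>+x. g 0 x * ?P k x \<partial>muN n))"
        unfolding nnB[OF gB[OF j]] swap ..
      finally have em: "emeasure (distr \<gamma> Bper (\<lambda>x. x j)) E = (\<Sum>k. ennreal (lam k) * (\<integral>\<^sup>+x. g 0 x * ?P k x \<partial>muN n))" .
      \<comment> \<open>\<open>densN\<close> contains the factor n, so both sides are compared after
        multiplication by n, which is cancelled at the end.\<close>
      have "ennreal (real n) * emeasure (distr \<gamma> Bper (\<lambda>x. x j)) E = (\<Sum>k. ennreal (real n) * (ennreal (lam k) * (\<integral>\<^sup>+x. g 0 x * ?P k x \<partial>muN n)))"
        unfolding em by (rule ennreal_suminf_cmult[symmetric])
      also have "\<dots> = (\<Sum>k. ennreal (lam k) * (\<integral>\<^sup>+t. densN n (\<Psi> k) t * indicator E t \<partial>Lper))"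
        by (intro suminf_cong) (simp only: nP[symmetric] mult.left_commute)
      also have "\<dots> = (\<Sum>k. \<integral>\<^sup>+t. ennreal (lam k) * (densN n (\<Psi> k) t * indicator E t) \<partial>Lper)"
        using mdens EL by (intro suminf_cong nn_integral_cmult[symmetric] borel_measurable_times_ennreal) auto
      also have "\<dots> = (\<integral>\<^sup>+t. (\<Sum>k. ennreal (lam k) * (densN n (\<Psi> k) t * indicator E t)) \<partial>Lper)"
        using mdens EL by (intro nn_integral_suminf[symmetric] borel_measurable_times_ennreal) auto
      also have "\<dots> = (\<integral>\<^sup>+t. ennreal (real n) * (ennreal (\<rho> t) * indicator E t) \<partial>Lper)"
      proof (rule nn_integral_cong_AE)
        have "AE t in Lper. (\<Sum>k. ennreal (lam k) * densN n (\<Psi> k) t) = ennreal (real n * \<rho> t)" using mix by (simp add: mixed_def)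
        then show "AE t in Lper. (\<Sum>k. ennreal (lam k) * (densN n (\<Psi> k) t * indicator E t)) = ennreal (real n) * (ennreal (\<rho> t) * indicator E t)"
        proof (rule AE_mp, intro AE_I2 impI)
          fix t assume e: "(\<Sum>k. ennreal (lam k) * densN n (\<Psi> k) t) = ennreal (real n * \<rho> t)"
          have "(\<Sum>k. ennreal (lam k) * (densN n (\<Psi> k) t * indicator E t)) = (\<Sum>k. ennreal (lam k) * densN n (\<Psi> k) t) * indicator E t"
            by (simp only: mult.assoc[symmetric] ennreal_suminf_multc)
          then show "(\<Sum>k. ennreal (lam k) * (densN n (\<Psi> k) t * indicator E t)) = ennreal (real n) * (ennreal (\<rho> t) * indicator E t)"
            unfolding e by (simp add: ennreal_mult' mult_ac)
        qed
      qed
      also have "\<dots> = (\<integral>\<^sup>+t. ennreal (real n) * (ennreal (\<rho> t) * indicator E t) \<partial>Bper)" by (rule nn_integral_Bper[symmetric])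
      also have "\<dots> = ennreal (real n) * (\<integral>\<^sup>+t. (ennreal (\<rho> t) * indicator E t) \<partial>Bper)"
        using rm E by (intro nn_integral_cmult borel_measurable_times_ennreal) auto
      also have "(\<integral>\<^sup>+t. (ennreal (\<rho> t) * indicator E t) \<partial>Bper) = emeasure (density Bper (\<lambda>t. ennreal (\<rho> t))) E"
        using rm E by (simp add: emeasure_density)
      finally show "emeasure (distr \<gamma> Bper (\<lambda>x. x j)) E = emeasure (density Bper (\<lambda>t. ennreal (\<rho> t))) E"
        using n by (simp add: ennreal_mult_cancel_left)
    qed simp
  qed
  have "FOT n w \<rho> \<le> (\<integral>\<^sup>+x. cN n w x \<partial>\<gamma>)" unfolding FOT_def using coup by (intro INF_lower) simp
  also have "\<dots> = (\<Sum>k. ennreal (lam k) * (\<integral>\<^sup>+x. cN n w x * ?P k x \<partial>muN n))" by (rule nnB[OF cN_measurable[OF A]])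
  also have "\<dots> \<le> (\<Sum>k. ennreal (lam k) * energyN n w \<epsilon> (\<Psi> k) (G k))"
    unfolding energyN_def by (intro suminf_le mult_left_mono nn_integral_mono) auto
  finally show "FOT n w \<rho> \<le> (case st of (lam, \<Psi>, G) \<Rightarrow> \<Sum>k. ennreal (lam k) * energyN n w \<epsilon> (\<Psi> k) (G k))" by (simp add: st)
qed

section \<open>The distance on the circle and the cost\<close>

text \<open>The infimum is attained at the nearest multiple of 2 pi, which lies within pi, and there
  arccos inverts cos. The closed form makes continuity, symmetry, periodicity and the comparison
  with cosines immediate.\<close>

lemma distT_arccos: "distT t = arccos (cos t)"
proof -
  define k where "k = round (t / (2 * pi))"
  define s where "s = t - 2 * pi * of_int k"
  have "\<bar>of_int k - t / (2 * pi)\<bar> \<le> 1/2" unfolding k_def by (rule of_int_round_abs_le)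
  then have "\<bar>t / (2 * pi) - of_int k\<bar> * (2 * pi) \<le> (1/2) * (2 * pi)" by (intro mult_right_mono) (auto simp: abs_minus_commute)
  moreover have "\<bar>t / (2 * pi) - of_int k\<bar> * (2 * pi) = \<bar>s\<bar>"
    unfolding s_def using abs_mult_pos[of "2 * pi" "t / (2 * pi) - of_int k"]
    by (simp add: field_simps)
  ultimately have s: "\<bar>s\<bar> \<le> pi" by simp
  have "distT t = \<bar>s\<bar>" unfolding distT_def
  proof (rule cInf_eq_minimum)
    show "\<bar>s\<bar> \<in> {\<bar>t - 2 * pi * real_of_int k\<bar> | k. True}" by (auto simp: s_def)
    fix x assume "x \<in> {\<bar>t - 2 * pi * real_of_int k\<bar> | k. True}"
    then obtain j :: int where x: "x = \<bar>t - 2 * pi * real_of_int j\<bar>" by auto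
    show "\<bar>s\<bar> \<le> x"
    proof (cases "j = k")
      case True then show ?thesis by (simp add: x s_def)
    next
      case False
      then have "\<bar>real_of_int k - real_of_int j\<bar> \<ge> 1" by linarith
      then have "2 * pi * \<bar>real_of_int k - real_of_int j\<bar> \<ge> 2 * pi * 1" by (intro mult_left_mono) auto
      then have "\<bar>2 * pi * (real_of_int k - real_of_int j)\<bar> \<ge> 2 * pi" by (simp add: abs_mult)
      moreover have "t - 2 * pi * real_of_int j = s + 2 * pi * (real_of_int k - real_of_int j)" by (simp add: s_def algebra_simps)
      ultimately show ?thesis using s x by linarith
    qed
  qed
  moreover have "cos t = cos \<bar>s\<bar>"
  proof -
    have "cos s = cos t" unfolding s_def using cos_diff[of t "2 * pi * of_int k"] cos_int_2pin[of k] sin_int_2pin[of k]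
      by (simp add: mult_ac)
    then show ?thesis by simp
  qed
  ultimately show ?thesis using s arccos_cos[of "\<bar>s\<bar>"] by simp
qed

lemma distT_nonneg: "0 \<le> distT t" and distT_le_pi: "distT t \<le> pi"
  unfolding distT_arccos by (auto intro: arccos_lbound arccos_ubound)

lemma distT_minus: "distT (- t) = distT t" by (simp add: distT_arccos)

lemma distT_commute: "distT (x - y) = distT (y - x)"
  using distT_minus[of "x - y"] by simp

lemma distT_bdd: "bdd_below {\<bar>t - 2 * pi * real_of_int k\<bar> | k. True}"
  by (rule bdd_belowI[of _ 0]) auto

lemma distT_le: "distT t \<le> \<bar>t - 2 * pi * real_of_int k\<bar>"
  unfolding distT_def by (rule cInf_lower[OF _ distT_bdd]) auto

lemma distT_le_abs: "distT t \<le> \<bar>t\<bar>" using distT_le[of t 0] by simp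

lemma distT_attained: "\<exists>k. distT t = \<bar>t - 2 * pi * real_of_int k\<bar>"
proof (rule ccontr)
  define k where "k = round (t / (2 * pi))"
  assume "\<not> ?thesis"
  then have ne: "distT t \<noteq> \<bar>t - 2 * pi * real_of_int k\<bar>" for k by blast
  let ?s = "t - 2 * pi * of_int k"
  have "\<bar>of_int k - t / (2 * pi)\<bar> \<le> 1/2" unfolding k_def by (rule of_int_round_abs_le)
  then have "\<bar>t / (2 * pi) - of_int k\<bar> * (2 * pi) \<le> (1/2) * (2 * pi)" by (intro mult_right_mono) (auto simp: abs_minus_commute)
  moreover have "\<bar>t / (2 * pi) - of_int k\<bar> * (2 * pi) = \<bar>?s\<bar>"
    using abs_mult_pos[of "2 * pi" "t / (2 * pi) - of_int k"] by (simp add: field_simps)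
  ultimately have s: "\<bar>?s\<bar> \<le> pi" by simp
  have "cos ?s = cos t" using cos_diff[of t "2 * pi * of_int k"] cos_int_2pin[of k] sin_int_2pin[of k]
    by (simp add: mult_ac)
  then have "cos t = cos \<bar>?s\<bar>" by simp
  then show False using ne[of k] s arccos_cos[of "\<bar>?s\<bar>"] by (simp add: distT_arccos)
qed

lemma distT_triangle: "distT (x + y) \<le> distT x + distT y"
proof -
  obtain k l where "distT x = \<bar>x - 2 * pi * real_of_int k\<bar>" "distT y = \<bar>y - 2 * pi * real_of_int l\<bar>"
    using distT_attained by metis
  moreover have "distT (x + y) \<le> \<bar>x + y - 2 * pi * real_of_int (k + l)\<bar>" by (rule distT_le)
  moreover have "x + y - 2 * pi * real_of_int (k + l) = (x - 2 * pi * real_of_int k) + (y - 2 * pi * real_of_int l)"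
    by (simp add: algebra_simps)
  ultimately show ?thesis by linarith
qed

lemma distT_triangle3: "distT (x - z) \<le> distT (x - y) + distT (y - z)"
  using distT_triangle[of "x - y" "y - z"] by simp

lemma distT_cont:
  fixes f :: "'a::t2_space \<Rightarrow> real"
  shows "continuous_on A f \<Longrightarrow> continuous_on A (\<lambda>x. distT (f x))"
  unfolding distT_arccos by (intro continuous_intros) (auto simp: abs_le_iff)

lemma cos_gt_distT: "cos b < cos t \<Longrightarrow> 0 \<le> b \<Longrightarrow> b \<le> pi \<Longrightarrow> distT t < b"
  unfolding distT_arccos by (metis arccos_cos arccos_less_mono abs_cos_le_one)

lemma distT_lt_cos: "distT t < b \<Longrightarrow> b \<le> pi \<Longrightarrow> cos b < cos t"
  using cos_monotone_0_pi[of "distT t" b] distT_nonneg[of t] by (simp add: distT_arccos)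

text \<open>Every multiple of 2 pi is at most 0 or at least 2 pi, and j m keeps distance m from
  both.\<close>

lemma distT_pi_frac: 
  assumes "0 < m" "real j * m \<le> 2 * pi - m" "j \<ge> 1"
  shows "m \<le> distT (real j * m)"
proof -
  obtain k where k: "distT (real j * m) = \<bar>real j * m - 2 * pi * real_of_int k\<bar>" using distT_attained by blast
  have jm: "m \<le> real j * m" using assms by simp
  show ?thesis
  proof (cases "k \<le> 0")
    case True
    then have "2 * pi * real_of_int k \<le> 0" by (simp add: mult_le_0_iff)
    then show ?thesis using k jm assms by linarith
  next
    case False
    then have "2 * pi * 1 \<le> 2 * pi * real_of_int k" by (intro mult_left_mono) auto
    then show ?thesis using k assms by linarith
  qed
qed

section \<open>Separation and continuity estimates for the cost\<close>

locale cost =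
  fixes n :: nat and w :: "real \<times> real \<Rightarrow> ennreal"
  assumes n1: "1 \<le> n" and A: "assumptionA w"
begin

lemma w_sym: "x \<in> Iper \<Longrightarrow> y \<in> Iper \<Longrightarrow> w (x, y) = w (y, x)"
  using A by (simp add: assumptionA_def)

lemma w_cont: "continuous_on (Iper \<times> Iper) w"
  using A by (simp add: assumptionA_def)

lemma w_inf: "x \<in> Iper \<Longrightarrow> y \<in> Iper \<Longrightarrow> w (x, y) = top \<longleftrightarrow> distT (x - y) = 0"
proof -
  assume xy: "x \<in> Iper" "y \<in> Iper"
  have e: "{p \<in> Iper \<times> Iper. w p = \<infinity>} = {(x, y) \<in> Iper \<times> Iper. distT (x - y) = 0}"
    using A by (simp add: assumptionA_def)
  have "(x, y) \<in> {p \<in> Iper \<times> Iper. w p = \<infinity>} \<longleftrightarrow> (x, y) \<in> {(x, y) \<in> Iper \<times> Iper. distT (x - y) = 0}"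
    unfolding e ..
  then show ?thesis using xy by (simp add: infinity_ennreal_def)
qed

text \<open>For a > 0 a compact set away from the diagonal, on which w is finite, bounded and
  uniformly continuous as a real function.\<close>

definition Ksep :: "real \<Rightarrow> (real \<times> real) set" where
  "Ksep a = {p \<in> Iper \<times> Iper. a \<le> distT (fst p - snd p)}"

lemma compact_Ksep: "compact (Ksep a)"
proof -
  have c: "closed (Iper \<times> Iper)" using compact_Iper by (intro closed_Times compact_imp_closed)
  have cd: "continuous_on (Iper \<times> Iper) (\<lambda>p. distT (fst p - snd p))"
    by (intro distT_cont continuous_intros)
  have "closed (Iper \<times> Iper \<inter> (\<lambda>p. distT (fst p - snd p)) -` {a..})"
    by (rule continuous_closed_preimage[OF cd c]) simp
  moreover have "Ksep a = Iper \<times> Iper \<inter> (\<lambda>p. distT (fst p - snd p)) -` {a..}" by (auto simp: Ksep_def)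
  ultimately have "closed (Ksep a)" by simp
  then have "compact ((Iper \<times> Iper) \<inter> Ksep a)"
    by (rule compact_Int_closed[OF compact_Times[OF compact_Iper compact_Iper]])
  moreover have "(Iper \<times> Iper) \<inter> Ksep a = Ksep a" by (auto simp: Ksep_def)
  ultimately show ?thesis by simp
qed

lemma w_fin: "0 < a \<Longrightarrow> (x, y) \<in> Ksep a \<Longrightarrow> w (x, y) < top"
  using w_inf[of x y] by (auto simp: Ksep_def less_top[symmetric])

lemma wr_cont: "0 < a \<Longrightarrow> continuous_on (Ksep a) (\<lambda>p. enn2real (w p))"
proof -
  assume a: "0 < a"
  have "continuous_on (Ksep a) w" by (rule continuous_on_subset[OF w_cont]) (auto simp: Ksep_def)
  then show ?thesis
    unfolding continuous_on_def
  proof safe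
    fix x y assume l: "\<forall>x\<in>Ksep a. (w \<longlongrightarrow> w x) (at x within Ksep a)" and xy: "(x, y) \<in> Ksep a"
    have "w (x, y) < top" by (rule w_fin[OF a xy])
    then obtain r where r: "w (x, y) = ennreal r" "0 \<le> r" by (cases "w (x, y)") auto
    have "(w \<longlongrightarrow> ennreal r) (at (x, y) within Ksep a)" using l xy r by metis
    from tendsto_enn2real[OF this r(2)] show "((\<lambda>p. enn2real (w p)) \<longlongrightarrow> enn2real (w (x, y))) (at (x, y) within Ksep a)"
      using r by simp
  qed
qed

lemma w_bound: assumes a: "0 < a"
  obtains W where "0 \<le> W" "\<And>x y. x \<in> Iper \<Longrightarrow> y \<in> Iper \<Longrightarrow> a \<le> distT (x - y) \<Longrightarrow> w (x, y) \<le> ennreal W"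
proof -
  have "bounded ((\<lambda>p. enn2real (w p)) ` Ksep a)"
    by (rule compact_imp_bounded[OF compact_continuous_image[OF wr_cont[OF a] compact_Ksep]])
  then obtain B where B: "\<And>p. p \<in> Ksep a \<Longrightarrow> \<bar>enn2real (w p)\<bar> \<le> B" by (auto simp: bounded_iff)
  show ?thesis
  proof (rule that[of "max B 0"])
    fix x y assume "x \<in> Iper" "y \<in> Iper" "a \<le> distT (x - y)"
    then have k: "(x, y) \<in> Ksep a" by (simp add: Ksep_def)
    have "w (x, y) = ennreal (enn2real (w (x, y)))" using w_fin[OF a k] by simp
    also have "\<dots> \<le> ennreal (max B 0)" using B[OF k] by (intro ennreal_leI) auto
    finally show "w (x, y) \<le> ennreal (max B 0)" .
  qed simp
qed

text \<open>The sublevel set is compact because w is continuous up to the value infinity, and it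
  misses the diagonal, so the circle distance attains a positive minimum on it. This is how a bound
  on the cost becomes a separation of the particles.\<close>

lemma w_sep:
  obtains a where "0 < a" "\<And>x y. x \<in> Iper \<Longrightarrow> y \<in> Iper \<Longrightarrow> w (x, y) \<le> ennreal C \<Longrightarrow> a \<le> distT (x - y)"
proof -
  define T where "T = {p \<in> Iper \<times> Iper. w p \<le> ennreal C}"
  have cI: "compact (Iper \<times> Iper)" by (intro compact_Times compact_Iper)
  have "closed (Iper \<times> Iper \<inter> w -` {..ennreal C})"
    by (rule continuous_closed_preimage[OF w_cont compact_imp_closed[OF cI]]) simp
  moreover have "T = Iper \<times> Iper \<inter> w -` {..ennreal C}" by (auto simp: T_def)
  ultimately have "closed T" by simp
  then have "compact ((Iper \<times> Iper) \<inter> T)" by (rule compact_Int_closed[OF cI])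
  moreover have "(Iper \<times> Iper) \<inter> T = T" by (auto simp: T_def)
  ultimately have cT: "compact T" by simp
  show ?thesis
  proof (cases "T = {}")
    case True
    show ?thesis by (rule that[of 1]) (use True in \<open>auto simp: T_def\<close>)
  next
    case False
    have cd: "continuous_on T (\<lambda>p. fst p - snd p)" by (intro continuous_intros)
    obtain p where p: "p \<in> T" "\<And>q. q \<in> T \<Longrightarrow> distT (fst p - snd p) \<le> distT (fst q - snd q)"
      using continuous_attains_inf[OF cT False distT_cont[OF cd]] by blast
    have "w (fst p, snd p) \<noteq> top" using p(1) by (auto simp: T_def top_unique)
    then have "distT (fst p - snd p) \<noteq> 0" using w_inf[of "fst p" "snd p"] p(1) by (auto simp: T_def)
    then have "0 < distT (fst p - snd p)" using distT_nonneg[of "fst p - snd p"] by simp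
    then show ?thesis
    proof (rule that)
      fix x y assume "x \<in> Iper" "y \<in> Iper" "w (x, y) \<le> ennreal C"
      then show "distT (fst p - snd p) \<le> distT (x - y)" using p(2)[of "(x, y)"] by (auto simp: T_def)
    qed
  qed
qed

lemma w_unif:
  assumes a: "0 < a" and e: "0 < e"
  obtains d where "0 < d" "\<And>x x' y y'. x \<in> Iper \<Longrightarrow> x' \<in> Iper \<Longrightarrow> y \<in> Iper \<Longrightarrow> y' \<in> Iper \<Longrightarrow> a \<le> distT (x - y) \<Longrightarrow> \<bar>x' - x\<bar> < d \<Longrightarrow> \<bar>y' - y\<bar> < d \<Longrightarrow>
    a / 2 \<le> distT (x' - y') \<and> \<bar>enn2real (w (x', y')) - enn2real (w (x, y))\<bar> < e"
proof -
  have "uniformly_continuous_on (Ksep (a/2)) (\<lambda>p. enn2real (w p))"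
    by (rule compact_uniformly_continuous[OF wr_cont compact_Ksep]) (use a in simp)
  then obtain d where d: "0 < d" "\<And>p q. p \<in> Ksep (a/2) \<Longrightarrow> q \<in> Ksep (a/2) \<Longrightarrow> dist q p < d \<Longrightarrow> dist (enn2real (w q)) (enn2real (w p)) < e"
    using e unfolding uniformly_continuous_on_def by metis
  show ?thesis
  \<comment> \<open>Moving both points by less than a / 4 costs at most a / 2 of their separation; d
    / 2 for each of them keeps the pair within d.\<close>
  proof (rule that[of "min (d/2) (a/4)"])
    show "0 < min (d/2) (a/4)" using d a by simp
    fix x x' y y' assume h: "x \<in> Iper" "x' \<in> Iper" "y \<in> Iper" "y' \<in> Iper" "a \<le> distT (x - y)" "\<bar>x' - x\<bar> < min (d/2) (a/4)" "\<bar>y' - y\<bar> < min (d/2) (a/4)"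
    have "distT (x - y) \<le> distT (x - x') + distT (x' - y') + distT (y' - y)"
      using distT_triangle3[of x y x'] distT_triangle3[of x' y y'] by simp
    moreover have "distT (x - x') \<le> \<bar>x' - x\<bar>" using distT_le_abs[of "x - x'"] by (simp add: abs_minus_commute)
    moreover have "distT (y' - y) \<le> \<bar>y' - y\<bar>" by (rule distT_le_abs)
    ultimately have s: "a / 2 \<le> distT (x' - y')" using h by linarith
    have "dist (x', y') (x, y) \<le> dist x' x + dist y' y"
      unfolding dist_Pair_Pair by (rule sqrt_sum_squares_le_sum) auto
    also have "\<dots> < d" using h by (simp add: dist_real_def)
    finally have "dist (enn2real (w (x', y'))) (enn2real (w (x, y))) < e"
      using h s a by (intro d) (auto simp: Ksep_def)
    then show "a / 2 \<le> distT (x' - y') \<and> \<bar>enn2real (w (x', y')) - enn2real (w (x, y))\<bar> < e"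
      using s by (simp add: dist_real_def)
  qed
qed

lemma w_le_cN: assumes "i < n" "j < n" "i \<noteq> j" shows "w (x i, x j) \<le> cN n w x"
proof -
  have "w (x i, x j) \<le> (\<Sum>j\<in>{..<n} - {i}. w (x i, x j))"
    using assms by (intro member_le_sum) auto
  also have "\<dots> \<le> cN n w x" unfolding cN_def
    using assms by (intro member_le_sum[where f="\<lambda>i. \<Sum>j\<in>{..<n} - {i}. w (x i, x j)"]) auto
  finally show ?thesis .
qed

definition cR :: "(nat \<Rightarrow> real) \<Rightarrow> real" where
  "cR x = (\<Sum>i<n. \<Sum>j\<in>{..<n} - {i}. enn2real (w (x i, x j)))"

definition sepN :: "real \<Rightarrow> (nat \<Rightarrow> real) \<Rightarrow> bool" where
  "sepN a x \<longleftrightarrow> (\<forall>i<n. \<forall>j<n. i \<noteq> j \<longrightarrow> a \<le> distT (x i - x j))"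

lemma cN_real: assumes "\<And>i. i < n \<Longrightarrow> x i \<in> Iper" "sepN a x" "0 < a"
  shows "cN n w x = ennreal (cR x)"
proof -
  have "cN n w x = (\<Sum>i<n. \<Sum>j\<in>{..<n} - {i}. ennreal (enn2real (w (x i, x j))))"
    unfolding cN_def
  proof (intro sum.cong refl)
    fix i j assume "i \<in> {..<n}" "j \<in> {..<n} - {i}"
    then have "(x i, x j) \<in> Ksep a" using assms by (auto simp: Ksep_def sepN_def)
    then show "w (x i, x j) = ennreal (enn2real (w (x i, x j)))" using w_fin[OF assms(3)] by simp
  qed
  also have "\<dots> = ennreal (cR x)" unfolding cR_def by (simp add: sum_ennreal sum_nonneg)
  finally show ?thesis .
qed

lemma cN_bound: assumes a: "0 < a"
  obtains S where "0 \<le> S" "\<And>x. (\<And>i. i < n \<Longrightarrow> x i \<in> Iper) \<Longrightarrow> sepN a x \<Longrightarrow> cN n w x \<le> ennreal S"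
proof -
  obtain W where W: "0 \<le> W" "\<And>x y. x \<in> Iper \<Longrightarrow> y \<in> Iper \<Longrightarrow> a \<le> distT (x - y) \<Longrightarrow> w (x, y) \<le> ennreal W"
    using w_bound[OF a] by metis
  show ?thesis
  proof (rule that[of "real n * (real n * W)"])
    fix x assume x: "\<And>i. i < n \<Longrightarrow> x i \<in> Iper" "sepN a x"
    have "cN n w x \<le> (\<Sum>i<n. \<Sum>j\<in>{..<n} - {i}. ennreal W)"
      unfolding cN_def using x by (intro sum_mono W) (auto simp: sepN_def)
    also have "\<dots> \<le> (\<Sum>i<n. \<Sum>j<n. ennreal W)" by (intro sum_mono sum_mono2) auto
    also have "\<dots> = ennreal (real n * (real n * W))" using W(1) by (simp add: ennreal_mult ennreal_of_nat_eq_real_of_nat)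
    finally show "cN n w x \<le> ennreal (real n * (real n * W))" .
  qed (use W in simp)
qed

lemma cN_sep:
  obtains a where "0 < a" "\<And>x. (\<And>i. i < n \<Longrightarrow> x i \<in> Iper) \<Longrightarrow> cN n w x \<le> ennreal C \<Longrightarrow> sepN a x"
proof -
  obtain a where a: "0 < a" "\<And>x y. x \<in> Iper \<Longrightarrow> y \<in> Iper \<Longrightarrow> w (x, y) \<le> ennreal C \<Longrightarrow> a \<le> distT (x - y)"
    using w_sep by metis
  show ?thesis
  proof (rule that[OF a(1)])
    fix x assume x: "\<And>i. i < n \<Longrightarrow> x i \<in> Iper" "cN n w x \<le> ennreal C"
    show "sepN a x" unfolding sepN_def
      using x a(2) w_le_cN[of _ _ x] by (meson order_trans)
  qed
qed

lemma cR_unif: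
  assumes a: "0 < a" and e: "0 < e"
  obtains d where "0 < d" "\<And>x y. (\<And>i. i < n \<Longrightarrow> x i \<in> Iper) \<Longrightarrow> (\<And>i. i < n \<Longrightarrow> y i \<in> Iper) \<Longrightarrow> sepN a x \<Longrightarrow>
     (\<And>i. i < n \<Longrightarrow> \<bar>y i - x i\<bar> < d) \<Longrightarrow> sepN (a/2) y \<and> \<bar>cR y - cR x\<bar> < e"
proof -
  \<comment> \<open>There are at most n^2 ordered pairs; the summand 1 makes the final estimate
    strict.\<close>
  define e' where "e' = e / (real n * real n + 1)"
  have e': "0 < e'" using e by (simp add: e'_def add_nonneg_pos)
  obtain d where d: "0 < d" "\<And>x x' y y'. x \<in> Iper \<Longrightarrow> x' \<in> Iper \<Longrightarrow> y \<in> Iper \<Longrightarrow> y' \<in> Iper \<Longrightarrow> a \<le> distT (x - y) \<Longrightarrow> \<bar>x' - x\<bar> < d \<Longrightarrow> \<bar>y' - y\<bar> < d \<Longrightarrow>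
    a / 2 \<le> distT (x' - y') \<and> \<bar>enn2real (w (x', y')) - enn2real (w (x, y))\<bar> < e'"
    using w_unif[OF a e'] by metis
  show ?thesis
  proof (rule that[OF d(1)])
    fix x y assume h: "\<And>i. i < n \<Longrightarrow> x i \<in> Iper" "\<And>i. i < n \<Longrightarrow> y i \<in> Iper" "sepN a x" "\<And>i. i < n \<Longrightarrow> \<bar>y i - x i\<bar> < d"
    have k: "a / 2 \<le> distT (y i - y j) \<and> \<bar>enn2real (w (y i, y j)) - enn2real (w (x i, x j))\<bar> < e'" if "i < n" "j < n" "i \<noteq> j" for i j
      using h that by (intro d(2)) (auto simp: sepN_def)
    have "\<bar>cR y - cR x\<bar> \<le> (\<Sum>i<n. \<Sum>j\<in>{..<n} - {i}. \<bar>enn2real (w (y i, y j)) - enn2real (w (x i, x j))\<bar>)"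
      unfolding cR_def sum_subtractf[symmetric] by (intro order_trans[OF sum_abs] sum_mono) (auto intro: sum_abs)
    also have "\<dots> \<le> (\<Sum>i<n. \<Sum>j\<in>{..<n} - {i}. e')" using k by (intro sum_mono) (auto intro: less_imp_le)
    also have "\<dots> \<le> (\<Sum>i<n. \<Sum>j<n. e')" using e' by (intro sum_mono sum_mono2) auto
    also have "\<dots> = real n * real n * e'" by simp
    also have "\<dots> < e"
    proof -
      have "real n * real n * e' < (real n * real n + 1) * e'" using e' by simp
      also have "\<dots> = e" unfolding e'_def by (simp add: add_nonneg_eq_0_iff)
      finally show ?thesis .
    qed
    finally show "sepN (a/2) y \<and> \<bar>cR y - cR x\<bar> < e" using k by (auto simp: sepN_def)
  qed
qed

end

section \<open>Partitions of unity on the circle\<close>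

lemma periodic_int:
  fixes f :: "real \<Rightarrow> 'a"
  assumes "\<And>t. f (t + 2 * pi) = f t"
  shows "f (t + 2 * pi * of_int k) = f t"
proof -
  have nat: "f (t + 2 * pi * real m) = f t" for m :: nat and t
  proof (induction m)
    case (Suc m)
    have "t + 2 * pi * real (Suc m) = (t + 2 * pi * real m) + 2 * pi" by (simp add: algebra_simps)
    then show ?case using assms[of "t + 2 * pi * real m"] Suc by metis
  qed simp
  show ?thesis
  proof (cases "k \<ge> 0")
    case True then show ?thesis using nat[of t "nat k"] by simp
  next
    case False
    then show ?thesis using nat[of "t + 2 * pi * of_int k" "nat (- k)"] by simp
  qed
qed

lemma reduce_Iper: "\<exists>k::int. t + 2 * pi * of_int k \<in> Iper"
proof -
  define k where "k = \<lfloor>t / (2 * pi)\<rfloor>"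
  have "of_int k \<le> t / (2 * pi)" "t / (2 * pi) < of_int k + 1" unfolding k_def by linarith+
  then have "of_int k * (2 * pi) \<le> t" "t < (of_int k + 1) * (2 * pi)"
    by (simp_all only: pos_le_divide_eq pos_divide_less_eq pi_gt_zero zero_less_mult_iff zero_less_numeral simp_thms)
  then have "t + 2 * pi * of_int (- k) \<in> Iper" by (auto simp: Iper_def algebra_simps)
  then show ?thesis by blast
qed

lemma C1per_deriv_periodic:
  assumes "C1per f f'" shows "f' (t + 2 * pi) = f' t"
proof -
  have "((\<lambda>t. f (t + 2 * pi)) has_real_derivative f' (t + 2 * pi) * 1) (at t)"
    by (rule DERIV_chain2[where f=f]) (use assms in \<open>auto simp: C1per_def intro!: derivative_eq_intros\<close>)
  then have "(f has_real_derivative f' (t + 2 * pi)) (at t)" using assms by (simp add: C1per_def)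
  moreover have "(f has_real_derivative f' t) (at t)" using assms by (simp add: C1per_def)
  ultimately show ?thesis by (rule DERIV_unique)
qed

lemma periodic_bounded:
  assumes "continuous_on UNIV f" "\<And>t. f (t + 2 * pi) = (f t :: real)"
  obtains B where "0 \<le> B" "\<And>t. \<bar>f t\<bar> \<le> B"
proof -
  have "bounded (f ` Iper)"
    by (rule compact_imp_bounded[OF compact_continuous_image[OF continuous_on_subset[OF assms(1)] compact_Iper]]) auto
  then obtain B where B: "\<And>t. t \<in> Iper \<Longrightarrow> \<bar>f t\<bar> \<le> B" by (auto simp: bounded_iff)
  show ?thesis
  proof (rule that[of "max B 0"])
    fix t
    obtain k :: int where k: "t + 2 * pi * of_int k \<in> Iper" using reduce_Iper by blast
    have "f (t + 2 * pi * of_int k) = f t" using periodic_int[of f t k] assms(2) by blast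
    then show "\<bar>f t\<bar> \<le> max B 0" using B[OF k] by simp
  qed simp
qed

lemma C1per_bounded:
  assumes "C1per f f'"
  obtains B where "0 \<le> B" "\<And>t. \<bar>f t\<bar> \<le> B" "\<And>t. \<bar>f' t\<bar> \<le> B"
proof -
  obtain B1 where B1: "0 \<le> B1" "\<And>t. \<bar>f t\<bar> \<le> B1"
    using periodic_bounded[of f] C1per_cont[OF assms] assms by (auto simp: C1per_def)
  obtain B2 where B2: "0 \<le> B2" "\<And>t. \<bar>f' t\<bar> \<le> B2"
    using periodic_bounded[of f'] C1per_cont[OF assms] C1per_deriv_periodic[OF assms] by auto
  show ?thesis by (rule that[of "max B1 B2"]) (use B1 B2 in \<open>auto simp: le_max_iff_disj\<close>)
qed

lemma C1per_shift:
  assumes "C1per f f'" shows "C1per (\<lambda>t. f (t - a)) (\<lambda>t. f' (t - a))"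
  unfolding C1per_def
proof (intro conjI allI)
  fix t
  have "((\<lambda>t. f (t - a)) has_real_derivative f' (t - a) * 1) (at t)"
    by (rule DERIV_chain2[where f=f]) (use assms in \<open>auto simp: C1per_def intro!: derivative_eq_intros\<close>)
  then show "((\<lambda>t. f (t - a)) has_real_derivative f' (t - a)) (at t)" by simp
  show "continuous_on UNIV (\<lambda>t. f' (t - a))"
    by (rule continuous_on_compose2[OF C1per_cont(2)[OF assms, of UNIV]]) (auto intro!: continuous_intros)
  have "f (t - a + 2 * pi) = f (t - a)" using assms unfolding C1per_def by blast
  then show "f (t + 2 * pi - a) = f (t - a)" by (simp add: algebra_simps)
qed

text \<open>Substitution y = 2 pi G(t) - a, carried out with an antiderivative Q of P: the integrand
  is the derivative of Q(2 pi G(t) - a) / (2 pi), and the arguments at the two endpoints differ by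
  one full period.\<close>

lemma integral_mass_coordinate:
  assumes G: "\<And>t. (G has_real_derivative g t) (at t)" and cg: "continuous_on UNIV g"
    and G0: "G 0 = 0" and G1: "G (2 * pi) = 1"
    and P: "continuous_on UNIV P" "\<And>t. P (t + 2 * pi) = P t"
  shows "(\<integral>t. g t * P (2 * pi * G t - a) \<partial>Lper) = 1 / (2 * pi) * (\<integral>t. P t \<partial>Lper)"
proof -
  obtain Q where Q: "\<And>t. (Q has_real_derivative P t) (at t)" using C1per_antideriv[OF P(1)] by metis
  have cG: "continuous_on UNIV G" using G by (meson DERIV_isCont continuous_at_imp_continuous_on)
  have d: "((\<lambda>t. 1 / (2 * pi) * Q (2 * pi * G t - a)) has_real_derivative g t * P (2 * pi * G t - a)) (at t)" for t
  proof -
    have "((\<lambda>t. Q (2 * pi * G t - a)) has_real_derivative P (2 * pi * G t - a) * (2 * pi * g t)) (at t)"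
      by (rule DERIV_chain2[OF Q]) (auto intro!: derivative_eq_intros G)
    from DERIV_cmult[OF this, of "1 / (2 * pi)"] show ?thesis by (simp add: mult_ac)
  qed
  have "(\<integral>t. g t * P (2 * pi * G t - a) \<partial>Lper) = 1 / (2 * pi) * Q (2 * pi * G (2 * pi) - a) - 1 / (2 * pi) * Q (2 * pi * G 0 - a)"
    by (rule integral_Lper_FTC)
      (use d in \<open>auto simp: has_real_derivative_iff_has_vector_derivative[symmetric] intro!: continuous_intros cg cG continuous_on_compose2[OF P(1)]\<close>)
  also have "\<dots> = 1 / (2 * pi) * (Q (- a + 2 * pi) - Q (- a))" by (simp only: G0 G1) (simp add: algebra_simps)
  also have "Q (- a + 2 * pi) - Q (- a) = (\<integral>t. P t \<partial>Lper)" using antideriv_periodic[OF Q P(2) P(1), of "- a"] by simp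
  finally show ?thesis .
qed

text \<open>The case G(t) = t / (2 pi) of the substitution.\<close>

lemma integral_shift:
  assumes P: "continuous_on UNIV P" "\<And>t. P (t + 2 * pi) = P t"
  shows "(\<integral>t. P (t - a) \<partial>Lper) = (\<integral>t. P t \<partial>Lper :: real)"
proof -
  have "(\<integral>t. (1 / (2 * pi)) * P (2 * pi * (t / (2 * pi)) - a) \<partial>Lper) = 1 / (2 * pi) * (\<integral>t. P t \<partial>Lper)"
    by (rule integral_mass_coordinate[OF _ _ _ _ P]) (auto intro!: derivative_eq_intros continuous_intros)
  then show ?thesis by simp
qed

section \<open>A C^1 partition of unity by rotated windows\<close>

definition bmp :: "real \<Rightarrow> real \<Rightarrow> real" where "bmp b t = (max 0 (cos t - cos b))\<^sup>2"
definition bmp' :: "real \<Rightarrow> real \<Rightarrow> real" where "bmp' b t = 2 * max 0 (cos t - cos b) * (- sin t)"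

lemma DERIV_pos_part_sq: "((\<lambda>y. (max 0 y)\<^sup>2) has_real_derivative 2 * max 0 y) (at (y::real))"
proof (cases y "0::real" rule: linorder_cases)
  case less
  have "((\<lambda>y. 0) has_real_derivative 2 * max 0 y) (at y)" using less by simp
  then show ?thesis
    by (rule has_field_derivative_transform_within_open[where S="{..<0}"]) (use less in auto)
next
  case greater
  have "((\<lambda>y. y\<^sup>2) has_real_derivative 2 * max 0 y) (at y)" using greater by (auto intro!: derivative_eq_intros)
  then show ?thesis
    by (rule has_field_derivative_transform_within_open[where S="{0<..}"]) (use greater in auto)
next
  case equal
  have "((\<lambda>h. ((max 0 (0 + h))\<^sup>2 - (max 0 0)\<^sup>2) / h) \<longlongrightarrow> 0) (at (0::real))"
  proof (rule Lim_null_comparison[where g="\<lambda>h. \<bar>h\<bar>"])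
    show "\<forall>\<^sub>F h in at (0::real). norm (((max 0 (0 + h))\<^sup>2 - (max 0 0)\<^sup>2) / h) \<le> \<bar>h\<bar>"
      by (rule always_eventually) (auto simp: max_def power2_eq_square)
    show "((\<lambda>h. \<bar>h\<bar>) \<longlongrightarrow> 0) (at (0::real))" by (rule tendsto_eq_intros | simp)+
  qed
  then show ?thesis unfolding equal DERIV_def by simp
qed

text \<open>Squaring the positive part gains exactly the derivative that is wanted, and the cosine
  makes the bump periodic; for b between 0 and pi it is positive on the arc of radius b.\<close>

lemma bmp_C1per: "C1per (bmp b) (bmp' b)"
  unfolding C1per_def
proof (intro conjI allI)
  fix t
  have "((\<lambda>t. (max 0 (cos t - cos b))\<^sup>2) has_real_derivative 2 * max 0 (cos t - cos b) * (- sin t)) (at t)"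
    by (rule DERIV_chain2[OF DERIV_pos_part_sq]) (auto intro!: derivative_eq_intros)
  then show "(bmp b has_real_derivative bmp' b t) (at t)" unfolding bmp_def bmp'_def .
  show "continuous_on UNIV (bmp' b)" unfolding bmp'_def by (intro continuous_intros)
  show "bmp b (t + 2 * pi) = bmp b t" by (simp add: bmp_def)
qed

lemma bmp_nonneg: "0 \<le> bmp b t" by (simp add: bmp_def)

lemma bmp_support: "bmp b t \<noteq> 0 \<Longrightarrow> 0 \<le> b \<Longrightarrow> b \<le> pi \<Longrightarrow> distT t < b"
  by (rule cos_gt_distT) (auto simp: bmp_def max_def split: if_splits)

lemma bmp_pos: "distT t < b \<Longrightarrow> b \<le> pi \<Longrightarrow> 0 < bmp b t"
  using distT_lt_cos[of t b] by (auto simp: bmp_def)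

text \<open>Centres at spacing 2 pi / N with radius 4 pi / (3 N): more than half the spacing, so the
  windows cover the circle, and less than the spacing, so windows whose centres are two steps apart
  leave a gap of 4 pi / (3 N). It is the squares of the windows that sum to 1, since orbitals are
  square roots of densities.\<close>

definition ang :: "nat \<Rightarrow> nat \<Rightarrow> real" where "ang N i = 2 * pi * real i / real N"
definition rad :: "nat \<Rightarrow> real" where "rad N = 4 * pi / (3 * real N)"
definition winZ :: "nat \<Rightarrow> real \<Rightarrow> real" where "winZ N t = (\<Sum>i<N. (bmp (rad N) (t - ang N i))\<^sup>2)"
definition win :: "nat \<Rightarrow> nat \<Rightarrow> real \<Rightarrow> real" where "win N i t = bmp (rad N) (t - ang N i) / sqrt (winZ N t)"

lemma rad_le: "2 \<le> N \<Longrightarrow> 0 \<le> rad N \<and> rad N \<le> pi"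
proof -
  assume "2 \<le> N"
  then have N: "real N \<ge> 2" by simp
  then have "4 * pi \<le> pi * (3 * real N)" using pi_gt_zero by simp
  then show ?thesis using N by (auto simp: rad_def divide_le_eq)
qed

text \<open>The centre nearest to t is within pi / N, which is less than \<open>rad N\<close>. Its
  index is found by rounding and reducing modulo N.\<close>

lemma winZ_pos: assumes N: "2 \<le> N" shows "0 < winZ N t"
proof -
  have N0: "real N > 0" using N by simp
  define j where "j = round (t * real N / (2 * pi))"
  define i where "i = nat (j mod int N)"
  have jm: "0 \<le> j mod int N" "j mod int N < int N" using N by auto
  then have i: "i < N" by (simp add: i_def nat_less_iff)
  define q where "q = j div int N"
  have j: "real_of_int j = real i + real N * real_of_int q"
  proof -
    have "j = int i + int N * q" using jm by (simp add: i_def q_def)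
    then show ?thesis by simp
  qed
  have "\<bar>of_int j - t * real N / (2 * pi)\<bar> \<le> 1/2" unfolding j_def by (rule of_int_round_abs_le)
  then have "\<bar>of_int j - t * real N / (2 * pi)\<bar> * (2 * pi / real N) \<le> 1/2 * (2 * pi / real N)"
    using N0 by (intro mult_right_mono) auto
  then have "\<bar>(of_int j - t * real N / (2 * pi)) * (2 * pi / real N)\<bar> \<le> pi / real N"
    using N0 by (simp only: abs_mult) simp
  moreover have "(of_int j - t * real N / (2 * pi)) * (2 * pi / real N) = - ((t - ang N i) - 2 * pi * of_int q)"
    using N0 by (simp add: j ang_def field_simps)
  ultimately have "\<bar>(t - ang N i) - 2 * pi * of_int q\<bar> \<le> pi / real N" by (simp only: abs_minus_cancel)
  then have "distT (t - ang N i) \<le> pi / real N" using distT_le[of "t - ang N i" q] by linarith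
  also have "pi / real N < rad N" using N0 by (simp add: rad_def field_simps)
  finally have "0 < bmp (rad N) (t - ang N i)" using rad_le[OF N] by (intro bmp_pos) auto
  then have "0 < (bmp (rad N) (t - ang N i))\<^sup>2" by simp
  also have "\<dots> \<le> winZ N t" unfolding winZ_def using i by (intro member_le_sum) auto
  finally show ?thesis .
qed

lemma winZ_C1per: "\<exists>Z'. C1per (winZ N) Z'"
proof -
  have "C1per (\<lambda>t. bmp (rad N) (t - ang N i) * bmp (rad N) (t - ang N i)) (\<lambda>t. bmp' (rad N) (t - ang N i) * bmp (rad N) (t - ang N i) + bmp (rad N) (t - ang N i) * bmp' (rad N) (t - ang N i))" for i
    by (intro C1per_mult C1per_shift bmp_C1per)
  then have "C1per (\<lambda>t. \<Sum>i<N. bmp (rad N) (t - ang N i) * bmp (rad N) (t - ang N i)) (\<lambda>t. \<Sum>i<N. bmp' (rad N) (t - ang N i) * bmp (rad N) (t - ang N i) + bmp (rad N) (t - ang N i) * bmp' (rad N) (t - ang N i))"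
    by (intro C1per_sum) auto
  moreover have "winZ N = (\<lambda>t. \<Sum>i<N. bmp (rad N) (t - ang N i) * bmp (rad N) (t - ang N i))"
    by (simp add: winZ_def fun_eq_iff power2_eq_square)
  ultimately show ?thesis by auto
qed

lemma C1per_sqrt:
  assumes "C1per f f'" "\<And>t. 0 < f t" shows "C1per (\<lambda>t. sqrt (f t)) (\<lambda>t. (inverse (sqrt (f t)) / 2) * f' t)"
proof (rule C1per_compose[OF assms(1), of sqrt "\<lambda>y. inverse (sqrt y) / 2"])
  show "(sqrt has_real_derivative inverse (sqrt (f t)) / 2) (at (f t))" for t
    by (rule DERIV_real_sqrt[OF assms(2)])
  show "continuous_on (range f) (\<lambda>y. inverse (sqrt y) / 2)"
    using assms(2) by (intro continuous_intros) (auto simp: less_imp_neq[symmetric])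
qed

lemma win_C1per: assumes N: "2 \<le> N" shows "\<exists>f'. C1per (win N i) f'"
proof -
  obtain Z' where Z': "C1per (winZ N) Z'" using winZ_C1per by blast
  have s: "C1per (\<lambda>t. sqrt (winZ N t)) (\<lambda>t. (inverse (sqrt (winZ N t)) / 2) * Z' t)"
    by (rule C1per_sqrt[OF Z' winZ_pos[OF N]])
  have inv: "C1per (\<lambda>t. inverse (sqrt (winZ N t))) (\<lambda>t. - (inverse (sqrt (winZ N t)) ^ Suc (Suc 0)) * ((inverse (sqrt (winZ N t)) / 2) * Z' t))"
  proof (rule C1per_compose[OF s, of inverse "\<lambda>y. - (inverse y ^ Suc (Suc 0))"])
    show "(inverse has_real_derivative - (inverse (sqrt (winZ N t)) ^ Suc (Suc 0))) (at (sqrt (winZ N t)))" for t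
      by (rule DERIV_inverse) (use winZ_pos[OF N, of t] in simp)
    show "continuous_on (range (\<lambda>t. sqrt (winZ N t))) (\<lambda>y. - (inverse y ^ Suc (Suc 0)))"
      using winZ_pos[OF N] by (intro continuous_intros) (auto simp: less_imp_neq[symmetric])
  qed
  have "C1per (\<lambda>t. bmp (rad N) (t - ang N i) * inverse (sqrt (winZ N t)))
    (\<lambda>t. bmp' (rad N) (t - ang N i) * inverse (sqrt (winZ N t)) + bmp (rad N) (t - ang N i) * (- (inverse (sqrt (winZ N t)) ^ Suc (Suc 0)) * ((inverse (sqrt (winZ N t)) / 2) * Z' t)))"
    by (intro C1per_mult C1per_shift bmp_C1per inv)
  moreover have "win N i = (\<lambda>t. bmp (rad N) (t - ang N i) * inverse (sqrt (winZ N t)))"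
    by (simp add: win_def fun_eq_iff divide_inverse)
  ultimately show ?thesis by auto
qed

lemma win_nonneg: "2 \<le> N \<Longrightarrow> 0 \<le> win N i t"
  using winZ_pos[of N t] by (simp add: win_def bmp_nonneg less_imp_le)

lemma win_sum: assumes N: "2 \<le> N" shows "(\<Sum>i<N. (win N i t)\<^sup>2) = 1"
proof -
  have "(\<Sum>i<N. (win N i t)\<^sup>2) = (\<Sum>i<N. (bmp (rad N) (t - ang N i))\<^sup>2 / winZ N t)"
    using winZ_pos[OF N, of t] by (simp add: win_def power_divide)
  also have "\<dots> = winZ N t / winZ N t" unfolding sum_divide_distrib[symmetric] winZ_def[of N t, symmetric] ..
  finally show ?thesis using winZ_pos[OF N, of t] by simp
qed

lemma win_le_one: assumes N: "2 \<le> N" "i < N" shows "win N i t \<le> 1"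
proof -
  have "(win N i t)\<^sup>2 \<le> (\<Sum>i<N. (win N i t)\<^sup>2)" using N by (intro member_le_sum) auto
  then have "(win N i t)\<^sup>2 \<le> 1\<^sup>2" by (simp add: win_sum[OF N(1)])
  then show ?thesis by (rule power2_le_imp_le) simp
qed

lemma win_support: "2 \<le> N \<Longrightarrow> win N i t \<noteq> 0 \<Longrightarrow> distT (t - ang N i) < rad N"
  using rad_le[of N] by (intro bmp_support) (auto simp: win_def)

text \<open>A rotation by one step permutes the centres cyclically, the last one becoming the first
  by periodicity. Hence all windows are translates of a single profile.\<close>

lemma winZ_shift: assumes N: "2 \<le> N" shows "winZ N (t - ang N i) = winZ N t"
proof -
  let ?F = "\<lambda>t i. (bmp (rad N) (t - ang N i))\<^sup>2"
  have one: "winZ N (t - ang N 1) = winZ N t" for t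
  proof -
    have N0: "real N > 0" using N by simp
    have "t - ang N 1 - ang N i = t - ang N (Suc i)" for i using N0 by (simp add: ang_def field_simps)
    then have "winZ N (t - ang N 1) = (\<Sum>i<N. ?F t (Suc i))" unfolding winZ_def by (simp only:)
    moreover have "(\<Sum>i<Suc N. ?F t i) = ?F t 0 + (\<Sum>i<N. ?F t (Suc i))" by (rule sum.lessThan_Suc_shift)
    moreover have "(\<Sum>i<Suc N. ?F t i) = (\<Sum>i<N. ?F t i) + ?F t N" by simp
    moreover have "?F t N = ?F t 0"
    proof -
      have "bmp (rad N) (t - 2 * pi + 2 * pi) = bmp (rad N) (t - 2 * pi)"
        using bmp_C1per unfolding C1per_def by blast
      then show ?thesis using N0 by (simp add: ang_def)
    qed
    ultimately show ?thesis unfolding winZ_def by linarith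
  qed
  show ?thesis
  proof (induction i)
    case 0 then show ?case by (simp add: ang_def)
  next
    case (Suc i)
    have "t - ang N (Suc i) = (t - ang N i) - ang N 1" using N by (simp add: ang_def field_simps)
    then show ?case using one[of "t - ang N i"] Suc by (simp only:)
  qed
qed

lemma win_shift: "2 \<le> N \<Longrightarrow> win N i t = win N 0 (t - ang N i)"
  by (simp add: win_def winZ_shift) (simp add: ang_def)

section \<open>Uniform bounds and extraction of a limit\<close>

definition lin_H1 :: "((real \<Rightarrow> real) \<Rightarrow> real) \<Rightarrow> bool" where
  "lin_H1 V \<longleftrightarrow> (\<forall>f h a b. H1per f \<longrightarrow> H1per h \<longrightarrow> V (\<lambda>t. a * f t + b * h t) = a * V f + b * V h)"

lemma lin_H1D: "lin_H1 V \<Longrightarrow> H1per f \<Longrightarrow> H1per h \<Longrightarrow> V (\<lambda>t. a * f t + b * h t) = a * V f + b * V h"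
  unfolding lin_H1_def by blast

lemma H1per_const: "H1per (\<lambda>t. c)" by (rule C1per_H1per[OF C1per_const])

lemma lin_H1_sum:
  assumes V: "lin_H1 V" and "finite A" and f: "\<And>i. i \<in> A \<Longrightarrow> H1per (f i)"
  shows "H1per (\<lambda>t. \<Sum>i\<in>A. c i * f i t) \<and> V (\<lambda>t. \<Sum>i\<in>A. c i * f i t) = (\<Sum>i\<in>A. c i * V (f i))"
  using assms(2) f
proof (induction rule: finite_induct)
  case empty
  have "V (\<lambda>t. 0 * 0 + 0 * 0) = 0 * V (\<lambda>t. 0) + 0 * V (\<lambda>t. 0)" by (rule lin_H1D[OF V H1per_const H1per_const])
  then show ?case by (simp add: H1per_const)
next
  case (insert x F)
  have IH: "H1per (\<lambda>t. \<Sum>i\<in>F. c i * f i t)" "V (\<lambda>t. \<Sum>i\<in>F. c i * f i t) = (\<Sum>i\<in>F. c i * V (f i))" using insert by auto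
  have e: "(\<lambda>t. \<Sum>i\<in>insert x F. c i * f i t) = (\<lambda>t. c x * f x t + 1 * (\<Sum>i\<in>F. c i * f i t))" using insert by simp
  have fx: "H1per (f x)" using insert by simp
  show ?case unfolding e using H1per_lin[OF fx IH(1), of "c x" 1] lin_H1D[OF V fx IH(1), of "c x" 1] IH(2) insert by simp
qed

lemma C1per_sq: "C1per f f' \<Longrightarrow> C1per (\<lambda>t. (f t)\<^sup>2) (\<lambda>t. 2 * f t * f' t)"
  using C1per_mult[of f f' f f'] by (simp add: power2_eq_square algebra_simps)

lemma C1per_cmult: "C1per f f' \<Longrightarrow> C1per (\<lambda>t. c * f t) (\<lambda>t. c * f' t)"
  using C1per_lin[of f f' f f' c 0] by simp

text \<open>The windows are translates of one another, so their squares have equal integrals, and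
  these add up to 2 pi.\<close>

lemma win_integral:
  assumes N2: "2 \<le> N" shows "(\<integral>t. (win N 0 t)\<^sup>2 \<partial>Lper) = 2 * pi / real N"
  proof -
    have c: "continuous_on B (\<lambda>t. (win N i t)\<^sup>2)" for i B
      using win_C1per[OF N2, of i] C1per_cont(1) by (auto intro!: continuous_intros)
    obtain W' where W': "C1per (win N 0) W'" using win_C1per[OF N2] by blast
    have N0: "real N > 0" using N2 by simp
    have p: "(win N 0 (t + 2 * pi))\<^sup>2 = (win N 0 t)\<^sup>2" for t using W' by (simp add: C1per_def)
    have "(\<integral>t. (win N i t)\<^sup>2 \<partial>Lper) = (\<integral>t. (win N 0 t)\<^sup>2 \<partial>Lper)" for i
      unfolding win_shift[OF N2, of i] by (rule integral_shift[OF c p])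
    then have "(\<Sum>i<N. \<integral>t. (win N i t)\<^sup>2 \<partial>Lper) = (\<Sum>i<N. \<integral>t. (win N 0 t)\<^sup>2 \<partial>Lper)" by (rule sum.cong[OF refl])
    then have "real N * (\<integral>t. (win N 0 t)\<^sup>2 \<partial>Lper) = (\<Sum>i<N. \<integral>t. (win N i t)\<^sup>2 \<partial>Lper)" by simp
    also have "\<dots> = (\<integral>t. (\<Sum>i<N. (win N i t)\<^sup>2) \<partial>Lper)"
      by (rule Bochner_Integration.integral_sum[symmetric]) (intro integrable_Lper_cont c)
    also have "\<dots> = 2 * pi" by (simp add: win_sum[OF N2] measure_Lper)
    finally show ?thesis using N0 by (simp add: field_simps)
  qed

context cost
begin

text \<open>What minimality says after normalisation, restricted to Slater densities and written
  without \<open>Feps\<close>. The factor \<epsilon> multiplies a kinetic term that is independent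
  of V, so the inequality passes to the limit and makes sense at \<epsilon> = 0.\<close>

definition slater_ineq :: "real \<Rightarrow> ((real \<Rightarrow> real) \<Rightarrow> real) \<Rightarrow> bool" where
  "slater_ineq \<epsilon> V \<longleftrightarrow> (\<forall>\<phi> \<phi>' S. (\<forall>j<n. C1per (\<phi> j) (\<phi>' j) \<and> (\<forall>t. 0 \<le> \<phi> j t) \<and> (\<integral>t. (\<phi> j t)\<^sup>2 \<partial>Lper) = 1) \<longrightarrow>
     (\<forall>i<n. \<forall>j<n. \<forall>t\<in>Iper. i \<noteq> j \<longrightarrow> \<phi> i t * \<phi> j t = 0) \<longrightarrow> 0 \<le> S \<longrightarrow>
     (\<forall>x. (\<forall>j<n. x j \<in> Iper \<and> \<phi> j (x j) \<noteq> 0) \<longrightarrow> cN n w x \<le> ennreal S) \<longrightarrow>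
     (\<Sum>j<n. V (\<lambda>t. (\<phi> j t)\<^sup>2)) \<le> \<epsilon> * (fact n * (\<Sum>j<n. \<integral>t. (\<phi>' j t)\<^sup>2 \<partial>Lper)) + S)"

lemma slater_ineqD:
  assumes "slater_ineq \<epsilon> V" "\<And>j. j < n \<Longrightarrow> C1per (\<phi> j) (\<phi>' j)" "\<And>j t. j < n \<Longrightarrow> 0 \<le> \<phi> j t"
    "\<And>j. j < n \<Longrightarrow> (\<integral>t. (\<phi> j t)\<^sup>2 \<partial>Lper) = 1"
    "\<And>i j t. i < n \<Longrightarrow> j < n \<Longrightarrow> t \<in> Iper \<Longrightarrow> i \<noteq> j \<Longrightarrow> \<phi> i t * \<phi> j t = 0" "0 \<le> S"
    "\<And>x. (\<And>j. j < n \<Longrightarrow> x j \<in> Iper) \<Longrightarrow> (\<And>j. j < n \<Longrightarrow> \<phi> j (x j) \<noteq> 0) \<Longrightarrow> cN n w x \<le> ennreal S"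
  shows "(\<Sum>j<n. V (\<lambda>t. (\<phi> j t)\<^sup>2)) \<le> \<epsilon> * (fact n * (\<Sum>j<n. \<integral>t. (\<phi>' j t)\<^sup>2 \<partial>Lper)) + S"
  using assms(1)[unfolded slater_ineq_def, rule_format, of \<phi> \<phi>' S] assms(2-) by blast

text \<open>Indices of equal parity on the grid of 2 n centres form a regular n-gon.\<close>

lemma ang_class_sep:
  assumes "j < n" "k < n" "j \<noteq> k"
  shows "2 * pi / real n \<le> distT (ang (2 * n) (2 * j + r) - ang (2 * n) (2 * k + r))"
proof -
  have n0: "real n > 0" using n1 by simp
  have *: "2 * pi / real n \<le> distT (ang (2 * n) (2 * j + r) - ang (2 * n) (2 * k + r))" if jk: "j < n" "k < j" for j k
  proof -
    have e: "ang (2 * n) (2 * j + r) - ang (2 * n) (2 * k + r) = real (j - k) * (2 * pi / real n)"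
      using jk n0 by (simp add: ang_def of_nat_diff field_simps)
    have "real (j - k) + 1 \<le> real n" using jk by linarith
    then have "(real (j - k) + 1) * (2 * pi / real n) \<le> real n * (2 * pi / real n)" using n0 by (intro mult_right_mono) auto
    then have "real (j - k) * (2 * pi / real n) \<le> 2 * pi - 2 * pi / real n" using n0 by (simp add: algebra_simps add_divide_distrib)
    then show ?thesis unfolding e using n0 jk by (intro distT_pi_frac) auto
  qed
  show ?thesis
  proof (cases "k < j")
    case True then show ?thesis using * assms by blast
  next
    case False
    then have "j < k" using assms by simp
    from *[OF assms(2) this] show ?thesis by (simp add: distT_commute)
  qed
qed

text \<open>A density bounded above and below is cut into 2n windows of equal mass, equally spaced in the mass coordinate
  2 * pi * G; the n windows of equal parity are separated, and each such class is the density of one Slater determinant.\<close>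

lemma density_bound:
  assumes m: "0 < m" and M: "0 < M"
  obtains K S where "0 \<le> K" "0 \<le> S"
    "\<And>\<epsilon> V g g'. 0 \<le> \<epsilon> \<Longrightarrow> lin_H1 V \<Longrightarrow> slater_ineq \<epsilon> V \<Longrightarrow> C1per g g' \<Longrightarrow> (\<And>t. m \<le> g t \<and> g t \<le> M) \<Longrightarrow>
       (\<integral>t. g t \<partial>Lper) = 1 \<Longrightarrow> real n * V g \<le> \<epsilon> * (K * (1 + (\<integral>t. (g' t)\<^sup>2 \<partial>Lper))) + S"
proof -
  define N where "N = 2 * n"
  have N2: "2 \<le> N" using n1 by (simp add: N_def)
  have n0: "real n > 0" using n1 by simp
  have N0: "real N > 0" using N2 by simp
  obtain W' where W': "C1per (win N 0) W'" using win_C1per[OF N2] by blast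
  obtain \<Lambda> where \<Lambda>: "0 \<le> \<Lambda>" "\<And>t. \<bar>W' t\<bar> \<le> \<Lambda>" using C1per_bounded[OF W'] by metis
  \<comment> \<open>The gap between windows of equal parity in the mass coordinate, 2 pi / (3 n),
    divided by the Lipschitz constant 2 pi M of that coordinate.\<close>
  define \<alpha> where "\<alpha> = 1 / (3 * real n * M)"
  have \<alpha>: "0 < \<alpha>" using n0 M by (simp add: \<alpha>_def)
  obtain S where S: "0 \<le> S" "\<And>x. (\<And>i. i < n \<Longrightarrow> x i \<in> Iper) \<Longrightarrow> sepN \<alpha> x \<Longrightarrow> cN n w x \<le> ennreal S"
    using cN_bound[OF \<alpha>] by metis
  \<comment> \<open>Collects the derivative of sqrt(N g) times a window: g'^2 / (4 g) \<le> g'^2 /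
    (4 m) comes from the root, and the chain rule through 2 pi G with |W'| \<le> \<Lambda> from the
    window.\<close>
  define K0 where "K0 = 2 * real N * (1 / (4 * m) + 2 * pi * (M * (2 * pi * M * \<Lambda>)\<^sup>2))"
  have K0: "0 \<le> K0" using m M by (simp add: K0_def)
  define K where "K = fact n * (real n * K0)"
  have winint: "(\<integral>t. (win N 0 t)\<^sup>2 \<partial>Lper) = 2 * pi / real N" by (rule win_integral[OF N2])
  show ?thesis
  proof (rule that[of K S])
    show "0 \<le> K" using K0 by (simp add: K_def)
    show "0 \<le> S" by (rule S(1))
    fix \<epsilon> V g g' assume eps: "0 \<le> \<epsilon>" and V: "lin_H1 V" and SI: "slater_ineq \<epsilon> V" and g: "C1per g g'"
      and gb: "\<And>t. m \<le> g t \<and> g t \<le> M" and g1: "(\<integral>t. g t \<partial>Lper) = 1"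
    have gpos: "0 < g t" for t using gb[of t] m by linarith
    have cg: "continuous_on B g" for B using C1per_cont[OF g] by blast
    obtain G where G: "\<And>t. (G has_real_derivative g t) (at t)" "G 0 = 0" using C1per_antideriv[OF cg] by metis
    have Gp: "G (t + 2 * pi) = G t + 1" for t
      using antideriv_periodic[OF G(1) _ cg, of t] g g1 by (simp add: C1per_def)
    have G1: "G (2 * pi) = 1" using Gp[of 0] G(2) by simp
    have cG: "continuous_on B G" for B using G by (meson DERIV_isCont continuous_at_imp_continuous_on)
    define \<psi> where "\<psi> = (\<lambda>i t. win N 0 (2 * pi * G t - ang N i))"
    define \<psi>' where "\<psi>' = (\<lambda>i t. W' (2 * pi * G t - ang N i) * (2 * pi * g t))"
    have C\<psi>: "C1per (\<psi> i) (\<psi>' i)" for i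
      unfolding C1per_def
    proof (intro conjI allI)
      fix t
      show "(\<psi> i has_real_derivative \<psi>' i t) (at t)" unfolding \<psi>_def \<psi>'_def
        by (rule DERIV_chain2[where f="win N 0"]) (use W' in \<open>auto simp: C1per_def intro!: derivative_eq_intros G\<close>)
      show "continuous_on UNIV (\<psi>' i)" unfolding \<psi>'_def
        by (intro continuous_intros continuous_on_compose2[OF C1per_cont(2)[OF W', of UNIV]] cg cG) auto
      have "win N 0 (2 * pi * G t - ang N i + 2 * pi) = win N 0 (2 * pi * G t - ang N i)" using W' unfolding C1per_def by blast
      moreover have "2 * pi * G (t + 2 * pi) - ang N i = 2 * pi * G t - ang N i + 2 * pi"
        by (simp only: Gp) (simp add: algebra_simps)
      ultimately show "\<psi> i (t + 2 * pi) = \<psi> i t" by (simp only: \<psi>_def)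
    qed
    have win_eq: "\<psi> i t = win N i (2 * pi * G t)" for i t by (simp add: \<psi>_def win_shift[OF N2, of i])
    \<comment> \<open>By substitution in the mass coordinate every squared window carries the
      fraction 1 / N of the mass of g, so sqrt N normalises the orbital.\<close>
    define \<phi> where "\<phi> = (\<lambda>i t. sqrt (real N) * (sqrt (g t) * \<psi> i t))"
    define \<phi>' where "\<phi>' = (\<lambda>i t. sqrt (real N) * ((inverse (sqrt (g t)) / 2 * g' t) * \<psi> i t + sqrt (g t) * \<psi>' i t))"
    have C\<phi>: "C1per (\<phi> i) (\<phi>' i)" for i
      unfolding \<phi>_def \<phi>'_def by (intro C1per_cmult C1per_mult C1per_sqrt g gpos C\<psi>)
    have nn: "0 \<le> \<phi> i t" for i t unfolding \<phi>_def win_eq using win_nonneg[OF N2] gpos[of t] by (simp add: less_imp_le)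
    have sq: "(\<phi> i t)\<^sup>2 = real N * (g t * (\<psi> i t)\<^sup>2)" for i t
      using gpos[of t] by (simp add: \<phi>_def power_mult_distrib less_imp_le)
    have one: "(\<integral>t. (\<phi> i t)\<^sup>2 \<partial>Lper) = 1" for i
    proof -
      have "(\<integral>t. g t * (win N 0 (2 * pi * G t - ang N i))\<^sup>2 \<partial>Lper) = 1 / (2 * pi) * (\<integral>t. (win N 0 t)\<^sup>2 \<partial>Lper)"
        by (rule integral_mass_coordinate[OF G(1) cg G(2) G1, of "\<lambda>t. (win N 0 t)\<^sup>2"])
          (use W' C1per_cont[OF W'] in \<open>auto simp: C1per_def intro!: continuous_intros\<close>)
      then show ?thesis unfolding sq \<psi>_def using N0 by (simp add: winint)
    qed
    \<comment> \<open>G increases by 1 over each period, so 2 pi G descends to the circle and y may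
      be replaced by its representative nearest to x.\<close>
    have lip: "distT (2 * pi * G x - 2 * pi * G y) \<le> 2 * pi * M * distT (x - y)" for x y
    proof -
      obtain k where k: "distT (x - y) = \<bar>x - y - 2 * pi * real_of_int k\<bar>" using distT_attained by blast
      have Gk: "G (y + 2 * pi * of_int k) = G y + of_int k"
      proof -
        have "(\<lambda>t. G t - t / (2 * pi)) (y + 2 * pi * of_int k) = (\<lambda>t. G t - t / (2 * pi)) y"
          by (rule periodic_int) (simp add: Gp add_divide_distrib)
        then show ?thesis by (simp add: add_divide_distrib)
      qed
      have lipG: "\<bar>G a - G b\<bar> \<le> M * \<bar>a - b\<bar>" for a b
      proof -
        have "norm (G a - G b) \<le> M * norm (a - b)"
          by (rule field_differentiable_bound[of UNIV G g M a b])
            (use G gb gpos in \<open>auto intro: less_imp_le simp: abs_of_pos\<close>)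
        then show ?thesis by simp
      qed
      have "distT (2 * pi * G x - 2 * pi * G y) \<le> \<bar>2 * pi * G x - 2 * pi * G y - 2 * pi * of_int k\<bar>" by (rule distT_le)
      also have "2 * pi * G x - 2 * pi * G y - 2 * pi * of_int k = 2 * pi * (G x - G (y + 2 * pi * of_int k))"
        by (simp only: Gk) (simp add: algebra_simps)
      also have "\<bar>\<dots>\<bar> = 2 * pi * \<bar>G x - G (y + 2 * pi * of_int k)\<bar>" by (simp add: abs_mult)
      also have "\<dots> \<le> 2 * pi * (M * \<bar>x - (y + 2 * pi * of_int k)\<bar>)" by (intro mult_left_mono lipG) simp
      also have "\<dots> = 2 * pi * M * distT (x - y)" by (simp add: k diff_diff_eq)
      finally show ?thesis .
    qed
    have sep: "\<alpha> \<le> distT (x - y)"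
      if jk: "j < n" "k < n" "j \<noteq> k" and x: "\<phi> (2 * j + r) x \<noteq> 0" and y: "\<phi> (2 * k + r) y \<noteq> 0" for j k r x y
    proof -
      let ?X = "2 * pi * G x" let ?Y = "2 * pi * G y" let ?a = "ang N (2 * j + r)" let ?b = "ang N (2 * k + r)"
      have "distT (?X - ?a) < rad N" "distT (?Y - ?b) < rad N"
        using x y by (auto intro!: win_support[OF N2] simp: \<phi>_def win_eq)
      moreover have "2 * pi / real n \<le> distT (?a - ?b)" using ang_class_sep[OF jk, of r] by (simp add: N_def)
      moreover have "distT (?a - ?b) \<le> distT (?a - ?X) + distT (?X - ?Y) + distT (?Y - ?b)"
        using distT_triangle3[of ?a ?b ?X] distT_triangle3[of ?X ?b ?Y] by linarith
      moreover have "distT (?a - ?X) = distT (?X - ?a)" by (rule distT_commute)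
      moreover have "2 * pi / real n - 2 * rad N = 2 * pi / (3 * real n)" using n0 by (simp add: rad_def N_def field_simps)
      ultimately have "2 * pi / (3 * real n) \<le> distT (?X - ?Y)" by linarith
      then have "2 * pi / (3 * real n) \<le> 2 * pi * M * distT (x - y)" using lip[of x y] by linarith
      then show ?thesis using n0 M unfolding \<alpha>_def by (simp add: field_simps)
    qed
    have kin: "(\<integral>t. (\<phi>' i t)\<^sup>2 \<partial>Lper) \<le> K0 * (1 + (\<integral>t. (g' t)\<^sup>2 \<partial>Lper))" if i: "i < N" for i
    proof -
      let ?C = "M * (2 * pi * M * \<Lambda>)\<^sup>2"
      have gen: "s \<le> 2 * p + 2 * q \<Longrightarrow> p \<le> u \<Longrightarrow> q \<le> v \<Longrightarrow> s \<le> 2 * (u + v)" for s p q u v :: real by (smt (verit))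
      have pt: "(\<phi>' i t)\<^sup>2 \<le> 2 * real N * (1 / (4 * m) * (g' t)\<^sup>2 + ?C)" for t
      proof -
        let ?a = "(inverse (sqrt (g t)) / 2 * g' t) * \<psi> i t" let ?b = "sqrt (g t) * \<psi>' i t"
        have "(?a + ?b)\<^sup>2 \<le> 2 * ?a\<^sup>2 + 2 * ?b\<^sup>2" using sum_squares_bound[of ?a ?b] by (simp add: power2_sum)
        moreover have "?a\<^sup>2 \<le> 1 / (4 * m) * (g' t)\<^sup>2"
        proof -
          have "(\<psi> i t)\<^sup>2 \<le> 1" unfolding win_eq using win_le_one[OF N2 i] win_nonneg[OF N2] by (simp add: power_le_one)
          moreover have "(inverse (sqrt (g t)) / 2)\<^sup>2 \<le> 1 / (4 * m)"
            using gb[of t] m gpos[of t] by (simp add: power_divide power_inverse less_imp_le field_simps)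
          ultimately have "(inverse (sqrt (g t)) / 2)\<^sup>2 * (\<psi> i t)\<^sup>2 \<le> 1 / (4 * m) * 1" using m by (intro mult_mono) auto
          then have "(inverse (sqrt (g t)) / 2)\<^sup>2 * (\<psi> i t)\<^sup>2 * (g' t)\<^sup>2 \<le> 1 / (4 * m) * (g' t)\<^sup>2" by (intro mult_right_mono) auto
          then show ?thesis by (simp only: power_mult_distrib mult_ac)
        qed
        moreover have "?b\<^sup>2 \<le> ?C"
        proof -
          have "\<bar>\<psi>' i t\<bar> \<le> \<Lambda> * (2 * pi * M)" unfolding \<psi>'_def abs_mult using gb[of t] gpos[of t] \<Lambda> by (intro mult_mono) auto
          then have "\<bar>\<psi>' i t\<bar>\<^sup>2 \<le> (\<Lambda> * (2 * pi * M))\<^sup>2" by (intro power_mono) auto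
          then have "(\<psi>' i t)\<^sup>2 \<le> (2 * pi * M * \<Lambda>)\<^sup>2" by (simp add: mult_ac)
          then have "g t * (\<psi>' i t)\<^sup>2 \<le> ?C" using gb[of t] M by (intro mult_mono) auto
          then show ?thesis using gpos[of t] by (simp add: power_mult_distrib less_imp_le)
        qed
        ultimately have "(?a + ?b)\<^sup>2 \<le> 2 * (1 / (4 * m) * (g' t)\<^sup>2 + ?C)" by (rule gen)
        then have "real N * (?a + ?b)\<^sup>2 \<le> real N * (2 * (1 / (4 * m) * (g' t)\<^sup>2 + ?C))" by (intro mult_left_mono) auto
        then show ?thesis unfolding \<phi>'_def by (simp add: power_mult_distrib mult_ac)
      qed
      have i1: "integrable Lper (\<lambda>t. (g' t)\<^sup>2)" by (intro integrable_Lper_cont continuous_intros C1per_cont[OF g])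
      have ic: "integrable Lper (\<lambda>t. c)" for c :: real by (intro integrable_Lper_cont continuous_intros)
      have "(\<integral>t. (\<phi>' i t)\<^sup>2 \<partial>Lper) \<le> (\<integral>t. 2 * real N * (1 / (4 * m) * (g' t)\<^sup>2 + ?C) \<partial>Lper)"
        using i1 ic by (intro integral_mono pt integrable_Lper_cont continuous_intros C1per_cont[OF C\<phi>]
            C1per_cont[OF g])
      also have "\<dots> = 2 * real N * (1 / (4 * m) * (\<integral>t. (g' t)\<^sup>2 \<partial>Lper) + 2 * pi * ?C)"
        using i1 ic by (simp add: measure_Lper)
      also have "\<dots> \<le> K0 * (1 + (\<integral>t. (g' t)\<^sup>2 \<partial>Lper))"
      proof -
        have "0 \<le> (\<integral>t. (g' t)\<^sup>2 \<partial>Lper)" by simp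
        moreover have "0 \<le> 1 / (4 * m)" "0 \<le> 2 * pi * ?C" using m M by auto
        moreover have "p * x + q \<le> (p + q) * (1 + x)" if "0 \<le> x" "0 \<le> p" "0 \<le> q" for p q x :: real
          using that by (simp add: algebra_simps)
        ultimately have "1 / (4 * m) * (\<integral>t. (g' t)\<^sup>2 \<partial>Lper) + 2 * pi * ?C \<le> (1 / (4 * m) + 2 * pi * ?C) * (1 + (\<integral>t. (g' t)\<^sup>2 \<partial>Lper))" by blast
        then have "2 * real N * (1 / (4 * m) * (\<integral>t. (g' t)\<^sup>2 \<partial>Lper) + 2 * pi * ?C) \<le> 2 * real N * ((1 / (4 * m) + 2 * pi * ?C) * (1 + (\<integral>t. (g' t)\<^sup>2 \<partial>Lper)))"
          by (intro mult_left_mono) auto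
        then show ?thesis by (simp only: K0_def mult.assoc)
      qed
      finally show ?thesis .
    qed
    have cls: "(\<Sum>j<n. V (\<lambda>t. (\<phi> (2 * j + r) t)\<^sup>2)) \<le> \<epsilon> * (K * (1 + (\<integral>t. (g' t)\<^sup>2 \<partial>Lper))) + S" if r: "r < 2" for r
    proof -
      have "(\<Sum>j<n. V (\<lambda>t. (\<phi> (2 * j + r) t)\<^sup>2)) \<le> \<epsilon> * (fact n * (\<Sum>j<n. \<integral>t. (\<phi>' (2 * j + r) t)\<^sup>2 \<partial>Lper)) + S"
      proof (rule slater_ineqD[OF SI])
        show "C1per (\<phi> (2 * j + r)) (\<phi>' (2 * j + r))" "0 \<le> \<phi> (2 * j + r) t" "(\<integral>t. (\<phi> (2 * j + r) t)\<^sup>2 \<partial>Lper) = 1" for j t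
          by (auto intro: C\<phi> nn one)
        show "0 \<le> S" by (rule S(1))
        show "\<phi> (2 * i + r) t * \<phi> (2 * j + r) t = 0" if "i < n" "j < n" "i \<noteq> j" for i j t
        proof (rule ccontr)
          assume "\<phi> (2 * i + r) t * \<phi> (2 * j + r) t \<noteq> 0"
          then have "\<alpha> \<le> distT (t - t)" using sep[OF that, of r t t] by auto
          then show False using \<alpha> by (simp add: distT_arccos)
        qed
        fix x assume x: "\<And>j. j < n \<Longrightarrow> x j \<in> Iper" "\<And>j. j < n \<Longrightarrow> \<phi> (2 * j + r) (x j) \<noteq> 0"
        show "cN n w x \<le> ennreal S"
        proof (rule S(2)[OF x(1)])
          show "sepN \<alpha> x" unfolding sepN_def
          proof (intro allI impI)
            fix i j assume ij: "i < n" "j < n" "i \<noteq> j"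
            show "\<alpha> \<le> distT (x i - x j)" by (rule sep[OF ij x(2)[OF ij(1)] x(2)[OF ij(2)]])
          qed
        qed
      qed
      also have "\<dots> \<le> \<epsilon> * (fact n * (\<Sum>j<n. K0 * (1 + (\<integral>t. (g' t)\<^sup>2 \<partial>Lper)))) + S"
        using eps r by (intro add_right_mono mult_left_mono sum_mono kin) (auto simp: N_def)
      also have "\<dots> = \<epsilon> * (K * (1 + (\<integral>t. (g' t)\<^sup>2 \<partial>Lper))) + S" by (simp add: K_def mult_ac)
      finally show ?thesis .
    qed
    have "g = (\<lambda>t. \<Sum>i<N. (1 / real N) * (\<phi> i t)\<^sup>2)"
    proof
      fix t
      have "(\<Sum>i<N. (1 / real N) * (\<phi> i t)\<^sup>2) = g t * (\<Sum>i<N. (win N i (2 * pi * G t))\<^sup>2)"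
        using N0 by (simp add: sq win_eq sum_distrib_left)
      then show "g t = (\<Sum>i<N. (1 / real N) * (\<phi> i t)\<^sup>2)" by (simp add: win_sum[OF N2])
    qed
    then have "V g = (\<Sum>i<N. (1 / real N) * V (\<lambda>t. (\<phi> i t)\<^sup>2))"
      using lin_H1_sum[OF V, of "{..<N}" "\<lambda>i t. (\<phi> i t)\<^sup>2" "\<lambda>_. 1 / real N"] C1per_H1per[OF C1per_sq[OF C\<phi>]] by simp
    \<comment> \<open>The vacuous case distinction brings the sum into the form in which even and
      odd indices are separated.\<close>
    also have "\<dots> = (1 / real N) * (\<Sum>i<2*n. if even i then V (\<lambda>t. (\<phi> i t)\<^sup>2) else V (\<lambda>t. (\<phi> i t)\<^sup>2))"
      by (simp add: N_def sum_distrib_left)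
    also have "(\<Sum>i<2*n. if even i then V (\<lambda>t. (\<phi> i t)\<^sup>2) else V (\<lambda>t. (\<phi> i t)\<^sup>2)) = (\<Sum>j<n. V (\<lambda>t. (\<phi> (2 * j) t)\<^sup>2)) + (\<Sum>j<n. V (\<lambda>t. (\<phi> (2 * j + 1) t)\<^sup>2))"
      by (rule sum_split_even_odd)
    finally have "2 * (real n * V g) = (\<Sum>j<n. V (\<lambda>t. (\<phi> (2 * j) t)\<^sup>2)) + (\<Sum>j<n. V (\<lambda>t. (\<phi> (2 * j + 1) t)\<^sup>2))"
      using n0 by (simp add: N_def)
    then show "real n * V g \<le> \<epsilon> * (K * (1 + (\<integral>t. (g' t)\<^sup>2 \<partial>Lper))) + S" using cls[of 0] cls[of 1] by simp
  qed
qed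

end

lemma h1dist_triangle:
  assumes "L2per (\<lambda>t. complex_of_real (f t))" "L2per (\<lambda>t. complex_of_real (g t))"
    "C1per a a'" "C1per b b'"
  shows "h1dist (\<lambda>t. a t - b t) (\<lambda>t. a' t - b' t) \<le> 2 * h1dist (\<lambda>t. f t - a t) (\<lambda>t. g t - a' t) + 2 * h1dist (\<lambda>t. f t - b t) (\<lambda>t. g t - b' t)"
proof -
  have L: "L2per (\<lambda>t. complex_of_real (a t))" "L2per (\<lambda>t. complex_of_real (a' t))"
    "L2per (\<lambda>t. complex_of_real (b t))" "L2per (\<lambda>t. complex_of_real (b' t))"
    using C1per_wderiv1[OF assms(3)] C1per_wderiv1[OF assms(4)] wderiv1_L2 by blast+
  have "(\<integral>t. (a t - b t)\<^sup>2 \<partial>Lper) \<le> 2 * (\<integral>t. (a t - f t)\<^sup>2 \<partial>Lper) + 2 * (\<integral>t. (f t - b t)\<^sup>2 \<partial>Lper)"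
    using L2_triangle[OF L(1) assms(1) L(3)] by (simp only: of_real_diff[symmetric] norm_of_real power2_abs)
  moreover have "(\<integral>t. (a' t - b' t)\<^sup>2 \<partial>Lper) \<le> 2 * (\<integral>t. (a' t - g t)\<^sup>2 \<partial>Lper) + 2 * (\<integral>t. (g t - b' t)\<^sup>2 \<partial>Lper)"
    using L2_triangle[OF L(2) assms(2) L(4)] by (simp only: of_real_diff[symmetric] norm_of_real power2_abs)
  ultimately show ?thesis unfolding h1dist_def by (simp add: power2_commute[of "a _" "f _"] power2_commute[of "a' _" "g _"])
qed

lemma sup_all_of_sup_Iper:
  assumes "\<And>t. f (t + 2 * pi) = f t" "\<And>t. t \<in> Iper \<Longrightarrow> P (f t)" shows "P (f t)"
proof -
  obtain k :: int where k: "t + 2 * pi * of_int k \<in> Iper" using reduce_Iper by blast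
  have "f (t + 2 * pi * of_int k) = f t" using periodic_int[of f t k] assms(1) by blast
  then show ?thesis using assms(2)[OF k] by simp
qed

lemma Hminus_lin: "Hminus V \<Longrightarrow> lin_H1 V" by (simp add: Hminus_def lin_H1_def)

text \<open>Adding a constant to a potential means adding a multiple of the Lebesgue integral, which
  is bounded by the L^2 norm.\<close>

lemma Hminus_add_integral:
  assumes "Hminus v" shows "Hminus (\<lambda>f. v f + c * (\<integral>t. f t \<partial>Lper))"
  unfolding Hminus_def
proof (intro conjI allI impI)
  fix f h a b assume fh: "H1per f" "H1per h"
  have "(\<integral>t. a * f t + b * h t \<partial>Lper) = a * (\<integral>t. f t \<partial>Lper) + b * (\<integral>t. h t \<partial>Lper)"
    using fh H1per_integrable by simp
  moreover have "v (\<lambda>t. a * f t + b * h t) = a * v f + b * v h" using assms fh unfolding Hminus_def by blast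
  ultimately show "v (\<lambda>t. a * f t + b * h t) + c * (\<integral>t. a * f t + b * h t \<partial>Lper) =
    a * (v f + c * (\<integral>t. f t \<partial>Lper)) + b * (v h + c * (\<integral>t. h t \<partial>Lper))"
    by (simp only:) (simp add: algebra_simps)
next
  obtain B where B: "\<And>f g. wderiv1 (\<lambda>t. complex_of_real (f t)) g \<Longrightarrow>
          \<bar>v f\<bar> \<le> B * sqrt ((\<integral>t. (f t)\<^sup>2 \<partial>Lper) + (\<integral>t. (cmod (g t))\<^sup>2 \<partial>Lper))"
    using assms unfolding Hminus_def by blast
  show "\<exists>B. \<forall>f g. wderiv1 (\<lambda>t. complex_of_real (f t)) g \<longrightarrow> \<bar>v f + c * (\<integral>t. f t \<partial>Lper)\<bar> \<le>
     B * sqrt ((\<integral>t. (f t)\<^sup>2 \<partial>Lper) + (\<integral>t. (cmod (g t))\<^sup>2 \<partial>Lper))"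
  proof (intro exI[of _ "B + \<bar>c\<bar> * sqrt (2 * pi)"] allI impI)
    fix f g assume w: "wderiv1 (\<lambda>t. complex_of_real (f t)) g"
    let ?q = "sqrt ((\<integral>t. (f t)\<^sup>2 \<partial>Lper) + (\<integral>t. (cmod (g t))\<^sup>2 \<partial>Lper))"
    have i: "integrable Lper f" "integrable Lper (\<lambda>t. (f t)\<^sup>2)" using integrable_sq_of_L2[OF wderiv1_L2(1)[OF w]] by auto
    have "\<bar>\<integral>t. f t \<partial>Lper\<bar> \<le> sqrt (2 * pi * (\<integral>t. (f t)\<^sup>2 \<partial>Lper))" by (rule abs_integral_le_L2[OF i])
    also have "\<dots> \<le> sqrt (2 * pi) * ?q" unfolding real_sqrt_mult by (intro mult_left_mono real_sqrt_le_mono) auto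
    finally have "\<bar>c * (\<integral>t. f t \<partial>Lper)\<bar> \<le> \<bar>c\<bar> * (sqrt (2 * pi) * ?q)" unfolding abs_mult by (intro mult_left_mono) auto
    then show "\<bar>v f + c * (\<integral>t. f t \<partial>Lper)\<bar> \<le> (B + \<bar>c\<bar> * sqrt (2 * pi)) * ?q"
      using B[OF w] by (simp only: distrib_right mult.assoc)
  qed
qed

section \<open>The uniform bound in the dual norm\<close>

context cost
begin

text \<open>Perturb \<rho> by a small multiple of f. The result stays between positive bounds, so
  after normalisation \<open>density_bound\<close> applies and V(\<rho>) + \<delta> V(f) is bounded
  above. As V(\<rho>) \<ge> 0, this bounds V(f) from above on the unit ball of H^1, and from below
  on replacing f by -f.\<close>

lemma uniform_H1_bound:
  assumes \<rho>: "Dper \<rho>"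
  obtains C where "0 \<le> C" "\<And>\<epsilon> V f f'. 0 \<le> \<epsilon> \<Longrightarrow> \<epsilon> \<le> 1 \<Longrightarrow> Hminus V \<Longrightarrow> slater_ineq \<epsilon> V \<Longrightarrow> 0 \<le> V \<rho> \<Longrightarrow>
     C1per f f' \<Longrightarrow> \<bar>V f\<bar> \<le> C * sqrt (h1dist f f')"
proof -
  have H\<rho>: "H1per \<rho>" and c\<rho>: "continuous_on Iper \<rho>" and p\<rho>: "\<And>x. x \<in> Iper \<Longrightarrow> 0 < \<rho> x" using \<rho> by (auto simp: Dper_def)
  \<comment> \<open>\<rho> is only H^1, whereas \<open>density_bound\<close> is about C^1 densities:
    the estimate is made for trigonometric approximations of \<rho> and passed to the limit by
    continuity of V.\<close>
  obtain g T T' where w: "wderiv1 (\<lambda>t. complex_of_real (\<rho> t)) (\<lambda>t. complex_of_real (g t))"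
    and T: "\<And>k. C1per (T k) (T' k)"
    and l: "(\<lambda>k::nat. h1dist (\<lambda>t. \<rho> t - T k t) (\<lambda>t. g t - T' k t)) \<longlonglongrightarrow> 0"
    using H1per_trig_approx[OF H\<rho>] by metis
  have ne: "Iper \<noteq> {}" by (auto simp: Iper_def)
  obtain x0 where x0: "x0 \<in> Iper" "\<And>y. y \<in> Iper \<Longrightarrow> \<rho> x0 \<le> \<rho> y" using continuous_attains_inf[OF compact_Iper ne c\<rho>] by auto
  obtain x1 where x1: "x1 \<in> Iper" "\<And>y. y \<in> Iper \<Longrightarrow> \<rho> y \<le> \<rho> x1" using continuous_attains_sup[OF compact_Iper ne c\<rho>] by auto
  define m0 where "m0 = \<rho> x0" define M0 where "M0 = \<rho> x1"
  have m0: "0 < m0" "m0 \<le> M0" using p\<rho>[OF x0(1)] x1(2)[OF x0(1)] by (auto simp: m0_def M0_def)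
  have M0: "0 < M0" using m0 by simp
  have unif: "uniform_limit Iper T \<rho> sequentially" by (rule trig_approx_uniform[OF c\<rho> w T l])
  \<comment> \<open>On the unit ball |f| \<le> 2, and the approximants of \<rho> stay above m0 / 2,
    so \<delta> = m0 / 8 leaves the perturbed density above m0 / 4.\<close>
  define \<delta> where "\<delta> = m0 / 8"
  have \<delta>: "0 < \<delta>" using m0 by (simp add: \<delta>_def)
  \<comment> \<open>Bounds for the mass of the perturbed density, whose values lie between m0 / 4
    and 3 M0; dividing by the mass gives the bounds m and M after normalisation.\<close>
  define c0 where "c0 = 2 * pi * (m0 / 4)" define c1 where "c1 = 2 * pi * (3 * M0)"
  have c01: "0 < c0" "0 < c1" using m0 M0 by (auto simp: c0_def c1_def)
  define m where "m = (m0 / 4) / c1" define M where "M = (3 * M0) / c0"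
  have mM: "0 < m" "0 < M" using c01 m0 M0 by (auto simp: m_def M_def)
  obtain K S where KS: "0 \<le> K" "0 \<le> S"
    "\<And>\<epsilon> V g g'. 0 \<le> \<epsilon> \<Longrightarrow> lin_H1 V \<Longrightarrow> slater_ineq \<epsilon> V \<Longrightarrow> C1per g g' \<Longrightarrow> (\<And>t. m \<le> g t \<and> g t \<le> M) \<Longrightarrow>
       (\<integral>t. g t \<partial>Lper) = 1 \<Longrightarrow> real n * V g \<le> \<epsilon> * (K * (1 + (\<integral>t. (g' t)\<^sup>2 \<partial>Lper))) + S"
    using density_bound[OF mM] by blast
  define R where "R = 2 * (\<integral>t. (g t)\<^sup>2 \<partial>Lper) + 2"
  have R: "0 \<le> R" by (simp add: R_def)
  define D where "D = (1 / c0\<^sup>2) * (2 * R + 2 * \<delta>\<^sup>2)"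
  have D: "0 \<le> D" using R by (simp add: D_def)
  define B where "B = K * (1 + D) + S"
  have B: "0 \<le> B" using KS D by (simp add: B_def)
  have evT: "\<forall>\<^sub>F k in sequentially. (\<forall>t\<in>Iper. dist (T k t) (\<rho> t) < m0 / 2) \<and> h1dist (\<lambda>t. \<rho> t - T k t) (\<lambda>t. g t - T' k t) < 1"
  proof (rule eventually_conj)
    show "\<forall>\<^sub>F k in sequentially. \<forall>t\<in>Iper. dist (T k t) (\<rho> t) < m0 / 2"
      using unif[unfolded uniform_limit_iff, rule_format, of "m0 / 2"] m0(1) by (simp only: half_gt_zero)
    show "\<forall>\<^sub>F k in sequentially. h1dist (\<lambda>t. \<rho> t - T k t) (\<lambda>t. g t - T' k t) < 1"
      by (rule order_tendstoD(2)[OF l]) simp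
  qed
  have key: "V \<rho> + \<delta> * V f \<le> c1 * B"
    if V: "0 \<le> \<epsilon>" "\<epsilon> \<le> 1" "Hminus V" "slater_ineq \<epsilon> V" and f: "C1per f f'" "h1dist f f' \<le> 1" for \<epsilon> V f f'
  proof -
    have lin: "lin_H1 V" by (rule Hminus_lin[OF V(3)])
    have f2: "\<bar>f t\<bar> \<le> 2" for t
    proof (rule sup_all_of_sup_Iper[of f "\<lambda>y. \<bar>y\<bar> \<le> 2"])
      show "f (t + 2 * pi) = f t" for t using f by (simp add: C1per_def)
      fix t assume "t \<in> Iper"
      then have "(f t)\<^sup>2 \<le> 2 * h1dist f f'" using C1per_sup_bound[OF f(1)] by (simp add: h1dist_def)
      then have "(f t)\<^sup>2 \<le> 2\<^sup>2" using f(2) by simp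
      then show "\<bar>f t\<bar> \<le> 2" using abs_le_square_iff[of "f t" 2] by simp
    qed
    have ev: "\<forall>\<^sub>F k in sequentially. V (T k) + \<delta> * V f \<le> c1 * B"
      using evT
    proof (rule eventually_mono)
      fix k assume k: "(\<forall>t\<in>Iper. dist (T k t) (\<rho> t) < m0 / 2) \<and> h1dist (\<lambda>t. \<rho> t - T k t) (\<lambda>t. g t - T' k t) < 1"
      have Tb: "m0 / 2 \<le> T k t \<and> T k t \<le> 2 * M0" for t
      proof (rule sup_all_of_sup_Iper[of "T k" "\<lambda>y. m0 / 2 \<le> y \<and> y \<le> 2 * M0"])
        show "T k (t + 2 * pi) = T k t" for t using T by (simp add: C1per_def)
        fix t assume t: "t \<in> Iper"
        have "\<bar>T k t - \<rho> t\<bar> < m0 / 2" using k t by (auto simp: dist_real_def)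
        moreover have "m0 \<le> \<rho> t" "\<rho> t \<le> M0" using x0(2)[OF t] x1(2)[OF t] by (auto simp: m0_def M0_def)
        ultimately show "m0 / 2 \<le> T k t \<and> T k t \<le> 2 * M0" using m0 unfolding abs_less_iff by (simp add: field_simps)
      qed
      define h where "h = (\<lambda>t. 1 * T k t + \<delta> * f t)" define h' where "h' = (\<lambda>t. 1 * T' k t + \<delta> * f' t)"
      have Ch: "C1per h h'" unfolding h_def h'_def by (rule C1per_lin[OF T f(1)])
      have hb: "m0 / 4 \<le> h t \<and> h t \<le> 3 * M0" for t
      proof -
        have "\<bar>\<delta> * f t\<bar> \<le> \<delta> * 2" unfolding abs_mult using f2[of t] \<delta> by (intro mult_mono) auto
        then have "\<bar>\<delta> * f t\<bar> \<le> m0 / 4" by (simp add: \<delta>_def)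
        moreover have "\<bar>a\<bar> \<le> m / 4 \<Longrightarrow> m / 2 \<le> x \<Longrightarrow> x \<le> 2 * M \<Longrightarrow> 0 < m \<Longrightarrow> m \<le> M \<Longrightarrow> m / 4 \<le> 1 * x + a \<and> 1 * x + a \<le> 3 * M" for a m x M :: real
          unfolding abs_le_iff by (simp add: field_simps)
        ultimately show ?thesis using Tb[of t] m0 unfolding h_def by blast
      qed
      define c where "c = (\<integral>t. h t \<partial>Lper)"
      have ih: "integrable Lper h" by (intro integrable_Lper_cont C1per_cont[OF Ch])
      have ic: "integrable Lper (\<lambda>t. a)" for a :: real by (intro integrable_Lper_cont continuous_intros)
      have "(\<integral>t. m0 / 4 \<partial>Lper) \<le> c" unfolding c_def using hb ih ic by (intro integral_mono) auto
      moreover have "c \<le> (\<integral>t. 3 * M0 \<partial>Lper)" unfolding c_def using hb ih ic by (intro integral_mono) auto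
      ultimately have c: "c0 \<le> c" "c \<le> c1" unfolding c0_def c1_def by (simp_all add: measure_Lper)
      have cpos: "0 < c" using c c01 by linarith
      define G where "G = (\<lambda>t. (1 / c) * h t)" define G' where "G' = (\<lambda>t. (1 / c) * h' t)"
      have CG: "C1per G G'" unfolding G_def G'_def by (rule C1per_cmult[OF Ch])
      have Gb: "m \<le> G t \<and> G t \<le> M" for t
      proof
        have "m \<le> h t / c" unfolding m_def using hb[of t] c cpos m0 by (intro frac_le) auto
        then show "m \<le> G t" by (simp add: G_def)
        have "h t / c \<le> M" unfolding M_def using hb[of t] c c01 M0 by (intro frac_le) auto
        then show "G t \<le> M" by (simp add: G_def)
      qed
      have G1: "(\<integral>t. G t \<partial>Lper) = 1" unfolding G_def using cpos by (simp add: c_def[symmetric])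
      have iT: "integrable Lper (\<lambda>t. (T' k t)\<^sup>2)" "integrable Lper (\<lambda>t. (f' t)\<^sup>2)"
        by (intro integrable_Lper_cont continuous_intros C1per_cont[OF T] C1per_cont[OF f(1)])+
      have TR: "(\<integral>t. (T' k t)\<^sup>2 \<partial>Lper) \<le> R"
      proof -
        have Lz: "L2per (\<lambda>t. complex_of_real 0)" by (intro L2per_cont continuous_intros)
        have LT: "L2per (\<lambda>t. complex_of_real (T' k t))" using C1per_wderiv1[OF T[of k]] wderiv1_L2 by blast
        have "(\<integral>t. (T' k t - 0)\<^sup>2 \<partial>Lper) \<le> 2 * (\<integral>t. (T' k t - g t)\<^sup>2 \<partial>Lper) + 2 * (\<integral>t. (g t - 0)\<^sup>2 \<partial>Lper)"
          using L2_triangle[OF LT wderiv1_L2(2)[OF w] Lz] by (simp only: of_real_diff[symmetric] norm_of_real power2_abs)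
        moreover have "(\<integral>t. (T' k t - g t)\<^sup>2 \<partial>Lper) \<le> 1"
        proof -
          have "(\<integral>t. (g t - T' k t)\<^sup>2 \<partial>Lper) \<le> h1dist (\<lambda>t. \<rho> t - T k t) (\<lambda>t. g t - T' k t)" by (simp add: h1dist_def)
          then show ?thesis using k by (simp add: power2_commute[of "T' k _" "g _"])
        qed
        ultimately show ?thesis by (simp add: R_def)
      qed
      have f'1: "(\<integral>t. (f' t)\<^sup>2 \<partial>Lper) \<le> 1"
      proof -
        have "(\<integral>t. (f' t)\<^sup>2 \<partial>Lper) \<le> h1dist f f'" by (simp add: h1dist_def)
        then show ?thesis using f(2) by linarith
      qed
      have "(\<integral>t. (G' t)\<^sup>2 \<partial>Lper) \<le> (\<integral>t. (1 / c0\<^sup>2) * (2 * (T' k t)\<^sup>2 + 2 * \<delta>\<^sup>2 * (f' t)\<^sup>2) \<partial>Lper)"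
      proof (rule integral_mono)
        show "integrable Lper (\<lambda>t. (G' t)\<^sup>2)" by (intro integrable_Lper_cont continuous_intros C1per_cont[OF CG])
        show "integrable Lper (\<lambda>t. (1 / c0\<^sup>2) * (2 * (T' k t)\<^sup>2 + 2 * \<delta>\<^sup>2 * (f' t)\<^sup>2))" using iT by auto
        fix t
        have "(T' k t + \<delta> * f' t)\<^sup>2 \<le> 2 * (T' k t)\<^sup>2 + 2 * (\<delta> * f' t)\<^sup>2"
          using sum_squares_bound[of "T' k t" "\<delta> * f' t"] by (simp add: power2_sum)
        then have "(T' k t + \<delta> * f' t)\<^sup>2 \<le> 2 * (T' k t)\<^sup>2 + 2 * \<delta>\<^sup>2 * (f' t)\<^sup>2" by (simp add: power_mult_distrib)
        moreover have "(1 / c)\<^sup>2 \<le> 1 / c0\<^sup>2"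
        proof -
          have "(1 / c)\<^sup>2 \<le> (1 / c0)\<^sup>2" using c c01 cpos by (intro power_mono divide_left_mono) auto
          then show ?thesis by (simp add: power_divide)
        qed
        ultimately have "(1 / c)\<^sup>2 * (T' k t + \<delta> * f' t)\<^sup>2 \<le> (1 / c0\<^sup>2) * (2 * (T' k t)\<^sup>2 + 2 * \<delta>\<^sup>2 * (f' t)\<^sup>2)"
          by (intro mult_mono) auto
        then show "(G' t)\<^sup>2 \<le> (1 / c0\<^sup>2) * (2 * (T' k t)\<^sup>2 + 2 * \<delta>\<^sup>2 * (f' t)\<^sup>2)"
          by (simp only: G'_def h'_def power_mult_distrib mult_1)
      qed
      also have "\<dots> = (1 / c0\<^sup>2) * (2 * (\<integral>t. (T' k t)\<^sup>2 \<partial>Lper) + 2 * \<delta>\<^sup>2 * (\<integral>t. (f' t)\<^sup>2 \<partial>Lper))" using iT by simp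
      also have "\<dots> \<le> (1 / c0\<^sup>2) * (2 * R + 2 * \<delta>\<^sup>2 * 1)"
        using TR f'1 by (intro mult_left_mono add_mono) auto
      finally have GD: "(\<integral>t. (G' t)\<^sup>2 \<partial>Lper) \<le> D" by (simp add: D_def)
      have "real n * V G \<le> \<epsilon> * (K * (1 + (\<integral>t. (G' t)\<^sup>2 \<partial>Lper))) + S" by (rule KS(3)[OF V(1) lin V(4) CG Gb G1])
      also have "\<dots> \<le> 1 * (K * (1 + D)) + S"
        using GD KS(1) V(1,2) by (intro add_right_mono mult_mono mult_left_mono add_left_mono mult_nonneg_nonneg add_nonneg_nonneg) auto
      finally have nV: "real n * V G \<le> B" by (simp add: B_def)
      \<comment> \<open>For negative V G the bound follows from B \<ge> 0; otherwise V G is at most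
        n times V G.\<close>
      have VG: "V G \<le> B"
      proof (cases "V G \<le> 0")
        case True then show ?thesis using B by linarith
      next
        case False
        then have "1 * V G \<le> real n * V G" using n1 by (intro mult_right_mono) auto
        then show ?thesis using nV by linarith
      qed
      have "V h = c * V G"
      proof -
        have "h = (\<lambda>t. c * G t + 0 * G t)" using cpos by (auto simp: G_def)
        then show ?thesis using lin_H1D[OF lin C1per_H1per[OF CG] C1per_H1per[OF CG], of c 0] by simp
      qed
      moreover have "V h = V (T k) + \<delta> * V f"
        unfolding h_def using lin_H1D[OF lin C1per_H1per[OF T] C1per_H1per[OF f(1)], of 1 k \<delta>] by simp
      moreover have "c * V G \<le> c1 * B"
      proof -
        have "c * V G \<le> c * B" using VG cpos by (intro mult_left_mono) auto
        also have "\<dots> \<le> c1 * B" using c B by (intro mult_right_mono) auto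
        finally show ?thesis .
      qed
      ultimately show "V (T k) + \<delta> * V f \<le> c1 * B" by simp
    qed
    have "(\<lambda>k. V (T k) + \<delta> * V f) \<longlonglongrightarrow> V \<rho> + \<delta> * V f"
      by (intro tendsto_intros Hminus_bound_trig[OF V(3) H\<rho> w T l])
    then show ?thesis by (rule tendsto_upperbound) (use ev in auto)
  qed
  define C where "C = c1 * B / \<delta>"
  have C: "0 \<le> C" using c01 B \<delta> by (simp add: C_def)
  show ?thesis
  proof (rule that[OF C])
    fix \<epsilon> V f f' assume V: "0 \<le> \<epsilon>" "\<epsilon> \<le> 1" "Hminus V" "slater_ineq \<epsilon> V" and V\<rho>: "0 \<le> V \<rho>" and f: "C1per f f'"
    have lin: "lin_H1 V" by (rule Hminus_lin[OF V(3)])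
    have one: "V h \<le> C" if "C1per h h'" "h1dist h h' \<le> 1" for h h'
    proof -
      have "\<delta> * V h \<le> c1 * B" using key[OF V that] V\<rho> by linarith
      then show ?thesis using \<delta> by (simp add: C_def field_simps)
    qed
    show "\<bar>V f\<bar> \<le> C * sqrt (h1dist f f')"
    proof (rule field_le_epsilon)
      fix e :: real assume e: "0 < e"
      define q where "q = sqrt (h1dist f f')"
      have q0: "0 \<le> q" by (simp add: q_def h1dist_def)
      \<comment> \<open>Slightly larger than the norm q, so that f can be divided by s even if q =
        0; the excess is absorbed into e.\<close>
      define s where "s = q + e / (C + 1)"
      have s: "0 < s" "q \<le> s" using q0 e C by (auto simp: s_def add_nonneg_pos)
      have sgn: "\<sigma> * V f \<le> C * s" if \<sigma>: "\<sigma> = 1 \<or> \<sigma> = -1" for \<sigma> :: real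
      proof -
        have h: "h1dist (\<lambda>t. (\<sigma> / s) * f t) (\<lambda>t. (\<sigma> / s) * f' t) = (1 / s\<^sup>2) * h1dist f f'"
          using \<sigma> by (auto simp: h1dist_def power_mult_distrib power_divide distrib_left)
        have "h1dist f f' = q\<^sup>2" by (simp add: q_def h1dist_def)
        also have "\<dots> \<le> s\<^sup>2" using q0 s by (intro power_mono) auto
        finally have "h1dist (\<lambda>t. (\<sigma> / s) * f t) (\<lambda>t. (\<sigma> / s) * f' t) \<le> 1" unfolding h using s by simp
        then have "V (\<lambda>t. (\<sigma> / s) * f t) \<le> C" by (rule one[OF C1per_cmult[OF f]])
        moreover have "V (\<lambda>t. (\<sigma> / s) * f t) = (\<sigma> / s) * V f"
          using lin_H1D[OF lin C1per_H1per[OF f] C1per_H1per[OF f], of "\<sigma> / s" 0] by simp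
 
        ultimately have "\<sigma> / s * V f \<le> C" by (simp only:)
        then show ?thesis using s by (simp add: field_simps)
      qed
      have "\<bar>V f\<bar> \<le> C * s" using sgn[of 1] sgn[of "-1"] by auto
      also have "\<dots> = C * q + C / (C + 1) * e" by (simp add: s_def distrib_left)
      also have "\<dots> \<le> C * q + e"
      proof -
        have "C / (C + 1) * e \<le> 1 * e" using C e by (intro mult_right_mono) auto
        then show ?thesis by simp
      qed
      finally show "\<bar>V f\<bar> \<le> C * sqrt (h1dist f f') + e" by (simp add: q_def)
    qed
  qed
qed

end

text \<open>Continuity along smooth approximations: the bound inherited by a limit functional is
  stated on smooth functions, and every H^1 function has such an approximating sequence.\<close>

definition H1_cont :: "((real \<Rightarrow> real) \<Rightarrow> real) \<Rightarrow> bool" where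
  "H1_cont V \<longleftrightarrow> (\<forall>f g T T'. H1per f \<longrightarrow> wderiv1 (\<lambda>t. complex_of_real (f t)) (\<lambda>t. complex_of_real (g t)) \<longrightarrow>
     (\<forall>k::nat. C1per (T k) (T' k)) \<longrightarrow> (\<lambda>k. h1dist (\<lambda>t. f t - T k t) (\<lambda>t. g t - T' k t)) \<longlonglongrightarrow> 0 \<longrightarrow> (\<lambda>k. V (T k)) \<longlonglongrightarrow> V f)"

section \<open>Extraction of a weak limit\<close>

context cost
begin

text \<open>For two smooth approximants the bound applies to their difference; letting one index
  tend to infinity replaces that approximant by f. The 2 under the root comes from the triangle
  inequality for squares.\<close>

lemma approx_error:
  assumes V: "Hminus V" and b: "\<And>f f'. C1per f f' \<Longrightarrow> \<bar>V f\<bar> \<le> C * sqrt (h1dist f f')" and C: "0 \<le> C"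
    and f: "H1per f" and w: "wderiv1 (\<lambda>t. complex_of_real (f t)) (\<lambda>t. complex_of_real (g t))"
    and T: "\<And>k. C1per (T k) (T' k)"
    and l: "(\<lambda>k::nat. h1dist (\<lambda>t. f t - T k t) (\<lambda>t. g t - T' k t)) \<longlonglongrightarrow> 0"
  shows "\<bar>V f - V (T k)\<bar> \<le> C * sqrt (2 * h1dist (\<lambda>t. f t - T k t) (\<lambda>t. g t - T' k t))"
proof -
  let ?d = "\<lambda>k. h1dist (\<lambda>t. f t - T k t) (\<lambda>t. g t - T' k t)"
  have le: "\<bar>V (T i) - V (T k)\<bar> \<le> C * sqrt (2 * ?d i + 2 * ?d k)" for i
  proof -
    have "V (\<lambda>t. 1 * T i t + (-1) * T k t) = V (T i) - V (T k)"
      using lin_H1D[OF Hminus_lin[OF V] C1per_H1per[OF T[of i]] C1per_H1per[OF T[of k]], of 1 "-1"] by simp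
    moreover have "\<bar>V (\<lambda>t. 1 * T i t + (-1) * T k t)\<bar> \<le> C * sqrt (h1dist (\<lambda>t. 1 * T i t + (-1) * T k t) (\<lambda>t. 1 * T' i t + (-1) * T' k t))"
      by (rule b[OF C1per_lin[OF T T]])
    moreover have "h1dist (\<lambda>t. 1 * T i t + (-1) * T k t) (\<lambda>t. 1 * T' i t + (-1) * T' k t) \<le> 2 * ?d i + 2 * ?d k"
      using h1dist_triangle[OF wderiv1_L2(1)[OF w] wderiv1_L2(2)[OF w] T[of i] T[of k]] by simp
    then have "C * sqrt (h1dist (\<lambda>t. 1 * T i t + (-1) * T k t) (\<lambda>t. 1 * T' i t + (-1) * T' k t)) \<le> C * sqrt (2 * ?d i + 2 * ?d k)"
      using C by (intro mult_left_mono real_sqrt_le_mono) auto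
    ultimately show ?thesis by linarith
  qed
  have 1: "(\<lambda>i. \<bar>V (T i) - V (T k)\<bar>) \<longlonglongrightarrow> \<bar>V f - V (T k)\<bar>"
    by (intro tendsto_intros Hminus_bound_trig[OF V f w T l])
  have 2: "(\<lambda>i. C * sqrt (2 * ?d i + 2 * ?d k)) \<longlonglongrightarrow> C * sqrt (2 * 0 + 2 * ?d k)"
    by (intro tendsto_intros l)
  show ?thesis using LIMSEQ_le[OF 1 2] le by simp
qed

text \<open>Weak compactness by hand: a diagonal subsequence converges on the countable
  trigonometric family, hence on its span, and the uniform bound extends the convergence to all of
  H^1 by approximation. The inequalities are not strict and pass to the limit.\<close>

lemma extract_limit:
  assumes \<rho>: "Dper \<rho>" and e: "\<And>j. 0 < e j" "\<And>j. e j \<le> 1" "e \<longlonglongrightarrow> 0"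
    and V: "\<And>j. Hminus (V j)" "\<And>j. slater_ineq (e j) (V j)" "\<And>j. 0 \<le> V j \<rho>"
  obtains r V0 C where "strict_mono r" "\<And>f. H1per f \<Longrightarrow> (\<lambda>j. V (r j) f) \<longlonglongrightarrow> V0 f"
    "lin_H1 V0" "slater_ineq 0 V0" "0 \<le> C" "\<And>f f'. C1per f f' \<Longrightarrow> \<bar>V0 f\<bar> \<le> C * sqrt (h1dist f f')" "H1_cont V0"
proof -
  obtain C where C: "0 \<le> C" "\<And>\<epsilon> V f f'. 0 \<le> \<epsilon> \<Longrightarrow> \<epsilon> \<le> 1 \<Longrightarrow> Hminus V \<Longrightarrow> slater_ineq \<epsilon> V \<Longrightarrow> 0 \<le> V \<rho> \<Longrightarrow>
     C1per f f' \<Longrightarrow> \<bar>V f\<bar> \<le> C * sqrt (h1dist f f')"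
    using uniform_H1_bound[OF \<rho>] by blast
  have b: "\<bar>V j f\<bar> \<le> C * sqrt (h1dist f f')" if "C1per f f'" for j f f'
    using C(2)[OF _ e(2)[of j] V(1,2,3)[of j] that] e(1)[of j] by simp
  define bas where "bas = (\<lambda>k. case (from_nat k :: int \<times> bool) of (m, s) \<Rightarrow> (if s then (\<lambda>t::real. cos (real_of_int m * t)) else (\<lambda>t. sin (real_of_int m * t))))"
  have basC: "\<exists>f'. C1per (bas k) f'" for k
    unfolding bas_def by (auto split: prod.split intro!: rtrig_C1per rtrig.cos rtrig.sin)
  interpret sub: subseqs "\<lambda>k s. convergent (\<lambda>j. V (s j) (bas k))"
  proof
    fix k and s :: "nat \<Rightarrow> nat"
    obtain f' where f': "C1per (bas k) f'" using basC by blast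
    have "bounded (range (\<lambda>j. V (s j) (bas k)))"
      unfolding bounded_iff using b[OF f'] by auto
    then obtain l r where "strict_mono r" "((\<lambda>j. V (s j) (bas k)) \<circ> r) \<longlonglongrightarrow> l"
      using bounded_imp_convergent_subsequence by blast
    then show "\<exists>r'. strict_mono r' \<and> convergent (\<lambda>j. V ((s \<circ> r') j) (bas k))"
      by (auto simp: o_def convergent_def)
  qed
  define r where "r = sub.diagseq"
  have r: "strict_mono r" unfolding r_def by (rule sub.subseq_diagseq)
  \<comment> \<open>Beyond index k the diagonal sequence is a subsequence of the one selected for
    \<open>bas k\<close>, and shifting the index does not affect convergence.\<close>
  have cb: "convergent (\<lambda>j. V (r j) (bas k))" for k
  proof -
    have "convergent (\<lambda>j. V ((sub.diagseq \<circ> ((+) (Suc k))) j) (bas k))"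
    proof (rule sub.diagseq_holds)
      fix q s :: "nat \<Rightarrow> nat" and m assume q: "strict_mono q" and c: "convergent (\<lambda>j. V (s j) (bas m))"
      from convergent_subseq_convergent[OF c q] show "convergent (\<lambda>j. V ((s \<circ> q) j) (bas m))" by (simp add: o_def)
    qed
    then obtain x where "(\<lambda>j. V (r (Suc k + j)) (bas k)) \<longlonglongrightarrow> x" by (auto simp: convergent_def r_def)
    then have "(\<lambda>j. V (r (j + Suc k)) (bas k)) \<longlonglongrightarrow> x" by (simp add: add.commute)
    from LIMSEQ_offset[OF this] show ?thesis by (auto simp: convergent_def)
  qed
  have ct: "convergent (\<lambda>j. V (r j) f)" if "rtrig f" for f
    using that
  proof (induction rule: rtrig.induct)
    case (cos m) then show ?case using cb[of "to_nat (m, True)"] by (simp add: bas_def)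
  next
    case (sin m) then show ?case using cb[of "to_nat (m, False)"] by (simp add: bas_def)
  next
    case (lin f h a c)
    have "V (r j) (\<lambda>t. a * f t + c * h t) = a * V (r j) f + c * V (r j) h" for j
      using rtrig_C1per[OF lin.hyps(1)] rtrig_C1per[OF lin.hyps(2)] by (auto intro!: lin_H1D[OF Hminus_lin[OF V(1)]] C1per_H1per)
    moreover obtain x y where "(\<lambda>j. V (r j) f) \<longlonglongrightarrow> x" "(\<lambda>j. V (r j) h) \<longlonglongrightarrow> y" using lin.IH by (auto simp: convergent_def)
    then have "(\<lambda>j. a * V (r j) f + c * V (r j) h) \<longlonglongrightarrow> a * x + c * y" by (intro tendsto_intros)
    ultimately show ?case by (auto simp: convergent_def)
  qed
  have cv: "convergent (\<lambda>j. V (r j) f)" if f: "H1per f" for f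
  proof -
    obtain g T T' where w: "wderiv1 (\<lambda>t. complex_of_real (f t)) (\<lambda>t. complex_of_real (g t))"
      and rT: "\<And>k. rtrig (T k)" and T: "\<And>k. C1per (T k) (T' k)"
      and l: "(\<lambda>k::nat. h1dist (\<lambda>t. f t - T k t) (\<lambda>t. g t - T' k t)) \<longlonglongrightarrow> 0"
      by (rule H1per_trig_approx[OF f]) blast
    let ?d = "\<lambda>k. h1dist (\<lambda>t. f t - T k t) (\<lambda>t. g t - T' k t)"
    have "(\<lambda>k. C * sqrt (2 * ?d k)) \<longlonglongrightarrow> C * sqrt (2 * 0)" by (intro tendsto_intros l)
    then have lim0: "(\<lambda>k. C * sqrt (2 * ?d k)) \<longlonglongrightarrow> 0" by simp
    have err: "\<bar>V j f - V j (T k)\<bar> \<le> C * sqrt (2 * ?d k)" for j k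
      by (rule approx_error[OF V(1) b C(1) f w T l])
    have gen: "\<bar>a - b\<bar> < h / 4 \<Longrightarrow> \<bar>x - a\<bar> \<le> c \<Longrightarrow> \<bar>y - b\<bar> \<le> c \<Longrightarrow> c < h / 4 \<Longrightarrow> \<bar>x - y\<bar> < h" for a b x y c h :: real
      by (simp add: abs_if field_simps split: if_splits)
    have "Cauchy (\<lambda>j. V (r j) f)"
    proof (rule metric_CauchyI)
      fix \<eta> :: real assume eta: "0 < \<eta>"
      then have "\<forall>\<^sub>F k in sequentially. C * sqrt (2 * ?d k) < \<eta> / 4" using lim0 by (intro order_tendstoD) auto
      then obtain k where k: "C * sqrt (2 * ?d k) < \<eta> / 4" by (auto simp: eventually_sequentially)
      have "Cauchy (\<lambda>j. V (r j) (T k))" using ct[OF rT[of k]] by (simp add: Cauchy_convergent_iff)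
      then obtain M where M: "\<And>i j. i \<ge> M \<Longrightarrow> j \<ge> M \<Longrightarrow> dist (V (r i) (T k)) (V (r j) (T k)) < \<eta> / 4"
        using eta unfolding Cauchy_def by (meson divide_pos_pos zero_less_numeral)
      show "\<exists>M. \<forall>m\<ge>M. \<forall>n\<ge>M. dist (V (r m) f) (V (r n) f) < \<eta>"
      proof (intro exI[of _ M] allI impI)
        fix i j assume "M \<le> i" "M \<le> j"
        then have "\<bar>V (r i) (T k) - V (r j) (T k)\<bar> < \<eta> / 4" using M[of i j] by (simp add: dist_real_def)
        then show "dist (V (r i) f) (V (r j) f) < \<eta>"
          using err[of "r i" k] err[of "r j" k] k eta gen unfolding dist_real_def by blast
      qed
    qed
    then show ?thesis by (simp add: Cauchy_convergent_iff)
  qed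
  define V0 where "V0 = (\<lambda>f. lim (\<lambda>j. V (r j) f))"
  have lim: "(\<lambda>j. V (r j) f) \<longlonglongrightarrow> V0 f" if "H1per f" for f
    using cv[OF that] by (simp add: V0_def convergent_LIMSEQ_iff)
  have er: "(\<lambda>j. e (r j)) \<longlonglongrightarrow> 0" using LIMSEQ_subseq_LIMSEQ[OF e(3) r] by (simp add: o_def)
  show ?thesis
  proof (rule that[OF r lim _ _ C(1)])
    show "lin_H1 V0" unfolding lin_H1_def
    proof (intro allI impI)
      fix f h a c assume fh: "H1per f" "H1per h"
      have "(\<lambda>j. V (r j) (\<lambda>t. a * f t + c * h t)) \<longlonglongrightarrow> V0 (\<lambda>t. a * f t + c * h t)" by (rule lim[OF H1per_lin[OF fh]])
      moreover have "(\<lambda>j. V (r j) (\<lambda>t. a * f t + c * h t)) = (\<lambda>j. a * V (r j) f + c * V (r j) h)"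
        using lin_H1D[OF Hminus_lin[OF V(1)] fh] by auto
      moreover have "(\<lambda>j. a * V (r j) f + c * V (r j) h) \<longlonglongrightarrow> a * V0 f + c * V0 h" by (intro tendsto_intros lim fh)
      ultimately show "V0 (\<lambda>t. a * f t + c * h t) = a * V0 f + c * V0 h" using LIMSEQ_unique by metis
    qed
    show "slater_ineq 0 V0" unfolding slater_ineq_def
    proof (intro allI impI)
      fix \<phi> \<phi>' S
      assume a: "\<forall>j<n. C1per (\<phi> j) (\<phi>' j) \<and> (\<forall>t. 0 \<le> \<phi> j t) \<and> (\<integral>t. (\<phi> j t)\<^sup>2 \<partial>Lper) = 1"
        "\<forall>i<n. \<forall>j<n. \<forall>t\<in>Iper. i \<noteq> j \<longrightarrow> \<phi> i t * \<phi> j t = 0" "0 \<le> S"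
        "\<forall>x. (\<forall>j<n. x j \<in> Iper \<and> \<phi> j (x j) \<noteq> 0) \<longrightarrow> cN n w x \<le> ennreal S"
      have le: "(\<Sum>j<n. V (r i) (\<lambda>t. (\<phi> j t)\<^sup>2)) \<le> e (r i) * (fact n * (\<Sum>j<n. \<integral>t. (\<phi>' j t)\<^sup>2 \<partial>Lper)) + S" for i
        using V(2)[of "r i", unfolded slater_ineq_def, rule_format, of \<phi> \<phi>' S] a by blast
      have H: "H1per (\<lambda>t. (\<phi> j t)\<^sup>2)" if "j < n" for j using a(1) that C1per_H1per[OF C1per_sq] by blast
      have 1: "(\<lambda>i. \<Sum>j<n. V (r i) (\<lambda>t. (\<phi> j t)\<^sup>2)) \<longlonglongrightarrow> (\<Sum>j<n. V0 (\<lambda>t. (\<phi> j t)\<^sup>2))"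
        using H by (intro tendsto_sum lim) auto
      have 2: "(\<lambda>i. e (r i) * (fact n * (\<Sum>j<n. \<integral>t. (\<phi>' j t)\<^sup>2 \<partial>Lper)) + S) \<longlonglongrightarrow> 0 * (fact n * (\<Sum>j<n. \<integral>t. (\<phi>' j t)\<^sup>2 \<partial>Lper)) + S"
        by (intro tendsto_intros er)
      show "(\<Sum>j<n. V0 (\<lambda>t. (\<phi> j t)\<^sup>2)) \<le> 0 * (fact n * (\<Sum>j<n. \<integral>t. (\<phi>' j t)\<^sup>2 \<partial>Lper)) + S"
        using LIMSEQ_le[OF 1 2] le by blast
    qed
    show "\<bar>V0 f\<bar> \<le> C * sqrt (h1dist f f')" if f: "C1per f f'" for f f'
    proof -
      have "(\<lambda>j. \<bar>V (r j) f\<bar>) \<longlonglongrightarrow> \<bar>V0 f\<bar>" by (intro tendsto_intros lim C1per_H1per[OF f])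
      then show ?thesis by (rule LIMSEQ_le_const2) (use b[OF f] in auto)
    qed
    show "H1_cont V0" unfolding H1_cont_def
    proof (intro allI impI)
      fix f g T T' assume f: "H1per f" and w: "wderiv1 (\<lambda>t. complex_of_real (f t)) (\<lambda>t. complex_of_real (g t))"
        and T: "\<forall>k::nat. C1per (T k) (T' k)" and l: "(\<lambda>k. h1dist (\<lambda>t. f t - T k t) (\<lambda>t. g t - T' k t)) \<longlonglongrightarrow> 0"
      let ?d = "\<lambda>k. h1dist (\<lambda>t. f t - T k t) (\<lambda>t. g t - T' k t)"
      have T': "\<And>k. C1per (T k) (T' k)" using T by blast
      have err: "\<bar>V0 f - V0 (T k)\<bar> \<le> C * sqrt (2 * ?d k)" for k
      proof -
        have "(\<lambda>j. \<bar>V (r j) f - V (r j) (T k)\<bar>) \<longlonglongrightarrow> \<bar>V0 f - V0 (T k)\<bar>" by (intro tendsto_intros lim f C1per_H1per[OF T'])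
        moreover have "\<And>j. \<bar>V (r j) f - V (r j) (T k)\<bar> \<le> C * sqrt (2 * ?d k)"
          by (rule approx_error[OF V(1) b C(1) f w T' l])
        ultimately show ?thesis by (intro LIMSEQ_le_const2) auto
      qed
      have "(\<lambda>k. C * sqrt (2 * ?d k)) \<longlonglongrightarrow> C * sqrt (2 * 0)" by (intro tendsto_intros l)
      then have lim0: "(\<lambda>k. C * sqrt (2 * ?d k)) \<longlonglongrightarrow> 0" by simp
      have "norm (V0 (T k) - V0 f) \<le> C * sqrt (2 * ?d k)" for k using err[of k] by (simp add: abs_minus_commute)
      then have "(\<lambda>k. V0 (T k) - V0 f) \<longlonglongrightarrow> 0"
        by (intro Lim_null_comparison[OF always_eventually[OF allI] lim0])
      then show "(\<lambda>k. V0 (T k)) \<longlonglongrightarrow> V0 f" by (rule LIM_zero_cancel)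
    qed
  qed
qed

end

section \<open>Maximal feasible potentials\<close>

lemma distT_periodic: "distT (t + 2 * pi * of_int k) = distT t"
  by (rule periodic_int) (simp add: distT_arccos)

context cost
begin

text \<open>Exactly the configurations of points of I with finite cost; values at indices from n on
  are free.\<close>

definition Xadm :: "(nat \<Rightarrow> real) set" where
  "Xadm = {x. (\<forall>i<n. x i \<in> Iper) \<and> (\<forall>i<n. \<forall>j<n. i \<noteq> j \<longrightarrow> 0 < distT (x i - x j))}"

text \<open>The minimum over the finitely many pairs of distinct indices; for n = 1 there are none
  and any separation works.\<close>

lemma Xadm_sep: assumes "x \<in> Xadm" shows "\<exists>a>0. sepN a x"
proof -
  define P where "P = {p \<in> {..<n} \<times> {..<n}. fst p \<noteq> snd p}"
  have fin: "finite P" unfolding P_def by auto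
  show ?thesis
  proof (cases "P = {}")
    case True then show ?thesis by (intro exI[of _ 1]) (auto simp: sepN_def P_def)
  next
    case False
    let ?f = "\<lambda>p. distT (x (fst p) - x (snd p))"
    have "Min (?f ` P) \<in> ?f ` P" using fin False by (intro Min_in) auto
    then have "0 < Min (?f ` P)" using assms by (auto simp: Xadm_def P_def)
    moreover have "sepN (Min (?f ` P)) x" unfolding sepN_def
    proof (intro allI impI)
      fix i j assume "i < n" "j < n" "i \<noteq> j"
      then have "(i, j) \<in> P" by (simp add: P_def)
      then show "Min (?f ` P) \<le> distT (x i - x j)" using fin by (intro Min_le) force+
    qed
    ultimately show ?thesis by blast
  qed
qed

lemma Xadm_of_sep: "(\<And>i. i < n \<Longrightarrow> x i \<in> Iper) \<Longrightarrow> sepN a x \<Longrightarrow> 0 < a \<Longrightarrow> x \<in> Xadm"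
  by (auto simp: Xadm_def sepN_def intro: less_le_trans)

lemma cN_Xadm: assumes "x \<in> Xadm" shows "cN n w x = ennreal (cR x)"
proof -
  obtain a where a: "0 < a" "sepN a x" using Xadm_sep[OF assms] by blast
  show ?thesis by (rule cN_real[OF _ a(2,1)]) (use assms in \<open>auto simp: Xadm_def\<close>)
qed

lemma cR_nonneg: "0 \<le> cR x" unfolding cR_def by (intro sum_nonneg) auto

lemma cN_top: assumes "\<And>i. i < n \<Longrightarrow> x i \<in> Iper" "x \<notin> Xadm" shows "cN n w x = top"
proof -
  obtain i j where ij: "i < n" "j < n" "i \<noteq> j" "\<not> 0 < distT (x i - x j)" using assms by (auto simp: Xadm_def)
  then have "distT (x i - x j) = 0" using distT_nonneg[of "x i - x j"] by linarith
  then have "w (x i, x j) = top" using w_inf assms(1) ij by auto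
  then show ?thesis using w_le_cN[OF ij(1,2,3), of x] by (simp add: top_unique)
qed

definition dual_feasible :: "(real \<Rightarrow> real) \<Rightarrow> bool" where
  "dual_feasible u \<longleftrightarrow> (\<forall>x\<in>Xadm. (\<Sum>i<n. u (x i)) \<le> cR x)"

text \<open>A regular n-gon through t with its vertices reduced into I. Vertex 0 is kept as t
  itself, because 0 and 2 pi are different points of I.\<close>

lemma spread_tuple:
  assumes t: "t \<in> Iper"
  obtains x where "x 0 = t" "\<And>i. i < n \<Longrightarrow> x i \<in> Iper" "sepN (2 * pi / real n) x"
proof -
  have "\<exists>y. y \<in> Iper \<and> (\<exists>k::int. y = t + ang (2 * n) (2 * i) + 2 * pi * of_int k) \<and> (i = 0 \<longrightarrow> y = t)" for i
  proof (cases "i = 0")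
    case True
    then show ?thesis using t by (intro exI[of _ t]) (auto simp: ang_def intro: exI[of _ 0])
  next
    case False
    then show ?thesis using reduce_Iper[of "t + ang (2 * n) (2 * i)"] by auto
  qed
  then obtain x where x: "\<And>i. x i \<in> Iper" "\<And>i. \<exists>k::int. x i = t + ang (2 * n) (2 * i) + 2 * pi * of_int k" "x 0 = t"
    by metis
  have "sepN (2 * pi / real n) x" unfolding sepN_def
  proof (intro allI impI)
    fix i j assume ij: "i < n" "j < n" "i \<noteq> j"
    obtain k l where "x i = t + ang (2 * n) (2 * i) + 2 * pi * of_int k" "x j = t + ang (2 * n) (2 * j) + 2 * pi * of_int l"
      using x(2) by metis
    then have "x i - x j = (ang (2 * n) (2 * i) - ang (2 * n) (2 * j)) + 2 * pi * of_int (k - l)" by (simp add: algebra_simps)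
    then have "distT (x i - x j) = distT (ang (2 * n) (2 * i) - ang (2 * n) (2 * j))" by (simp only: distT_periodic)
    then show "2 * pi / real n \<le> distT (x i - x j)" using ang_class_sep[OF ij, of 0] by simp
  qed
  then show ?thesis using that x by blast
qed

text \<open>The constraint on the regular n-gon through t bounds u(t) by the cost minus the other n
  - 1 values. S does not depend on u, so this bounds all competitors of the maximisation at
  once.\<close>

lemma feasible_upper_bound:
  obtains S where "0 \<le> S" "\<And>u M t. dual_feasible u \<Longrightarrow> (\<And>s. s \<in> Iper \<Longrightarrow> - M \<le> u s) \<Longrightarrow> 0 \<le> M \<Longrightarrow> t \<in> Iper \<Longrightarrow> u t \<le> S + real n * M"
proof -
  have a: "0 < 2 * pi / real n" using n1 by simp
  obtain S where S: "0 \<le> S" "\<And>x. (\<And>i. i < n \<Longrightarrow> x i \<in> Iper) \<Longrightarrow> sepN (2 * pi / real n) x \<Longrightarrow> cN n w x \<le> ennreal S"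
    using cN_bound[OF a] by blast
  show ?thesis
  proof (rule that[OF S(1)])
    fix u M t assume u: "dual_feasible u" "\<And>s. s \<in> Iper \<Longrightarrow> - M \<le> u s" "0 \<le> M" "t \<in> Iper"
    obtain x where x: "x 0 = t" "\<And>i. i < n \<Longrightarrow> x i \<in> Iper" "sepN (2 * pi / real n) x" using spread_tuple[OF u(4)] by blast
    have X: "x \<in> Xadm" by (rule Xadm_of_sep[OF x(2,3) a])
    have "ennreal (cR x) \<le> ennreal S" using S(2)[OF x(2,3)] cN_Xadm[OF X] by simp
    then have "cR x \<le> S" using S(1) by (simp add: ennreal_le_iff)
    then have "(\<Sum>i<n. u (x i)) \<le> S" using u(1) X unfolding dual_feasible_def by force
    moreover have "(\<Sum>i<n. u (x i)) = u t + (\<Sum>i\<in>{..<n} - {0}. u (x i))"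
      using n1 x(1) by (subst sum.remove[of _ 0]) auto
    moreover have "(\<Sum>i\<in>{..<n} - {0}. - M) \<le> (\<Sum>i\<in>{..<n} - {0}. u (x i))" using u(2) x(2) by (intro sum_mono) auto
    moreover have "(\<Sum>i\<in>{..<n} - {0}. - M) = - (real n - 1) * M" using n1 by (simp add: of_nat_diff algebra_simps)
    ultimately have "u t \<le> S + (real n - 1) * M" by linarith
    also have "\<dots> \<le> S + real n * M" using u(3) by (simp add: algebra_simps)
    finally show "u t \<le> S + real n * M" .
  qed
qed

text \<open>A maximal feasible potential is c-conjugate: at every point the constraint is nearly active along some
  configuration, where the point occurs only once because the cost is infinite on the diagonal.\<close>

lemma maximal_feasible:
  assumes v: "dual_feasible v" "\<And>t. t \<in> Iper \<Longrightarrow> - M \<le> v t" "0 \<le> M"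
  obtains u where "dual_feasible u" "\<And>t. t \<in> Iper \<Longrightarrow> v t \<le> u t" "continuous_on Iper u"
proof -
  obtain S where S: "0 \<le> S" "\<And>u t. dual_feasible u \<Longrightarrow> (\<And>s. s \<in> Iper \<Longrightarrow> - M \<le> u s) \<Longrightarrow> t \<in> Iper \<Longrightarrow> u t \<le> S + real n * M"
    using feasible_upper_bound v(3) by metis
  define B where "B = S + real n * M"
  have B0: "0 \<le> B" using S v(3) by (simp add: B_def)
  \<comment> \<open>Values off I are frozen at 0: feasibility does not see them, so without this no
    element would be maximal.\<close>
  define U where "U = {u. dual_feasible u \<and> (\<forall>t\<in>Iper. v t \<le> u t) \<and> (\<forall>t. t \<notin> Iper \<longrightarrow> u t = 0)}"
  have UB: "u t \<le> B" if "u \<in> U" "t \<in> Iper" for u t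
    unfolding B_def
  proof (rule S(2)[OF _ _ that(2)])
    show "dual_feasible u" using that by (simp add: U_def)
    show "- M \<le> u s" if "s \<in> Iper" for s using \<open>u \<in> U\<close> v(2)[OF that] that by (force simp: U_def)
  qed
  have XI: "x i \<in> Iper" if "x \<in> Xadm" "i < n" for x i using that by (auto simp: Xadm_def)
  have v0: "(\<lambda>t. if t \<in> Iper then v t else 0) \<in> U"
    unfolding U_def dual_feasible_def
  proof (intro CollectI conjI ballI allI impI)
    fix x assume x: "x \<in> Xadm"
    have "(\<Sum>i<n. if x i \<in> Iper then v (x i) else 0) = (\<Sum>i<n. v (x i))" using XI[OF x] by (intro sum.cong) auto
    then show "(\<Sum>i<n. if x i \<in> Iper then v (x i) else 0) \<le> cR x" using v(1) x by (simp add: dual_feasible_def)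
  qed auto
  have "\<exists>u\<in>U. \<forall>a\<in>U. u \<le> a \<longrightarrow> a = u"
  proof (rule predicate_Zorn)
    show "partial_order_on U (relation_of (\<le>) U)"
      by (rule partial_order_on_relation_ofI) auto
    fix Ch assume Ch: "Ch \<in> Chains (relation_of (\<le>) U)"
    have sub: "Ch \<subseteq> U" using Ch by (auto simp: Chains_def relation_of_def)
    have tot: "a \<le> b \<or> b \<le> a" if "a \<in> Ch" "b \<in> Ch" for a b using Ch that by (auto simp: Chains_def relation_of_def)
    show "\<exists>u\<in>U. \<forall>a\<in>Ch. a \<le> u"
    proof (cases "Ch = {}")
      case True then show ?thesis using v0 by blast
    next
      case False
      \<comment> \<open>Pointwise supremum of the chain. It stays feasible because a constraint
        involves only n points, and finitely many members of a chain have a greatest one.\<close>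
      define u where "u = (\<lambda>t. if t \<in> Iper then Sup ((\<lambda>a. a t) ` Ch) else 0)"
      have bdd: "bdd_above ((\<lambda>a. a t) ` Ch)" if "t \<in> Iper" for t using UB sub that by (intro bdd_aboveI[of _ B]) auto
      have ub: "a t \<le> u t" if "a \<in> Ch" for a t
      proof (cases "t \<in> Iper")
        case True then show ?thesis unfolding u_def using that bdd[OF True] by (auto intro: cSup_upper)
      next
        case False then show ?thesis using that sub by (auto simp: u_def U_def)
      qed
      have "u \<in> U" unfolding U_def
      proof (intro CollectI conjI ballI allI impI)
        show "u t = 0" if "t \<notin> Iper" for t using that by (simp add: u_def)
        show "v t \<le> u t" if "t \<in> Iper" for t
        proof -
          obtain a where "a \<in> Ch" using False by blast
          then show ?thesis using ub[of a t] sub that by (force simp: U_def)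
        qed
        show "dual_feasible u" unfolding dual_feasible_def
        proof (intro ballI, rule field_le_epsilon)
          fix x e assume x: "x \<in> Xadm" and e: "(0::real) < e"
          have e': "0 < e / real n" using e n1 by simp
          have "\<exists>a\<in>Ch. u (x i) < a (x i) + e / real n" if i: "i < n" for i
          proof -
            have "u (x i) - e / real n < Sup ((\<lambda>a. a (x i)) ` Ch)" using XI[OF x i] e' by (simp add: u_def)
            then obtain y where "y \<in> (\<lambda>a. a (x i)) ` Ch" "u (x i) - e / real n < y" using less_cSupE False by blast
            then show ?thesis by (auto simp only: diff_less_eq image_iff)
          qed
          then obtain a where a: "\<And>i. i < n \<Longrightarrow> a i \<in> Ch" "\<And>i. i < n \<Longrightarrow> u (x i) < a i (x i) + e / real n" by metis
          have "finite (a ` {..<n})" "a ` {..<n} \<noteq> {}" using n1 by (auto simp: lessThan_empty_iff)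
          from finite_has_maximal[OF this] obtain m where m: "m \<in> a ` {..<n}" "\<And>b. b \<in> a ` {..<n} \<Longrightarrow> m \<le> b \<Longrightarrow> m = b" by blast
          have mCh: "m \<in> Ch" using m(1) a(1) by auto
          have am: "a i \<le> m" if "i < n" for i using tot[OF a(1)[OF that] mCh] m(2)[of "a i"] that by auto
          have "(\<Sum>i<n. u (x i)) \<le> (\<Sum>i<n. m (x i) + e / real n)"
          proof (rule sum_mono)
            fix i assume "i \<in> {..<n}"
            then show "u (x i) \<le> m (x i) + e / real n" using a(2)[of i] le_funD[OF am[of i], of "x i"] by auto
          qed
          also have "\<dots> = (\<Sum>i<n. m (x i)) + e" using n1 by (simp add: sum.distrib)
          also have "\<dots> \<le> cR x + e" using mCh sub x by (auto simp: U_def dual_feasible_def)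
          finally show "(\<Sum>i<n. u (x i)) \<le> cR x + e" .
        qed
      qed
      then show ?thesis using ub by (auto simp: le_fun_def)
    qed
  qed
  then obtain u where u: "u \<in> U" and max: "\<And>a. a \<in> U \<Longrightarrow> u \<le> a \<Longrightarrow> a = u" by blast
  have uf: "dual_feasible u" using u by (simp add: U_def)
  \<comment> \<open>Otherwise raising u by e at the single point t would keep it feasible and
    contradict maximality.\<close>
  have active: "\<exists>x\<in>Xadm. \<exists>i<n. x i = t \<and> cR x - e < (\<Sum>j<n. u (x j))" if t: "t \<in> Iper" and e: "0 < e" for t e
  proof (rule ccontr)
    assume "\<not> ?thesis"
    then have neg: "(\<Sum>j<n. u (x j)) \<le> cR x - e" if "x \<in> Xadm" "i < n" "x i = t" for x i using that by force
    define u' where "u' = u(t := u t + e)"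
    have "u' \<in> U" unfolding U_def
    proof (intro CollectI conjI ballI allI impI)
      show "u' s = 0" if "s \<notin> Iper" for s using that t u by (auto simp: u'_def U_def)
      show "v s \<le> u' s" if "s \<in> Iper" for s
      proof -
        have "v s \<le> u s" using u that by (auto simp: U_def)
        then show ?thesis using e by (auto simp: u'_def)
      qed
      show "dual_feasible u'" unfolding dual_feasible_def
      proof
        fix x assume x: "x \<in> Xadm"
        show "(\<Sum>i<n. u' (x i)) \<le> cR x"
        proof (cases "\<exists>i<n. x i = t")
          case False
          then have "(\<Sum>i<n. u' (x i)) = (\<Sum>i<n. u (x i))" by (intro sum.cong) (auto simp: u'_def)
          then show ?thesis using uf x by (simp add: dual_feasible_def)
        next
          case True
          then obtain i where i: "i < n" "x i = t" by blast
          have ne: "x j \<noteq> t" if "j < n" "j \<noteq> i" for j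
          proof
            assume "x j = t"
            then have "distT (x j - x i) = 0" using i by (simp add: distT_arccos)
            moreover have "0 < distT (x j - x i)" using x that i(1) unfolding Xadm_def by blast
            ultimately show False by simp
          qed
          have "(\<Sum>j<n. u' (x j)) = u' (x i) + (\<Sum>j\<in>{..<n} - {i}. u' (x j))" using i by (subst sum.remove[of _ i]) auto
          also have "(\<Sum>j\<in>{..<n} - {i}. u' (x j)) = (\<Sum>j\<in>{..<n} - {i}. u (x j))" using ne by (intro sum.cong) (auto simp: u'_def)
          also have "u' (x i) + (\<Sum>j\<in>{..<n} - {i}. u (x j)) = (\<Sum>j<n. u (x j)) + e"
            using i by (subst (2) sum.remove[of _ i]) (auto simp: u'_def)
          also have "\<dots> \<le> cR x" using neg[OF x i] by simp
          finally show ?thesis .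
        qed
      qed
    qed
    moreover have "u \<le> u'" using e by (auto simp: le_fun_def u'_def)
    ultimately have "u' = u" by (rule max)
    then have "u' t = u t" by simp
    then show False using e by (simp add: u'_def)
  qed
  have "continuous_on Iper u" unfolding continuous_on_iff
  proof (intro ballI allI impI)
    fix t0 e0 :: real assume t0: "t0 \<in> Iper" and e0: "0 < e0"
    define e where "e = min 1 (e0 / 3)"
    have e: "0 < e" "e \<le> 1" "3 * e \<le> e0" using e0 by (auto simp: e_def)
    obtain \<alpha> where al: "0 < \<alpha>" "\<And>x. (\<And>i. i < n \<Longrightarrow> x i \<in> Iper) \<Longrightarrow> cN n w x \<le> ennreal (real n * B + 1) \<Longrightarrow> sepN \<alpha> x"
      using cN_sep[of "real n * B + 1"] by blast
    obtain d where d: "0 < d" "\<And>x y. (\<And>i. i < n \<Longrightarrow> x i \<in> Iper) \<Longrightarrow> (\<And>i. i < n \<Longrightarrow> y i \<in> Iper) \<Longrightarrow> sepN \<alpha> x \<Longrightarrow>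
     (\<And>i. i < n \<Longrightarrow> \<bar>y i - x i\<bar> < d) \<Longrightarrow> sepN (\<alpha>/2) y \<and> \<bar>cR y - cR x\<bar> < e"
      using cR_unif[OF al(1) e(1)] by blast
    \<comment> \<open>Replace t by s in a configuration nearly active at t. Its cost is at most n B
      + 1, so its points are \<alpha>-separated and the cost changes by less than e, while the
      remaining values of u cancel. Exchanging s and t gives continuity.\<close>
    have half: "u s - u t < 2 * e" if t: "t \<in> Iper" and s: "s \<in> Iper" and st: "\<bar>s - t\<bar> < d" for s t
    proof -
      obtain x i where x: "x \<in> Xadm" "i < n" "x i = t" "cR x - e < (\<Sum>j<n. u (x j))" using active[OF t e(1)] by blast
      have "(\<Sum>j<n. u (x j)) \<le> (\<Sum>j<n. B)" using UB[OF u XI[OF x(1)]] by (intro sum_mono) auto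
      then have "cR x \<le> real n * B + 1" using x(4) e(2) by simp
      then have "cN n w x \<le> ennreal (real n * B + 1)" unfolding cN_Xadm[OF x(1)] by (intro ennreal_leI)
      then have sx: "sepN \<alpha> x" by (intro al(2) XI[OF x(1)])
      define y where "y = x(i := s)"
      have yI: "y j \<in> Iper" if "j < n" for j using XI[OF x(1) that] s by (simp add: y_def)
      have yd: "\<bar>y j - x j\<bar> < d" if "j < n" for j using st d(1) x(3) by (simp add: y_def)
      have yy: "sepN (\<alpha>/2) y \<and> \<bar>cR y - cR x\<bar> < e" by (rule d(2)[OF XI[OF x(1)] yI sx yd])
      have "y \<in> Xadm" using yy al(1) yI by (intro Xadm_of_sep[where a="\<alpha>/2"]) auto
      then have "(\<Sum>j<n. u (y j)) \<le> cR y" using uf by (simp add: dual_feasible_def)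
      moreover have "(\<Sum>j<n. u (y j)) = u s + (\<Sum>j\<in>{..<n} - {i}. u (x j))"
        using x(2) by (subst sum.remove[of _ i]) (auto simp: y_def)
      moreover have "(\<Sum>j<n. u (x j)) = u t + (\<Sum>j\<in>{..<n} - {i}. u (x j))"
        using x(2,3) by (subst sum.remove[of _ i]) auto
      ultimately show ?thesis using yy x(4) unfolding abs_less_iff by linarith
    qed
    show "\<exists>d>0. \<forall>x'\<in>Iper. dist x' t0 < d \<longrightarrow> dist (u x') (u t0) < e0"
    proof (intro exI[of _ d] conjI ballI impI d(1))
      fix s assume s: "s \<in> Iper" "dist s t0 < d"
      have "u s - u t0 < 2 * e" "u t0 - u s < 2 * e"
        using half[OF t0 s(1)] half[OF s(1) t0] s(2) by (auto simp: dist_real_def abs_minus_commute)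
      then show "dist (u s) (u t0) < e0" using e unfolding dist_real_def abs_less_iff by linarith
    qed
  qed
  then show ?thesis using that uf u by (auto simp: U_def)
qed

end

section \<open>The limit functional is given by a Kantorovich potential\<close>

lemma h1dist_shift:
  assumes "C1per f f'" shows "h1dist (\<lambda>t. f (t - a)) (\<lambda>t. f' (t - a)) = h1dist f f'"
proof -
  have "continuous_on UNIV (\<lambda>t. (f t)\<^sup>2)" "continuous_on UNIV (\<lambda>t. (f' t)\<^sup>2)"
    using C1per_cont[OF assms] by (auto intro!: continuous_intros)
  moreover have "(f (t + 2 * pi))\<^sup>2 = (f t)\<^sup>2" "(f' (t + 2 * pi))\<^sup>2 = (f' t)\<^sup>2" for t
    using assms C1per_deriv_periodic[OF assms] by (auto simp: C1per_def)
  ultimately show ?thesis unfolding h1dist_def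
    using integral_shift[of "\<lambda>t. (f t)\<^sup>2" a] integral_shift[of "\<lambda>t. (f' t)\<^sup>2" a] by simp
qed

lemma integral_pos_of_pos:
  fixes f :: "real \<Rightarrow> real"
  assumes "continuous_on Iper f" "\<And>t. t \<in> Iper \<Longrightarrow> 0 \<le> f t" "s \<in> Iper" "0 < f s"
  shows "0 < (\<integral>t. f t \<partial>Lper)"
proof -
  have "0 \<le> (\<integral>t. f t \<partial>Lper)" using assms(2) by (intro integral_nonneg_AE AE_I2) simp
  moreover have "(\<integral>t. f t \<partial>Lper) \<noteq> 0"
  proof
    assume "(\<integral>t. f t \<partial>Lper) = 0"
    then have "\<forall>x\<in>{0..2*pi}. f x = 0"
      using integralL_eq_0_iff[of 0 "2*pi" f] assms(1,2) by (simp add: Iper_def)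
    then show False using assms(3,4) by (auto simp: Iper_def)
  qed
  ultimately show ?thesis by simp
qed

context cost
begin

text \<open>With radius 2 pi / (3 n), n arcs centred at a regular n-gon leave gaps of that same
  length.\<close>

lemma bump_family:
  obtains \<beta> \<beta>' where "C1per \<beta> \<beta>'" "\<And>t. 0 \<le> \<beta> t" "\<And>c. (\<integral>t. (\<beta> (t - c))\<^sup>2 \<partial>Lper) = 1"
    "\<And>t. \<beta> t \<noteq> 0 \<Longrightarrow> distT t < 2 * pi / (3 * real n)"
proof -
  define b where "b = 2 * pi / (3 * real n)"
  have b: "0 < b" "b \<le> pi"
  proof -
    show "0 < b" using n1 by (simp add: b_def)
    have "2 * pi \<le> pi * (3 * real n)" using n1 pi_gt_zero by simp
    then show "b \<le> pi" using n1 by (simp add: b_def divide_le_eq)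
  qed
  define I2 where "I2 = (\<integral>t. (bmp b t)\<^sup>2 \<partial>Lper)"
  have cb: "continuous_on B (\<lambda>t. (bmp b t)\<^sup>2)" for B using C1per_cont[OF bmp_C1per] by (intro continuous_intros)
  have I2: "0 < I2" unfolding I2_def
  proof (rule integral_pos_of_pos[OF cb, of 0])
    have "0 < bmp b 0" by (rule bmp_pos) (use b in \<open>auto simp: distT_arccos\<close>)
    then show "0 < (bmp b 0)\<^sup>2" by simp
  qed (auto simp: Iper_def)
  show ?thesis
  proof (rule that[of "\<lambda>t. (1 / sqrt I2) * bmp b t" "\<lambda>t. (1 / sqrt I2) * bmp' b t"])
    show "C1per (\<lambda>t. (1 / sqrt I2) * bmp b t) (\<lambda>t. (1 / sqrt I2) * bmp' b t)" by (rule C1per_cmult[OF bmp_C1per])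
    show "0 \<le> (1 / sqrt I2) * bmp b t" for t using I2 bmp_nonneg[of b t] by simp
    show "distT t < 2 * pi / (3 * real n)" if "(1 / sqrt I2) * bmp b t \<noteq> 0" for t
      unfolding b_def[symmetric] using that b by (intro bmp_support) auto
    fix c
    have p: "(bmp b (t + 2 * pi))\<^sup>2 = (bmp b t)\<^sup>2" for t by (simp add: bmp_def)
    have "(\<integral>t. ((1 / sqrt I2) * bmp b (t - c))\<^sup>2 \<partial>Lper) = (1 / I2) * (\<integral>t. (bmp b (t - c))\<^sup>2 \<partial>Lper)"
      using I2 by (simp add: power_mult_distrib power_divide)
    also have "(\<integral>t. (bmp b (t - c))\<^sup>2 \<partial>Lper) = I2" unfolding I2_def by (rule integral_shift[OF cb p])
    finally show "(\<integral>t. ((1 / sqrt I2) * bmp b (t - c))\<^sup>2 \<partial>Lper) = 1" using I2 by simp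
  qed
qed

lemma arcs_separated:
  assumes jk: "j < n" "k < n" "j \<noteq> k"
    and x: "distT (x - (a + ang (2 * n) (2 * j))) < 2 * pi / (3 * real n)"
    and y: "distT (y - (a + ang (2 * n) (2 * k))) < 2 * pi / (3 * real n)"
  shows "2 * pi / (3 * real n) \<le> distT (x - y)"
proof -
  let ?cj = "a + ang (2 * n) (2 * j)" and ?ck = "a + ang (2 * n) (2 * k)"
  have 1: "2 * pi / real n \<le> distT (?cj - ?ck)" using ang_class_sep[OF jk, of 0] by simp
  have 2: "distT (?cj - ?ck) \<le> distT (?cj - x) + distT (x - y) + distT (y - ?ck)"
    using distT_triangle3[of ?cj ?ck x] distT_triangle3[of x ?ck y] by linarith
  have 3: "distT (?cj - x) < 2 * pi / (3 * real n)" using x by (simp add: distT_commute[of ?cj x])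
  have "2 * pi / real n - 2 * (2 * pi / (3 * real n)) = 2 * pi / (3 * real n)" using n1 by (simp add: field_simps)
  then show ?thesis using 1 2 3 y by linarith
qed

text \<open>A competitor of finite energy, the same for all \<epsilon>. Through minimality it makes
  the energy of \<rho> finite, which is not evident from the definition as an infimum.\<close>

lemma Feps_finite_somewhere: "\<exists>\<zeta>. adm \<zeta> \<and> (\<forall>\<epsilon>>0. Feps n w \<epsilon> \<zeta> < top)"
proof -
  obtain \<beta> \<beta>' where b: "C1per \<beta> \<beta>'" "\<And>t. 0 \<le> \<beta> t" "\<And>c. (\<integral>t. (\<beta> (t - c))\<^sup>2 \<partial>Lper) = 1"
    "\<And>t. \<beta> t \<noteq> 0 \<Longrightarrow> distT t < 2 * pi / (3 * real n)" by (rule bump_family) blast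
  define \<phi> where "\<phi> = (\<lambda>j t. \<beta> (t - (0 + ang (2 * n) (2 * j))))"
  define \<phi>' where "\<phi>' = (\<lambda>j t. \<beta>' (t - (0 + ang (2 * n) (2 * j))))"
  have \<sigma>: "0 < 2 * pi / (3 * real n)" using n1 by simp
  obtain S where S: "0 \<le> S" "\<And>x. (\<And>i. i < n \<Longrightarrow> x i \<in> Iper) \<Longrightarrow> sepN (2 * pi / (3 * real n)) x \<Longrightarrow> cN n w x \<le> ennreal S"
    using cN_bound[OF \<sigma>] by blast
  have C: "C1per (\<phi> j) (\<phi>' j)" and nn: "0 \<le> \<phi> j t" and one: "(\<integral>t. (\<phi> j t)\<^sup>2 \<partial>Lper) = 1" for j t
    unfolding \<phi>_def \<phi>'_def by (rule C1per_shift[OF b(1)], rule b(2), rule b(3))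
  have sep: "2 * pi / (3 * real n) \<le> distT (x - y)" if "j < n" "k < n" "j \<noteq> k" "\<phi> j x \<noteq> 0" "\<phi> k y \<noteq> 0" for j k x y
    using that b(4) unfolding \<phi>_def by (intro arcs_separated[of j k x 0 y]) auto
  have dis: "\<phi> i t * \<phi> j t = 0" if "i < n" "j < n" "i \<noteq> j" for i j t
  proof (rule ccontr)
    assume "\<phi> i t * \<phi> j t \<noteq> 0"
    then have "2 * pi / (3 * real n) \<le> distT (t - t)" by (intro sep[OF that]) auto
    then show False using \<sigma> by (simp add: distT_arccos)
  qed
  have cS: "cN n w x \<le> ennreal S" if x: "\<And>j. j < n \<Longrightarrow> x j \<in> Iper" "\<And>j. j < n \<Longrightarrow> \<phi> j (x j) \<noteq> 0" for x
  proof (rule S(2)[OF x(1)])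
    show "sepN (2 * pi / (3 * real n)) x" unfolding sepN_def
    proof (intro allI impI)
      fix i j assume ij: "i < n" "j < n" "i \<noteq> j"
      show "2 * pi / (3 * real n) \<le> distT (x i - x j)" by (rule sep[OF ij x(2)[OF ij(1)] x(2)[OF ij(2)]])
    qed
  qed
  note sl = slater_Feps[where n=n and w=w and \<phi>=\<phi> and \<phi>'=\<phi>' and S=S, OF n1 C nn one dis S(1) cS]
  have "adm (\<lambda>t. (1 / real n) * (\<Sum>j<n. (\<phi> j t)\<^sup>2))" by (rule sl(1)[of 1]) auto
  moreover have "Feps n w \<epsilon> (\<lambda>t. (1 / real n) * (\<Sum>j<n. (\<phi> j t)\<^sup>2)) < top" if "0 < \<epsilon>" for \<epsilon>
    by (rule le_less_trans[OF sl(2)]) (use that in auto)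
  ultimately show ?thesis by blast
qed

end

text \<open>What survives the limit: the Slater inequality without its kinetic term, boundedness and
  continuity in H^1, and at \<rho> the comparison with the transport cost and the sign.\<close>

locale limit_potential = cost +
  fixes \<rho> :: "real \<Rightarrow> real" and V :: "(real \<Rightarrow> real) \<Rightarrow> real" and C :: real
  assumes D: "Dper \<rho>" and lin: "lin_H1 V" and SI: "slater_ineq 0 V" and C0: "0 \<le> C"
    and bd: "\<And>f f'. C1per f f' \<Longrightarrow> \<bar>V f\<bar> \<le> C * sqrt (h1dist f f')" and hc: "H1_cont V"
    and FV: "FOT n w \<rho> \<le> ennreal (real n * V \<rho>)" and V0: "0 \<le> V \<rho>"
begin

definition brad :: real where "brad = 2 * pi / (3 * real n)"

lemma brad: "0 < brad" using n1 by (simp add: brad_def)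

text \<open>Complete a localised orbital to an n-tuple by translates of a fixed bump; their values under V are
  bounded below, so the value of the localised density is bounded above.\<close>

lemma bump_upper:
  obtains C2 where "0 \<le> C2" "\<And>\<phi> \<phi>' a. C1per \<phi> \<phi>' \<Longrightarrow> (\<And>t. 0 \<le> \<phi> t) \<Longrightarrow> (\<integral>t. (\<phi> t)\<^sup>2 \<partial>Lper) = 1 \<Longrightarrow>
     (\<And>t. t \<in> Iper \<Longrightarrow> \<phi> t \<noteq> 0 \<Longrightarrow> distT (t - a) < brad) \<Longrightarrow> V (\<lambda>t. (\<phi> t)\<^sup>2) \<le> C2"
proof -
  obtain S where S: "0 \<le> S" "\<And>x. (\<And>i. i < n \<Longrightarrow> x i \<in> Iper) \<Longrightarrow> sepN brad x \<Longrightarrow> cN n w x \<le> ennreal S"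
    using cN_bound[OF brad] by blast
  obtain \<beta> \<beta>' where C\<beta>: "C1per \<beta> \<beta>'" and \<beta>nn: "\<And>t. 0 \<le> \<beta> t" and \<beta>1: "\<And>c. (\<integral>t. (\<beta> (t - c))\<^sup>2 \<partial>Lper) = 1"
    and \<beta>s: "\<And>t. \<beta> t \<noteq> 0 \<Longrightarrow> distT t < brad" unfolding brad_def by (rule bump_family) blast
  define q where "q = sqrt (h1dist (\<lambda>t. (\<beta> t)\<^sup>2) (\<lambda>t. 2 * \<beta> t * \<beta>' t))"
  have q: "0 \<le> q" by (simp add: q_def h1dist_def)
  show ?thesis
  proof (rule that[of "S + real n * (C * q)"])
    show "0 \<le> S + real n * (C * q)" using S q C0 by simp
    fix \<phi> \<phi>' a assume C\<phi>: "C1per \<phi> \<phi>'" and nn: "\<And>t. 0 \<le> \<phi> t" and one: "(\<integral>t. (\<phi> t)\<^sup>2 \<partial>Lper) = 1"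
      and supp: "\<And>t. t \<in> Iper \<Longrightarrow> \<phi> t \<noteq> 0 \<Longrightarrow> distT (t - a) < brad"
    define c where "c = (\<lambda>j. a + ang (2 * n) (2 * j))"
    define \<Phi> where "\<Phi> = (\<lambda>j. if j = 0 then \<phi> else (\<lambda>t. \<beta> (t - c j)))"
    define \<Phi>' where "\<Phi>' = (\<lambda>j. if j = 0 then \<phi>' else (\<lambda>t. \<beta>' (t - c j)))"
    have C\<Phi>: "C1per (\<Phi> j) (\<Phi>' j)" for j unfolding \<Phi>_def \<Phi>'_def using C\<phi> C1per_shift[OF C\<beta>] by simp
    have sup\<Phi>: "distT (t - c j) < brad" if "t \<in> Iper" "\<Phi> j t \<noteq> 0" for t j
    proof (cases "j = 0")
      case True then show ?thesis using supp[of t] that by (simp add: \<Phi>_def c_def ang_def)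
    next
      case False then show ?thesis using that by (intro \<beta>s) (auto simp: \<Phi>_def)
    qed
    have sep: "brad \<le> distT (x - y)" if jk: "j < n" "k < n" "j \<noteq> k" and x: "x \<in> Iper" "\<Phi> j x \<noteq> 0" and y: "y \<in> Iper" "\<Phi> k y \<noteq> 0" for j k x y
      using sup\<Phi>[OF x] sup\<Phi>[OF y] unfolding brad_def c_def by (rule arcs_separated[OF jk])
    have norm: "(\<integral>t. (\<Phi> j t)\<^sup>2 \<partial>Lper) = 1" for j
    proof (cases "j = 0")
      case True then show ?thesis using one by (simp add: \<Phi>_def)
    next
      case False then show ?thesis using \<beta>1 by (simp add: \<Phi>_def)
    qed
    have "(\<Sum>j<n. V (\<lambda>t. (\<Phi> j t)\<^sup>2)) \<le> 0 * (fact n * (\<Sum>j<n. \<integral>t. (\<Phi>' j t)\<^sup>2 \<partial>Lper)) + S"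
    proof (rule slater_ineqD[OF SI C\<Phi> _ norm _ S(1)])
      show "0 \<le> \<Phi> j t" for j t using nn \<beta>nn by (simp add: \<Phi>_def)
      show "\<Phi> i t * \<Phi> j t = 0" if "i < n" "j < n" "t \<in> Iper" "i \<noteq> j" for i j t
      proof (rule ccontr)
        assume "\<Phi> i t * \<Phi> j t \<noteq> 0"
        then have "brad \<le> distT (t - t)" using sep[of i j t t] that by auto
        then show False using brad by (simp add: distT_arccos)
      qed
      fix x assume x: "\<And>j. j < n \<Longrightarrow> x j \<in> Iper" "\<And>j. j < n \<Longrightarrow> \<Phi> j (x j) \<noteq> 0"
      have "sepN brad x" unfolding sepN_def
      proof (intro allI impI)
        fix i j assume ij: "i < n" "j < n" "i \<noteq> j"
        show "brad \<le> distT (x i - x j)"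
          by (rule sep[OF ij x(1)[OF ij(1)] x(2)[OF ij(1)] x(1)[OF ij(2)] x(2)[OF ij(2)]])
      qed
      then show "cN n w x \<le> ennreal S" by (intro S(2) x(1))
    qed
    moreover have "(\<Sum>j<n. V (\<lambda>t. (\<Phi> j t)\<^sup>2)) = V (\<lambda>t. (\<phi> t)\<^sup>2) + (\<Sum>j\<in>{..<n} - {0}. V (\<lambda>t. (\<Phi> j t)\<^sup>2))"
      using n1 by (subst sum.remove[of _ 0]) (auto simp: \<Phi>_def)
    moreover have "(\<Sum>j\<in>{..<n} - {0}. V (\<lambda>t. (\<Phi> j t)\<^sup>2)) \<ge> (\<Sum>j\<in>{..<n} - {0}. - (C * q))"
    proof (rule sum_mono)
      fix j assume "j \<in> {..<n} - {0}"
      then have j: "j \<noteq> 0" by simp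
      have sh: "C1per (\<lambda>t. (\<beta> (t - c j))\<^sup>2) (\<lambda>t. 2 * \<beta> (t - c j) * \<beta>' (t - c j))"
        by (rule C1per_shift[OF C1per_sq[OF C\<beta>]])
      \<comment> \<open>Translation invariance of the H^1 norm makes this bound independent of j and
        of the centre a.\<close>
      have "\<bar>V (\<lambda>t. (\<beta> (t - c j))\<^sup>2)\<bar> \<le> C * q"
        using bd[OF sh] h1dist_shift[OF C1per_sq[OF C\<beta>], of "c j"] by (simp add: q_def)
      then show "- (C * q) \<le> V (\<lambda>t. (\<Phi> j t)\<^sup>2)" using j by (simp add: \<Phi>_def abs_le_iff)
    qed
    moreover have "(\<Sum>j\<in>{..<n} - {0}. - (C * q)) \<ge> - (real n * (C * q))"
    proof -
      have "(real n - 1) * (C * q) \<le> real n * (C * q)" using C0 q by (intro mult_right_mono) auto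
      then show ?thesis using n1 by (simp add: of_nat_diff algebra_simps)
    qed
    ultimately show "V (\<lambda>t. (\<phi> t)\<^sup>2) \<le> S + real n * (C * q)" by linarith
  qed
qed

text \<open>The support is measured by distance on the line, not on the circle. For d below 2 pi a
  periodic bump near x = 0 or x = 2 pi must then vanish at both endpoints, so it lies on one side of
  the seam, and the envelope may take different values at 0 and 2 pi.\<close>

definition Bump :: "real \<Rightarrow> real \<Rightarrow> (real \<Rightarrow> real) set" where
  "Bump x d = {\<phi>. (\<exists>\<phi>'. C1per \<phi> \<phi>') \<and> (\<forall>t. 0 \<le> \<phi> t) \<and> (\<integral>t. (\<phi> t)\<^sup>2 \<partial>Lper) = 1 \<and> (\<forall>t\<in>Iper. \<phi> t \<noteq> 0 \<longrightarrow> \<bar>t - x\<bar> < d)}"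

text \<open>The upper envelope of the functional V is feasible, as one sees by testing V with narrow bumps.\<close>

lemma envelope:
  obtains C2 v M where "0 \<le> C2" "0 \<le> M"
    "\<And>\<phi> \<phi>' a. C1per \<phi> \<phi>' \<Longrightarrow> (\<And>t. 0 \<le> \<phi> t) \<Longrightarrow> (\<integral>t. (\<phi> t)\<^sup>2 \<partial>Lper) = 1 \<Longrightarrow>
     (\<And>t. t \<in> Iper \<Longrightarrow> \<phi> t \<noteq> 0 \<Longrightarrow> distT (t - a) < brad) \<Longrightarrow> V (\<lambda>t. (\<phi> t)\<^sup>2) \<le> C2"
    "dual_feasible v" "\<And>t. t \<in> Iper \<Longrightarrow> - M \<le> v t"
    "\<And>t e. t \<in> Iper \<Longrightarrow> 0 < e \<Longrightarrow> \<exists>d>0. \<forall>\<phi>\<in>Bump t d. V (\<lambda>t. (\<phi> t)\<^sup>2) \<le> v t + e"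
proof -
  obtain C2 where C2: "0 \<le> C2" "\<And>\<phi> \<phi>' a. C1per \<phi> \<phi>' \<Longrightarrow> (\<And>t. 0 \<le> \<phi> t) \<Longrightarrow> (\<integral>t. (\<phi> t)\<^sup>2 \<partial>Lper) = 1 \<Longrightarrow>
     (\<And>t. t \<in> Iper \<Longrightarrow> \<phi> t \<noteq> 0 \<Longrightarrow> distT (t - a) < brad) \<Longrightarrow> V (\<lambda>t. (\<phi> t)\<^sup>2) \<le> C2"
    using bump_upper by blast
  \<comment> \<open>The value -M is put into every Q to bound the suprema from below. It cannot
    spoil feasibility: with one value -n C2 and the other n - 1 values at most C2, the sum is at
    most 0.\<close>
  define M where "M = real n * C2"
  have M: "0 \<le> M" using C2 by (simp add: M_def)
  define Q where "Q = (\<lambda>x d. insert (- M) ((\<lambda>\<phi>. V (\<lambda>t. (\<phi> t)\<^sup>2)) ` Bump x d))"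
  define dk where "dk = (\<lambda>k::nat. brad / real (Suc k))"
  have dk: "0 < dk k" "dk k \<le> brad" for k
  proof -
    show "0 < dk k" using brad by (simp add: dk_def)
    show "dk k \<le> brad" unfolding dk_def using brad by (simp add: divide_le_eq mult_le_cancel_left1)
  qed
  have QB: "s \<le> C2" if "s \<in> Q x (dk k)" for s x k
  proof -
    have "V (\<lambda>t. (\<phi> t)\<^sup>2) \<le> C2" if b: "\<phi> \<in> Bump x (dk k)" for \<phi>
    proof -
      obtain \<phi>' where "C1per \<phi> \<phi>'" using b by (auto simp: Bump_def)
      then show ?thesis
      proof (rule C2(2)[where a=x])
        fix t assume "t \<in> Iper" "\<phi> t \<noteq> 0"
        then have "\<bar>t - x\<bar> < dk k" using b by (auto simp: Bump_def)
        then show "distT (t - x) < brad" using distT_le_abs[of "t - x"] dk[of k] by linarith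
      qed (use b in \<open>auto simp: Bump_def\<close>)
    qed
    then show ?thesis using that M C2(1) by (auto simp: Q_def)
  qed
  have bddQ: "bdd_above (Q x (dk k))" for x k using QB by (intro bdd_aboveI) auto
  have neQ: "Q x d \<noteq> {}" for x d by (auto simp: Q_def)
  have SupM: "- M \<le> Sup (Q x (dk k))" for x k by (rule cSup_upper[OF _ bddQ]) (simp add: Q_def)
  \<comment> \<open>The upper limit of V over bumps shrinking to x, cut off below at -M.\<close>
  define v where "v = (\<lambda>x. INF k. Sup (Q x (dk k)))"
  have bddS: "bdd_below (range (\<lambda>k. Sup (Q x (dk k))))" for x using SupM by (intro bdd_belowI) auto
  have vM: "- M \<le> v x" for x unfolding v_def by (rule cINF_greatest) (auto simp: SupM)
  have vS: "v x \<le> Sup (Q x (dk k))" for x k unfolding v_def by (rule cINF_lower[OF bddS]) simp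
  show ?thesis
  proof (rule that[where v=v and M=M and ?C2.0=C2])
    show "0 \<le> C2" "0 \<le> M" by (rule C2(1), rule M)
    fix \<phi> \<phi>' a assume h: "C1per \<phi> \<phi>'" "\<And>t. 0 \<le> \<phi> t" "(\<integral>t. (\<phi> t)\<^sup>2 \<partial>Lper) = 1"
      "\<And>t. t \<in> Iper \<Longrightarrow> \<phi> t \<noteq> 0 \<Longrightarrow> distT (t - a) < brad"
    show "V (\<lambda>t. (\<phi> t)\<^sup>2) \<le> C2" by (rule C2(2)[OF h])
  next
    show "- M \<le> v t" for t by (rule vM)
    show "\<exists>d>0. \<forall>\<phi>\<in>Bump t d. V (\<lambda>t. (\<phi> t)\<^sup>2) \<le> v t + e" if e: "0 < e" for t e
    proof -
      have "Inf (range (\<lambda>k. Sup (Q t (dk k)))) < v t + e" using e by (simp add: v_def)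
      then obtain k where k: "Sup (Q t (dk k)) < v t + e" using cInf_lessD[of "range (\<lambda>k. Sup (Q t (dk k)))"] by auto
      have "V (\<lambda>t. (\<phi> t)\<^sup>2) \<le> v t + e" if "\<phi> \<in> Bump t (dk k)" for \<phi>
      proof -
        have "V (\<lambda>t. (\<phi> t)\<^sup>2) \<le> Sup (Q t (dk k))" using that by (intro cSup_upper[OF _ bddQ]) (auto simp: Q_def)
        then show ?thesis using k by linarith
      qed
      then show ?thesis using dk(1) by blast
    qed
    show "dual_feasible v" unfolding dual_feasible_def
    proof (intro ballI, rule field_le_epsilon)
      fix x e0 assume x: "x \<in> Xadm" and e0: "(0::real) < e0"
      define e where "e = e0 / 2"
      have e: "0 < e" using e0 by (simp add: e_def)
      have xI: "x i \<in> Iper" if "i < n" for i using x that by (auto simp: Xadm_def)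
      obtain a where a: "0 < a" "sepN a x" using Xadm_sep[OF x] by blast
      obtain d where d: "0 < d" "\<And>x y. (\<And>i. i < n \<Longrightarrow> x i \<in> Iper) \<Longrightarrow> (\<And>i. i < n \<Longrightarrow> y i \<in> Iper) \<Longrightarrow> sepN a x \<Longrightarrow>
     (\<And>i. i < n \<Longrightarrow> \<bar>y i - x i\<bar> < d) \<Longrightarrow> sepN (a/2) y \<and> \<bar>cR y - cR x\<bar> < e"
        using cR_unif[OF a(1) e] by blast
      have "\<exists>k. dk k < min d (a / 2)"
      proof -
        have "0 < min d (a / 2) / brad" using d a brad by simp
        then obtain k where "inverse (real (Suc k)) < min d (a / 2) / brad" using reals_Archimedean by blast
        then have "brad * inverse (real (Suc k)) < min d (a / 2)" using brad by (simp add: pos_less_divide_eq mult.commute)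
        then have "dk k < min d (a / 2)" by (simp only: dk_def divide_inverse)
        then show ?thesis ..
      qed
      then obtain k where k: "dk k < d" "dk k < a / 2" by auto
      have e': "0 < e / real n" using e n1 by simp
      have "\<exists>s\<in>Q (x i) (dk k). v (x i) < s + e / real n" for i
      proof -
        have "v (x i) - e / real n < Sup (Q (x i) (dk k))" using vS[of "x i" k] e' by linarith
        then obtain s where "s \<in> Q (x i) (dk k)" "v (x i) - e / real n < s" using less_cSupE[OF _ neQ] by blast
        then show ?thesis by (auto simp only: diff_less_eq)
      qed
      then obtain s where s: "\<And>i. s i \<in> Q (x i) (dk k)" "\<And>i. v (x i) < s i + e / real n" by metis
      have "(\<Sum>i<n. v (x i)) \<le> (\<Sum>i<n. s i + e / real n)" using s(2) by (intro sum_mono less_imp_le) auto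
      also have "\<dots> = (\<Sum>i<n. s i) + e" using n1 by (simp add: sum.distrib)
      finally have 1: "(\<Sum>i<n. v (x i)) \<le> (\<Sum>i<n. s i) + e" .
      have "(\<Sum>i<n. s i) \<le> cR x + e"
      proof (cases "\<exists>i<n. s i = - M")
        case True
        then obtain i where i: "i < n" "s i = - M" by blast
        have "(\<Sum>j<n. s j) = - M + (\<Sum>j\<in>{..<n} - {i}. s j)" using i by (subst sum.remove[of _ i]) auto
        also have "(\<Sum>j\<in>{..<n} - {i}. s j) \<le> (\<Sum>j\<in>{..<n} - {i}. C2)" using QB s(1) by (intro sum_mono) blast
        also have "\<dots> = (real n - 1) * C2" using i by (simp add: of_nat_diff)
        also have "- M + (real n - 1) * C2 \<le> 0" using C2(1) by (simp add: M_def algebra_simps)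
        finally show ?thesis using cR_nonneg[of x] e by linarith
      next
        case False
        then have "\<exists>\<phi>\<in>Bump (x i) (dk k). s i = V (\<lambda>t. (\<phi> t)\<^sup>2)" if "i < n" for i using s(1)[of i] that by (auto simp: Q_def)
        then obtain \<phi> where \<phi>: "\<And>i. i < n \<Longrightarrow> \<phi> i \<in> Bump (x i) (dk k)" "\<And>i. i < n \<Longrightarrow> s i = V (\<lambda>t. (\<phi> i t)\<^sup>2)" by metis
        have "\<forall>i. \<exists>\<phi>'. i < n \<longrightarrow> C1per (\<phi> i) \<phi>'" using \<phi>(1) by (auto simp: Bump_def)
        then obtain \<phi>' where \<phi>': "\<And>i. i < n \<Longrightarrow> C1per (\<phi> i) (\<phi>' i)" by metis
        have supp: "\<bar>t - x i\<bar> < dk k" if "i < n" "t \<in> Iper" "\<phi> i t \<noteq> 0" for i t using \<phi>(1)[OF that(1)] that by (auto simp: Bump_def)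
        \<comment> \<open>At \<epsilon> = 0 only the potential term remains, and on the product of
          the narrow supports the cost is below cR x + e.\<close>
        have "(\<Sum>j<n. V (\<lambda>t. (\<phi> j t)\<^sup>2)) \<le> 0 * (fact n * (\<Sum>j<n. \<integral>t. (\<phi>' j t)\<^sup>2 \<partial>Lper)) + (cR x + e)"
        proof (rule slater_ineqD[OF SI \<phi>'])
          show "0 \<le> \<phi> j t" "(\<integral>t. (\<phi> j t)\<^sup>2 \<partial>Lper) = 1" if "j < n" for j t using \<phi>(1)[OF that] by (auto simp: Bump_def)
          show "0 \<le> cR x + e" using cR_nonneg[of x] e by simp
          show "\<phi> i t * \<phi> j t = 0" if ij: "i < n" "j < n" "t \<in> Iper" "i \<noteq> j" for i j t
          proof (rule ccontr)
            assume "\<phi> i t * \<phi> j t \<noteq> 0"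
            then have "\<bar>t - x i\<bar> < dk k" "\<bar>t - x j\<bar> < dk k" using supp ij by auto
            then have "\<bar>x i - x j\<bar> < a" using k(2) unfolding abs_less_iff by linarith
            moreover have "a \<le> distT (x i - x j)" using a(2) ij by (auto simp: sepN_def)
            ultimately show False using distT_le_abs[of "x i - x j"] by linarith
          qed
          fix y assume y: "\<And>j. j < n \<Longrightarrow> y j \<in> Iper" "\<And>j. j < n \<Longrightarrow> \<phi> j (y j) \<noteq> 0"
          have yd: "\<bar>y i - x i\<bar> < d" if "i < n" for i using supp[OF that y(1)[OF that] y(2)[OF that]] k(1) by linarith
          have yy: "sepN (a/2) y \<and> \<bar>cR y - cR x\<bar> < e" by (rule d(2)[OF xI y(1) a(2) yd])
          then have "y \<in> Xadm" using a(1) y(1) by (intro Xadm_of_sep[where a="a/2"]) auto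
          then have "cN n w y = ennreal (cR y)" by (rule cN_Xadm)
          also have "\<dots> \<le> ennreal (cR x + e)" using yy unfolding abs_less_iff by (intro ennreal_leI) linarith
          finally show "cN n w y \<le> ennreal (cR x + e)" .
        qed
        then show ?thesis using \<phi>(2) by simp
      qed
      then show "(\<Sum>i<n. v (x i)) \<le> cR x + e0" using 1 by (simp add: e_def)
    qed
  qed
qed

end

section \<open>Weak duality for couplings\<close>

lemma Bper_cont_measurable:
  assumes "continuous_on Iper (f :: real \<Rightarrow> real)" shows "f \<in> borel_measurable Bper"
proof -
  have "f \<in> borel_measurable (restrict_space borel Iper)" by (rule borel_measurable_continuous_on_restrict[OF assms])
  moreover have "sets (restrict_space borel Iper) = sets Bper" by (simp add: sets_restrict_space)
  ultimately show ?thesis using measurable_cong_sets by blast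
qed

lemma cont_bounded_Iper:
  assumes "continuous_on Iper (u :: real \<Rightarrow> real)"
  obtains U where "0 \<le> U" "\<And>t. t \<in> Iper \<Longrightarrow> \<bar>u t\<bar> \<le> U"
proof -
  have "bounded (u ` Iper)" using compact_imp_bounded[OF compact_continuous_image[OF assms compact_Iper]] .
  then obtain U where "\<And>t. t \<in> Iper \<Longrightarrow> \<bar>u t\<bar> \<le> U" by (auto simp: bounded_iff)
  then show ?thesis using that[of "max U 0"] by (auto simp: le_max_iff_disj)
qed

context cost
begin

lemma coupling_component:
  assumes g: "coupling n \<rho> \<gamma>" and i: "i < n" shows "(\<lambda>x. x i) \<in> measurable \<gamma> Bper"
proof -
  have "sets \<gamma> = sets (Pi\<^sub>M {..<n} (\<lambda>_. Bper))" using g by (simp add: coupling_def)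
  then have "measurable \<gamma> Bper = measurable (Pi\<^sub>M {..<n} (\<lambda>_. Bper)) Bper" by (rule measurable_cong_sets[OF _ refl])
  moreover have "(\<lambda>x. x i) \<in> measurable (Pi\<^sub>M {..<n} (\<lambda>_. Bper)) Bper"
    by (rule measurable_component_singleton) (simp add: i)
  ultimately show ?thesis by simp
qed

lemma coupling_integral:
  assumes g: "coupling n \<rho> \<gamma>" and \<rho>: "continuous_on Iper \<rho>" "\<And>t. t \<in> Iper \<Longrightarrow> 0 \<le> \<rho> t" and h: "continuous_on Iper h" "\<And>t. t \<in> Iper \<Longrightarrow> 0 \<le> h t" and i: "i < n"
  shows "(\<integral>\<^sup>+x. ennreal (h (x i)) \<partial>\<gamma>) = ennreal (\<integral>t. \<rho> t * h t \<partial>Lper)"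
proof -
  have [measurable]: "h \<in> borel_measurable Bper" "\<rho> \<in> borel_measurable Bper" using \<rho> h Bper_cont_measurable by auto
  note cm = coupling_component[OF g i]
  have "(\<integral>\<^sup>+x. ennreal (h (x i)) \<partial>\<gamma>) = (\<integral>\<^sup>+t. ennreal (h t) \<partial>distr \<gamma> Bper (\<lambda>x. x i))"
    using cm by (intro nn_integral_distr[symmetric]) auto
  also have "\<dots> = (\<integral>\<^sup>+t. ennreal (h t) \<partial>density Bper (\<lambda>t. ennreal (\<rho> t)))" using g i by (simp add: coupling_def)
  also have "\<dots> = (\<integral>\<^sup>+t. ennreal (\<rho> t) * ennreal (h t) \<partial>Bper)" by (intro nn_integral_density) measurable
  also have "\<dots> = (\<integral>\<^sup>+t. ennreal (\<rho> t) * ennreal (h t) \<partial>Lper)" by (rule nn_integral_Bper)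
  also have "\<dots> = (\<integral>\<^sup>+t. ennreal (\<rho> t * h t) \<partial>Lper)" using \<rho>(2) h(2) by (intro nn_integral_cong) (simp add: ennreal_mult)
  also have "\<dots> = ennreal (\<integral>t. \<rho> t * h t \<partial>Lper)"
    using \<rho> h by (intro nn_integral_eq_integral integrable_Lper_cont continuous_intros AE_I2) auto
  finally show ?thesis .
qed

lemma coupling_space: assumes "coupling n \<rho> \<gamma>" shows "space \<gamma> = PiE {..<n} (\<lambda>_. Iper)"
proof -
  have "sets \<gamma> = sets (Pi\<^sub>M {..<n} (\<lambda>_. Bper))" using assms by (simp add: coupling_def)
  then show ?thesis by (subst sets_eq_imp_space_eq) (auto simp: space_PiM)
qed

lemma coupling_sum_integral:
  assumes g: "coupling n \<rho> \<gamma>" and \<rho>: "continuous_on Iper \<rho>" "\<And>t. t \<in> Iper \<Longrightarrow> 0 \<le> \<rho> t" and h: "continuous_on Iper h" "\<And>t. t \<in> Iper \<Longrightarrow> 0 \<le> h t"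
  shows "(\<integral>\<^sup>+x. ennreal (\<Sum>i<n. h (x i)) \<partial>\<gamma>) = ennreal (real n * (\<integral>t. \<rho> t * h t \<partial>Lper))"
proof -
  have m: "(\<lambda>x. ennreal (h (x i))) \<in> borel_measurable \<gamma>" if "i \<in> {..<n}" for i
  proof -
    have "(\<lambda>x. x i) \<in> measurable \<gamma> Bper" using that by (intro coupling_component[OF g]) simp
    from measurable_compose[OF this Bper_cont_measurable[OF h(1)]] show ?thesis by simp
  qed
  have "(\<integral>\<^sup>+x. ennreal (\<Sum>i<n. h (x i)) \<partial>\<gamma>) = (\<integral>\<^sup>+x. (\<Sum>i<n. ennreal (h (x i))) \<partial>\<gamma>)"
    using h(2) coupling_space[OF g] by (intro nn_integral_cong sum_ennreal[symmetric]) auto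
  also have "\<dots> = (\<Sum>i<n. \<integral>\<^sup>+x. ennreal (h (x i)) \<partial>\<gamma>)" by (rule nn_integral_sum[OF m])
  also have "\<dots> = (\<Sum>i<n. ennreal (\<integral>t. \<rho> t * h t \<partial>Lper))" by (intro sum.cong refl coupling_integral[OF g \<rho> h]) auto
  also have "\<dots> = ennreal (real n * (\<integral>t. \<rho> t * h t \<partial>Lper))"
  proof -
    have "0 \<le> (\<integral>t. \<rho> t * h t \<partial>Lper)" using \<rho>(2) h(2) by (intro integral_nonneg_AE AE_I2) simp
    then show ?thesis by (simp add: ennreal_mult ennreal_of_nat_eq_real_of_nat)
  qed
  finally show ?thesis .
qed

lemma Dper_cont: assumes "Dper \<rho>" shows "continuous_on Iper \<rho>" "\<And>t. t \<in> Iper \<Longrightarrow> 0 < \<rho> t" "\<And>t. t \<in> Iper \<Longrightarrow> 0 \<le> \<rho> t" "(\<integral>t. \<rho> t \<partial>Lper) = 1"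
  using assms by (auto simp: Dper_def less_imp_le)

text \<open>Integrate the constraint against a coupling, all of whose marginals are \<rho>. Adding
  the constant U to u keeps the integrands nonnegative, and n U is cancelled at the end.\<close>

lemma FOT_lower:
  assumes u: "continuous_on Iper u" "dual_feasible u" and D: "Dper \<rho>" and nn: "0 \<le> (\<integral>t. \<rho> t * u t \<partial>Lper)"
  shows "ennreal (real n * (\<integral>t. \<rho> t * u t \<partial>Lper)) \<le> FOT n w \<rho>"
  unfolding FOT_def
proof (rule INF_greatest)
  fix \<gamma> assume "\<gamma> \<in> {\<gamma>. coupling n \<rho> \<gamma>}"
  then have g: "coupling n \<rho> \<gamma>" by simp
  note r = Dper_cont[OF D]
  obtain U where U: "0 \<le> U" "\<And>t. t \<in> Iper \<Longrightarrow> \<bar>u t\<bar> \<le> U" using cont_bounded_Iper[OF u(1)] by blast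
  interpret prob_space \<gamma> using g by (simp add: coupling_def)
  have hn: "0 \<le> u t + U" if "t \<in> Iper" for t using U(2)[OF that] unfolding abs_le_iff by linarith
  have e: "(\<integral>t. \<rho> t * (u t + U) \<partial>Lper) = (\<integral>t. \<rho> t * u t \<partial>Lper) + U"
  proof -
    have "integrable Lper (\<lambda>t. \<rho> t * u t)" "integrable Lper \<rho>" using r u by (auto intro!: integrable_Lper_cont continuous_intros)
    then show ?thesis using r(4) by (simp add: distrib_left)
  qed
  have "ennreal (real n * (\<integral>t. \<rho> t * u t \<partial>Lper)) + ennreal (real n * U) = (\<integral>\<^sup>+x. ennreal (\<Sum>i<n. u (x i) + U) \<partial>\<gamma>)"
  proof -
    have "(\<integral>\<^sup>+x. ennreal (\<Sum>i<n. u (x i) + U) \<partial>\<gamma>) = ennreal (real n * (\<integral>t. \<rho> t * (u t + U) \<partial>Lper))"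
      by (rule coupling_sum_integral[OF g r(1,3), of "\<lambda>t. u t + U"]) (use u(1) hn in \<open>auto intro!: continuous_intros\<close>)
    also have "\<dots> = ennreal (real n * (\<integral>t. \<rho> t * u t \<partial>Lper)) + ennreal (real n * U)"
    proof -
      have "real n * (\<integral>t. \<rho> t * (u t + U) \<partial>Lper) = real n * (\<integral>t. \<rho> t * u t \<partial>Lper) + real n * U"
        by (simp only: e distrib_left[of "real n"])
      then show ?thesis using nn U(1) by (simp only:) (intro ennreal_plus, auto)
    qed
    finally show ?thesis by simp
  qed
  also have "\<dots> \<le> (\<integral>\<^sup>+x. cN n w x + ennreal (real n * U) \<partial>\<gamma>)"
  proof (rule nn_integral_mono)
    fix x assume x: "x \<in> space \<gamma>"
    show "ennreal (\<Sum>i<n. u (x i) + U) \<le> cN n w x + ennreal (real n * U)"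
    proof (cases "x \<in> Xadm")
      case True
      then have "(\<Sum>i<n. u (x i)) \<le> cR x" using u(2) by (simp add: dual_feasible_def)
      then have "(\<Sum>i<n. u (x i) + U) \<le> cR x + real n * U" by (simp add: sum.distrib)
      then have "ennreal (\<Sum>i<n. u (x i) + U) \<le> ennreal (cR x + real n * U)" by (rule ennreal_leI)
      also have "\<dots> = cN n w x + ennreal (real n * U)" using cN_Xadm[OF True] cR_nonneg[of x] U(1) by (simp add: ennreal_plus)
      finally show ?thesis .
    next
      case False
      have "cN n w x = top" by (rule cN_top[OF _ False]) (use x coupling_space[OF g] in auto)
      then show ?thesis by simp
    qed
  qed
  also have "\<dots> = (\<integral>\<^sup>+x. cN n w x \<partial>\<gamma>) + ennreal (real n * U)"
  proof -
    have "measurable \<gamma> borel = (measurable (Pi\<^sub>M {..<n} (\<lambda>_. Bper)) borel :: ((nat \<Rightarrow> real) \<Rightarrow> ennreal) set)"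
      using g by (intro measurable_cong_sets) (auto simp: coupling_def)
    then have "cN n w \<in> borel_measurable \<gamma>" using cN_measurable[OF A, of n] by (simp only:)
    then show ?thesis by (subst nn_integral_add) (auto simp: emeasure_space_1)
  qed
  finally show "ennreal (real n * (\<integral>t. \<rho> t * u t \<partial>Lper)) \<le> (\<integral>\<^sup>+x. cN n w x \<partial>\<gamma>)"
    by (simp add: ennreal_add_left_cancel_le add.commute[of _ "ennreal (real n * U)"])
qed

end

section \<open>Domination of the limit functional by integration against u\<close>

context limit_potential
begin

text \<open>Split f by the squared windows. On a small window V is at most u(x) + \<kappa> times the
  mass, and uniform continuity of u turns this into the integral of u over the piece, up to 2
  \<kappa> times the mass. Window 0 is centred at the seam, where the envelope hypothesis does not
  apply, but its mass is of order 1 / N and the fixed bound C2 suffices.\<close>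

lemma V_le_integral:
  assumes C2: "0 \<le> C2" "\<And>\<phi> \<phi>' a. C1per \<phi> \<phi>' \<Longrightarrow> (\<And>t. 0 \<le> \<phi> t) \<Longrightarrow> (\<integral>t. (\<phi> t)\<^sup>2 \<partial>Lper) = 1 \<Longrightarrow>
     (\<And>t. t \<in> Iper \<Longrightarrow> \<phi> t \<noteq> 0 \<Longrightarrow> distT (t - a) < brad) \<Longrightarrow> V (\<lambda>t. (\<phi> t)\<^sup>2) \<le> C2"
    and env: "\<And>t e. t \<in> Iper \<Longrightarrow> 0 < e \<Longrightarrow> \<exists>d>0. \<forall>\<phi>\<in>Bump t d. V (\<lambda>t. (\<phi> t)\<^sup>2) \<le> u t + e"
    and u: "continuous_on Iper u" and f: "C1per f f'" and fp: "\<And>t. 0 < f t"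
  shows "V f \<le> (\<integral>t. u t * f t \<partial>Lper)"
proof -
  obtain U where U: "0 \<le> U" "\<And>t. t \<in> Iper \<Longrightarrow> \<bar>u t\<bar> \<le> U" using cont_bounded_Iper[OF u] by blast
  obtain Fm where Fm: "0 \<le> Fm" "\<And>t. \<bar>f t\<bar> \<le> Fm" using C1per_bounded[OF f] by metis
  have cf: "continuous_on B f" for B using C1per_cont[OF f] by blast
  define If where "If = (\<integral>t. f t \<partial>Lper)"
  have If: "0 \<le> If" unfolding If_def using fp by (intro integral_nonneg_AE AE_I2) (simp add: less_imp_le)
  have main: "V f \<le> (\<integral>t. u t * f t \<partial>Lper) + \<kappa> * (1 + 2 * If)" if \<kappa>: "0 < \<kappa>" for \<kappa>
  proof -
    have "uniformly_continuous_on Iper u" by (rule compact_uniformly_continuous[OF u compact_Iper])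
    then obtain du where du: "0 < du" "\<And>s t. s \<in> Iper \<Longrightarrow> t \<in> Iper \<Longrightarrow> dist t s < du \<Longrightarrow> dist (u t) (u s) < \<kappa>"
      using \<kappa> unfolding uniformly_continuous_on_def by metis
    have "\<exists>d>0. d \<le> du \<and> (\<forall>\<phi>\<in>Bump t d. V (\<lambda>t. (\<phi> t)\<^sup>2) \<le> u t + \<kappa>)" if t: "t \<in> Iper" for t
    proof -
      obtain d where d: "d > 0" "\<forall>\<phi>\<in>Bump t d. V (\<lambda>t. (\<phi> t)\<^sup>2) \<le> u t + \<kappa>" using env[OF t \<kappa>] by blast
      have "Bump t (min d du) \<subseteq> Bump t d" by (auto simp: Bump_def)
      then show ?thesis using d du(1) by (intro exI[of _ "min d du"]) auto
    qed
    then obtain dl where dl: "\<And>t. t \<in> Iper \<Longrightarrow> 0 < dl t \<and> dl t \<le> du \<and> (\<forall>\<phi>\<in>Bump t (dl t). V (\<lambda>t. (\<phi> t)\<^sup>2) \<le> u t + \<kappa>)"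
      by metis
    have "Iper \<subseteq> \<Union>((\<lambda>t. ball t (dl t)) ` Iper)" using dl by force
    \<comment> \<open>Lebesgue number of the cover: any interval of radius below \<eta> centred in I
      fits into a neighbourhood on which the envelope estimate holds.\<close>
    then obtain \<eta> where eta: "0 < \<eta>" "\<And>x. x \<in> Iper \<Longrightarrow> \<exists>G\<in>(\<lambda>t. ball t (dl t)) ` Iper. ball x \<eta> \<subseteq> G"
      by (rule Heine_Borel_lemma[OF compact_Iper]) auto
    \<comment> \<open>The three thresholds make the windows finer than the Lebesgue number, narrow
      enough for the bound C2, and the contribution of window 0 at most \<kappa>.\<close>
    define X where "X = max (4 * pi / (3 * \<eta>)) (max (4 * pi / (3 * brad)) ((C2 + U) * Fm * 2 * pi / \<kappa>))"
    obtain N0 :: nat where N0: "X < real N0" using reals_Archimedean2 by blast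
    define N where "N = Suc (Suc N0)"
    have N2: "2 \<le> N" by (simp add: N_def)
    have Np: "0 < real N" by (simp add: N_def)
    have NX: "X < real N" using N0 by (simp add: N_def)
    have r1: "rad N < \<eta>"
    proof -
      have "4 * pi / (3 * \<eta>) < real N" using NX by (simp add: X_def)
      then show ?thesis using eta(1) Np by (simp add: rad_def field_simps)
    qed
    have r2: "rad N < brad"
    proof -
      have "4 * pi / (3 * brad) < real N" using NX by (simp add: X_def)
      then show ?thesis using brad Np by (simp add: rad_def field_simps)
    qed
    have r3: "(C2 + U) * (Fm * (2 * pi / real N)) \<le> \<kappa>"
    proof -
      have "(C2 + U) * Fm * 2 * pi / \<kappa> < real N" using NX by (simp add: X_def)
      then have "(C2 + U) * Fm * 2 * pi < real N * \<kappa>" using \<kappa> by (simp add: pos_divide_less_eq)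
      then have "(C2 + U) * Fm * 2 * pi / real N < \<kappa>" using Np by (simp add: pos_divide_less_eq mult.commute)
      then show ?thesis by (simp add: mult.assoc)
    qed
    define \<phi> where "\<phi> = (\<lambda>i t. sqrt (f t) * win N i t)"
    have "\<forall>i. \<exists>\<phi>'. C1per (\<phi> i) \<phi>'"
    proof
      fix i obtain W' where "C1per (win N i) W'" using win_C1per[OF N2] by blast
      from C1per_mult[OF C1per_sqrt[OF f fp] this] show "\<exists>\<phi>'. C1per (\<phi> i) \<phi>'" by (auto simp: \<phi>_def)
    qed
    then obtain \<phi>' where C\<phi>: "\<And>i. C1per (\<phi> i) (\<phi>' i)" by metis
    have nn: "0 \<le> \<phi> i t" for i t using win_nonneg[OF N2, of i t] fp[of t] by (simp add: \<phi>_def less_imp_le)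
    have sq: "(\<phi> i t)\<^sup>2 = f t * (win N i t)\<^sup>2" for i t using fp[of t] by (simp add: \<phi>_def power_mult_distrib less_imp_le)
    define \<mu> where "\<mu> = (\<lambda>i. \<integral>t. (\<phi> i t)\<^sup>2 \<partial>Lper)"
    have c2: "continuous_on B (\<lambda>t. (\<phi> i t)\<^sup>2)" for i B by (intro continuous_intros C1per_cont[OF C\<phi>])
    have angI: "ang N i \<in> Iper" if "i < N" for i
    proof -
      have "2 * pi * real i \<le> 2 * pi * real N" using that by (intro mult_left_mono) auto
      then show ?thesis using Np by (simp add: ang_def Iper_def divide_le_eq)
    qed
    have \<mu>: "0 < \<mu> i" if "i < N" for i
      unfolding \<mu>_def
    proof (rule integral_pos_of_pos[OF c2 _ angI[OF that]])
      have "0 < rad N" using Np by (simp add: rad_def)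
      then have "0 < bmp (rad N) (ang N i - ang N i)" using rad_le[OF N2] by (intro bmp_pos) (auto simp: distT_arccos)
      then have "0 < win N i (ang N i)" using winZ_pos[OF N2, of "ang N i"] by (simp add: win_def)
      then show "0 < (\<phi> i (ang N i))\<^sup>2" using fp[of "ang N i"] by (simp add: \<phi>_def)
    qed simp
    define \<xi> where "\<xi> = (\<lambda>i t. (1 / sqrt (\<mu> i)) * \<phi> i t)"
    have C\<xi>: "C1per (\<xi> i) (\<lambda>t. (1 / sqrt (\<mu> i)) * \<phi>' i t)" for i unfolding \<xi>_def by (rule C1per_cmult[OF C\<phi>])
    have \<xi>sq: "(\<xi> i t)\<^sup>2 = (1 / \<mu> i) * (\<phi> i t)\<^sup>2" if "i < N" for i t
      using \<mu>[OF that] by (simp add: \<xi>_def power_mult_distrib power_divide)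
    have \<xi>nn: "0 \<le> \<xi> i t" if "i < N" for i t using nn[of i t] \<mu>[OF that] by (simp add: \<xi>_def)
    have \<xi>1: "(\<integral>t. (\<xi> i t)\<^sup>2 \<partial>Lper) = 1" if "i < N" for i
    proof -
      have "(\<integral>t. (1 / \<mu> i) * (\<phi> i t)\<^sup>2 \<partial>Lper) = (1 / \<mu> i) * \<mu> i" unfolding \<mu>_def by (rule integral_mult_right_zero)
      then show ?thesis unfolding \<xi>sq[OF that] using \<mu>[OF that] by simp
    qed
    have V\<xi>: "V (\<lambda>t. (\<phi> i t)\<^sup>2) = \<mu> i * V (\<lambda>t. (\<xi> i t)\<^sup>2)" if "i < N" for i
    proof -
      have H: "H1per (\<lambda>t. (\<xi> i t)\<^sup>2)" by (rule C1per_H1per[OF C1per_sq[OF C\<xi>]])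
      have "(\<lambda>t. (\<phi> i t)\<^sup>2) = (\<lambda>t. \<mu> i * (\<xi> i t)\<^sup>2 + 0 * (\<xi> i t)\<^sup>2)" using \<mu>[OF that] by (auto simp: \<xi>sq[OF that])
      then show ?thesis using lin_H1D[OF lin H H, of "\<mu> i" 0] by simp
    qed
    have supp: "distT (t - ang N i) < rad N" if "\<xi> i t \<noteq> 0" for i t
      using that by (intro win_support[OF N2]) (auto simp: \<xi>_def \<phi>_def)
    have V0: "V (\<lambda>t. (\<phi> 0 t)\<^sup>2) \<le> \<mu> 0 * C2"
    proof -
      have "V (\<lambda>t. (\<xi> 0 t)\<^sup>2) \<le> C2"
        by (rule C2(2)[OF C\<xi>, of 0 "ang N 0"]) (use \<xi>nn[of 0] \<xi>1[of 0] supp[of 0] r2 Np in \<open>force+\<close>)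
      then show ?thesis using V\<xi>[of 0] \<mu>[of 0] Np by (simp add: mult_left_mono)
    qed
    have iu: "integrable Lper (\<lambda>t. u t * (\<phi> i t)\<^sup>2)" for i by (intro integrable_Lper_cont continuous_intros u C1per_cont[OF C\<phi>])
    have Vi: "V (\<lambda>t. (\<phi> i t)\<^sup>2) \<le> (\<integral>t. u t * (\<phi> i t)\<^sup>2 \<partial>Lper) + 2 * \<kappa> * \<mu> i" if i: "i < N" "i \<noteq> 0" for i
    proof -
      let ?c = "ang N i"
      \<comment> \<open>For i \<noteq> 0 the centre is at least one spacing away from both ends of I
        and the radius is smaller than a spacing, so the window does not wrap around and circle
        distance is distance on the line.\<close>
      have near: "\<bar>t - ?c\<bar> < rad N" if t: "t \<in> Iper" "\<xi> i t \<noteq> 0" for t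
      proof -
        obtain k where k: "distT (t - ?c) = \<bar>t - ?c - 2 * pi * real_of_int k\<bar>" using distT_attained by blast
        have lt: "\<bar>t - ?c - 2 * pi * real_of_int k\<bar> < rad N" using supp[OF t(2)] k by simp
        have h: "rad N < 2 * pi / real N" using Np by (simp add: rad_def field_simps)
        have cl: "2 * pi / real N \<le> ?c"
        proof -
          have "2 * pi * 1 \<le> 2 * pi * real i" using i by (intro mult_left_mono) auto
          then show ?thesis using Np by (simp add: ang_def divide_right_mono)
        qed
        have cu: "?c \<le> 2 * pi - 2 * pi / real N"
        proof -
          have "real i \<le> real N - 1" using i(1) by linarith
          then have "2 * pi * real i \<le> 2 * pi * (real N - 1)" by (intro mult_left_mono) auto
          then have "2 * pi * real i / real N \<le> 2 * pi * (real N - 1) / real N" using Np by (intro divide_right_mono) auto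
          then show ?thesis using Np by (simp add: ang_def field_simps)
        qed
        have tI: "0 \<le> t" "t \<le> 2 * pi" using t(1) by (auto simp: Iper_def)
        have "k = 0"
        proof (rule ccontr)
          assume "k \<noteq> 0"
          then consider "k \<ge> 1" | "k \<le> -1" by linarith
          then show False
          proof cases
            case 1
            then have "2 * pi * 1 \<le> 2 * pi * real_of_int k" by (intro mult_left_mono) auto
            then show False using lt cl cu tI h unfolding abs_less_iff by linarith
          next
            case 2
            then have "2 * pi * real_of_int k \<le> 2 * pi * (-1)" by (intro mult_left_mono) auto
            then show False using lt cl cu tI h unfolding abs_less_iff by linarith
          qed
        qed
        then show ?thesis using lt by simp
      qed
      obtain x where x: "x \<in> Iper" "ball ?c \<eta> \<subseteq> ball x (dl x)" using eta(2)[OF angI[OF i(1)]] by auto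
      have nx: "\<bar>t - x\<bar> < dl x" if "t \<in> Iper" "\<xi> i t \<noteq> 0" for t
      proof -
        have "t \<in> ball ?c \<eta>" using near[OF that] r1 by (simp add: dist_real_def abs_minus_commute)
        then have "t \<in> ball x (dl x)" using x(2) by blast
        then show ?thesis by (simp add: dist_real_def abs_minus_commute)
      qed
      have "\<xi> i \<in> Bump x (dl x)" unfolding Bump_def using C\<xi> \<xi>nn[OF i(1)] \<xi>1[OF i(1)] nx by blast
      then have 1: "V (\<lambda>t. (\<xi> i t)\<^sup>2) \<le> u x + \<kappa>" using dl[OF x(1)] by blast
      have "(u x - \<kappa>) * \<mu> i = (\<integral>t. (u x - \<kappa>) * (\<phi> i t)\<^sup>2 \<partial>Lper)" by (simp add: \<mu>_def)
      also have "\<dots> \<le> (\<integral>t. u t * (\<phi> i t)\<^sup>2 \<partial>Lper)"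
      proof (rule integral_mono[OF _ iu])
        show "integrable Lper (\<lambda>t. (u x - \<kappa>) * (\<phi> i t)\<^sup>2)" by (intro integrable_Lper_cont continuous_intros C1per_cont[OF C\<phi>])
        fix t assume "t \<in> space Lper"
        then have t: "t \<in> Iper" by simp
        show "(u x - \<kappa>) * (\<phi> i t)\<^sup>2 \<le> u t * (\<phi> i t)\<^sup>2"
        proof (cases "\<phi> i t = 0")
          case False
          then have "\<xi> i t \<noteq> 0" using \<mu>[OF i(1)] by (simp add: \<xi>_def)
          then have "dist t x < du" using nx[OF t] dl[OF x(1)] by (simp add: dist_real_def)
          then have "\<bar>u t - u x\<bar> < \<kappa>" using du(2)[OF x(1) t] by (simp add: dist_real_def)
          then show ?thesis unfolding abs_less_iff by (intro mult_right_mono) auto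
        qed simp
      qed
      finally have 2: "(u x - \<kappa>) * \<mu> i \<le> (\<integral>t. u t * (\<phi> i t)\<^sup>2 \<partial>Lper)" .
      have "V (\<lambda>t. (\<phi> i t)\<^sup>2) \<le> \<mu> i * (u x + \<kappa>)" unfolding V\<xi>[OF i(1)] using 1 \<mu>[OF i(1)] by (intro mult_left_mono) auto
      also have "\<dots> = (u x - \<kappa>) * \<mu> i + 2 * \<kappa> * \<mu> i" by (simp add: algebra_simps)
      finally show ?thesis using 2 by linarith
    qed
    have fsum: "f t = (\<Sum>i<N. 1 * (\<phi> i t)\<^sup>2)" for t
      using win_sum[OF N2, of t] by (simp add: sq sum_distrib_left[symmetric])
    have "V f = (\<Sum>i<N. 1 * V (\<lambda>t. (\<phi> i t)\<^sup>2))"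
    proof -
      have "f = (\<lambda>t. \<Sum>i<N. 1 * (\<phi> i t)\<^sup>2)" using fsum by auto
      then show ?thesis using lin_H1_sum[OF lin, of "{..<N}" "\<lambda>i t. (\<phi> i t)\<^sup>2" "\<lambda>_. 1"] C1per_H1per[OF C1per_sq[OF C\<phi>]] by simp
    qed
    also have "\<dots> = V (\<lambda>t. (\<phi> 0 t)\<^sup>2) + (\<Sum>i\<in>{..<N} - {0}. V (\<lambda>t. (\<phi> i t)\<^sup>2))"
      using N2 by (subst sum.remove[of _ 0]) auto
    also have "\<dots> \<le> \<mu> 0 * C2 + (\<Sum>i\<in>{..<N} - {0}. (\<integral>t. u t * (\<phi> i t)\<^sup>2 \<partial>Lper) + 2 * \<kappa> * \<mu> i)"
      using Vi by (intro add_mono V0 sum_mono) auto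
    also have "\<dots> = \<mu> 0 * C2 + (\<Sum>i\<in>{..<N} - {0}. \<integral>t. u t * (\<phi> i t)\<^sup>2 \<partial>Lper) + 2 * \<kappa> * (\<Sum>i\<in>{..<N} - {0}. \<mu> i)"
      by (simp add: sum.distrib sum_distrib_left)
    also have "(\<Sum>i\<in>{..<N} - {0}. \<integral>t. u t * (\<phi> i t)\<^sup>2 \<partial>Lper) = (\<integral>t. u t * f t \<partial>Lper) - (\<integral>t. u t * (\<phi> 0 t)\<^sup>2 \<partial>Lper)"
    proof -
      have "(\<integral>t. u t * f t \<partial>Lper) = (\<integral>t. (\<Sum>i<N. u t * (\<phi> i t)\<^sup>2) \<partial>Lper)" by (simp add: fsum sum_distrib_left)
      also have "\<dots> = (\<Sum>i<N. \<integral>t. u t * (\<phi> i t)\<^sup>2 \<partial>Lper)" by (rule Bochner_Integration.integral_sum) (rule iu)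
      also have "\<dots> = (\<integral>t. u t * (\<phi> 0 t)\<^sup>2 \<partial>Lper) + (\<Sum>i\<in>{..<N} - {0}. \<integral>t. u t * (\<phi> i t)\<^sup>2 \<partial>Lper)"
        using N2 by (subst sum.remove[of _ 0]) auto
      finally show ?thesis by simp
    qed
    finally have E1: "V f \<le> \<mu> 0 * C2 + ((\<integral>t. u t * f t \<partial>Lper) - (\<integral>t. u t * (\<phi> 0 t)\<^sup>2 \<partial>Lper)) + 2 * \<kappa> * (\<Sum>i\<in>{..<N} - {0}. \<mu> i)" .
    have E2: "2 * \<kappa> * (\<Sum>i\<in>{..<N} - {0}. \<mu> i) \<le> 2 * \<kappa> * If"
    proof -
      have "(\<Sum>i\<in>{..<N} - {0}. \<mu> i) \<le> (\<Sum>i<N. \<mu> i)" using \<mu> by (intro sum_mono2) (auto intro: less_imp_le)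
      also have "\<dots> = (\<integral>t. (\<Sum>i<N. (\<phi> i t)\<^sup>2) \<partial>Lper)" unfolding \<mu>_def by (rule Bochner_Integration.integral_sum[symmetric]) (intro integrable_Lper_cont c2)
      also have "\<dots> = If" by (simp add: If_def fsum)
      finally show ?thesis using \<kappa> by (intro mult_left_mono) auto
    qed
    have E3: "- (\<integral>t. u t * (\<phi> 0 t)\<^sup>2 \<partial>Lper) \<le> U * \<mu> 0"
    proof -
      have "(\<integral>t. (- U) * (\<phi> 0 t)\<^sup>2 \<partial>Lper) \<le> (\<integral>t. u t * (\<phi> 0 t)\<^sup>2 \<partial>Lper)"
      proof (rule integral_mono[OF _ iu])
        show "integrable Lper (\<lambda>t. (- U) * (\<phi> 0 t)\<^sup>2)" by (intro integrable_Lper_cont continuous_intros C1per_cont[OF C\<phi>])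
        fix t assume "t \<in> space Lper"
        then have "- U \<le> u t" using U(2)[of t] unfolding abs_le_iff by auto
        then show "(- U) * (\<phi> 0 t)\<^sup>2 \<le> u t * (\<phi> 0 t)\<^sup>2" by (intro mult_right_mono) auto
      qed
      then show ?thesis by (simp add: \<mu>_def)
    qed
    have A: "V f \<le> \<mu> 0 * C2 + ((\<integral>t. u t * f t \<partial>Lper) + U * \<mu> 0) + 2 * \<kappa> * If" using E1 E2 E3 by linarith
    have "\<mu> 0 \<le> Fm * (2 * pi / real N)"
    proof -
      have cw: "continuous_on B (win N 0)" for B using win_C1per[OF N2, of 0] C1per_cont(1) by blast
      have "\<mu> 0 \<le> (\<integral>t. Fm * (win N 0 t)\<^sup>2 \<partial>Lper)" unfolding \<mu>_def sq
      proof (rule integral_mono)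
        show "integrable Lper (\<lambda>t. f t * (win N 0 t)\<^sup>2)" "integrable Lper (\<lambda>t. Fm * (win N 0 t)\<^sup>2)"
          by (intro integrable_Lper_cont continuous_intros cw cf)+
        show "f t * (win N 0 t)\<^sup>2 \<le> Fm * (win N 0 t)\<^sup>2" for t using Fm(2)[of t] by (intro mult_right_mono) auto
      qed
      also have "\<dots> = Fm * (2 * pi / real N)" by (simp add: win_integral[OF N2])
      finally show ?thesis .
    qed
    then have "(C2 + U) * \<mu> 0 \<le> (C2 + U) * (Fm * (2 * pi / real N))" using C2(1) U(1) by (intro mult_left_mono) auto
    then have "(C2 + U) * \<mu> 0 \<le> \<kappa>" using r3 by linarith
    then show ?thesis using A by (simp add: algebra_simps)
  qed
  show ?thesis
  proof (rule field_le_epsilon)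
    fix e :: real assume e: "0 < e"
    have "0 < e / (1 + 2 * If)" using e If by simp
    from main[OF this] show "V f \<le> (\<integral>t. u t * f t \<partial>Lper) + e" using If by simp
  qed
qed

end

text \<open>u is bounded on I, so Cauchy-Schwarz turns L^2 convergence of the approximants into
  convergence of the integrals.\<close>

lemma integral_bounded_mult_tendsto:
  assumes u: "continuous_on Iper u" and w: "wderiv1 (\<lambda>t. complex_of_real (f t)) (\<lambda>t. complex_of_real (g t))"
    and T: "\<And>k. C1per (T k) (T' k)" and l: "(\<lambda>k::nat. h1dist (\<lambda>t. f t - T k t) (\<lambda>t. g t - T' k t)) \<longlonglongrightarrow> 0"
  shows "integrable Lper (\<lambda>t. u t * f t)" "(\<lambda>k. \<integral>t. u t * T k t \<partial>Lper) \<longlonglongrightarrow> (\<integral>t. u t * f t \<partial>Lper)"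
proof -
  obtain U where U: "0 \<le> U" "\<And>t. t \<in> Iper \<Longrightarrow> \<bar>u t\<bar> \<le> U" using cont_bounded_Iper[OF u] by blast
  note F = integrable_sq_of_L2[OF wderiv1_L2(1)[OF w]]
  have um: "u \<in> borel_measurable Lper" by (rule measurable_Lper_cont[OF u])
  have mult: "integrable Lper (\<lambda>t. u t * h t)" if "integrable Lper h" for h
  proof (rule Bochner_Integration.integrable_bound)
    show "integrable Lper (\<lambda>t. U * h t)" using that by simp
    show "(\<lambda>t. u t * h t) \<in> borel_measurable Lper" using um that by measurable
    show "AE t in Lper. norm (u t * h t) \<le> norm (U * h t)"
      using U by (intro AE_I2) (auto simp: abs_mult intro!: mult_right_mono)
  qed
  show iu: "integrable Lper (\<lambda>t. u t * f t)" by (rule mult[OF F(3)])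
  have iT: "integrable Lper (\<lambda>t. u t * T k t)" for k by (intro integrable_Lper_cont continuous_intros u C1per_cont[OF T])
  let ?d = "\<lambda>k. h1dist (\<lambda>t. f t - T k t) (\<lambda>t. g t - T' k t)"
  have le: "norm ((\<integral>t. u t * T k t \<partial>Lper) - (\<integral>t. u t * f t \<partial>Lper)) \<le> sqrt (2 * pi * (U\<^sup>2 * ?d k))" for k
  proof -
    have Ld: "L2per (\<lambda>t. complex_of_real (f t - T k t))"
      using L2per_diff[OF wderiv1_L2(1)[OF w] wderiv1_L2(1)[OF C1per_wderiv1[OF T[of k]]]] by simp
    note d = integrable_sq_of_L2[OF Ld]
    have mu: "(\<lambda>t. (u t * (f t - T k t))\<^sup>2) \<in> borel_measurable Lper" using um d(2) by measurable
    have pt: "(u t * (f t - T k t))\<^sup>2 \<le> U\<^sup>2 * (f t - T k t)\<^sup>2" if "t \<in> Iper" for t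
    proof -
      have "\<bar>u t\<bar>\<^sup>2 \<le> U\<^sup>2" using U(2)[OF that] by (rule power_mono) simp
      then show ?thesis by (simp add: power_mult_distrib mult_right_mono)
    qed
    have i2: "integrable Lper (\<lambda>t. (u t * (f t - T k t))\<^sup>2)"
      by (rule Bochner_Integration.integrable_bound[OF integrable_mult_right[OF d(1), of "U\<^sup>2"] mu]) (use pt in auto)
    have "\<bar>\<integral>t. u t * (f t - T k t) \<partial>Lper\<bar> \<le> sqrt (2 * pi * (\<integral>t. (u t * (f t - T k t))\<^sup>2 \<partial>Lper))"
      by (rule abs_integral_le_L2[OF mult[OF d(3)] i2])
    also have "(\<integral>t. (u t * (f t - T k t))\<^sup>2 \<partial>Lper) \<le> (\<integral>t. U\<^sup>2 * (f t - T k t)\<^sup>2 \<partial>Lper)"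
      by (rule integral_mono[OF i2]) (use d(1) pt in auto)
    also have "\<dots> \<le> U\<^sup>2 * ?d k" unfolding integral_mult_right_zero by (intro mult_left_mono) (auto simp: h1dist_def)
    finally have "\<bar>\<integral>t. u t * (f t - T k t) \<partial>Lper\<bar> \<le> sqrt (2 * pi * (U\<^sup>2 * ?d k))" by (simp add: mult_left_mono)
    moreover have "(\<integral>t. u t * (f t - T k t) \<partial>Lper) = (\<integral>t. u t * f t \<partial>Lper) - (\<integral>t. u t * T k t \<partial>Lper)"
      using iu iT by (simp add: right_diff_distrib)
    ultimately show ?thesis by (simp add: abs_minus_commute)
  qed
  have "(\<lambda>k. sqrt (2 * pi * (U\<^sup>2 * ?d k))) \<longlonglongrightarrow> sqrt (2 * pi * (U\<^sup>2 * 0))" by (intro tendsto_intros l)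
  then have "(\<lambda>k. sqrt (2 * pi * (U\<^sup>2 * ?d k))) \<longlonglongrightarrow> 0" by simp
  then have "(\<lambda>k. (\<integral>t. u t * T k t \<partial>Lper) - (\<integral>t. u t * f t \<partial>Lper)) \<longlonglongrightarrow> 0"
    by (rule Lim_null_comparison[OF always_eventually[OF allI[OF le]]])
  then show "(\<lambda>k. \<integral>t. u t * T k t \<partial>Lper) \<longlonglongrightarrow> (\<integral>t. u t * f t \<partial>Lper)" by (rule LIM_zero_cancel)
qed

context limit_potential
begin

text \<open>V minus integration against u is linear and at most 0 near \<rho>, and weak duality
  together with the energy bound makes it 0 at \<rho>. A linear functional that attains its maximum
  at an interior point vanishes. The same equalities show that u attains the transport cost.\<close>

lemma exists_potential:
  "\<exists>u. regular_kantorovich_pot n w \<rho> u \<and> (\<forall>f. H1per f \<longrightarrow> V f = (\<integral>t. u t * f t \<partial>Lper))"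
proof (rule envelope)
  fix C2 v M assume E: "0 \<le> C2" "0 \<le> M"
    "\<And>\<phi> \<phi>' a. C1per \<phi> \<phi>' \<Longrightarrow> (\<And>t. 0 \<le> \<phi> t) \<Longrightarrow> (\<integral>t. (\<phi> t)\<^sup>2 \<partial>Lper) = 1 \<Longrightarrow>
     (\<And>t. t \<in> Iper \<Longrightarrow> \<phi> t \<noteq> 0 \<Longrightarrow> distT (t - a) < brad) \<Longrightarrow> V (\<lambda>t. (\<phi> t)\<^sup>2) \<le> C2"
    "dual_feasible v" "\<And>t. t \<in> Iper \<Longrightarrow> - M \<le> v t"
    "\<And>t e. t \<in> Iper \<Longrightarrow> 0 < e \<Longrightarrow> \<exists>d>0. \<forall>\<phi>\<in>Bump t d. V (\<lambda>t. (\<phi> t)\<^sup>2) \<le> v t + e"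
  obtain u where u: "dual_feasible u" "\<And>t. t \<in> Iper \<Longrightarrow> v t \<le> u t" "continuous_on Iper u"
    using maximal_feasible[OF E(4,5,2)] by blast
  have env: "\<exists>d>0. \<forall>\<phi>\<in>Bump t d. V (\<lambda>t. (\<phi> t)\<^sup>2) \<le> u t + e" if "t \<in> Iper" "0 < e" for t e
    using E(6)[OF that] u(2)[OF that(1)] by (meson add_right_mono order_trans)
  have Vle: "V f \<le> (\<integral>t. u t * f t \<partial>Lper)" if "C1per f f'" "\<And>t. 0 < f t" for f f'
    by (rule V_le_integral[OF E(1) E(3) env u(3) that])
  note r = Dper_cont[OF D]
  have H\<rho>: "H1per \<rho>" using D by (simp add: Dper_def)
  obtain g T T' where w: "wderiv1 (\<lambda>t. complex_of_real (\<rho> t)) (\<lambda>t. complex_of_real (g t))"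
    and T: "\<And>k. C1per (T k) (T' k)"
    and l: "(\<lambda>k::nat. h1dist (\<lambda>t. \<rho> t - T k t) (\<lambda>t. g t - T' k t)) \<longlonglongrightarrow> 0"
    by (rule H1per_trig_approx[OF H\<rho>]) blast
  have ne: "Iper \<noteq> {}" by (auto simp: Iper_def)
  obtain x0 where x0: "x0 \<in> Iper" "\<And>y. y \<in> Iper \<Longrightarrow> \<rho> x0 \<le> \<rho> y" using continuous_attains_inf[OF compact_Iper ne r(1)] by auto
  have unif: "uniform_limit Iper T \<rho> sequentially" by (rule trig_approx_uniform[OF r(1) w T l])
  have m0: "0 < \<rho> x0 / 2" using r(2)[OF x0(1)] by simp
  have evT: "\<forall>\<^sub>F k in sequentially. \<forall>t\<in>Iper. dist (T k t) (\<rho> t) < \<rho> x0 / 2"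
    using unif[unfolded uniform_limit_iff, rule_format, OF m0] .
  have VT: "(\<lambda>k. V (T k)) \<longlonglongrightarrow> V \<rho>" using hc H\<rho> w T l unfolding H1_cont_def by blast
  note iT = integral_bounded_mult_tendsto[OF u(3) w T l]
  \<comment> \<open>Domination is known for positive C^1 functions, whereas \<rho> is only H^1. It
    is applied to T_k + c h, which is positive for large k, and passed to the limit.\<close>
  have pert: "V \<rho> + c * V h \<le> (\<integral>t. u t * \<rho> t \<partial>Lper) + c * (\<integral>t. u t * h t \<partial>Lper)"
    if h: "C1per h h'" "\<And>t. \<bar>c * h t\<bar> < \<rho> x0 / 2" for h h' c
  proof -
    have "\<forall>\<^sub>F k in sequentially. V (T k) + c * V h \<le> (\<integral>t. u t * T k t \<partial>Lper) + c * (\<integral>t. u t * h t \<partial>Lper)"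
      using evT
    proof (rule eventually_mono)
      fix k assume k: "\<forall>t\<in>Iper. dist (T k t) (\<rho> t) < \<rho> x0 / 2"
      have Tb: "\<rho> x0 / 2 \<le> T k t" for t
      proof (rule sup_all_of_sup_Iper[of "T k" "\<lambda>y. \<rho> x0 / 2 \<le> y"])
        show "T k (t + 2 * pi) = T k t" for t using T by (simp add: C1per_def)
        fix t assume t: "t \<in> Iper"
        have "\<bar>T k t - \<rho> t\<bar> < \<rho> x0 / 2" using k t by (auto simp: dist_real_def)
        then show "\<rho> x0 / 2 \<le> T k t" using x0(2)[OF t] unfolding abs_less_iff by (simp add: field_simps)
      qed
      have pos: "0 < 1 * T k t + c * h t" for t using Tb[of t] h(2)[of t] unfolding abs_less_iff by linarith
      have "V (\<lambda>t. 1 * T k t + c * h t) \<le> (\<integral>t. u t * (1 * T k t + c * h t) \<partial>Lper)"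
        by (rule Vle[OF C1per_lin[OF T h(1)] pos])
      moreover have "V (\<lambda>t. 1 * T k t + c * h t) = V (T k) + c * V h"
        using lin_H1D[OF lin C1per_H1per[OF T] C1per_H1per[OF h(1)], of 1 k c] by simp
      moreover have "(\<integral>t. u t * (1 * T k t + c * h t) \<partial>Lper) = (\<integral>t. u t * T k t \<partial>Lper) + c * (\<integral>t. u t * h t \<partial>Lper)"
      proof -
        have "integrable Lper (\<lambda>t. u t * T k t)" "integrable Lper (\<lambda>t. c * (u t * h t))"
          by (intro integrable_Lper_cont continuous_intros u C1per_cont[OF T] C1per_cont[OF h(1)])+
        then have "(\<integral>t. u t * T k t + c * (u t * h t) \<partial>Lper) = (\<integral>t. u t * T k t \<partial>Lper) + (\<integral>t. c * (u t * h t) \<partial>Lper)"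
          by (rule Bochner_Integration.integral_add)
        then show ?thesis by (simp add: distrib_left mult_ac)
      qed
      ultimately show "V (T k) + c * V h \<le> (\<integral>t. u t * T k t \<partial>Lper) + c * (\<integral>t. u t * h t \<partial>Lper)" by simp
    qed
    moreover have "(\<lambda>k. V (T k) + c * V h) \<longlonglongrightarrow> V \<rho> + c * V h" by (intro tendsto_intros VT)
    moreover have "(\<lambda>k. (\<integral>t. u t * T k t \<partial>Lper) + c * (\<integral>t. u t * h t \<partial>Lper)) \<longlonglongrightarrow> (\<integral>t. u t * \<rho> t \<partial>Lper) + c * (\<integral>t. u t * h t \<partial>Lper)"
      by (intro tendsto_intros iT(2))
    ultimately show ?thesis by (intro tendsto_le[OF sequentially_bot]) auto
  qed
  have up: "V \<rho> \<le> (\<integral>t. \<rho> t * u t \<partial>Lper)"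
    using pert[OF C1per_const[of 0], of 0] m0 by (simp add: mult.commute)
  have nn: "0 \<le> (\<integral>t. \<rho> t * u t \<partial>Lper)" using up V0 by linarith
  have "ennreal (real n * (\<integral>t. \<rho> t * u t \<partial>Lper)) \<le> FOT n w \<rho>" by (rule FOT_lower[OF u(3,1) D nn])
  then have le2: "ennreal (real n * (\<integral>t. \<rho> t * u t \<partial>Lper)) \<le> ennreal (real n * V \<rho>)" using FV by (rule order_trans)
  then have "real n * (\<integral>t. \<rho> t * u t \<partial>Lper) \<le> real n * V \<rho>" using V0 by (subst (asm) ennreal_le_iff) auto
  then have dn: "(\<integral>t. \<rho> t * u t \<partial>Lper) \<le> V \<rho>" using n1 by simp
  have eq: "V \<rho> = (\<integral>t. \<rho> t * u t \<partial>Lper)" using up dn by simp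
  have F: "FOT n w \<rho> = ennreal (real n * (\<integral>t. \<rho> t * u t \<partial>Lper))"
    using FV \<open>ennreal (real n * (\<integral>t. \<rho> t * u t \<partial>Lper)) \<le> FOT n w \<rho>\<close> by (simp add: eq antisym)
  have VC: "V h = (\<integral>t. u t * h t \<partial>Lper)" if h: "C1per h h'" for h h'
  proof -
    obtain B where B: "0 \<le> B" "\<And>t. \<bar>h t\<bar> \<le> B" using C1per_bounded[OF h] by metis
    \<comment> \<open>Small enough that \<tau> |h| stays below half the minimum of \<rho>, so that h
      can be added with both signs.\<close>
    define \<tau> where "\<tau> = \<rho> x0 / 2 / (B + 1)"
    have \<tau>: "0 < \<tau>" using m0 B by (simp add: \<tau>_def)
    have small: "\<bar>c * h t\<bar> < \<rho> x0 / 2" if c: "\<bar>c\<bar> = \<tau>" for c t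
    proof -
      have "\<bar>c * h t\<bar> \<le> \<tau> * B" unfolding abs_mult c using \<tau> B by (intro mult_left_mono) auto
      also have "\<dots> < \<tau> * (B + 1)" using \<tau> by simp
      also have "\<dots> = \<rho> x0 / 2"
      proof -
        have "B + 1 \<noteq> 0" using B by linarith
        then show ?thesis unfolding \<tau>_def by (rule nonzero_eq_divide_eq[THEN iffD1, OF _ refl])
      qed
      finally show ?thesis .
    qed
    have "\<tau> * V h \<le> \<tau> * (\<integral>t. u t * h t \<partial>Lper)" using pert[OF h small, of \<tau>] \<tau> eq by (simp add: mult.commute)
    moreover have "- \<tau> * V h \<le> - \<tau> * (\<integral>t. u t * h t \<partial>Lper)" using pert[OF h small, of "- \<tau>"] \<tau> eq by (simp add: mult.commute)
    ultimately show ?thesis using \<tau> by simp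
  qed
  have VH: "V f = (\<integral>t. u t * f t \<partial>Lper)" if f: "H1per f" for f
  proof -
    obtain g S S' where w: "wderiv1 (\<lambda>t. complex_of_real (f t)) (\<lambda>t. complex_of_real (g t))"
      and S: "\<And>k. C1per (S k) (S' k)"
      and l: "(\<lambda>k::nat. h1dist (\<lambda>t. f t - S k t) (\<lambda>t. g t - S' k t)) \<longlonglongrightarrow> 0"
      by (rule H1per_trig_approx[OF f]) blast
    have "(\<lambda>k. V (S k)) \<longlonglongrightarrow> V f" using hc f w S l unfolding H1_cont_def by blast
    moreover have "(\<lambda>k. V (S k)) = (\<lambda>k. \<integral>t. u t * S k t \<partial>Lper)" using VC[OF S] by auto
    ultimately show ?thesis using integral_bounded_mult_tendsto(2)[OF u(3) w S l] LIMSEQ_unique by metis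
  qed
  have "kantorovich_pot n w \<rho> u" unfolding kantorovich_pot_def
  proof (intro conjI ballI)
    show "integrable Lper (\<lambda>t. \<rho> t * u t)" by (intro integrable_Lper_cont continuous_intros r(1) u(3))
    show "enn2ereal (FOT n w \<rho>) = ereal (real n * (\<integral>t. \<rho> t * u t \<partial>Lper))" unfolding F using nn by simp
    fix x assume x: "x \<in> PiE {..<n} (\<lambda>_. Iper)"
    show "0 \<le> enn2ereal (cN n w x) - ereal (\<Sum>j<n. u (x j))"
    proof (cases "x \<in> Xadm")
      case True
      then show ?thesis using u(1) cR_nonneg[of x] by (simp add: cN_Xadm dual_feasible_def)
    next
      case False
      have "cN n w x = top" by (rule cN_top[OF _ False]) (use x in auto)
      then show ?thesis by simp
    qed
  qed
  then show ?thesis using VH u(3) by (auto simp: regular_kantorovich_pot_def)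
qed

end

section \<open>Uniqueness of regular potentials\<close>

lemma cN_cong: "(\<And>i. i < n \<Longrightarrow> x i = y i) \<Longrightarrow> cN n w x = cN n w y"
  unfolding cN_def by (intro sum.cong) auto

context cost
begin

text \<open>Potentials are tested on \<open>PiE\<close>, where values at indices from n on are
  undefined; restricting x reaches this set without changing the cost or the sum.\<close>

lemma kantorovich_feasible:
  assumes "kantorovich_pot n w \<rho> u" shows "dual_feasible u"
  unfolding dual_feasible_def
proof
  fix x assume x: "x \<in> Xadm"
  let ?y = "restrict x {..<n}"
  have y: "?y \<in> PiE {..<n} (\<lambda>_. Iper)" using x by (auto simp: Xadm_def)
  have "0 \<le> enn2ereal (cN n w ?y) - ereal (\<Sum>j<n. u (?y j))" using assms y unfolding kantorovich_pot_def by blast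
  moreover have "cN n w ?y = cN n w x" by (rule cN_cong) simp
  moreover have "(\<Sum>j<n. u (?y j)) = (\<Sum>j<n. u (x j))" by (rule sum.cong) auto
  ultimately have "0 \<le> enn2ereal (ennreal (cR x)) - ereal (\<Sum>j<n. u (x j))" by (simp add: cN_Xadm[OF x])
  then show "(\<Sum>i<n. u (x i)) \<le> cR x" using cR_nonneg[of x] by (simp add: enn2ereal_ennreal)
qed

lemma kantorovich_FOT:
  assumes "kantorovich_pot n w \<rho> u"
  shows "0 \<le> (\<integral>t. \<rho> t * u t \<partial>Lper)" "FOT n w \<rho> = ennreal (real n * (\<integral>t. \<rho> t * u t \<partial>Lper))"
proof -
  let ?r = "real n * (\<integral>t. \<rho> t * u t \<partial>Lper)"
  have e: "enn2ereal (FOT n w \<rho>) = ereal ?r" using assms by (simp add: kantorovich_pot_def)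
  have "0 \<le> enn2ereal (FOT n w \<rho>)" by simp
  then have r: "0 \<le> ?r" unfolding e by simp
  then show "0 \<le> (\<integral>t. \<rho> t * u t \<partial>Lper)" using n1 by (simp add: zero_le_mult_iff)
  have "enn2ereal (FOT n w \<rho>) = enn2ereal (ennreal ?r)" using e r by (simp add: enn2ereal_ennreal)
  then show "FOT n w \<rho> = ennreal ?r" by (simp only: enn2ereal_inject)
qed

text \<open>If all configurations with x_0 near t had slack \<delta> in the sum of the two
  constraints, a small tent h in the coordinate x_0 could be added to that sum. Integrating against
  a coupling with cost within m / 2 of the infimum F would give 2 F + m < 2 F + m, where m > 0 is
  the integral of \<rho> h. Testing both potentials at once yields one configuration for
  both.\<close>

lemma approx_contact:
  assumes D: "Dper \<rho>" and k1: "kantorovich_pot n w \<rho> u1" and k2: "kantorovich_pot n w \<rho> u2"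
    and c1: "continuous_on Iper u1" and c2: "continuous_on Iper u2" and t: "t \<in> Iper" and \<delta>: "0 < \<delta>" "\<delta> \<le> 1"
  shows "\<exists>x\<in>Xadm. \<bar>x 0 - t\<bar> < \<delta> \<and> 2 * cR x \<le> (\<Sum>i<n. u1 (x i)) + (\<Sum>i<n. u2 (x i)) + \<delta>"
proof (rule ccontr)
  assume "\<not> ?thesis"
  then have neg: "(\<Sum>i<n. u1 (x i)) + (\<Sum>i<n. u2 (x i)) + \<delta> < 2 * cR x" if "x \<in> Xadm" "\<bar>x 0 - t\<bar> < \<delta>" for x using that by force
  note r = Dper_cont[OF D]
  note f1 = kantorovich_feasible[OF k1] and f2 = kantorovich_feasible[OF k2]
  \<comment> \<open>A tent of height \<delta>^2 \<le> \<delta>, hence within the slack, that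
    vanishes outside the \<delta>-neighbourhood of t.\<close>
  define h where "h = (\<lambda>s. \<delta> * max 0 (\<delta> - \<bar>s - t\<bar>))"
  have hc: "continuous_on B h" for B unfolding h_def by (intro continuous_intros)
  have hn: "0 \<le> h s" for s using \<delta> by (simp add: h_def)
  have hle: "h s \<le> \<delta>" for s
  proof -
    have "\<delta> * max 0 (\<delta> - \<bar>s - t\<bar>) \<le> \<delta> * 1" using \<delta> by (intro mult_left_mono) auto
    then show ?thesis by (simp add: h_def)
  qed
  define m where "m = (\<integral>s. \<rho> s * h s \<partial>Lper)"
  have m: "0 < m" unfolding m_def
  proof (rule integral_pos_of_pos[OF _ _ t])
    show "continuous_on Iper (\<lambda>s. \<rho> s * h s)" by (intro continuous_intros r(1) hc)
    show "0 \<le> \<rho> s * h s" if "s \<in> Iper" for s using r(3)[OF that] hn by simp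
    show "0 < \<rho> t * h t" using r(2)[OF t] \<delta> by (simp add: h_def)
  qed
  obtain U1 where U1: "0 \<le> U1" "\<And>t. t \<in> Iper \<Longrightarrow> \<bar>u1 t\<bar> \<le> U1" using cont_bounded_Iper[OF c1] by blast
  obtain U2 where U2: "0 \<le> U2" "\<And>t. t \<in> Iper \<Longrightarrow> \<bar>u2 t\<bar> \<le> U2" using cont_bounded_Iper[OF c2] by blast
  \<comment> \<open>Shifted to be nonnegative, so that the integrals can be taken in the extended
    nonnegative reals.\<close>
  define q where "q = (\<lambda>s. u1 s + u2 s + (U1 + U2))"
  have qc: "continuous_on Iper q" unfolding q_def by (intro continuous_intros c1 c2)
  have qn: "0 \<le> q s" if "s \<in> Iper" for s using U1(2)[OF that] U2(2)[OF that] unfolding q_def abs_le_iff by linarith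
  define F where "F = real n * (\<integral>t. \<rho> t * u1 t \<partial>Lper)"
  have F1: "FOT n w \<rho> = ennreal F" "0 \<le> F" using kantorovich_FOT[OF k1] by (auto simp: F_def)
  have F2: "real n * (\<integral>t. \<rho> t * u2 t \<partial>Lper) = F"
  proof -
    have "ennreal (real n * (\<integral>t. \<rho> t * u2 t \<partial>Lper)) = ennreal F" using kantorovich_FOT(2)[OF k2] F1(1) by simp
    then show ?thesis using kantorovich_FOT(1)[OF k2] F1(2) by (subst (asm) ennreal_inj) auto
  qed
  have intq: "real n * (\<integral>t. \<rho> t * q t \<partial>Lper) = 2 * F + real n * (U1 + U2)"
  proof -
    have i: "integrable Lper (\<lambda>t. \<rho> t * u1 t)" "integrable Lper (\<lambda>t. \<rho> t * u2 t)" "integrable Lper \<rho>"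
      by (intro integrable_Lper_cont continuous_intros r(1) c1 c2)+
    have "(\<integral>t. \<rho> t * q t \<partial>Lper) = (\<integral>t. (\<rho> t * u1 t + \<rho> t * u2 t) + (U1 + U2) * \<rho> t \<partial>Lper)"
      by (rule Bochner_Integration.integral_cong) (auto simp: q_def algebra_simps)
    also have "\<dots> = ((\<integral>t. \<rho> t * u1 t \<partial>Lper) + (\<integral>t. \<rho> t * u2 t \<partial>Lper)) + (U1 + U2)"
      using i r(4) by simp
    finally have "real n * (\<integral>t. \<rho> t * q t \<partial>Lper) = real n * (\<integral>t. \<rho> t * u1 t \<partial>Lper) + real n * (\<integral>t. \<rho> t * u2 t \<partial>Lper) + real n * (U1 + U2)"
      by (simp add: distrib_left)
    then show ?thesis using F2 by (simp add: F_def)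
  qed
  have "FOT n w \<rho> < ennreal (F + m / 2)" unfolding F1(1) using m F1(2) by (intro ennreal_lessI) auto
  then obtain \<gamma> where g: "coupling n \<rho> \<gamma>" and gl: "(\<integral>\<^sup>+x. cN n w x \<partial>\<gamma>) < ennreal (F + m / 2)"
    unfolding FOT_def INF_less_iff by auto
  interpret prob_space \<gamma> using g by (simp add: coupling_def)
  have "measurable \<gamma> borel = (measurable (Pi\<^sub>M {..<n} (\<lambda>_. Bper)) borel :: ((nat \<Rightarrow> real) \<Rightarrow> ennreal) set)"
    using g by (intro measurable_cong_sets) (auto simp: coupling_def)
  then have cm: "cN n w \<in> borel_measurable \<gamma>" using cN_measurable[OF A, of n] by (simp only:)
  have mh: "(\<lambda>x. ennreal (h (x 0))) \<in> borel_measurable \<gamma>"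
    using measurable_compose[OF coupling_component[OF g, of 0] Bper_cont_measurable[OF hc]] n1 by simp
  have mq: "(\<lambda>x. ennreal (\<Sum>i<n. q (x i))) \<in> borel_measurable \<gamma>"
  proof -
    have "(\<lambda>x. q (x i)) \<in> borel_measurable \<gamma>" if "i \<in> {..<n}" for i
      using measurable_compose[OF coupling_component[OF g, of i] Bper_cont_measurable[OF qc]] that by simp
    then have "(\<lambda>x. \<Sum>i<n. q (x i)) \<in> borel_measurable \<gamma>" by (rule borel_measurable_sum)
    then show ?thesis by simp
  qed
  have "ennreal (2 * F + real n * (U1 + U2)) + ennreal m = (\<integral>\<^sup>+x. ennreal (\<Sum>i<n. q (x i)) \<partial>\<gamma>) + (\<integral>\<^sup>+x. ennreal (h (x 0)) \<partial>\<gamma>)"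
    using coupling_sum_integral[OF g r(1,3) qc qn] coupling_integral[OF g r(1,3) hc hn, of 0] n1 intq
    by (simp add: m_def)
  also have "\<dots> = (\<integral>\<^sup>+x. ennreal (\<Sum>i<n. q (x i)) + ennreal (h (x 0)) \<partial>\<gamma>)"
    by (rule nn_integral_add[symmetric, OF mq mh])
  also have "\<dots> \<le> (\<integral>\<^sup>+x. 2 * cN n w x + ennreal (real n * (U1 + U2)) \<partial>\<gamma>)"
  proof (rule nn_integral_mono)
    fix x assume "x \<in> space \<gamma>"
    then have xI: "x i \<in> Iper" if "i < n" for i using coupling_space[OF g] that by auto
    show "ennreal (\<Sum>i<n. q (x i)) + ennreal (h (x 0)) \<le> 2 * cN n w x + ennreal (real n * (U1 + U2))"
    proof (cases "x \<in> Xadm")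
      case True
      have s: "(\<Sum>i<n. u1 (x i)) + (\<Sum>i<n. u2 (x i)) + h (x 0) \<le> 2 * cR x"
      proof (cases "\<bar>x 0 - t\<bar> < \<delta>")
        case near: True
        then show ?thesis using neg[OF True near] hle[of "x 0"] by linarith
      next
        case False
        then have "h (x 0) = 0" by (simp add: h_def)
        moreover have "(\<Sum>i<n. u1 (x i)) \<le> cR x" "(\<Sum>i<n. u2 (x i)) \<le> cR x" using f1 f2 True by (auto simp: dual_feasible_def)
        ultimately show ?thesis by linarith
      qed
      have qs: "(\<Sum>i<n. q (x i)) = (\<Sum>i<n. u1 (x i)) + (\<Sum>i<n. u2 (x i)) + real n * (U1 + U2)"
        by (simp add: q_def sum.distrib)
      have "ennreal (\<Sum>i<n. q (x i)) + ennreal (h (x 0)) = ennreal ((\<Sum>i<n. q (x i)) + h (x 0))"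
        using qn xI hn by (intro ennreal_plus[symmetric] sum_nonneg) auto
      also have "\<dots> \<le> ennreal (2 * cR x + real n * (U1 + U2))" using s qs by (intro ennreal_leI) linarith
      also have "\<dots> = 2 * cN n w x + ennreal (real n * (U1 + U2))"
        using cN_Xadm[OF True] cR_nonneg[of x] U1(1) U2(1) by (simp add: ennreal_plus ennreal_mult)
      finally show ?thesis .
    next
      case False
      then show ?thesis using cN_top[OF xI False] by (simp add: ennreal_mult_top)
    qed
  qed
  also have "\<dots> = 2 * (\<integral>\<^sup>+x. cN n w x \<partial>\<gamma>) + ennreal (real n * (U1 + U2))"
    using cm by (subst nn_integral_add) (auto simp: emeasure_space_1 nn_integral_cmult)
  finally have "ennreal (real n * (U1 + U2)) + ennreal (2 * F + m) \<le> ennreal (real n * (U1 + U2)) + 2 * (\<integral>\<^sup>+x. cN n w x \<partial>\<gamma>)"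
    using F1(2) m U1(1) U2(1) by (simp add: ennreal_plus[symmetric] add_ac del: ennreal_plus)
  then have "ennreal (2 * F + m) \<le> 2 * (\<integral>\<^sup>+x. cN n w x \<partial>\<gamma>)" by (simp add: ennreal_add_left_cancel_le)
  also have "\<dots> < 2 * ennreal (F + m / 2)" using gl by (intro ennreal_mult_strict_left_mono) auto
  also have "\<dots> = ennreal (2 * F + m)" using F1(2) m by (simp add: ennreal_mult[symmetric] distrib_left flip: ennreal_numeral)
  finally show False by simp
qed

text \<open>The near-contact configurations have bounded cost, so they stay uniformly separated and
  a limit point is admissible. In the limit the sum of the two constraints is tight, and since each
  of them holds separately, both are tight.\<close>

lemma contact:
  assumes D: "Dper \<rho>" and k1: "kantorovich_pot n w \<rho> u1" and k2: "kantorovich_pot n w \<rho> u2"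
    and c1: "continuous_on Iper u1" and c2: "continuous_on Iper u2" and t: "t \<in> Iper"
  shows "\<exists>x\<in>Xadm. x 0 = t \<and> (\<Sum>i<n. u1 (x i)) = cR x \<and> (\<Sum>i<n. u2 (x i)) = cR x"
proof -
  note f1 = kantorovich_feasible[OF k1] and f2 = kantorovich_feasible[OF k2]
  define dk where "dk = (\<lambda>k::nat. inverse (real (Suc k)))"
  have dk: "0 < dk k" "dk k \<le> 1" for k by (auto simp: dk_def inverse_le_1_iff)
  have dk0: "dk \<longlonglongrightarrow> 0" unfolding dk_def by (rule LIMSEQ_inverse_real_of_nat)
  have "\<forall>k. \<exists>x\<in>Xadm. \<bar>x 0 - t\<bar> < dk k \<and> 2 * cR x \<le> (\<Sum>i<n. u1 (x i)) + (\<Sum>i<n. u2 (x i)) + dk k"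
    using approx_contact[OF D k1 k2 c1 c2 t dk] by blast
  then obtain y where y: "\<And>k. y k \<in> Xadm" "\<And>k. \<bar>y k 0 - t\<bar> < dk k"
    "\<And>k. 2 * cR (y k) \<le> (\<Sum>i<n. u1 (y k i)) + (\<Sum>i<n. u2 (y k i)) + dk k" by metis
  have yI: "y k i \<in> Iper" if "i < n" for k i using y(1)[of k] that by (auto simp: Xadm_def)
  \<comment> \<open>Diagonal extraction over the coordinates; indices from n on are vacuous.\<close>
  interpret sub: subseqs "\<lambda>i s. i < n \<longrightarrow> convergent (\<lambda>k. y (s k) i)"
  proof
    fix i and s :: "nat \<Rightarrow> nat"
    show "\<exists>r'. strict_mono r' \<and> (i < n \<longrightarrow> convergent (\<lambda>k. y ((s \<circ> r') k) i))"
    proof (cases "i < n")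
      case True
      have "bounded (range (\<lambda>k. y (s k) i))"
        by (rule bounded_subset[OF compact_imp_bounded[OF compact_Iper]]) (use yI[OF True] in auto)
      then obtain l r where "strict_mono r" "((\<lambda>k. y (s k) i) \<circ> r) \<longlonglongrightarrow> l"
        using bounded_imp_convergent_subsequence by blast
      then show ?thesis by (auto simp: o_def convergent_def)
    next
      case False then show ?thesis using strict_mono_id by blast
    qed
  qed
  define r where "r = sub.diagseq"
  have r: "strict_mono r" unfolding r_def by (rule sub.subseq_diagseq)
  have cv: "convergent (\<lambda>k. y (r k) i)" if i: "i < n" for i
  proof -
    have "i < n \<longrightarrow> convergent (\<lambda>k. y ((sub.diagseq \<circ> ((+) (Suc i))) k) i)"
    proof (rule sub.diagseq_holds)
      fix q s :: "nat \<Rightarrow> nat" and m assume q: "strict_mono q" and c: "m < n \<longrightarrow> convergent (\<lambda>k. y (s k) m)"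
      show "m < n \<longrightarrow> convergent (\<lambda>k. y ((s \<circ> q) k) m)"
        using c convergent_subseq_convergent[OF _ q, of "\<lambda>k. y (s k) m"] by (auto simp: o_def)
    qed
    then obtain z where "(\<lambda>k. y (r (Suc i + k)) i) \<longlonglongrightarrow> z" using i by (auto simp: convergent_def r_def)
    then have "(\<lambda>k. y (r (k + Suc i)) i) \<longlonglongrightarrow> z" by (simp add: add.commute)
    from LIMSEQ_offset[OF this] show ?thesis by (auto simp: convergent_def)
  qed
  then obtain x where x: "\<And>i. i < n \<Longrightarrow> (\<lambda>k. y (r k) i) \<longlonglongrightarrow> x i" unfolding convergent_def by metis
  have xI: "x i \<in> Iper" if "i < n" for i
    using closed_sequentially[OF compact_imp_closed[OF compact_Iper] _ x[OF that]] yI[OF that] by blast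
  obtain U1 where U1: "0 \<le> U1" "\<And>t. t \<in> Iper \<Longrightarrow> \<bar>u1 t\<bar> \<le> U1" using cont_bounded_Iper[OF c1] by blast
  obtain U2 where U2: "0 \<le> U2" "\<And>t. t \<in> Iper \<Longrightarrow> \<bar>u2 t\<bar> \<le> U2" using cont_bounded_Iper[OF c2] by blast
  define B where "B = real n * U1 + real n * U2 + 1"
  obtain \<alpha> where al: "0 < \<alpha>" "\<And>x. (\<And>i. i < n \<Longrightarrow> x i \<in> Iper) \<Longrightarrow> cN n w x \<le> ennreal B \<Longrightarrow> sepN \<alpha> x"
    using cN_sep[of B] by blast
  have sy: "sepN \<alpha> (y k)" for k
  proof (rule al(2)[OF yI])
    have "(\<Sum>i<n. u1 (y k i)) \<le> (\<Sum>i<n. U1)" using U1(2)[OF yI] unfolding abs_le_iff by (intro sum_mono) auto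
    moreover have "(\<Sum>i<n. u2 (y k i)) \<le> (\<Sum>i<n. U2)" using U2(2)[OF yI] unfolding abs_le_iff by (intro sum_mono) auto
    ultimately have "2 * cR (y k) \<le> B" using y(3)[of k] dk(2)[of k] by (simp add: B_def)
    then have "cR (y k) \<le> B" using cR_nonneg[of "y k"] by linarith
    then show "cN n w (y k) \<le> ennreal B" unfolding cN_Xadm[OF y(1)] by (rule ennreal_leI)
  qed
  have sx: "sepN \<alpha> x" unfolding sepN_def
  proof (intro allI impI)
    fix i j assume ij: "i < n" "j < n" "i \<noteq> j"
    have c: "isCont distT z" for z
      using distT_cont[OF continuous_on_id, of UNIV] by (simp add: continuous_on_eq_continuous_at)
    have "(\<lambda>k. distT (y (r k) i - y (r k) j)) \<longlonglongrightarrow> distT (x i - x j)"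
      by (rule isCont_tendsto_compose[OF c]) (intro tendsto_intros x ij)
    then show "\<alpha> \<le> distT (x i - x j)"
      by (rule LIMSEQ_le_const) (use sy ij in \<open>auto simp: sepN_def\<close>)
  qed
  have X: "x \<in> Xadm" using xI sx al(1) by (rule Xadm_of_sep)
  have lc: "(\<lambda>k. cR (y (r k))) \<longlonglongrightarrow> cR x"
  proof (rule tendstoI)
    fix e :: real assume e: "0 < e"
    obtain d where d: "0 < d" "\<And>x y. (\<And>i. i < n \<Longrightarrow> x i \<in> Iper) \<Longrightarrow> (\<And>i. i < n \<Longrightarrow> y i \<in> Iper) \<Longrightarrow> sepN \<alpha> x \<Longrightarrow>
     (\<And>i. i < n \<Longrightarrow> \<bar>y i - x i\<bar> < d) \<Longrightarrow> sepN (\<alpha>/2) y \<and> \<bar>cR y - cR x\<bar> < e"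
      using cR_unif[OF al(1) e] by blast
    have "\<forall>\<^sub>F k in sequentially. \<forall>i\<in>{..<n}. dist (y (r k) i) (x i) < d"
      using x d(1) by (intro eventually_ball_finite) (auto simp: tendsto_iff)
    then show "\<forall>\<^sub>F k in sequentially. dist (cR (y (r k))) (cR x) < e"
    proof (rule eventually_mono)
      fix k assume "\<forall>i\<in>{..<n}. dist (y (r k) i) (x i) < d"
      then have "\<bar>y (r k) i - x i\<bar> < d" if "i < n" for i using that by (auto simp: dist_real_def)
      then have "\<bar>cR (y (r k)) - cR x\<bar> < e" using d(2)[of x "y (r k)"] xI yI sx by blast
      then show "dist (cR (y (r k))) (cR x) < e" by (simp add: dist_real_def)
    qed
  qed
  have lu: "(\<lambda>k. \<Sum>i<n. u (y (r k) i)) \<longlonglongrightarrow> (\<Sum>i<n. u (x i))" if "continuous_on Iper u" for u :: "real \<Rightarrow> real"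
  proof (rule tendsto_sum)
    fix i assume "i \<in> {..<n}"
    then have i: "i < n" by simp
    show "(\<lambda>k. u (y (r k) i)) \<longlonglongrightarrow> u (x i)"
      by (rule continuous_on_tendsto_compose[OF that x[OF i] xI[OF i]]) (use yI[OF i] in simp)
  qed
  have x0: "x 0 = t"
  proof -
    have n0: "0 < n" using n1 by simp
    have "(\<lambda>k. \<bar>y (r k) 0 - t\<bar>) \<longlonglongrightarrow> \<bar>x 0 - t\<bar>" by (intro tendsto_intros x n0)
    moreover have "(\<lambda>k. dk (r k)) \<longlonglongrightarrow> 0" using LIMSEQ_subseq_LIMSEQ[OF dk0 r] by (simp add: o_def)
    ultimately have "\<bar>x 0 - t\<bar> \<le> 0" by (rule LIMSEQ_le) (use y(2) less_imp_le in blast)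
    then show ?thesis by simp
  qed
  have "2 * cR x \<le> (\<Sum>i<n. u1 (x i)) + (\<Sum>i<n. u2 (x i)) + 0"
  proof (rule LIMSEQ_le)
    show "(\<lambda>k. 2 * cR (y (r k))) \<longlonglongrightarrow> 2 * cR x" by (intro tendsto_intros lc)
    have "(\<lambda>k. dk (r k)) \<longlonglongrightarrow> 0" using LIMSEQ_subseq_LIMSEQ[OF dk0 r] by (simp add: o_def)
    then show "(\<lambda>k. (\<Sum>i<n. u1 (y (r k) i)) + (\<Sum>i<n. u2 (y (r k) i)) + dk (r k)) \<longlonglongrightarrow> (\<Sum>i<n. u1 (x i)) + (\<Sum>i<n. u2 (x i)) + 0"
      by (intro tendsto_intros lu c1 c2)
  qed (use y(3) in blast)
  moreover have "(\<Sum>i<n. u1 (x i)) \<le> cR x" "(\<Sum>i<n. u2 (x i)) \<le> cR x" using f1 f2 X by (auto simp: dual_feasible_def)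
  ultimately have "(\<Sum>i<n. u1 (x i)) = cR x" "(\<Sum>i<n. u2 (x i)) = cR x" by linarith+
  then show ?thesis using X x0 by blast
qed

end

section \<open>Common supergradients for a differentiable cost\<close>

context cost
begin

lemma Ksep_offdiag: "0 < a \<Longrightarrow> Ksep a \<subseteq> offdiag"
  by (auto simp: Ksep_def offdiag_def)

text \<open>Mean value theorem on the segment between s and t, with a derivative that is uniformly
  continuous on the compact set \<open>Ksep (\<alpha>/2)\<close>; hence d depends neither on t nor
  on z. Derivatives are taken within the segment, which covers the endpoints of I.\<close>

lemma partial_derivative_estimate:
  assumes C1: "C1_offdiag w" and a: "0 < \<alpha>"
  obtains g where "\<And>e. 0 < e \<Longrightarrow> \<exists>d>0. \<forall>s\<in>Iper. \<forall>t\<in>Iper. \<forall>z\<in>Iper. \<alpha> \<le> distT (t - z) \<longrightarrow> \<bar>s - t\<bar> < d \<longrightarrow>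
     \<bar>enn2real (w (s, z)) - enn2real (w (t, z)) - g (t, z) * (s - t)\<bar> \<le> e * \<bar>s - t\<bar>"
proof -
  obtain D :: "real \<times> real \<Rightarrow> ((real \<times> real) \<Rightarrow>\<^sub>L real)" where Dc: "continuous_on offdiag D"
    and Dd: "\<And>p. p \<in> offdiag \<Longrightarrow> ((\<lambda>q. enn2real (w q)) has_derivative blinfun_apply (D p)) (at p within offdiag)"
    using C1 unfolding C1_offdiag_def by blast
  define g where "g = (\<lambda>p. blinfun_apply (D p) (1, 0))"
  have a2: "0 < \<alpha> / 2" using a by simp
  have "uniformly_continuous_on (Ksep (\<alpha>/2)) D"
    by (rule compact_uniformly_continuous[OF continuous_on_subset[OF Dc Ksep_offdiag[OF a2]] compact_Ksep])
  note uc = this[unfolded uniformly_continuous_on_def, rule_format]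
  show ?thesis
  proof (rule that[of g])
    fix e :: real assume e: "0 < e"
    obtain d0 where d0: "0 < d0" "\<And>p q. p \<in> Ksep (\<alpha>/2) \<Longrightarrow> q \<in> Ksep (\<alpha>/2) \<Longrightarrow> dist q p < d0 \<Longrightarrow> dist (D q) (D p) < e"
      using uc[OF e] by blast
    \<comment> \<open>The bound \<alpha> / 2 keeps the whole segment at separation \<alpha> / 2 from
      z.\<close>
    define d where "d = min d0 (\<alpha> / 2)"
    have d: "0 < d" using d0 a by (simp add: d_def)
    show "\<exists>d>0. \<forall>s\<in>Iper. \<forall>t\<in>Iper. \<forall>z\<in>Iper. \<alpha> \<le> distT (t - z) \<longrightarrow> \<bar>s - t\<bar> < d \<longrightarrow>
     \<bar>enn2real (w (s, z)) - enn2real (w (t, z)) - g (t, z) * (s - t)\<bar> \<le> e * \<bar>s - t\<bar>"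
    proof (intro exI[of _ d] conjI d ballI impI)
      fix s t z assume I: "s \<in> Iper" "t \<in> Iper" "z \<in> Iper" and sep: "\<alpha> \<le> distT (t - z)" and st: "\<bar>s - t\<bar> < d"
      define J where "J = {min s t..max s t}"
      have JI: "\<tau> \<in> Iper" "\<bar>\<tau> - t\<bar> < d" if "\<tau> \<in> J" for \<tau> using that I st by (auto simp: J_def Iper_def min_def max_def split: if_splits)
      have JK: "(\<tau>, z) \<in> Ksep (\<alpha>/2)" if "\<tau> \<in> J" for \<tau>
      proof -
        have "distT (t - z) \<le> distT (t - \<tau>) + distT (\<tau> - z)" by (rule distT_triangle3)
        moreover have "distT (t - \<tau>) \<le> \<bar>\<tau> - t\<bar>" using distT_le_abs[of "t - \<tau>"] by (simp add: abs_minus_commute)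
        moreover have "\<bar>\<tau> - t\<bar> < \<alpha> / 2" using JI(2)[OF that] by (simp add: d_def)
        ultimately have "\<alpha> / 2 \<le> distT (\<tau> - z)" using sep by linarith
        then show ?thesis using JI(1)[OF that] I by (simp add: Ksep_def)
      qed
      let ?f = "\<lambda>\<tau>. enn2real (w (\<tau>, z)) - g (t, z) * \<tau>"
      have der: "(?f has_field_derivative (g (\<tau>, z) - g (t, z))) (at \<tau> within J)" if t': "\<tau> \<in> J" for \<tau>
      proof -
        have p: "((\<lambda>\<tau>. (\<tau>, z)) has_derivative (\<lambda>h. (h, 0))) (at \<tau> within J)" by (auto intro!: derivative_eq_intros)
        have im: "(\<lambda>\<tau>. (\<tau>, z)) ` J \<subseteq> offdiag" using JK Ksep_offdiag[OF a2] by blast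
        have "(\<tau>, z) \<in> offdiag" using im t' by blast
        from has_derivative_subset[OF Dd[OF this] im]
        have "((\<lambda>q. enn2real (w q)) \<circ> (\<lambda>\<tau>. (\<tau>, z)) has_derivative blinfun_apply (D (\<tau>, z)) \<circ> (\<lambda>h. (h, 0))) (at \<tau> within J)"
          by (rule diff_chain_within[OF p])
        moreover have "blinfun_apply (D (\<tau>, z)) \<circ> (\<lambda>h. (h, 0)) = (*) (g (\<tau>, z))"
        proof
          fix h :: real
          have "blinfun_apply (D (\<tau>, z)) (h *\<^sub>R (1, 0)) = h *\<^sub>R blinfun_apply (D (\<tau>, z)) (1, 0)" by (rule blinfun.scaleR_right)
          then show "(blinfun_apply (D (\<tau>, z)) \<circ> (\<lambda>h. (h, 0))) h = g (\<tau>, z) * h" by (simp add: g_def)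
        qed
        ultimately have "((\<lambda>\<tau>. enn2real (w (\<tau>, z))) has_field_derivative g (\<tau>, z)) (at \<tau> within J)"
          by (simp add: has_field_derivative_def o_def)
        then show ?thesis by (auto intro!: derivative_eq_intros)
      qed
      have bd: "norm (g (\<tau>, z) - g (t, z)) \<le> e" if t': "\<tau> \<in> J" for \<tau>
      proof -
        have tJ: "t \<in> J" by (auto simp: J_def)
        have "dist (\<tau>, z) (t, z) < d0" using JI(2)[OF t'] by (simp add: dist_Pair_Pair dist_real_def d_def)
        then have "dist (D (\<tau>, z)) (D (t, z)) < e" by (rule d0(2)[OF JK[OF tJ] JK[OF t']])
        then have n: "norm (D (\<tau>, z) - D (t, z)) < e" by (simp add: dist_norm)
        have "norm (g (\<tau>, z) - g (t, z)) = norm (blinfun_apply (D (\<tau>, z) - D (t, z)) (1, 0))" by (simp add: g_def blinfun.diff_left)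
        also have "\<dots> \<le> norm (D (\<tau>, z) - D (t, z)) * norm ((1, 0) :: real \<times> real)" by (rule norm_blinfun)
        also have "norm ((1, 0) :: real \<times> real) = 1" by (simp add: norm_Pair)
        finally show ?thesis using n by simp
      qed
      have "norm (?f s - ?f t) \<le> e * norm (s - t)"
        by (rule field_differentiable_bound[of J, OF _ der bd]) (auto simp: J_def)
      then show "\<bar>enn2real (w (s, z)) - enn2real (w (t, z)) - g (t, z) * (s - t)\<bar> \<le> e * \<bar>s - t\<bar>"
        by (simp add: algebra_simps)
    qed
  qed
qed

text \<open>Every pair is counted in both orders and w is symmetric, hence the factor 2; pairs
  without the index 0 cancel.\<close>

lemma cR_change:
  assumes x: "\<And>i. i < n \<Longrightarrow> x i \<in> Iper" and s: "s \<in> Iper"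
  shows "cR (x(0 := s)) - cR x = (\<Sum>j\<in>{..<n} - {0}. 2 * (enn2real (w (s, x j)) - enn2real (w (x 0, x j))))"
proof -
  let ?wr = "\<lambda>a b. enn2real (w (a, b))"
  have n0: "0 \<in> {..<n}" using n1 by simp
  have split: "cR z = (\<Sum>j\<in>{..<n} - {0}. ?wr (z 0) (z j)) + (\<Sum>i\<in>{..<n} - {0}. ?wr (z i) (z 0)) + (\<Sum>i\<in>{..<n} - {0}. \<Sum>j\<in>{..<n} - {i} - {0}. ?wr (z i) (z j))" for z
  proof -
    have "cR z = (\<Sum>j\<in>{..<n} - {0}. ?wr (z 0) (z j)) + (\<Sum>i\<in>{..<n} - {0}. \<Sum>j\<in>{..<n} - {i}. ?wr (z i) (z j))"
      unfolding cR_def by (rule sum.remove[OF _ n0]) simp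
    also have "(\<Sum>i\<in>{..<n} - {0}. \<Sum>j\<in>{..<n} - {i}. ?wr (z i) (z j)) = (\<Sum>i\<in>{..<n} - {0}. ?wr (z i) (z 0) + (\<Sum>j\<in>{..<n} - {i} - {0}. ?wr (z i) (z j)))"
      using n0 by (intro sum.cong refl sum.remove) auto
    finally show ?thesis by (simp add: sum.distrib)
  qed
  let ?y = "x(0 := s)"
  have a: "(\<Sum>j\<in>{..<n} - {0}. ?wr (?y 0) (?y j)) = (\<Sum>j\<in>{..<n} - {0}. ?wr s (x j))" by (rule sum.cong) auto
  have b: "(\<Sum>i\<in>{..<n} - {0}. ?wr (?y i) (?y 0)) = (\<Sum>i\<in>{..<n} - {0}. ?wr s (x i))"
    using x s w_sym by (intro sum.cong) auto
  have b': "(\<Sum>i\<in>{..<n} - {0}. ?wr (x i) (x 0)) = (\<Sum>i\<in>{..<n} - {0}. ?wr (x 0) (x i))"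
    using x n0 w_sym by (intro sum.cong) auto
  have c: "(\<Sum>i\<in>{..<n} - {0}. \<Sum>j\<in>{..<n} - {i} - {0}. ?wr (?y i) (?y j)) = (\<Sum>i\<in>{..<n} - {0}. \<Sum>j\<in>{..<n} - {i} - {0}. ?wr (x i) (x j))"
    by (intro sum.cong) auto
  show ?thesis unfolding split[of ?y] split[of x] a b b' c
    by (simp add: sum_subtractf sum_distrib_left[symmetric])
qed

text \<open>Both potentials share the supergradient p at every point; the Riemann sums of p telescope.\<close>

lemma potentials_difference_antimono:
  assumes D: "Dper \<rho>" and C1: "C1_offdiag w" and k1: "kantorovich_pot n w \<rho> u1" and k2: "kantorovich_pot n w \<rho> u2"
    and c1: "continuous_on Iper u1" and c2: "continuous_on Iper u2" and ab: "a \<in> Iper" "b \<in> Iper" "a < b"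
  shows "u1 b - u2 b \<le> u1 a - u2 a"
proof -
  note f1 = kantorovich_feasible[OF k1] and f2 = kantorovich_feasible[OF k2]
  have "\<forall>t. \<exists>x. t \<in> Iper \<longrightarrow> x \<in> Xadm \<and> x 0 = t \<and> (\<Sum>i<n. u1 (x i)) = cR x \<and> (\<Sum>i<n. u2 (x i)) = cR x"
    using contact[OF D k1 k2 c1 c2] by blast
  then obtain X where X: "\<And>t. t \<in> Iper \<Longrightarrow> X t \<in> Xadm" "\<And>t. t \<in> Iper \<Longrightarrow> X t 0 = t"
    "\<And>t. t \<in> Iper \<Longrightarrow> (\<Sum>i<n. u1 (X t i)) = cR (X t)" "\<And>t. t \<in> Iper \<Longrightarrow> (\<Sum>i<n. u2 (X t i)) = cR (X t)" by metis
  have XI: "X t i \<in> Iper" if "t \<in> Iper" "i < n" for t i using X(1)[OF that(1)] that by (auto simp: Xadm_def)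
  obtain U1 where U1: "0 \<le> U1" "\<And>t. t \<in> Iper \<Longrightarrow> \<bar>u1 t\<bar> \<le> U1" using cont_bounded_Iper[OF c1] by blast
  obtain \<alpha> where al: "0 < \<alpha>" "\<And>x. (\<And>i. i < n \<Longrightarrow> x i \<in> Iper) \<Longrightarrow> cN n w x \<le> ennreal (real n * U1) \<Longrightarrow> sepN \<alpha> x"
    using cN_sep[of "real n * U1"] by blast
  have sX: "sepN \<alpha> (X t)" if t: "t \<in> Iper" for t
  proof (rule al(2)[OF XI[OF t]])
    have "(\<Sum>i<n. u1 (X t i)) \<le> (\<Sum>i<n. U1)" using U1(2)[OF XI[OF t]] unfolding abs_le_iff by (intro sum_mono) auto
    then have "cR (X t) \<le> real n * U1" using X(3)[OF t] by simp
    then show "cN n w (X t) \<le> ennreal (real n * U1)" unfolding cN_Xadm[OF X(1)[OF t]] by (rule ennreal_leI)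
  qed
  obtain g where g: "\<And>e. 0 < e \<Longrightarrow> \<exists>d>0. \<forall>s\<in>Iper. \<forall>t\<in>Iper. \<forall>z\<in>Iper. \<alpha> \<le> distT (t - z) \<longrightarrow> \<bar>s - t\<bar> < d \<longrightarrow>
     \<bar>enn2real (w (s, z)) - enn2real (w (t, z)) - g (t, z) * (s - t)\<bar> \<le> e * \<bar>s - t\<bar>"
    using partial_derivative_estimate[OF C1 al(1)] by blast
  \<comment> \<open>Partial derivative of the cost in its first variable at the chosen contact
    configuration. It depends on that choice, but the configuration is the same for u1 and
    u2.\<close>
  define p where "p = (\<lambda>t. \<Sum>j\<in>{..<n} - {0}. 2 * g (t, X t j))"
  have super: "\<exists>d>0. \<forall>s\<in>Iper. \<forall>t\<in>Iper. \<bar>s - t\<bar> < d \<longrightarrow> u1 s - u1 t \<le> p t * (s - t) + e * \<bar>s - t\<bar> \<and> u2 s - u2 t \<le> p t * (s - t) + e * \<bar>s - t\<bar>"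
    if e: "0 < e" for e
  proof -
    define e' where "e' = e / (2 * real n)"
    have e': "0 < e'" using e n1 by (simp add: e'_def)
    obtain d1 where d1: "0 < d1" "\<And>s t z. s \<in> Iper \<Longrightarrow> t \<in> Iper \<Longrightarrow> z \<in> Iper \<Longrightarrow> \<alpha> \<le> distT (t - z) \<Longrightarrow> \<bar>s - t\<bar> < d1 \<Longrightarrow>
     \<bar>enn2real (w (s, z)) - enn2real (w (t, z)) - g (t, z) * (s - t)\<bar> \<le> e' * \<bar>s - t\<bar>"
      using g[OF e'] by blast
    obtain d2 where d2: "0 < d2" "\<And>x y. (\<And>i. i < n \<Longrightarrow> x i \<in> Iper) \<Longrightarrow> (\<And>i. i < n \<Longrightarrow> y i \<in> Iper) \<Longrightarrow> sepN \<alpha> x \<Longrightarrow>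
     (\<And>i. i < n \<Longrightarrow> \<bar>y i - x i\<bar> < d2) \<Longrightarrow> sepN (\<alpha>/2) y \<and> \<bar>cR y - cR x\<bar> < 1"
      using cR_unif[OF al(1) zero_less_one] by blast
    show ?thesis
    proof (intro exI[of _ "min d1 d2"] conjI ballI impI)
      show "0 < min d1 d2" using d1 d2 by simp
      fix s t assume s: "s \<in> Iper" and t: "t \<in> Iper" and st: "\<bar>s - t\<bar> < min d1 d2"
      \<comment> \<open>The tight constraint at \<open>X t\<close> is compared with the constraint
        at the same configuration with t moved to s; all other values of u1 and u2 cancel.\<close>
      let ?y = "(X t)(0 := s)"
      have yI: "?y i \<in> Iper" if "i < n" for i using XI[OF t that] s by simp
      have "sepN (\<alpha>/2) ?y \<and> \<bar>cR ?y - cR (X t)\<bar> < 1"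
        by (rule d2(2)[of "X t" ?y]) (use XI[OF t] yI sX[OF t] st X(2)[OF t] d2(1) in auto)
      then have yX: "?y \<in> Xadm" using al(1) yI by (intro Xadm_of_sep[where a="\<alpha>/2"]) auto
      have "cR ?y - cR (X t) = (\<Sum>j\<in>{..<n} - {0}. 2 * (enn2real (w (s, X t j)) - enn2real (w (t, X t j))))"
        using cR_change[of "X t" s] XI[OF t] s X(2)[OF t] by simp
      also have "\<dots> \<le> (\<Sum>j\<in>{..<n} - {0}. 2 * (g (t, X t j) * (s - t)) + 2 * (e' * \<bar>s - t\<bar>))"
      proof (rule sum_mono)
        fix j assume j: "j \<in> {..<n} - {0}"
        have "\<alpha> \<le> distT (t - X t j)" using sX[OF t] j n1 X(2)[OF t] unfolding sepN_def by force
        then have "\<bar>enn2real (w (s, X t j)) - enn2real (w (t, X t j)) - g (t, X t j) * (s - t)\<bar> \<le> e' * \<bar>s - t\<bar>"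
          using j st by (intro d1(2) s t XI) auto
        then have "enn2real (w (s, X t j)) - enn2real (w (t, X t j)) \<le> g (t, X t j) * (s - t) + e' * \<bar>s - t\<bar>"
          by (simp only: abs_le_iff diff_le_eq add.commute)
        then show "2 * (enn2real (w (s, X t j)) - enn2real (w (t, X t j))) \<le> 2 * (g (t, X t j) * (s - t)) + 2 * (e' * \<bar>s - t\<bar>)"
          unfolding distrib_left[symmetric] by (rule mult_left_mono) simp
      qed
      also have "\<dots> = p t * (s - t) + real (n - 1) * (2 * (e' * \<bar>s - t\<bar>))"
      proof -
        have "(\<Sum>j\<in>{..<n} - {0}. 2 * (g (t, X t j) * (s - t))) = p t * (s - t)"
          unfolding p_def sum_distrib_right by (simp only: mult.assoc)
        moreover have "card ({..<n} - {0}) = n - 1" using n1 by simp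
        ultimately show ?thesis by (simp only: sum.distrib sum_constant)
      qed
      finally have c0: "cR ?y - cR (X t) \<le> p t * (s - t) + real (n - 1) * (2 * (e' * \<bar>s - t\<bar>))" .
      have "real (n - 1) * (2 * (e' * \<bar>s - t\<bar>)) \<le> real n * (2 * (e' * \<bar>s - t\<bar>))"
        using e' by (intro mult_right_mono) auto
      also have "\<dots> = e * \<bar>s - t\<bar>" using n1 by (simp add: e'_def)
      finally have cc: "cR ?y - cR (X t) \<le> p t * (s - t) + e * \<bar>s - t\<bar>" using c0 by linarith
      have upd: "(\<Sum>i<n. u (?y i)) = (\<Sum>i<n. u (X t i)) - u t + u s" for u :: "real \<Rightarrow> real"
      proof -
        have n0: "0 \<in> {..<n}" using n1 by simp
        have "(\<Sum>i<n. u (?y i)) = u s + (\<Sum>i\<in>{..<n} - {0}. u (X t i))" using n0 by (subst sum.remove[OF _ n0]) auto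
        moreover have "(\<Sum>i<n. u (X t i)) = u t + (\<Sum>i\<in>{..<n} - {0}. u (X t i))" using n0 X(2)[OF t] by (subst sum.remove[OF _ n0]) auto
        ultimately show ?thesis by simp
      qed
      have "(\<Sum>i<n. u1 (?y i)) \<le> cR ?y" "(\<Sum>i<n. u2 (?y i)) \<le> cR ?y" using f1 f2 yX unfolding dual_feasible_def by blast+
      then show "u1 s - u1 t \<le> p t * (s - t) + e * \<bar>s - t\<bar>" "u2 s - u2 t \<le> p t * (s - t) + e * \<bar>s - t\<bar>"
        using upd[of u1] upd[of u2] X(3,4)[OF t] cc by linarith+
    qed
  qed
  let ?h = "\<lambda>t. u1 t - u2 t"
  have main: "?h b - ?h a \<le> e" if e: "0 < e" for e
  proof -
    define e' where "e' = e / (4 * (b - a))"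
    have e': "0 < e'" using e ab by (simp add: e'_def)
    obtain d where d: "0 < d" "\<And>s t. s \<in> Iper \<Longrightarrow> t \<in> Iper \<Longrightarrow> \<bar>s - t\<bar> < d \<Longrightarrow> u1 s - u1 t \<le> p t * (s - t) + e' * \<bar>s - t\<bar> \<and> u2 s - u2 t \<le> p t * (s - t) + e' * \<bar>s - t\<bar>"
      using super[OF e'] by blast
    \<comment> \<open>The first bound makes the mesh finer than d, the second makes the telescoped
      sum of p at most e / 2. Only the values of p at a and b enter, so no regularity of p in
      between is involved.\<close>
    define Q where "Q = max ((b - a) / d) (2 * (\<bar>p a - p b\<bar> * (b - a)) / e)"
    obtain N0 :: nat where N0: "Q < real N0" using reals_Archimedean2 by blast
    define N where "N = Suc N0"
    have NQ: "Q < real N" "0 < real N" using N0 by (auto simp: N_def)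
    define \<delta> where "\<delta> = (b - a) / real N"
    have \<delta>0: "0 < \<delta>" using NQ ab by (simp add: \<delta>_def)
    have \<delta>d: "\<delta> < d"
    proof -
      have "(b - a) / d < real N" using NQ by (simp add: Q_def)
      then show ?thesis using d(1) NQ by (simp add: \<delta>_def field_simps)
    qed
    have \<delta>e: "\<bar>p a - p b\<bar> * \<delta> \<le> e / 2"
    proof -
      have "2 * (\<bar>p a - p b\<bar> * (b - a)) / e < real N" using NQ by (simp add: Q_def)
      then have "2 * (\<bar>p a - p b\<bar> * (b - a)) < real N * e" using e by (simp add: pos_divide_less_eq)
      then have "2 * (\<bar>p a - p b\<bar> * (b - a)) / real N < e" using NQ by (simp add: pos_divide_less_eq mult.commute)
      then show ?thesis by (simp add: \<delta>_def mult.commute)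
    qed
    define \<tau> where "\<tau> = (\<lambda>i::nat. a + real i * \<delta>)"
    have \<tau>I: "\<tau> i \<in> Iper" if "i \<le> N" for i
    proof -
      have "real i * \<delta> \<le> real N * \<delta>" using that \<delta>0 by (intro mult_right_mono) auto
      also have "real N * \<delta> = b - a" using NQ by (simp add: \<delta>_def)
      finally have "\<tau> i \<le> b" by (simp add: \<tau>_def)
      moreover have "a \<le> \<tau> i" using \<delta>0 by (simp add: \<tau>_def)
      ultimately show ?thesis using ab by (auto simp: Iper_def)
    qed
    have step: "?h (\<tau> (Suc i)) - ?h (\<tau> i) \<le> (p (\<tau> i) - p (\<tau> (Suc i))) * \<delta> + 2 * e' * \<delta>" if i: "i < N" for i
    proof -
      have df: "\<tau> (Suc i) - \<tau> i = \<delta>" by (simp add: \<tau>_def algebra_simps)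
      have I: "\<tau> i \<in> Iper" "\<tau> (Suc i) \<in> Iper" using \<tau>I i by auto
      \<comment> \<open>u1 is estimated forward from the left node and u2 backward from the right
        node, so the two values of p appear with opposite signs.\<close>
      have "u1 (\<tau> (Suc i)) - u1 (\<tau> i) \<le> p (\<tau> i) * (\<tau> (Suc i) - \<tau> i) + e' * \<bar>\<tau> (Suc i) - \<tau> i\<bar>"
        using d(2)[OF I(2) I(1)] df \<delta>0 \<delta>d by simp
      then have 1: "u1 (\<tau> (Suc i)) - u1 (\<tau> i) \<le> p (\<tau> i) * \<delta> + e' * \<delta>" using df \<delta>0 by simp
      have df2: "\<tau> i - \<tau> (Suc i) = - \<delta>" using df by linarith
      have "u2 (\<tau> i) - u2 (\<tau> (Suc i)) \<le> p (\<tau> (Suc i)) * (\<tau> i - \<tau> (Suc i)) + e' * \<bar>\<tau> i - \<tau> (Suc i)\<bar>"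
        using d(2)[OF I(1) I(2)] df2 \<delta>0 \<delta>d by simp
      then have 2: "u2 (\<tau> i) - u2 (\<tau> (Suc i)) \<le> - p (\<tau> (Suc i)) * \<delta> + e' * \<delta>" unfolding df2 using \<delta>0 by simp
      show ?thesis using 1 2 by (simp add: left_diff_distrib)
    qed
    have "?h b - ?h a = (\<Sum>i<N. ?h (\<tau> (Suc i)) - ?h (\<tau> i))"
    proof -
      have "(\<Sum>i<N. ?h (\<tau> (Suc i)) - ?h (\<tau> i)) = ?h (\<tau> N) - ?h (\<tau> 0)" by (rule sum_lessThan_telescope)
      moreover have "\<tau> N = b" "\<tau> 0 = a" using NQ by (auto simp: \<tau>_def \<delta>_def)
      ultimately show ?thesis by simp
    qed
    also have "\<dots> \<le> (\<Sum>i<N. (p (\<tau> i) - p (\<tau> (Suc i))) * \<delta> + 2 * e' * \<delta>)" using step by (intro sum_mono) auto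
    also have "\<dots> = (\<Sum>i<N. p (\<tau> i) - p (\<tau> (Suc i))) * \<delta> + real N * (2 * e' * \<delta>)"
      by (simp add: sum.distrib sum_distrib_right)
    also have "(\<Sum>i<N. p (\<tau> i) - p (\<tau> (Suc i))) = p (\<tau> 0) - p (\<tau> N)" by (rule sum_lessThan_telescope')
    also have "p (\<tau> 0) - p (\<tau> N) = p a - p b" using NQ by (simp add: \<tau>_def \<delta>_def)
    also have "real N * (2 * e' * \<delta>) = e / 2"
    proof -
      have "4 * (b - a) \<noteq> 0" using ab by simp
      then have 1: "e' * (4 * (b - a)) = e" unfolding e'_def by (rule nonzero_eq_divide_eq[THEN iffD1, OF _ refl])
      have 2: "real N * \<delta> = b - a" using NQ by (simp add: \<delta>_def)
      have "2 * (real N * (2 * e' * \<delta>)) = e' * (4 * (real N * \<delta>))" by simp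
      then have "2 * (real N * (2 * e' * \<delta>)) = e" unfolding 2 1 .
      then show ?thesis by simp
    qed
    finally have "?h b - ?h a \<le> (p a - p b) * \<delta> + e / 2" .
    moreover have "(p a - p b) * \<delta> \<le> \<bar>p a - p b\<bar> * \<delta>" using \<delta>0 by (intro mult_right_mono) auto
    ultimately show ?thesis using \<delta>e by linarith
  qed
  have "?h b - ?h a \<le> 0" by (rule field_le_epsilon) (use main in simp)
  then show ?thesis by simp
qed

text \<open>Monotonicity of the difference, applied with the potentials in both orders, makes it a
  constant K. Both potentials have the same integral against \<rho>, which has mass 1, so K =
  0.\<close>

lemma regular_potential_unique:
  assumes D: "Dper \<rho>" and C1: "C1_offdiag w" and r1: "regular_kantorovich_pot n w \<rho> u1" and r2: "regular_kantorovich_pot n w \<rho> u2"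
    and x: "x \<in> Iper"
  shows "u1 x = u2 x"
proof -
  have k: "kantorovich_pot n w \<rho> u1" "kantorovich_pot n w \<rho> u2" and c: "continuous_on Iper u1" "continuous_on Iper u2"
    using r1 r2 by (auto simp: regular_kantorovich_pot_def)
  note r = Dper_cont[OF D]
  have const: "u1 a - u2 a = u1 b - u2 b" if ab: "a \<in> Iper" "b \<in> Iper" "a < b" for a b
    using potentials_difference_antimono[OF D C1 k c ab] potentials_difference_antimono[OF D C1 k(2,1) c(2,1) ab] by linarith
  define K where "K = u1 x - u2 x"
  have K: "u1 s - u2 s = K" if "s \<in> Iper" for s
    using const[OF x that] const[OF that x] by (cases s x rule: linorder_cases) (auto simp: K_def)
  have "real n * (\<integral>t. \<rho> t * u1 t \<partial>Lper) = real n * (\<integral>t. \<rho> t * u2 t \<partial>Lper)"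
  proof -
    have "ennreal (real n * (\<integral>t. \<rho> t * u1 t \<partial>Lper)) = ennreal (real n * (\<integral>t. \<rho> t * u2 t \<partial>Lper))"
      using kantorovich_FOT(2)[OF k(1)] kantorovich_FOT(2)[OF k(2)] by simp
    then show ?thesis using kantorovich_FOT(1)[OF k(1)] kantorovich_FOT(1)[OF k(2)] by (subst (asm) ennreal_inj) auto
  qed
  then have e: "(\<integral>t. \<rho> t * u1 t \<partial>Lper) = (\<integral>t. \<rho> t * u2 t \<partial>Lper)" using n1 by simp
  have i: "integrable Lper (\<lambda>t. \<rho> t * u1 t)" "integrable Lper (\<lambda>t. \<rho> t * u2 t)"
    by (intro integrable_Lper_cont continuous_intros r(1) c)+
  have "(\<integral>t. \<rho> t * u1 t \<partial>Lper) - (\<integral>t. \<rho> t * u2 t \<partial>Lper) = (\<integral>t. \<rho> t * u1 t - \<rho> t * u2 t \<partial>Lper)"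
    by (rule Bochner_Integration.integral_diff[OF i, symmetric])
  also have "\<dots> = (\<integral>t. K * \<rho> t \<partial>Lper)"
    by (rule Bochner_Integration.integral_cong) (use K in \<open>auto simp: right_diff_distrib[symmetric] mult.commute\<close>)
  also have "\<dots> = K" using r(4) by simp
  finally show ?thesis using e by (simp add: K_def)
qed

end

context cost
begin

section \<open>Convergence of the normalised potentials\<close>

text \<open>The additive constant is chosen such that n V(rho) is the energy of rho; then n V is dominated by the
  energy on all admissible densities, with equality at rho.\<close>

lemma normalised_potential:
  fixes v :: "(real \<Rightarrow> real) \<Rightarrow> real"
  assumes D: "Dper \<rho>" and e: "0 < \<epsilon>" and H: "Hminus v"
    and min: "\<And>\<zeta>. adm \<zeta> \<Longrightarrow> enn2ereal (Feps n w \<epsilon> \<rho>) - ereal (real n * v \<rho>)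
                \<le> enn2ereal (Feps n w \<epsilon> \<zeta>) - ereal (real n * v \<zeta>)"
  defines "V \<equiv> (\<lambda>f. v f + (enn2real (Feps n w \<epsilon> \<rho>) / real n - v \<rho>) * (\<integral>t. f t \<partial>Lper))"
  shows "Hminus V" "0 \<le> V \<rho>" "slater_ineq \<epsilon> V" "FOT n w \<rho> \<le> ennreal (real n * V \<rho>)"
proof -
  note r = Dper_cont[OF D]
  have n0: "real n > 0" using n1 by simp
  show HV: "Hminus V" unfolding V_def by (rule Hminus_add_integral[OF H])
  \<comment> \<open>Minimality against a density of finite energy excludes an infinite energy of
    \<rho>. Only then does the normalising constant carry its meaning, since \<open>enn2real\<close>
    sends infinity to 0.\<close>
  obtain \<zeta>0 where z0: "adm \<zeta>0" "Feps n w \<epsilon> \<zeta>0 < top" using Feps_finite_somewhere e by blast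
  have fin: "Feps n w \<epsilon> \<rho> < top"
  proof -
    obtain q where "Feps n w \<epsilon> \<zeta>0 = ennreal q" "0 \<le> q" using z0(2) by (cases "Feps n w \<epsilon> \<zeta>0") auto
    then have "enn2ereal (Feps n w \<epsilon> \<rho>) \<noteq> \<infinity>" using min[OF z0(1)] by auto
    then show ?thesis by (cases "Feps n w \<epsilon> \<rho>") (auto simp: enn2ereal_ennreal)
  qed
  define F where "F = enn2real (Feps n w \<epsilon> \<rho>)"
  have F: "Feps n w \<epsilon> \<rho> = ennreal F" "0 \<le> F" using fin by (auto simp: F_def)
  have Vr: "real n * V \<rho> = F" using n0 r(4) by (simp add: V_def F_def)
  show "0 \<le> V \<rho>" using Vr F(2) n0 by (metis zero_le_mult_iff not_le)
  show "FOT n w \<rho> \<le> ennreal (real n * V \<rho>)" unfolding Vr F(1)[symmetric] by (rule FOT_le_Feps[OF n1 A r(1)])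
  show "slater_ineq \<epsilon> V" unfolding slater_ineq_def
  proof (intro allI impI)
    fix \<phi> \<phi>' S
    assume a: "\<forall>j<n. C1per (\<phi> j) (\<phi>' j) \<and> (\<forall>t. 0 \<le> \<phi> j t) \<and> (\<integral>t. (\<phi> j t)\<^sup>2 \<partial>Lper) = 1"
      "\<forall>i<n. \<forall>j<n. \<forall>t\<in>Iper. i \<noteq> j \<longrightarrow> \<phi> i t * \<phi> j t = 0" "0 \<le> S"
      "\<forall>x. (\<forall>j<n. x j \<in> Iper \<and> \<phi> j (x j) \<noteq> 0) \<longrightarrow> cN n w x \<le> ennreal S"
    let ?B = "\<epsilon> * (fact n * (\<Sum>j<n. \<integral>t. (\<phi>' j t)\<^sup>2 \<partial>Lper)) + S"
    define \<zeta> where "\<zeta> = (\<lambda>t. (1 / real n) * (\<Sum>j<n. (\<phi> j t)\<^sup>2))"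
    have z: "adm \<zeta>" "Feps n w \<epsilon> \<zeta> \<le> ennreal ?B"
      unfolding \<zeta>_def using a e by (intro slater_Feps[of n \<phi> \<phi>' S w \<epsilon>] n1; simp)+
    have B0: "0 \<le> ?B" using a(3) e by (intro add_nonneg_nonneg mult_nonneg_nonneg sum_nonneg) auto
    have zf: "\<zeta> = (\<lambda>t. \<Sum>j<n. (1 / real n) * (\<phi> j t)\<^sup>2)" by (simp add: \<zeta>_def sum_distrib_left)
    have Vz: "V \<zeta> = (\<Sum>j<n. (1 / real n) * V (\<lambda>t. (\<phi> j t)\<^sup>2))" unfolding zf
      by (rule lin_H1_sum[OF Hminus_lin[OF HV], THEN conjunct2]) (use a in \<open>auto intro!: C1per_H1per[OF C1per_sq]\<close>)
    have "real n * V \<zeta> = (\<Sum>j<n. V (\<lambda>t. (\<phi> j t)\<^sup>2))" using n0 by (simp add: Vz sum_divide_distrib[symmetric])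
    moreover have "real n * V \<zeta> \<le> ?B"
    proof -
      obtain q where q: "Feps n w \<epsilon> \<zeta> = ennreal q" "0 \<le> q" "q \<le> ?B"
        using z(2) B0 by (cases "Feps n w \<epsilon> \<zeta>") (auto simp: top_unique)
      have "F - real n * v \<rho> \<le> q - real n * v \<zeta>" using min[OF z(1)] F q(1,2) by (simp add: enn2ereal_ennreal)
      moreover have "real n * V \<zeta> = real n * v \<zeta> + (F - real n * v \<rho>)"
      proof -
        have "(\<integral>t. \<zeta> t \<partial>Lper) = 1" using z(1) by (simp add: adm_def)
        then show ?thesis using n0 by (simp add: V_def F_def algebra_simps)
      qed
      ultimately show ?thesis using q(3) by linarith
    qed
    ultimately show "(\<Sum>j<n. V (\<lambda>t. (\<phi> j t)\<^sup>2)) \<le> ?B" by simp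
  qed
qed

text \<open>The uniform bound is for \<epsilon> \<le> 1, so finitely many terms are dropped first;
  the extracted limit then satisfies the assumptions of \<open>limit_potential\<close>.\<close>

lemma convergent_subsequence_of_potentials:
  assumes D: "Dper \<rho>" and e: "\<And>j. 0 < e j" "e \<longlonglongrightarrow> 0"
    and V: "\<And>\<epsilon>. 0 < \<epsilon> \<Longrightarrow> Hminus (V \<epsilon>)" "\<And>\<epsilon>. 0 < \<epsilon> \<Longrightarrow> 0 \<le> V \<epsilon> \<rho>" "\<And>\<epsilon>. 0 < \<epsilon> \<Longrightarrow> slater_ineq \<epsilon> (V \<epsilon>)"
      "\<And>\<epsilon>. 0 < \<epsilon> \<Longrightarrow> FOT n w \<rho> \<le> ennreal (real n * V \<epsilon> \<rho>)"
  obtains r u where "strict_mono r" "regular_kantorovich_pot n w \<rho> u"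
    "\<And>f. H1per f \<Longrightarrow> (\<lambda>j. V (e (r j)) f) \<longlonglongrightarrow> (\<integral>t. u t * f t \<partial>Lper)"
proof -
  have "eventually (\<lambda>j. e j < 1) sequentially" using order_tendstoD(2)[OF e(2), of 1] by simp
  then obtain k where k: "\<And>j. k \<le> j \<Longrightarrow> e j < 1" by (auto simp: eventually_sequentially)
  define e' where "e' = (\<lambda>j. e (j + k))"
  have e': "0 < e' j" "e' j \<le> 1" for j using e(1) k[of "j + k"] by (auto simp: e'_def less_imp_le)
  have l: "e' \<longlonglongrightarrow> 0" unfolding e'_def by (rule LIMSEQ_ignore_initial_segment[OF e(2)])
  obtain r V0 C where r: "strict_mono r" "\<And>f. H1per f \<Longrightarrow> (\<lambda>j. V (e' (r j)) f) \<longlonglongrightarrow> V0 f"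
    "lin_H1 V0" "slater_ineq 0 V0" "0 \<le> C" "\<And>f f'. C1per f f' \<Longrightarrow> \<bar>V0 f\<bar> \<le> C * sqrt (h1dist f f')" "H1_cont V0"
    by (rule extract_limit[OF D e' l, of "\<lambda>j. V (e' j)"]) (use V e'(1) in blast)+
  have H: "H1per \<rho>" using D by (simp add: Dper_def)
  have lr: "(\<lambda>j. V (e' (r j)) \<rho>) \<longlonglongrightarrow> V0 \<rho>" by (rule r(2)[OF H])
  have V00: "0 \<le> V0 \<rho>" by (rule LIMSEQ_le_const[OF lr]) (use V(2) e'(1) in auto)
  have "(\<lambda>j. ennreal (real n * V (e' (r j)) \<rho>)) \<longlonglongrightarrow> ennreal (real n * V0 \<rho>)"
    by (intro tendsto_ennrealI tendsto_mult tendsto_const lr)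
  then have FV: "FOT n w \<rho> \<le> ennreal (real n * V0 \<rho>)"
    by (rule LIMSEQ_le_const) (use V(4) e'(1) in auto)
  interpret limit_potential n w \<rho> V0 C
    by unfold_locales (fact D r(3-7) FV V00)+
  obtain u where u: "regular_kantorovich_pot n w \<rho> u" "\<And>f. H1per f \<Longrightarrow> V0 f = (\<integral>t. u t * f t \<partial>Lper)"
    using exists_potential by blast
  show thesis
  proof (rule that[of "\<lambda>j. r j + k" u])
    show "strict_mono (\<lambda>j. r j + k)" using r(1) by (simp add: strict_mono_def)
    show "(\<lambda>j. V (e (r j + k)) f) \<longlonglongrightarrow> (\<integral>t. u t * f t \<partial>Lper)" if "H1per f" for f
      using r(2)[OF that] by (simp add: e'_def u(2)[OF that])
  qed (rule u(1))
qed

end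

theorem theorem2p4:
  fixes n :: nat and w :: "real \<times> real \<Rightarrow> ennreal" and \<rho> :: "real \<Rightarrow> real"
    and v :: "real \<Rightarrow> (real \<Rightarrow> real) \<Rightarrow> real"
  assumes "1 \<le> n"
    and "assumptionA w"
    and "Dper \<rho>"
    and "\<forall>\<epsilon>>0. Hminus (v \<epsilon>) \<and>
           (\<forall>\<zeta>. adm \<zeta> \<longrightarrow>
              enn2ereal (Feps n w \<epsilon> \<rho>) - ereal (real n * v \<epsilon> \<rho>)
                \<le> enn2ereal (Feps n w \<epsilon> \<zeta>) - ereal (real n * v \<epsilon> \<zeta>))"
  shows "\<exists>(C :: real \<Rightarrow> real) (u :: real \<Rightarrow> real).
           regular_kantorovich_pot n w \<rho> u \<and>
           (\<exists>\<epsilon>s :: nat \<Rightarrow> real. (\<forall>k. 0 < \<epsilon>s k) \<and> (\<forall>k. \<epsilon>s (Suc k) < \<epsilon>s k) \<and> \<epsilon>s \<longlonglongrightarrow> 0 \<and>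
              (\<forall>f. H1per f \<longrightarrow>
                 (\<lambda>k. v (\<epsilon>s k) f + C (\<epsilon>s k) * (\<integral>t. f t \<partial>lebesgue_on Iper))
                   \<longlonglongrightarrow> (\<integral>t. u t * f t \<partial>lebesgue_on Iper))) \<and>
           (C1_offdiag w \<longrightarrow>
              (\<forall>u'. regular_kantorovich_pot n w \<rho> u' \<longrightarrow> (\<forall>x\<in>Iper. u' x = u x)) \<and>
              (\<forall>f. H1per f \<longrightarrow>
                 ((\<lambda>\<epsilon>. v \<epsilon> f + C \<epsilon> * (\<integral>t. f t \<partial>lebesgue_on Iper))
                   \<longlongrightarrow> (\<integral>t. u t * f t \<partial>lebesgue_on Iper)) (at_right 0)))"
proof -
  interpret cost n w by unfold_locales (fact assms)+
  \<comment> \<open>Fixed before any sequence is chosen, so that the same constants serve the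
    subsequence and the full limit.\<close>
  define C where "C = (\<lambda>\<epsilon>. enn2real (Feps n w \<epsilon> \<rho>) / real n - v \<epsilon> \<rho>)"
  define V where "V = (\<lambda>\<epsilon> f. v \<epsilon> f + C \<epsilon> * (\<integral>t. f t \<partial>Lper))"
  have V: "Hminus (V \<epsilon>)" "0 \<le> V \<epsilon> \<rho>" "slater_ineq \<epsilon> (V \<epsilon>)" "FOT n w \<rho> \<le> ennreal (real n * V \<epsilon> \<rho>)" if "0 < \<epsilon>" for \<epsilon>
    unfolding V_def C_def using assms(4) that by (intro normalised_potential[OF assms(3) that]; blast)+
  have key: "\<exists>r u. strict_mono r \<and> regular_kantorovich_pot n w \<rho> u \<and>
    (\<forall>f. H1per f \<longrightarrow> (\<lambda>j. V (e (r j)) f) \<longlonglongrightarrow> (\<integral>t. u t * f t \<partial>Lper))"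
    if "\<And>j. 0 < e j" "e \<longlonglongrightarrow> 0" for e :: "nat \<Rightarrow> real"
    by (rule convergent_subsequence_of_potentials[where e = e and V = V, OF assms(3) that V]) blast+
  \<comment> \<open>Strictly decreasing, as the conclusion demands of the sequence, and every
    subsequence inherits this.\<close>
  define e0 where "e0 = (\<lambda>j. inverse (real (Suc j)))"
  have e0: "0 < e0 j" "e0 \<longlonglongrightarrow> 0" for j unfolding e0_def by (simp, rule LIMSEQ_inverse_real_of_nat)
  obtain r u where r: "strict_mono r" and u: "regular_kantorovich_pot n w \<rho> u"
    and ru: "\<And>f. H1per f \<Longrightarrow> (\<lambda>j. V (e0 (r j)) f) \<longlonglongrightarrow> (\<integral>t. u t * f t \<partial>Lper)"
    using key[of e0, OF e0] by blast
  have first: "\<exists>\<epsilon>s :: nat \<Rightarrow> real. (\<forall>k. 0 < \<epsilon>s k) \<and> (\<forall>k. \<epsilon>s (Suc k) < \<epsilon>s k) \<and> \<epsilon>s \<longlonglongrightarrow> 0 \<and>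
     (\<forall>f. H1per f \<longrightarrow> (\<lambda>k. V (\<epsilon>s k) f) \<longlonglongrightarrow> (\<integral>t. u t * f t \<partial>Lper))"
  proof (intro exI[of _ "e0 \<circ> r"] conjI allI impI)
    show "(e0 \<circ> r) \<longlonglongrightarrow> 0" by (rule LIMSEQ_subseq_LIMSEQ[OF e0(2) r])
    show "(e0 \<circ> r) (Suc k) < (e0 \<circ> r) k" for k
      using strict_monoD[OF r, of k "Suc k"] by (simp add: e0_def)
  qed (use e0 ru in auto)
  have second: "(\<forall>u'. regular_kantorovich_pot n w \<rho> u' \<longrightarrow> (\<forall>x\<in>Iper. u' x = u x)) \<and>
     (\<forall>f. H1per f \<longrightarrow> ((\<lambda>\<epsilon>. V \<epsilon> f) \<longlongrightarrow> (\<integral>t. u t * f t \<partial>Lper)) (at_right 0))" if C1: "C1_offdiag w"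
  proof (intro conjI allI impI)
    show un: "\<forall>x\<in>Iper. u' x = u x" if "regular_kantorovich_pot n w \<rho> u'" for u'
      using regular_potential_unique[OF assms(3) C1 that u] by blast
    fix f assume f: "H1per f"
    let ?L = "\<integral>t. u t * f t \<partial>Lper"
    show "((\<lambda>\<epsilon>. V \<epsilon> f) \<longlongrightarrow> ?L) (at_right 0)"
    proof (rule tendsto_at_right_sequentially[of 0 1])
      fix S :: "nat \<Rightarrow> real" assume S: "\<And>i. 0 < S i" "S \<longlonglongrightarrow> 0"
      show "(\<lambda>i. V (S i) f) \<longlonglongrightarrow> ?L"
      proof (rule ccontr)
        assume "\<not> ?thesis"
        \<comment> \<open>Subsequence principle: terms that stay at distance d from the limit would
          have a further subsequence converging to the integral against some regular potential,
          which by uniqueness agrees with u on I.\<close>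
        then obtain d where d: "0 < d" "\<forall>N. \<exists>i\<ge>N. d \<le> dist (V (S i) f) ?L"
          by (auto simp: lim_sequentially not_less)
        then have "infinite {i. d \<le> dist (V (S i) f) ?L}" by (auto simp: infinite_nat_iff_unbounded_le)
        then obtain q :: "nat \<Rightarrow> nat" where q: "strict_mono q" "\<And>i. d \<le> dist (V (S (q i)) f) ?L"
          using infinite_enumerate by blast
        obtain r' u' where r': "strict_mono r'" and u': "regular_kantorovich_pot n w \<rho> u'"
          and l: "(\<lambda>j. V ((S \<circ> q) (r' j)) f) \<longlonglongrightarrow> (\<integral>t. u' t * f t \<partial>Lper)"
          using key[of "S \<circ> q"] S(1) LIMSEQ_subseq_LIMSEQ[OF S(2) q(1)] f by (auto simp: o_def)
        have "(\<integral>t. u' t * f t \<partial>Lper) = ?L"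
          using un[OF u'] by (intro Bochner_Integration.integral_cong) auto
        then have "eventually (\<lambda>j. dist (V ((S \<circ> q) (r' j)) f) ?L < d) sequentially"
          using tendstoD[OF l d(1)] by simp
        then obtain j where "dist (V ((S \<circ> q) (r' j)) f) ?L < d" by (auto simp: eventually_sequentially)
        then show False using q(2)[of "r' j"] by simp
      qed
    qed simp
  qed
  show ?thesis using u first second unfolding V_def by blast
qed

end
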